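(* Let $\mathbf{k}$ be an algebraically closed field of characteristic 2, $G=Sp(2n)$ and $\mathfrak{g}=\mathfrak{sp}(2n)$ over $\mathbf{k}$. For every nilpotent $\xi\in\mathfrak{g}^*$ there is a unique sequence of modules ${}^*W_{l_i}(m_i)$, $1\le i\le s$, such that the form module $V_\xi$ is equivalent to ${}^*W_{l_1}(m_1)\oplus\cdots\oplus{}^*W_{l_s}(m_s)$ with $[\frac{m_i}{2}]\le l_i\le m_i$, $m_1\ge\cdots\ge m_s$, $l_1\ge\cdots\ge l_s$ and $m_1-l_1\ge\cdots\ge m_s-l_s$. Associating to the orbit of $\xi$ the pair of partitions $(l_1,\dots,l_s)(m_1-l_1,\dots,m_s-l_s)$ defines a bijection from the set of nilpotent $G$-orbits in $\mathfrak{g}^*$ to the set $\{(\mu,\nu)\mid|\mu|+|\nu|=n,\ \nu_i\le\mu_i+1\}$ of pairs of partitions, which has cardinality $p_2(n)-p_2(n-2)$.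
   Context: $p_2(n)$ is the number of pairs of partitions $(\mu,\nu)$ with $|\mu|+|\nu|=n$ (zero for $n<0$). $V$ is a $2n$-dimensional $\mathbf{k}$-space with a non-degenerate symplectic (alternating) form $\beta$, $G=\{g\in GL(V)\mid\beta(gv,gw)=\beta(v,w)\}$, $\mathfrak{g}=\{x\in\mathfrak{gl}(V)\mid\beta(xv,w)+\beta(v,xw)=0\}$; $G$ acts on $\mathfrak{g}^*$ by $(g.\xi)(x)=\xi(\mathrm{Ad}(g)^{-1}x)$. $\xi\in\mathfrak{g}^*$ is nilpotent if some $g.\xi$, $g\in G$, vanishes on the Lie algebra of a fixed Borel subgroup. For $\xi\in\mathfrak{g}^*$ choose $X\in\mathfrak{gl}(V)$ with $\xi(x)=\mathrm{tr}(Xx)$ and set $\alpha_\xi(v)=\beta(v,Xv)$ (independent of $X$), $\beta_\xi(v,w)=\alpha_\xi(v+w)+\alpha_\xi(v)+\alpha_\xi(w)$; define $T_\xi$ by $\beta(T_\xi v,w)=\beta_\xi(v,w)$. The form module of $\xi$ is $V_\xi=(V,\beta,\alpha_\xi)$; two form modules are equivalent if there is a linear isomorphism preserving the bilinear forms and the quadratic forms. ${}^*W_l(m)$ ($[\frac m2]\le l\le m$) is the form module of dimension $2m$ with basis $T^iv_1,T^iv_2$ ($0\le i\le m-1$), $T^mv_1=T^mv_2=0$, $\beta(T^iv_1,T^jv_2)=\delta_{i+j,m-1}$, $\beta(T^iv_1,T^jv_1)=\beta(T^iv_2,T^jv_2)=0$, and quadratic form $\alpha$ with polar form $\beta(T\cdot,\cdot)$,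 $\alpha(T^iv_1)=\delta_{i,l-1}$, $\alpha(T^iv_2)=0$. Direct sums are orthogonal. *)

theory Defs
  imports
    "HOL-Computational_Algebra.Polynomial"
    "HOL-Library.Function_Algebras"
    "HOL-Library.Product_Plus"
    "HOL-Library.FuncSet"
    "HOL-Analysis.Abstract_Topology"
    "HOL-Algebra.Group_Action"
    "HOL-Algebra.Solvable_Groups"
begin

section \<open>The symplectic group, its Lie algebra and the coadjoint action\<close>

definition symplectic_form ::
    "('k::field \<Rightarrow> 'v::ab_group_add \<Rightarrow> 'v) \<Rightarrow> ('v \<Rightarrow> 'v \<Rightarrow> 'k) \<Rightarrow> bool" where
  "symplectic_form scale \<beta> \<longleftrightarrow>
     (\<forall>v. Vector_Spaces.linear scale (*) (\<lambda>w. \<beta> v w)) \<and>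
     (\<forall>w. Vector_Spaces.linear scale (*) (\<lambda>v. \<beta> v w)) \<and>
     (\<forall>v. \<beta> v v = 0) \<and>
     (\<forall>v. (\<forall>w. \<beta> v w = 0) \<longrightarrow> v = 0)"

definition gl :: "('k::field \<Rightarrow> 'v::ab_group_add \<Rightarrow> 'v) \<Rightarrow> ('v \<Rightarrow> 'v) set" where
  "gl scale = {x. Vector_Spaces.linear scale scale x}"

definition Sp ::
    "('k::field \<Rightarrow> 'v::ab_group_add \<Rightarrow> 'v) \<Rightarrow> ('v \<Rightarrow> 'v \<Rightarrow> 'k) \<Rightarrow> ('v \<Rightarrow> 'v) monoid" where
  "Sp scale \<beta> =
     \<lparr>carrier = {g \<in> gl scale. bij g \<and> (\<forall>v w. \<beta> (g v) (g w) = \<beta> v w)},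
      mult = (\<circ>), one = id\<rparr>"

definition sp ::
    "('k::field \<Rightarrow> 'v::ab_group_add \<Rightarrow> 'v) \<Rightarrow> ('v \<Rightarrow> 'v \<Rightarrow> 'k) \<Rightarrow> ('v \<Rightarrow> 'v) set" where
  "sp scale \<beta> = {x \<in> gl scale. \<forall>v w. \<beta> (x v) w + \<beta> v (x w) = 0}"

text \<open>Functionals on \<open>sp\<close> are extensional (\<open>undefined\<close> off \<open>sp\<close>), so that
  equality of elements of the dual space is equality in HOL.\<close>

definition sp_dual ::
    "('k::field \<Rightarrow> 'v::ab_group_add \<Rightarrow> 'v) \<Rightarrow> ('v \<Rightarrow> 'v \<Rightarrow> 'k) \<Rightarrow> (('v \<Rightarrow> 'v) \<Rightarrow> 'k) set" where
  "sp_dual scale \<beta> =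
     {\<xi> \<in> extensional (sp scale \<beta>).
        (\<forall>x\<in>sp scale \<beta>. \<forall>y\<in>sp scale \<beta>. \<xi> (\<lambda>v. x v + y v) = \<xi> x + \<xi> y) \<and>
        (\<forall>c. \<forall>x\<in>sp scale \<beta>. \<xi> (\<lambda>v. scale c (x v)) = c * \<xi> x)}"

definition coadjoint ::
    "('k::field \<Rightarrow> 'v::ab_group_add \<Rightarrow> 'v) \<Rightarrow> ('v \<Rightarrow> 'v \<Rightarrow> 'k) \<Rightarrow>
       ('v \<Rightarrow> 'v) \<Rightarrow> (('v \<Rightarrow> 'v) \<Rightarrow> 'k) \<Rightarrow> (('v \<Rightarrow> 'v) \<Rightarrow> 'k)" where
  "coadjoint scale \<beta> g \<xi> =
     restrict (\<lambda>x. \<xi> (inv\<^bsub>Sp scale \<beta>\<^esub> g \<circ> x \<circ> g)) (sp scale \<beta>)"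


section \<open>Borel subgroups and their Lie algebras\<close>

inductive_set poly_funs ::
    "('k::field \<Rightarrow> 'v::ab_group_add \<Rightarrow> 'v) \<Rightarrow> (('v \<Rightarrow> 'v) \<Rightarrow> 'k) set"
  for scale :: "'k \<Rightarrow> 'v \<Rightarrow> 'v" where
  const: "(\<lambda>_. c) \<in> poly_funs scale"
| coord: "Vector_Spaces.linear scale (*) \<phi> \<Longrightarrow> (\<lambda>x. \<phi> (x v)) \<in> poly_funs scale"
| add: "f \<in> poly_funs scale \<Longrightarrow> h \<in> poly_funs scale \<Longrightarrow> (\<lambda>x. f x + h x) \<in> poly_funs scale"
| mult: "f \<in> poly_funs scale \<Longrightarrow> h \<in> poly_funs scale \<Longrightarrow> (\<lambda>x. f x * h x) \<in> poly_funs scale"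

text \<open>The Zariski topology on the affine space \<open>gl\<close>. As \<open>Sp\<close> is closed in \<open>gl\<close>
  (not only in the general linear group), its Zariski topology is the subspace topology.\<close>

definition zariski ::
    "('k::field \<Rightarrow> 'v::ab_group_add \<Rightarrow> 'v) \<Rightarrow> ('v \<Rightarrow> 'v) topology" where
  "zariski scale =
     topology_generated_by {{x \<in> gl scale. f x \<noteq> 0} | f. f \<in> poly_funs scale}"

definition closed_connected_solvable ::
    "('k::field \<Rightarrow> 'v::ab_group_add \<Rightarrow> 'v) \<Rightarrow> ('v \<Rightarrow> 'v) monoid \<Rightarrow> ('v \<Rightarrow> 'v) set \<Rightarrow> bool" where
  "closed_connected_solvable scale G H \<longleftrightarrow>
     subgroup H G \<and>
     closedin (subtopology (zariski scale) (carrier G)) H \<and>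
     connectedin (zariski scale) H \<and>
     solvable (G\<lparr>carrier := H\<rparr>)"

definition borel_subgroup ::
    "('k::field \<Rightarrow> 'v::ab_group_add \<Rightarrow> 'v) \<Rightarrow> ('v \<Rightarrow> 'v) monoid \<Rightarrow> ('v \<Rightarrow> 'v) set \<Rightarrow> bool" where
  "borel_subgroup scale G B \<longleftrightarrow>
     closed_connected_solvable scale G B \<and>
     (\<forall>H. closed_connected_solvable scale G H \<and> B \<subseteq> H \<longrightarrow> H = B)"

text \<open>The derivative at the identity, in direction \<open>x\<close>, of a polynomial function. The
  polynomial \<open>p\<close> is unique because the ground field is infinite in the application.\<close>

definition deriv_at_id ::
    "('k::field \<Rightarrow> 'v::ab_group_add \<Rightarrow> 'v) \<Rightarrow> (('v \<Rightarrow> 'v) \<Rightarrow> 'k) \<Rightarrow> ('v \<Rightarrow> 'v) \<Rightarrow> 'k" where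
  "deriv_at_id scale f x =
     poly (pderiv (THE p. \<forall>t. poly p t = f (\<lambda>v. v + scale t (x v)))) 0"

text \<open>The Lie algebra of a closed subgroup, as the Zariski tangent space at the identity.\<close>

definition lie_algebra ::
    "('k::field \<Rightarrow> 'v::ab_group_add \<Rightarrow> 'v) \<Rightarrow> ('v \<Rightarrow> 'v) set \<Rightarrow> ('v \<Rightarrow> 'v) set" where
  "lie_algebra scale H =
     {x \<in> gl scale. \<forall>f\<in>poly_funs scale. (\<forall>h\<in>H. f h = 0) \<longrightarrow> deriv_at_id scale f x = 0}"

definition nilpotent_dual ::
    "('k::field \<Rightarrow> 'v::ab_group_add \<Rightarrow> 'v) \<Rightarrow> ('v \<Rightarrow> 'v \<Rightarrow> 'k) \<Rightarrow> ('v \<Rightarrow> 'v) set \<Rightarrow>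
       (('v \<Rightarrow> 'v) \<Rightarrow> 'k) set" where
  "nilpotent_dual scale \<beta> B =
     {\<xi> \<in> sp_dual scale \<beta>. \<exists>g\<in>carrier (Sp scale \<beta>).
        \<forall>x\<in>lie_algebra scale B. coadjoint scale \<beta> g \<xi> x = 0}"


section \<open>Form modules\<close>

record ('k, 'v) form_module =
  fm_carrier :: "'v set"
  fm_scale :: "'k \<Rightarrow> 'v \<Rightarrow> 'v"
  fm_bilin :: "'v \<Rightarrow> 'v \<Rightarrow> 'k"
  fm_quad :: "'v \<Rightarrow> 'k"

definition fm_equiv ::
    "('k, 'v::ab_group_add) form_module \<Rightarrow> ('k, 'w::ab_group_add) form_module \<Rightarrow> bool" where
  "fm_equiv M N \<longleftrightarrow> (\<exists>f. bij_betw f (fm_carrier M) (fm_carrier N) \<and>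
     (\<forall>v\<in>fm_carrier M. \<forall>w\<in>fm_carrier M. f (v + w) = f v + f w) \<and>
     (\<forall>c. \<forall>v\<in>fm_carrier M. f (fm_scale M c v) = fm_scale N c (f v)) \<and>
     (\<forall>v\<in>fm_carrier M. \<forall>w\<in>fm_carrier M. fm_bilin N (f v) (f w) = fm_bilin M v w) \<and>
     (\<forall>v\<in>fm_carrier M. fm_quad N (f v) = fm_quad M v))"

definition endo_trace ::
    "('k::field \<Rightarrow> 'v::ab_group_add \<Rightarrow> 'v) \<Rightarrow> 'v set \<Rightarrow> ('v \<Rightarrow> 'v) \<Rightarrow> 'k" where
  "endo_trace scale Basis x = (\<Sum>b\<in>Basis. module.representation scale Basis (x b) b)"

definition alpha_form ::
    "('k::field \<Rightarrow> 'v::ab_group_add \<Rightarrow> 'v) \<Rightarrow> 'v set \<Rightarrow> ('v \<Rightarrow> 'v \<Rightarrow> 'k) \<Rightarrow>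
       (('v \<Rightarrow> 'v) \<Rightarrow> 'k) \<Rightarrow> 'v \<Rightarrow> 'k" where
  "alpha_form scale Basis \<beta> \<xi> v =
     (let X = (SOME X. X \<in> gl scale \<and>
                 (\<forall>x\<in>sp scale \<beta>. \<xi> x = endo_trace scale Basis (X \<circ> x)))
      in \<beta> v (X v))"

definition form_module_of ::
    "('k::field \<Rightarrow> 'v::ab_group_add \<Rightarrow> 'v) \<Rightarrow> 'v set \<Rightarrow> ('v \<Rightarrow> 'v \<Rightarrow> 'k) \<Rightarrow>
       (('v \<Rightarrow> 'v) \<Rightarrow> 'k) \<Rightarrow> ('k, 'v) form_module" where
  "form_module_of scale Basis \<beta> \<xi> =
     \<lparr>fm_carrier = UNIV, fm_scale = scale, fm_bilin = \<beta>,
      fm_quad = alpha_form scale Basis \<beta> \<xi>\<rparr>"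

text \<open>The modules \<open>*W\<^sub>l(m)\<close> in coordinates: the pair \<open>(a, b)\<close>, with \<open>a\<close> and \<open>b\<close>
  supported on \<open>{..<m}\<close>, is the vector \<open>\<Sum>i<m. a i T\<^sup>i v\<^sub>1 + b i T\<^sup>i v\<^sub>2\<close>.\<close>

type_synonym 'k W_vec = "(nat \<Rightarrow> 'k) \<times> (nat \<Rightarrow> 'k)"

definition W_carrier :: "nat \<Rightarrow> 'k::field W_vec set" where
  "W_carrier m = {(a, b). \<forall>i\<ge>m. a i = 0 \<and> b i = 0}"

definition W_scale :: "'k::field \<Rightarrow> 'k W_vec \<Rightarrow> 'k W_vec" where
  "W_scale c v = ((\<lambda>i. c * fst v i), (\<lambda>i. c * snd v i))"

definition W_T :: "nat \<Rightarrow> 'k::field W_vec \<Rightarrow> 'k W_vec" where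
  "W_T m v =
     ((\<lambda>i. if 0 < i \<and> i < m then fst v (i - 1) else 0),
      (\<lambda>i. if 0 < i \<and> i < m then snd v (i - 1) else 0))"

definition W_bilin :: "nat \<Rightarrow> 'k::field W_vec \<Rightarrow> 'k W_vec \<Rightarrow> 'k" where
  "W_bilin m v w = (\<Sum>i<m. \<Sum>j<m.
     if Suc (i + j) = m then fst v i * snd w j - snd v i * fst w j else 0)"

text \<open>By the prescribed polar form, \<open>\<alpha>(a + b) = \<alpha>(a) + \<alpha>(b) + \<beta>(T a, b)\<close> for \<open>a\<close> in the span
  of the \<open>T\<^sup>i v\<^sub>1\<close> and \<open>b\<close> in the span of the \<open>T\<^sup>i v\<^sub>2\<close>; on each of these two spans \<open>\<alpha>\<close>
  is additive, with the prescribed values on the basis.\<close>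

definition W_quad :: "nat \<Rightarrow> nat \<Rightarrow> 'k::field W_vec \<Rightarrow> 'k" where
  "W_quad l m v =
     (\<Sum>i<m. if Suc i = l then (fst v i)\<^sup>2 else 0) + W_bilin m (W_T m (fst v, \<lambda>_. 0)) (\<lambda>_. 0, snd v)"

definition W_module :: "nat \<Rightarrow> nat \<Rightarrow> ('k::field, 'k W_vec) form_module" where
  "W_module l m =
     \<lparr>fm_carrier = W_carrier m, fm_scale = W_scale, fm_bilin = W_bilin m, fm_quad = W_quad l m\<rparr>"

definition fm_direct_sum ::
    "('k::field, 'v::ab_group_add) form_module list \<Rightarrow> ('k, nat \<Rightarrow> 'v) form_module" where
  "fm_direct_sum Ms =
     \<lparr>fm_carrier = {v. (\<forall>i<length Ms. v i \<in> fm_carrier (Ms ! i)) \<and> (\<forall>i\<ge>length Ms. v i = 0)},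
      fm_scale = (\<lambda>c v i. if i < length Ms then fm_scale (Ms ! i) c (v i) else 0),
      fm_bilin = (\<lambda>v w. \<Sum>i<length Ms. fm_bilin (Ms ! i) (v i) (w i)),
      fm_quad = (\<lambda>v. \<Sum>i<length Ms. fm_quad (Ms ! i) (v i))\<rparr>"

text \<open>A sequence \<open>*W\<^bsub>l\<^sub>1\<^esub>(m\<^sub>1), ..., *W\<^bsub>l\<^sub>s\<^esub>(m\<^sub>s)\<close> is encoded by the list of the
  pairs \<open>(l\<^sub>i, m\<^sub>i)\<close>; its members are nonzero modules, i.e. \<open>m\<^sub>i \<ge> 1\<close>.\<close>

definition W_sum :: "(nat \<times> nat) list \<Rightarrow> ('k::field, nat \<Rightarrow> 'k W_vec) form_module" where
  "W_sum ps = fm_direct_sum (map (\<lambda>(l, m). W_module l m) ps)"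

definition normal_sequence :: "(nat \<times> nat) list \<Rightarrow> bool" where
  "normal_sequence ps \<longleftrightarrow>
     (\<forall>(l, m)\<in>set ps. 1 \<le> m \<and> m div 2 \<le> l \<and> l \<le> m) \<and>
     sorted_wrt (\<lambda>(l, m) (l', m'). m \<ge> m' \<and> l \<ge> l' \<and> m - l \<ge> m' - l') ps"


section \<open>Pairs of partitions\<close>

text \<open>A partition is a weakly decreasing, eventually zero sequence of naturals (indexed from 0).\<close>

definition is_partition :: "(nat \<Rightarrow> nat) \<Rightarrow> bool" where
  "is_partition \<mu> \<longleftrightarrow> antimono \<mu> \<and> finite {i. \<mu> i \<noteq> 0}"

definition part_size :: "(nat \<Rightarrow> nat) \<Rightarrow> nat" where
  "part_size \<mu> = (\<Sum>i | \<mu> i \<noteq> 0. \<mu> i)"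

definition p2 :: "int \<Rightarrow> nat" where
  "p2 n = card {(\<mu>, \<nu>). is_partition \<mu> \<and> is_partition \<nu> \<and>
                  int (part_size \<mu> + part_size \<nu>) = n}"

definition orbit_labels :: "nat \<Rightarrow> ((nat \<Rightarrow> nat) \<times> (nat \<Rightarrow> nat)) set" where
  "orbit_labels n = {(\<mu>, \<nu>). is_partition \<mu> \<and> is_partition \<nu> \<and>
                       part_size \<mu> + part_size \<nu> = n \<and> (\<forall>i. \<nu> i \<le> \<mu> i + 1)}"

definition pair_of_sequence :: "(nat \<times> nat) list \<Rightarrow> (nat \<Rightarrow> nat) \<times> (nat \<Rightarrow> nat)" where
  "pair_of_sequence ps =
     ((\<lambda>i. if i < length ps then fst (ps ! i) else 0),
      (\<lambda>i. if i < length ps then snd (ps ! i) - fst (ps ! i) else 0))"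

end

theory Submission imports Defs begin

text \<open>In characteristic 2 the Lie algebra \<open>sp(V)\<close> is the space of symmetric tensors, so \<open>\<xi> \<mapsto> \<alpha>\<^sub>\<xi>\<close> identifies its
  dual \<open>G\<close>-equivariantly with the quadratic forms on \<open>V\<close>, and orbits are equivalence classes of form
  modules. A Borel subgroup is the stabiliser of a complete isotropic flag (Lie-Kolchin), and vanishing
  on its Lie algebra makes \<open>T\<^sub>\<xi>\<close> lower the flag, hence nilpotent.

  A nilpotent form module splits into blocks \<open>\<^sup>*W\<^sub>l(m)\<close>, peeled off with \<open>m\<close> and then \<open>l\<close> maximal. The sequence
  can be read off the dimensions of \<open>T\<^sup>k V\<close> and the function \<open>m \<mapsto> min {l | \<alpha> (T\<^sup>l v) = 0 whenever T\<^sup>m v = 0}\<close>.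
  Conversely every sequence occurs: its blocks can be arranged so that \<open>T\<close> lowers a flag whose isotropic
  half is singular for \<open>\<alpha>\<close>.

  The pairs \<open>(\<mu>, \<nu>)\<close> violating \<open>\<nu>\<^sub>i \<le> \<mu>\<^sub>i + 1\<close> are counted by \<open>p\<^sub>2(n - 2)\<close>: exchanging the tails at the first
  violation is a bijection onto all pairs of size \<open>n - 2\<close>.\<close>

section \<open>Pairs of partitions\<close>

text \<open>A splitting into blocks is far from unique. A greedy choice makes \<open>m\<close> and
  \<open>l\<close> decrease but leaves \<open>m - l\<close> uncontrolled, and a block with
  \<open>m - l > M - L\<close> beside a block \<open>(L, M)\<close> can be exchanged for one with
  larger \<open>l\<close>. Only when all three of \<open>m\<close>, \<open>l\<close>,
  \<open>m - l\<close> decrease are the labels invariants. The bound \<open>[m/2] \<le> l\<close>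
  comes from polarisation: \<open>\<alpha> (T^l x)\<close> has the polar form
  \<open>\<beta> (T^(2l+1) x) y\<close>, so its vanishing on a nondegenerate space forces
  \<open>T^(2l+1) = 0\<close> there. Algebraic closure enters through square roots and quadratic
  equations for the coefficients of \<open>\<alpha>\<close>. The Lie algebra of the Borel subgroup
  is bounded from two sides instead of being computed. Nilpotency of \<open>T\<close> uses that it
  contains the elements \<open>sym (b i) (b j)\<close> with \<open>i + j + 1 \<le> 2 * n\<close>;
  the existence of orbits uses that its members lie in \<open>sp\<close> and preserve the flag. The
  delicate elements are the toral ones, \<open>i + j + 1 = 2 * n\<close>: the line in such a
  direction leaves the group, so a rational curve tangent to it is used.\<close>

lemma is_partition_iff:
  "is_partition \<mu> \<longleftrightarrow> (\<forall>i. \<mu> (Suc i) \<le> \<mu> i) \<and> (\<exists>N. \<forall>i\<ge>N. \<mu> i = 0)"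
proof -
  have "finite {i. \<mu> i \<noteq> 0} \<longleftrightarrow> (\<exists>N. \<forall>i\<ge>N. \<mu> i = 0)"
  proof
    assume "finite {i. \<mu> i \<noteq> 0}"
    then obtain N where N: "{i. \<mu> i \<noteq> 0} \<subseteq> {..<N}" using finite_nat_iff_bounded by blast
    have "\<mu> i = 0" if "N \<le> i" for i using N that by (rule_tac ccontr) auto
    then show "\<exists>N. \<forall>i\<ge>N. \<mu> i = 0" by blast
  next
    assume "\<exists>N. \<forall>i\<ge>N. \<mu> i = 0"
    then obtain N where N: "\<forall>i\<ge>N. \<mu> i = 0" by blast
    have "i < N" if "\<mu> i \<noteq> 0" for i using N that by (cases "N \<le> i") auto
    then show "finite {i. \<mu> i \<noteq> 0}" by (intro finite_subset[OF _ finite_lessThan[of N]]) auto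
  qed
  then show ?thesis unfolding is_partition_def antimono_iff_le_Suc by simp
qed

lemma part_size_eq: "\<forall>i\<ge>N. \<mu> i = 0 \<Longrightarrow> part_size \<mu> = (\<Sum>i<N. \<mu> i)"
  unfolding part_size_def
proof (intro sum.mono_neutral_left subsetI)
  fix i assume "\<forall>i\<ge>N. \<mu> i = 0" "i \<in> {i. \<mu> i \<noteq> 0}"
  then show "i \<in> {..<N}" by (cases "N \<le> i") auto
qed auto

text \<open>Each part is a summand of the size, and a nonzero part \<open>i\<close> would force the
  first \<open>i + 1\<close> parts to add up to at least \<open>i + 1\<close>. Both bounds confine
  the partitions of a given size to finitely many functions.\<close>

lemma partition_bounds:
  assumes "is_partition \<mu>"
  shows "\<mu> i \<le> part_size \<mu>" and "part_size \<mu> \<le> i \<Longrightarrow> \<mu> i = 0"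
proof -
  obtain N where N: "\<forall>i\<ge>N. \<mu> i = 0" using assms is_partition_iff by auto
  have anti: "antimono \<mu>" using assms is_partition_def by auto
  have "\<mu> i \<le> (\<Sum>i<max N (Suc i). \<mu> i)"
    by (rule member_le_sum) auto
  with N show "\<mu> i \<le> part_size \<mu>" by (subst part_size_eq[of "max N (Suc i)"]) auto
  show "\<mu> i = 0" if "part_size \<mu> \<le> i"
  proof (rule ccontr)
    assume "\<mu> i \<noteq> 0"
    then have "\<forall>j\<le>i. 1 \<le> \<mu> j" using antimonoD[OF anti] by (metis One_nat_def Suc_leI le_trans neq0_conv)
    then have "(\<Sum>j<Suc i. 1) \<le> (\<Sum>j<Suc i. \<mu> j)" by (intro sum_mono) auto
    also have "\<dots> \<le> (\<Sum>j<max N (Suc i). \<mu> j)" by (intro sum_mono2) auto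
    also have "\<dots> = part_size \<mu>" using N by (subst part_size_eq[of "max N (Suc i)"]) auto
    finally show False using that by simp
  qed
qed

lemma finite_partition_pairs:
  "finite {(\<mu>, \<nu>). is_partition \<mu> \<and> is_partition \<nu> \<and> part_size \<mu> + part_size \<nu> \<le> n}"
proof -
  define F where "F = {f::nat\<Rightarrow>nat. \<forall>i. (i \<in> {..<n} \<longrightarrow> f i \<in> {..n}) \<and> (i \<notin> {..<n} \<longrightarrow> f i = 0)}"
  have "finite F" unfolding F_def by (rule finite_set_of_finite_funs) auto
  then have fin: "finite (F \<times> F)" by simp
  have mem: "\<mu> \<in> F" if "is_partition \<mu>" "part_size \<mu> \<le> n" for \<mu>
  proof -
    have "\<mu> i \<le> n" for i using partition_bounds(1)[OF that(1), of i] that(2) by simp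
    moreover have "\<mu> i = 0" if "n \<le> i" for i
      using partition_bounds(2)[OF \<open>is_partition \<mu>\<close>, of i] that \<open>part_size \<mu> \<le> n\<close> by simp
    ultimately show ?thesis by (auto simp: F_def)
  qed
  show ?thesis
    by (rule finite_subset[OF _ fin]) (use mem in auto)
qed

lemma sum_lessThan_add:
  fixes f :: "nat \<Rightarrow> 'a::comm_monoid_add"
  shows "(\<Sum>j<a + b. f j) = (\<Sum>j<a. f j) + (\<Sum>j<b. f (a + j))"
  by (induction b) (auto simp: add.assoc)

text \<open>A pair violating \<open>\<nu>\<^sub>i \<le> \<mu>\<^sub>i + 1\<close> is cut at its first violation and the tails are exchanged.\<close>

definition tail_swap :: "(nat \<Rightarrow> nat) \<times> (nat \<Rightarrow> nat) \<Rightarrow> (nat \<Rightarrow> nat) \<times> (nat \<Rightarrow> nat)" where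
  "tail_swap = (\<lambda>(\<mu>, \<nu>). let i = LEAST i. \<mu> i + 2 \<le> \<nu> i in
     ((\<lambda>j. if j \<le> i then \<nu> j - 2 else \<mu> (j - 1)), (\<lambda>j. if j < i then \<mu> j + 2 else \<nu> (j + 1))))"

definition tail_unswap :: "(nat \<Rightarrow> nat) \<times> (nat \<Rightarrow> nat) \<Rightarrow> (nat \<Rightarrow> nat) \<times> (nat \<Rightarrow> nat)" where
  "tail_unswap = (\<lambda>(p, q). let i = LEAST i. q i \<le> p i + 2 in
     ((\<lambda>j. if j < i then q j - 2 else p (j + 1)), (\<lambda>j. if j \<le> i then p j + 2 else q (j - 1))))"

lemma LEAST_cut:
  fixes P :: "nat \<Rightarrow> bool"
  assumes "P k"
  obtains i where "(LEAST i. P i) = i" "P i" "\<And>j. j < i \<Longrightarrow> \<not> P j"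
  using assms by (metis LeastI not_less_Least)

text \<open>The \<open>i\<close> leading rows of \<open>q\<close> lose 2 each on moving to
  \<open>\<mu>\<close>, the \<open>i + 1\<close> leading rows of \<open>p\<close> gain 2 each on
  moving to \<open>\<nu>\<close>, so the total grows by exactly 2. Before the cut
  \<open>q j > p j + 2\<close>, which keeps the truncated subtraction exact.\<close>

lemma tail_unswap:
  assumes "is_partition p" "is_partition q"
  obtains \<mu> \<nu> where "tail_unswap (p, q) = (\<mu>, \<nu>)" "is_partition \<mu>" "is_partition \<nu>"
    "part_size \<mu> + part_size \<nu> = part_size p + part_size q + 2" "\<exists>i. \<mu> i + 2 \<le> \<nu> i"
    "tail_swap (\<mu>, \<nu>) = (p, q)"
proof -
  obtain N where N: "\<forall>i\<ge>N. p i = 0 \<and> q i = 0"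
    using assms unfolding is_partition_iff by (metis nle_le order_trans)
  have dp: "p (Suc i) \<le> p i" and dq: "q (Suc i) \<le> q i" for i using assms unfolding is_partition_iff by auto
  have "q N \<le> p N + 2" using N by auto
  then obtain i where i: "(LEAST i. q i \<le> p i + 2) = i" "q i \<le> p i + 2" "\<And>j. j < i \<Longrightarrow> p j + 2 < q j"
    by (rule LEAST_cut[of "\<lambda>i. q i \<le> p i + 2"]) (auto simp: not_le)
  define \<mu> where "\<mu> = (\<lambda>j. if j < i then q j - 2 else p (j + 1))"
  define \<nu> where "\<nu> = (\<lambda>j. if j \<le> i then p j + 2 else q (j - 1))"
  have 1: "tail_unswap (p, q) = (\<mu>, \<nu>)" by (simp only: tail_unswap_def prod.case Let_def i(1) \<mu>_def \<nu>_def)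
  have mu: "is_partition \<mu>" unfolding is_partition_iff
  proof (intro conjI allI)
    fix j show "\<mu> (Suc j) \<le> \<mu> j"
    proof (cases "Suc j = i")
      case True
      then have "p j + 2 < q j" using i(3) by auto
      with True dp[of j] dp[of "Suc j"] show ?thesis by (auto simp: \<mu>_def)
    next
      case False then show ?thesis using dp[of "Suc j"] dq[of j] by (auto simp: \<mu>_def)
    qed
  next
    show "\<exists>M. \<forall>j\<ge>M. \<mu> j = 0" using N by (intro exI[of _ "N + i"]) (auto simp: \<mu>_def)
  qed
  have nu: "is_partition \<nu>" unfolding is_partition_iff
  proof (intro conjI allI)
    fix j show "\<nu> (Suc j) \<le> \<nu> j"
    proof (cases "j = i")
      case True with i(2) show ?thesis by (auto simp: \<nu>_def)
    next
      case False then show ?thesis using dp[of j] dq[of "j - 1"] by (auto simp: \<nu>_def)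
    qed
  next
    show "\<exists>M. \<forall>j\<ge>M. \<nu> j = 0" using N by (intro exI[of _ "N + i + 1"]) (auto simp: \<nu>_def)
  qed
  have "part_size \<mu> = (\<Sum>j<i + N. \<mu> j)" "part_size q = (\<Sum>j<i + N. q j)"
    "part_size \<nu> = (\<Sum>j<Suc i + N. \<nu> j)" "part_size p = (\<Sum>j<Suc i + N. p j)"
    using N by (intro part_size_eq; auto simp: \<mu>_def \<nu>_def)+
  note sizes = this[unfolded sum_lessThan_add]
  have "(\<Sum>j<i. \<mu> j) + 2 * i = (\<Sum>j<i. q j)"
  proof -
    have "(\<Sum>j<i. \<mu> j) + 2 * i = (\<Sum>j<i. \<mu> j + 2)" by (simp add: sum.distrib del: add_2_eq_Suc' add_2_eq_Suc)
    also have "\<dots> = (\<Sum>j<i. q j)" 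
    proof (intro sum.cong refl)
      fix j assume "j \<in> {..<i}"
      then show "\<mu> j + 2 = q j" using i(3)[of j] by (simp add: \<mu>_def)
    qed
    finally show ?thesis .
  qed
  moreover have "(\<Sum>j<Suc i. \<nu> j) = (\<Sum>j<Suc i. p j) + 2 * i + 2"
  proof -
    have "(\<Sum>j<Suc i. \<nu> j) = (\<Sum>j<Suc i. p j + 2)" by (intro sum.cong) (auto simp: \<nu>_def)
    then show ?thesis by (simp add: sum.distrib del: add_2_eq_Suc' add_2_eq_Suc)
  qed
  moreover have "(\<Sum>j<N. \<mu> (i + j)) = (\<Sum>j<N. p (Suc i + j))" "(\<Sum>j<N. \<nu> (Suc i + j)) = (\<Sum>j<N. q (i + j))"
    by (auto simp: \<mu>_def \<nu>_def)
  ultimately have size: "part_size \<mu> + part_size \<nu> = part_size p + part_size q + 2"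
    unfolding sizes by presburger
  have viol: "\<mu> i + 2 \<le> \<nu> i" using dp[of i] by (auto simp: \<mu>_def \<nu>_def)
  \<comment> \<open>The cut is found again: for \<open>j < i\<close> one has
    \<open>\<mu> j + 2 = q j > p j + 2 = \<nu> j\<close>, so nothing is violated before
    \<open>i\<close>.\<close>
  have least: "(LEAST j. \<mu> j + 2 \<le> \<nu> j) = i"
  proof (rule Least_equality)
    fix j assume j: "\<mu> j + 2 \<le> \<nu> j"
    show "i \<le> j"
    proof (rule ccontr)
      assume "\<not> i \<le> j"
      with i(3)[of j] j show False by (auto simp: \<mu>_def \<nu>_def)
    qed
  qed (rule viol)
  have "(\<lambda>j. if j \<le> i then \<nu> j - 2 else \<mu> (j - 1)) = p"
  proof
    fix j show "(if j \<le> i then \<nu> j - 2 else \<mu> (j - 1)) = p j"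
      by (cases "j \<le> i") (simp_all add: \<mu>_def \<nu>_def)
  qed
  moreover have "(\<lambda>j. if j < i then \<mu> j + 2 else \<nu> (j + 1)) = q"
  proof
    fix j show "(if j < i then \<mu> j + 2 else \<nu> (j + 1)) = q j"
      using i(3)[of j] by (cases "j < i") (simp_all add: \<mu>_def \<nu>_def)
  qed
  ultimately have sw: "tail_swap (\<mu>, \<nu>) = (p, q)"
    by (simp only: tail_swap_def prod.case Let_def least)
  have "\<exists>i. \<mu> i + 2 \<le> \<nu> i" using viol ..
  from that[OF 1 mu nu size this sw] show thesis .
qed

lemma tail_swap:
  assumes "is_partition \<mu>" "is_partition \<nu>" "\<exists>i. \<mu> i + 2 \<le> \<nu> i"
  obtains p q where "tail_swap (\<mu>, \<nu>) = (p, q)" "is_partition p" "is_partition q" "tail_unswap (p, q) = (\<mu>, \<nu>)"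
proof -
  obtain N where N: "\<forall>i\<ge>N. \<mu> i = 0 \<and> \<nu> i = 0"
    using assms unfolding is_partition_iff by (metis nle_le order_trans)
  have dm: "\<mu> (Suc i) \<le> \<mu> i" and dn: "\<nu> (Suc i) \<le> \<nu> i" for i using assms unfolding is_partition_iff by auto
  have "antimono \<nu>" using assms is_partition_def by auto
  obtain k where "\<mu> k + 2 \<le> \<nu> k" using assms by auto
  then obtain i where i: "(LEAST i. \<mu> i + 2 \<le> \<nu> i) = i" "\<mu> i + 2 \<le> \<nu> i" "\<And>j. j < i \<Longrightarrow> \<nu> j < \<mu> j + 2"
    by (rule LEAST_cut[of "\<lambda>i. \<mu> i + 2 \<le> \<nu> i"]) (auto simp: not_le)
  \<comment> \<open>Up to the cut the truncated subtraction in \<open>p\<close> is therefore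
    exact.\<close>
  have ge2: "2 \<le> \<nu> j" if "j \<le> i" for j using antimonoD[OF \<open>antimono \<nu>\<close> that] i(2) by linarith
  define p where "p = (\<lambda>j. if j \<le> i then \<nu> j - 2 else \<mu> (j - 1))"
  define q where "q = (\<lambda>j. if j < i then \<mu> j + 2 else \<nu> (j + 1))"
  have 1: "tail_swap (\<mu>, \<nu>) = (p, q)" by (simp only: tail_swap_def prod.case Let_def i(1) p_def q_def)
  have p: "is_partition p" unfolding is_partition_iff
  proof (intro conjI allI)
    fix j show "p (Suc j) \<le> p j"
      using dm[of "j - 1"] dn[of j] i(2) by (cases "j = i") (auto simp: p_def)
  next
    show "\<exists>M. \<forall>j\<ge>M. p j = 0" using N by (intro exI[of _ "N + i + 1"]) (auto simp: p_def)
  qed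
  have q: "is_partition q" unfolding is_partition_iff
  proof (intro conjI allI)
    fix j show "q (Suc j) \<le> q j"
      using dm[of j] dn[of "Suc j"] dn[of j] i(3)[of j] by (cases "Suc j = i") (auto simp: q_def)
  next
    show "\<exists>M. \<forall>j\<ge>M. q j = 0" using N by (intro exI[of _ "N + i"]) (auto simp: q_def)
  qed
  have least: "(LEAST j. q j \<le> p j + 2) = i"
  proof (rule Least_equality)
    show "q i \<le> p i + 2" using dn[of i] ge2[of i] by (auto simp: p_def q_def)
    fix j assume j: "q j \<le> p j + 2"
    show "i \<le> j"
    proof (rule ccontr)
      assume "\<not> i \<le> j"
      with i(3)[of j] ge2[of j] j show False by (auto simp: p_def q_def)
    qed
  qed
  have "(\<lambda>j. if j < i then q j - 2 else p (j + 1)) = \<mu>"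
  proof
    fix j show "(if j < i then q j - 2 else p (j + 1)) = \<mu> j"
      by (cases "j < i") (simp_all add: p_def q_def)
  qed
  moreover have "(\<lambda>j. if j \<le> i then p j + 2 else q (j - 1)) = \<nu>"
  proof
    fix j show "(if j \<le> i then p j + 2 else q (j - 1)) = \<nu> j"
      using ge2[of j] by (cases "j \<le> i"; cases j) (simp_all add: p_def q_def)
  qed
  ultimately have "tail_unswap (p, q) = (\<mu>, \<nu>)"
    by (simp only: tail_unswap_def prod.case Let_def least)
  from that[OF 1 p q this] show thesis .
qed

lemma finite_orbit_labels: "finite (orbit_labels n)"
  by (rule finite_subset[OF _ finite_partition_pairs[of n]]) (auto simp: orbit_labels_def)

lemma card_orbit_labels: "int (card (orbit_labels n)) = int (p2 (int n)) - int (p2 (int n - 2))"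
proof -
  define A where "A = {(\<mu>, \<nu>). is_partition \<mu> \<and> is_partition \<nu> \<and> int (part_size \<mu> + part_size \<nu>) = int n}"
  \<comment> \<open>Sizes are compared as integers, so \<open>A'\<close> is empty for
    \<open>n < 2\<close>, in agreement with \<open>p2\<close> at a negative argument.\<close>
  define A' where "A' = {(\<mu>, \<nu>). is_partition \<mu> \<and> is_partition \<nu> \<and> int (part_size \<mu> + part_size \<nu>) = int n - 2}"
  have fin: "finite A" by (rule finite_subset[OF _ finite_partition_pairs[of n]]) (auto simp: A_def)
  have sub: "orbit_labels n \<subseteq> A" by (auto simp: A_def orbit_labels_def)
  have mem: "(\<mu>, \<nu>) \<in> A - orbit_labels n \<longleftrightarrow> is_partition \<mu> \<and> is_partition \<nu> \<and> part_size \<mu> + part_size \<nu> = n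
      \<and> (\<exists>i. \<mu> i + 2 \<le> \<nu> i)" for \<mu> \<nu>
    by (auto simp: A_def orbit_labels_def not_le Suc_le_eq)
  have sw: "tail_unswap (tail_swap x) = x \<and> tail_swap x \<in> A'" if x: "x \<in> A - orbit_labels n" for x
  proof -
    obtain \<mu> \<nu> where [simp]: "x = (\<mu>, \<nu>)" by force
    have h: "is_partition \<mu>" "is_partition \<nu>" "part_size \<mu> + part_size \<nu> = n" "\<exists>i. \<mu> i + 2 \<le> \<nu> i"
      using x mem[of \<mu> \<nu>] by simp_all
    obtain p q where pq: "tail_swap (\<mu>, \<nu>) = (p, q)" "is_partition p" "is_partition q" "tail_unswap (p, q) = (\<mu>, \<nu>)"
      using tail_swap[OF h(1,2,4)] by metis
    have "part_size \<mu> + part_size \<nu> = part_size p + part_size q + 2"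
      using tail_unswap[OF pq(2,3)] pq(4) by (metis prod.inject)
    with pq h show ?thesis by (auto simp: A'_def)
  qed
  have us: "tail_swap (tail_unswap x) = x \<and> tail_unswap x \<in> A - orbit_labels n" if x: "x \<in> A'" for x
  proof -
    obtain p q where [simp]: "x = (p, q)" by force
    have h: "is_partition p" "is_partition q" "int (part_size p + part_size q) = int n - 2"
      using x by (auto simp: A'_def)
    obtain \<mu> \<nu> where "tail_unswap (p, q) = (\<mu>, \<nu>)" "is_partition \<mu>" "is_partition \<nu>"
      "part_size \<mu> + part_size \<nu> = part_size p + part_size q + 2" "\<exists>i. \<mu> i + 2 \<le> \<nu> i"
      "tail_swap (\<mu>, \<nu>) = (p, q)"
      using tail_unswap[OF h(1,2)] by metis
    with h(3) show ?thesis using mem[of \<mu> \<nu>] by simp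
  qed
  have "bij_betw tail_swap (A - orbit_labels n) A'"
    by (rule bij_betw_byWitness[of _ tail_unswap]) (use sw us in blast)+
  then have "card (A - orbit_labels n) = card A'" by (rule bij_betw_same_card)
  moreover have "card (A - orbit_labels n) = card A - card (orbit_labels n)"
    by (rule card_Diff_subset[OF finite_orbit_labels sub])
  moreover have "card (orbit_labels n) \<le> card A" by (rule card_mono[OF fin sub])
  ultimately show ?thesis unfolding p2_def A_def[symmetric] A'_def[symmetric] by linarith
qed

section \<open>Normal sequences\<close>

text \<open>Half the dimension of \<open>W_sum ps\<close>, since a block \<open>(l, m)\<close> has
  dimension \<open>2 * m\<close>.\<close>

definition total_rank :: "(nat \<times> nat) list \<Rightarrow> nat" where
  "total_rank ps = sum_list (map snd ps)"

lemma sorted_wrt_nth_le: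
  assumes "sorted_wrt P xs" "i \<le> j" "j < length xs" "\<And>x. P x x"
  shows "P (xs ! i) (xs ! j)"
  using assms by (cases "i = j") (auto simp: sorted_wrt_iff_nth_less)

lemma normal_sequenceD:
  assumes "normal_sequence ps" "i < length ps"
  shows "1 \<le> snd (ps ! i)" "snd (ps ! i) div 2 \<le> fst (ps ! i)" "fst (ps ! i) \<le> snd (ps ! i)"
  using assms nth_mem[OF assms(2)] unfolding normal_sequence_def by (auto simp: case_prod_beta)

lemma normal_sequence_mono:
  assumes "normal_sequence ps" "i \<le> j" "j < length ps"
  shows "snd (ps ! j) \<le> snd (ps ! i)" "fst (ps ! j) \<le> fst (ps ! i)"
    "snd (ps ! j) - fst (ps ! j) \<le> snd (ps ! i) - fst (ps ! i)"
proof -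
  let ?P = "\<lambda>(l, m) (l', m'). m \<ge> m' \<and> l \<ge> l' \<and> m - l \<ge> m' - (l' :: nat)"
  have "sorted_wrt ?P ps" using assms(1) by (simp add: normal_sequence_def)
  then have "?P (ps ! i) (ps ! j)" by (rule sorted_wrt_nth_le[OF _ assms(2,3)]) auto
  then show "snd (ps ! j) \<le> snd (ps ! i)" "fst (ps ! j) \<le> fst (ps ! i)"
    "snd (ps ! j) - fst (ps ! j) \<le> snd (ps ! i) - fst (ps ! i)"
    by (simp_all add: case_prod_beta)
qed

text \<open>\<open>m div 2 \<le> l\<close> amounts to \<open>m - l \<le> l + 1\<close>, which is the
  condition on labels, and \<open>l + (m - l) = m\<close> sums to the rank.\<close>

lemma pair_of_sequence_labels:
  assumes "normal_sequence ps"
  shows "pair_of_sequence ps \<in> orbit_labels (total_rank ps)"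
proof -
  define \<mu> where "\<mu> = (\<lambda>i. if i < length ps then fst (ps ! i) else 0)"
  define \<nu> where "\<nu> = (\<lambda>i. if i < length ps then snd (ps ! i) - fst (ps ! i) else 0)"
  have "is_partition \<mu>" "is_partition \<nu>"
    using normal_sequence_mono[OF assms, of i "Suc i" for i]
    unfolding is_partition_iff by (auto simp: \<mu>_def \<nu>_def intro!: exI[of _ "length ps"])
  moreover have "part_size \<mu> + part_size \<nu> = total_rank ps"
  proof -
    have "part_size \<mu> = (\<Sum>i<length ps. \<mu> i)" "part_size \<nu> = (\<Sum>i<length ps. \<nu> i)"
      by (rule part_size_eq, simp add: \<mu>_def \<nu>_def)+
    then have "part_size \<mu> + part_size \<nu> = (\<Sum>i<length ps. \<mu> i + \<nu> i)" by (simp add: sum.distrib)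
    also have "\<dots> = (\<Sum>i<length ps. snd (ps ! i))"
      by (intro sum.cong) (auto simp: \<mu>_def \<nu>_def normal_sequenceD(3)[OF assms])
    finally show ?thesis by (simp add: total_rank_def sum_list_sum_nth atLeast0LessThan)
  qed
  moreover have "\<nu> i \<le> \<mu> i + 1" for i
    using normal_sequenceD(2)[OF assms, of i] by (auto simp: \<mu>_def \<nu>_def)
  ultimately show ?thesis by (simp add: orbit_labels_def pair_of_sequence_def \<mu>_def \<nu>_def)
qed

text \<open>Because \<open>1 \<le> m\<close>, no block has both \<open>l\<close> and
  \<open>m - l\<close> equal to 0; the length of the sequence is thus visible in the pair of
  functions, although these are extended by 0.\<close>

lemma pair_of_sequence_inj:
  assumes "normal_sequence ps" "normal_sequence qs" "pair_of_sequence ps = pair_of_sequence qs"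
  shows "ps = qs"
proof -
  have *: "(if i < length ps then fst (ps ! i) else 0) = (if i < length qs then fst (qs ! i) else 0)"
    "(if i < length ps then snd (ps ! i) - fst (ps ! i) else 0) = (if i < length qs then snd (qs ! i) - fst (qs ! i) else 0)" for i
    using arg_cong[OF assms(3), of "\<lambda>x. fst x i"] arg_cong[OF assms(3), of "\<lambda>x. snd x i"]
    by (simp_all only: pair_of_sequence_def fst_conv snd_conv)
  have len: "i < length ps \<longleftrightarrow> i < length qs" for i
  proof (cases "i < length ps"; cases "i < length qs")
    assume "i < length ps" "\<not> i < length qs"
    with *[of i] normal_sequenceD(1,3)[OF assms(1), of i] show ?thesis by simp
  next
    assume "\<not> i < length ps" "i < length qs"
    with *[of i] normal_sequenceD(1,3)[OF assms(2), of i] show ?thesis by simp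
  qed auto
  show ?thesis
  proof (rule nth_equalityI)
    show "length ps = length qs" using len[of "length ps"] len[of "length qs"] by linarith
    fix i assume i: "i < length ps"
    then have i': "i < length qs" using len by simp
    show "ps ! i = qs ! i"
      using *[of i] i i' normal_sequenceD(3)[OF assms(1) i] normal_sequenceD(3)[OF assms(2) i']
      by (intro prod_eqI) simp_all
  qed
qed

text \<open>The number of blocks is the first index at which both partitions vanish; monotonicity
  keeps them zero from there on.\<close>

lemma pair_of_sequence_surj:
  assumes "x \<in> orbit_labels n"
  obtains ps where "normal_sequence ps" "pair_of_sequence ps = x" "total_rank ps = n"
proof -
  obtain \<mu> \<nu> where x: "x = (\<mu>, \<nu>)" by force
  have h: "is_partition \<mu>" "is_partition \<nu>" "part_size \<mu> + part_size \<nu> = n" "\<And>i. \<nu> i \<le> \<mu> i + 1"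
    using assms unfolding x orbit_labels_def by auto
  have anti: "antimono \<mu>" "antimono \<nu>" using h is_partition_def by auto
  obtain N where N: "\<forall>i\<ge>N. \<mu> i = 0 \<and> \<nu> i = 0"
    using h(1,2) unfolding is_partition_iff by (metis nle_le order_trans)
  then have "\<mu> N = 0 \<and> \<nu> N = 0" by auto
  then obtain k where k: "\<mu> k = 0 \<and> \<nu> k = 0" "\<And>j. j < k \<Longrightarrow> \<not> (\<mu> j = 0 \<and> \<nu> j = 0)"
    by (rule LEAST_cut[of "\<lambda>i. \<mu> i = 0 \<and> \<nu> i = 0"]) auto
  have z: "\<mu> i = 0 \<and> \<nu> i = 0" if "k \<le> i" for i using antimonoD[OF anti(1) that] antimonoD[OF anti(2) that] k(1) by auto
  define ps where "ps = map (\<lambda>i. (\<mu> i, \<mu> i + \<nu> i)) [0..<k]"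
  have norm: "normal_sequence ps" unfolding normal_sequence_def
  proof
    have "1 \<le> \<mu> i + \<nu> i" if "i < k" for i using k(2)[OF that] by auto
    moreover have "(\<mu> i + \<nu> i) div 2 \<le> \<mu> i" for i using h(4)[of i] by linarith
    ultimately show "\<forall>(l, m)\<in>set ps. 1 \<le> m \<and> m div 2 \<le> l \<and> l \<le> m" by (auto simp: ps_def)
    show "sorted_wrt (\<lambda>(l, m) (l', m'). m \<ge> m' \<and> l \<ge> l' \<and> m - l \<ge> m' - l') ps"
      using antimonoD[OF anti(1)] antimonoD[OF anti(2)]
      by (auto simp: ps_def sorted_wrt_iff_nth_less add_mono)
  qed
  have pair: "pair_of_sequence ps = x"
    unfolding pair_of_sequence_def x by (auto simp: fun_eq_iff ps_def z)
  have "x \<in> orbit_labels (total_rank ps)" using pair_of_sequence_labels[OF norm] pair by simp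
  then have "total_rank ps = n" using h(3) by (auto simp: orbit_labels_def x)
  with that[OF norm pair] show thesis by simp
qed

lemma sum_list_minus_filter:
  "sum_list (map (\<lambda>m. m - k) ms) = sum_list (map (\<lambda>m. m - Suc k) ms) + length (filter (\<lambda>m. k < m) ms)"
  by (induction ms) auto

text \<open>The first differences in \<open>k\<close> of the sum of the \<open>m - k\<close> count
  the entries above \<open>k\<close>, the second differences count the entries equal to
  \<open>k + 1\<close>. Decreasing order then fixes the list.\<close>

lemma sorted_ge_eqI:
  fixes xs ys :: "nat list"
  assumes "sorted_wrt (\<ge>) xs" "sorted_wrt (\<ge>) ys" "\<forall>x\<in>set xs. 1 \<le> x" "\<forall>y\<in>set ys. 1 \<le> y"
    and "\<And>k. sum_list (map (\<lambda>m. m - k) xs) = sum_list (map (\<lambda>m. m - k) ys)"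
  shows "xs = ys"
proof -
  have len: "length (filter (\<lambda>m. k < m) xs) = length (filter (\<lambda>m. k < m) ys)" for k
    using sum_list_minus_filter[of k xs] sum_list_minus_filter[of k ys] assms(5)[of k] assms(5)[of "Suc k"] by simp
  have split: "length (filter (\<lambda>m. k < m) zs) = length (filter (\<lambda>m. Suc k < m) zs) + count (mset zs) (Suc k)" for k zs
    by (induction zs) auto
  have zero: "count (mset zs) 0 = 0" if "\<forall>x\<in>set zs. 1 \<le> x" for zs :: "nat list"
    using that by (metis One_nat_def count_eq_zero_iff not_one_le_zero set_mset_mset)
  have "mset xs = mset ys"
  proof (rule multiset_eqI)
    fix m show "count (mset xs) m = count (mset ys) m"
    proof (cases m)
      case 0 with zero assms(3,4) show ?thesis by metis
    next
      case (Suc k)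
      show ?thesis unfolding Suc using split[of k xs] split[of k ys] len[of k] len[of "Suc k"] by linarith
    qed
  qed
  then have "mset (rev xs) = mset (rev ys)" by simp
  moreover have "sorted (rev xs)" "sorted (rev ys)" using assms(1,2) by (simp_all add: sorted_wrt_rev)
  ultimately have "rev xs = rev ys" by (metis properties_for_sort)
  then show ?thesis by simp
qed

lemma normal_sequence_eqI:
  assumes ps: "normal_sequence ps" and qs: "normal_sequence qs"
    and sums: "\<And>k. sum_list (map (\<lambda>(l, m). m - k) ps) = sum_list (map (\<lambda>(l, m). m - k) qs)"
    and inv: "\<And>p k. (\<forall>(l, m)\<in>set ps. l \<le> k + (m - p)) \<longleftrightarrow> (\<forall>(l, m)\<in>set qs. l \<le> k + (m - p))"
  shows "ps = qs"
proof -
  have ms: "map snd ps = map snd qs"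
  proof (rule sorted_ge_eqI)
    fix k
    show "sum_list (map (\<lambda>m. m - k) (map snd ps)) = sum_list (map (\<lambda>m. m - k) (map snd qs))"
      using sums[of k] by (simp add: case_prod_unfold o_def)
  qed (use ps qs in \<open>auto simp: normal_sequence_def sorted_wrt_map elim!: sorted_wrt_mono_rel[rotated]\<close>)
  have l: "fst (xs ! i) = (LEAST k. \<forall>(l, m)\<in>set xs. l \<le> k + (m - snd (xs ! i)))"
    if xs: "normal_sequence xs" and i: "i < length xs" for xs i
  proof (rule Least_equality[symmetric])
    show "\<forall>(l, m)\<in>set xs. l \<le> fst (xs ! i) + (m - snd (xs ! i))"
    proof clarify
      fix l m assume "(l, m) \<in> set xs"
      then obtain j where j: "j < length xs" "xs ! j = (l, m)" by (auto simp: in_set_conv_nth)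
      show "l \<le> fst (xs ! i) + (m - snd (xs ! i))"
      proof (cases "i \<le> j")
        case True then show ?thesis using normal_sequence_mono(2)[OF xs True j(1)] j(2) by simp
      next
        case False
        then have "snd (xs ! i) \<le> m" "snd (xs ! i) - fst (xs ! i) \<le> m - l"
          using normal_sequence_mono[OF xs, of j i] i j(2) by auto
        then show ?thesis using normal_sequenceD(3)[OF xs i] normal_sequenceD(3)[OF xs j(1)] j(2) by simp
      qed
    qed
    fix k assume k: "\<forall>(l, m)\<in>set xs. l \<le> k + (m - snd (xs ! i))"
    have "(fst (xs ! i), snd (xs ! i)) \<in> set xs" using i by simp
    with k show "fst (xs ! i) \<le> k" by fastforce
  qed
  show ?thesis
  proof (rule nth_equalityI)
    show len: "length ps = length qs" using ms by (metis length_map)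
    fix i assume i: "i < length ps"
    have s: "snd (ps ! i) = snd (qs ! i)" using ms i len by (metis nth_map)
    moreover have "fst (ps ! i) = fst (qs ! i)"
      using l[OF ps i] l[OF qs, of i] i len s inv by simp
    ultimately show "ps ! i = qs ! i" by (rule prod_eqI[rotated])
  qed
qed

section \<open>Symplectic spaces in characteristic 2\<close>

lemma (in vector_space) gl_iff:
  "x \<in> gl scale \<longleftrightarrow> (\<forall>v w. x (v + w) = x v + x w) \<and> (\<forall>c v. x (scale c v) = scale c (x v))"
  using vector_space_axioms by (simp add: gl_def Vector_Spaces.linear_iff)

lemma (in vector_space) functional_iff:
  "Vector_Spaces.linear scale (*) f \<longleftrightarrow> (\<forall>v w. f (v + w) = f v + f w) \<and> (\<forall>c v. f (scale c v) = c * f v)"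
proof -
  have "vector_space ((*) :: 'a \<Rightarrow> 'a \<Rightarrow> 'a)" by unfold_locales (simp_all add: algebra_simps)
  with vector_space_axioms show ?thesis by (simp add: Vector_Spaces.linear_iff)
qed

lemma infinite_alg_closed: "infinite (UNIV :: 'a::alg_closed_field set)"
proof
  assume fin: "finite (UNIV :: 'a set)"
  define p where "p = (\<Prod>a\<in>(UNIV :: 'a set). [:- a, 1:])"
  have deg: "degree p = card (UNIV :: 'a set)"
    unfolding p_def by (subst degree_prod_eq_sum_degree) auto
  have "card (UNIV :: 'a set) > 0" using fin by (simp add: card_gt_0_iff)
  then have "degree (p + 1) > 0" using deg by (subst degree_add_eq_left) auto
  then obtain x where "poly (p + 1) x = 0" using alg_closed_imp_poly_has_root by blast
  moreover have "poly p x = 0" unfolding p_def poly_prod using fin by (auto intro!: prod_zero)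
  ultimately show False by simp
qed

lemma quadratic_root:
  fixes a b c :: "'a::alg_closed_field"
  assumes "a \<noteq> 0"
  obtains x where "a * x\<^sup>2 + b * x + c = 0"
proof -
  have "degree [:c, b, a:] > 0" using assms by auto
  then obtain x where "poly [:c, b, a:] x = 0" using alg_closed_imp_poly_has_root by blast
  then show thesis by (intro that[of x]) (simp add: algebra_simps power2_eq_square)
qed

text \<open>Downward induction from the region where all values are \<open>z\<close>. With
  \<open>z = 0\<close> this is the form in which the injectivity of \<open>1 + c T^i\<close> for
  nilpotent \<open>T\<close> is used.\<close>

lemma shift_recurrence_zero:
  fixes f :: "nat \<Rightarrow> 'a"
  assumes "\<And>k. f k = g (f (k + i))" "g z = z" "1 \<le> i" "\<And>k. N \<le> k \<Longrightarrow> f k = z"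
  shows "f k = z"
proof (induction "N - k" arbitrary: k rule: less_induct)
  case less
  show ?case
  proof (cases "N \<le> k")
    case False
    then have "f (k + i) = z" using assms(3) by (intro less) linarith
    then show ?thesis using assms(1)[of k] assms(2) by simp
  qed (rule assms(4))
qed

locale symp = finite_dimensional_vector_space scale Basis
  for scale :: "'k::alg_closed_field \<Rightarrow> 'v::ab_group_add \<Rightarrow> 'v" (infixr "*s" 75) and Basis +
  fixes \<beta> :: "'v \<Rightarrow> 'v \<Rightarrow> 'k"
  assumes char2: "CHAR('k) = 2" and symp: "symplectic_form scale \<beta>"
begin

lemma add_self [simp]: "x + x = (0 :: 'k)"
proof -
  have "of_nat 2 = (0 :: 'k)" using char2 by (metis of_nat_CHAR)
  then have "(1 + 1) * x = 0" by simp
  then show ?thesis by (simp only: distrib_right mult_1_left)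
qed

lemma minus_id [simp]: "- x = (x :: 'k)" using add_self[of x] by (simp only: add_eq_0_iff)

lemma diff_eq_add [simp]: "x - y = (x + y :: 'k)" by (simp only: diff_conv_add_uminus minus_id)

lemma add_self_left [simp]: "x + (x + y) = (y :: 'k)" by (simp flip: add.assoc)

lemma sum_eq_0_iff: "x + y = (0 :: 'k) \<longleftrightarrow> x = y" using add_eq_0_iff[of x y] by auto

lemma power2_add: "(x + y)\<^sup>2 = x\<^sup>2 + (y :: 'k)\<^sup>2"
proof -
  have "(x + y)\<^sup>2 = x\<^sup>2 + y\<^sup>2 + (x * y + x * y)" by (simp only: power2_eq_square algebra_simps)
  then show ?thesis by simp
qed

lemma vadd_self [simp]: "v + v = (0 :: 'v)"
  using scale_left_distrib[of 1 1 v] by simp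

lemma vminus_id [simp]: "- v = (v :: 'v)" using vadd_self[of v] by (simp only: add_eq_0_iff)

lemma vadd_self_left [simp]: "v + (v + w) = (w :: 'v)" by (simp flip: add.assoc)

lemma vsum_eq_0_iff: "v + w = (0 :: 'v) \<longleftrightarrow> v = w" using add_eq_0_iff[of v w] by auto

lemma \<beta>_add: "\<beta> (u + v) w = \<beta> u w + \<beta> v w" "\<beta> u (v + w) = \<beta> u v + \<beta> u w"
  and \<beta>_scale: "\<beta> (c *s u) w = c * \<beta> u w" "\<beta> u (c *s w) = c * \<beta> u w"
  and \<beta>_self [simp]: "\<beta> u u = 0"
  using symp unfolding symplectic_form_def functional_iff by auto

lemma \<beta>_nondeg: "(\<And>w. \<beta> v w = 0) \<Longrightarrow> v = 0"
  using symp unfolding symplectic_form_def by blast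

lemma \<beta>_0 [simp]: "\<beta> 0 v = 0" "\<beta> v 0 = 0"
  using \<beta>_scale(1)[of 0 0 v] \<beta>_scale(2)[of v 0 0] by simp_all

lemma \<beta>_sym: "\<beta> u v = \<beta> v u"
  using \<beta>_self[of "u + v"] by (simp add: \<beta>_add sum_eq_0_iff del: \<beta>_self) (simp add: sum_eq_0_iff)

lemma \<beta>_sum: "\<beta> (sum f A) w = (\<Sum>i\<in>A. \<beta> (f i) w)" "\<beta> w (sum f A) = (\<Sum>i\<in>A. \<beta> w (f i))"
  by (induction A rule: infinite_finite_induct) (simp_all add: \<beta>_add)

text \<open>Pairing with \<open>y i\<close> annihilates \<open>S\<close> and every other
  \<open>x j\<close> but not \<open>x i\<close>, so each new vector lies outside the span of the old
  ones. Dimensions below are counted by exhibiting such dual families.\<close>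

lemma dim_dual_family:
  assumes "finite I" "\<And>i j. i \<in> I \<Longrightarrow> j \<in> I \<Longrightarrow> \<beta> (y i) (x j) = (if i = j then 1 else 0)"
    and "\<And>i s. i \<in> I \<Longrightarrow> s \<in> S \<Longrightarrow> \<beta> (y i) s = 0"
  shows "dim (S \<union> x ` I) = dim S + card I"
  using assms
proof (induction I rule: finite_induct)
  case (insert i I)
  have "x i \<notin> span (S \<union> x ` I)"
  proof
    assume "x i \<in> span (S \<union> x ` I)"
    moreover have "S \<union> x ` I \<subseteq> {v. \<beta> (y i) v = 0}" using insert by auto
    moreover have "subspace {v. \<beta> (y i) v = 0}" by (auto simp: subspace_def \<beta>_add \<beta>_scale)
    ultimately have "\<beta> (y i) (x i) = 0" using span_minimal by blast
    then show False using insert.prems(1)[of i i] by simp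
  qed
  then have "dim (insert (x i) (S \<union> x ` I)) = dim (S \<union> x ` I) + 1" by (simp add: dim_insert)
  then show ?case using insert by simp
qed simp

end

section \<open>Form modules with nilpotent operator\<close>

text \<open>The form module of a nilpotent functional, freed from the functional. \<open>T\<close>
  is determined by \<open>\<alpha>_add\<close> as the operator of the polar form.\<close>

locale form_mod = symp +
  fixes \<alpha> :: "'b \<Rightarrow> 'a" and T :: "'b \<Rightarrow> 'b"
  assumes T_gl: "T \<in> gl scale"
    and \<alpha>_scale: "\<alpha> (scale c v) = c\<^sup>2 * \<alpha> v"
    and \<alpha>_add: "\<alpha> (v + w) = \<alpha> v + \<alpha> w + \<beta> (T v) w"
    and nilpotent: "\<exists>N. \<forall>v. (T ^^ N) v = 0"
begin

abbreviation Tp :: "nat \<Rightarrow> 'b \<Rightarrow> 'b" where "Tp k v \<equiv> (T ^^ k) v"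

lemma T_add: "T (v + w) = T v + T w" and T_scale: "T (c *s v) = c *s T v"
  using T_gl by (auto simp: gl_iff)

lemma T_0 [simp]: "T 0 = 0" using T_scale[of 0 0] by simp

lemma Tp_add: "Tp k (v + w) = Tp k v + Tp k w" by (induction k) (simp_all add: T_add)

lemma Tp_scale: "Tp k (c *s v) = c *s Tp k v" by (induction k) (simp_all add: T_scale)

lemma Tp_0 [simp]: "Tp k 0 = 0" by (induction k) simp_all

lemma Tp_Tp [simp]: "Tp i (Tp j v) = Tp (i + j) v" by (simp add: funpow_add)

lemma T_Tp: "T (Tp j v) = Tp (Suc j) v" by simp

lemma Tp_sum: "Tp k (sum f A) = (\<Sum>i\<in>A. Tp k (f i))"
  by (induction A rule: infinite_finite_induct) (simp_all add: Tp_add)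

lemma Tp_ge: "Tp m v = 0 \<Longrightarrow> m \<le> k \<Longrightarrow> Tp k v = 0"
  using Tp_Tp[of "k - m" m v] by simp

lemma \<alpha>_0 [simp]: "\<alpha> 0 = 0" using \<alpha>_scale[of 0 0] by simp

lemma T_adj: "\<beta> (T u) v = \<beta> u (T v)"
proof -
  have "\<alpha> u + \<alpha> v + \<beta> (T u) v = \<alpha> v + \<alpha> u + \<beta> (T v) u"
    using \<alpha>_add[of u v] \<alpha>_add[of v u] by (simp add: add.commute)
  then show ?thesis by (simp add: add.commute[of "\<alpha> v"] \<beta>_sym)
qed

lemma Tp_adj: "\<beta> (Tp k u) v = \<beta> u (Tp k v)"
  by (induction k arbitrary: v) (simp_all add: T_adj funpow_swap1[symmetric])

lemma T_alt: "\<beta> (T v) v = 0"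
  using \<alpha>_add[of v v] by simp

text \<open>Self-adjointness distributes \<open>T^k\<close> over both arguments. With
  \<open>x = T^j v\<close> the value is \<open>\<beta> x x\<close> for even \<open>k\<close> and
  \<open>\<beta> (T x) x\<close> for odd \<open>k\<close>, the polar form of \<open>\<alpha>\<close>
  on the diagonal. Hence cyclic modules are totally isotropic.\<close>

lemma Tp_alt [simp]: "\<beta> (Tp k v) v = 0"
proof (cases "even k")
  case True
  then obtain j where "k = j + j" by (metis evenE mult_2)
  then have "\<beta> (Tp k v) v = \<beta> (Tp j (Tp j v)) v" by simp
  also have "\<dots> = \<beta> (Tp j v) (Tp j v)" by (rule Tp_adj)
  finally show ?thesis by simp
next
  case False
  then obtain j where "k = Suc (j + j)" by (metis oddE mult_2 Suc_eq_plus1)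
  then have "\<beta> (Tp k v) v = \<beta> (Tp j (T (Tp j v))) v" by (simp add: funpow_swap1)
  also have "\<dots> = \<beta> (T (Tp j v)) (Tp j v)" by (rule Tp_adj)
  finally show ?thesis by (simp only: T_alt)
qed

lemma \<beta>_Tp_Tp: "\<beta> (Tp i u) (Tp j v) = \<beta> (Tp (i + j) u) v"
  using Tp_adj[of j "Tp i u" v] by (simp add: add.commute)

lemma \<beta>_Tp_swap: "\<beta> (Tp i u) v = \<beta> (Tp i v) u"
  by (subst Tp_adj) (rule \<beta>_sym)

lemma \<beta>_Tp_same [simp]: "\<beta> (Tp i u) (Tp j u) = 0" by (simp add: \<beta>_Tp_Tp)

text \<open>The exponent \<open>2 * k + 1\<close> is \<open>k\<close> from either argument plus the
  \<open>T\<close> of the polar form. It is the source of the bound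
  \<open>m \<le> 2 * l + 1\<close>.\<close>

lemma \<alpha>_Tp_add: "\<alpha> (Tp k (v + w)) = \<alpha> (Tp k v) + \<alpha> (Tp k w) + \<beta> (Tp (2 * k + 1) v) w"
proof -
  have "\<beta> (T (Tp k v)) (Tp k w) = \<beta> (Tp (Suc k + k) v) w"
    using \<beta>_Tp_Tp[of "Suc k" v k w] by simp
  then show ?thesis by (simp add: Tp_add \<alpha>_add mult_2)
qed

lemma \<alpha>_Tp_ge: "(\<And>x. x \<in> Q \<Longrightarrow> T x \<in> Q) \<Longrightarrow> (\<And>x. x \<in> Q \<Longrightarrow> \<alpha> (Tp l x) = 0) \<Longrightarrow> l \<le> k \<Longrightarrow> x \<in> Q \<Longrightarrow> \<alpha> (Tp k x) = 0"
proof -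
  assume *: "\<And>x. x \<in> Q \<Longrightarrow> T x \<in> Q" "\<And>x. x \<in> Q \<Longrightarrow> \<alpha> (Tp l x) = 0" "l \<le> k" "x \<in> Q"
  have "Tp j x \<in> Q" for j by (induction j) (simp_all add: *)
  then have "\<alpha> (Tp l (Tp (k - l) x)) = 0" by (rule *)
  then show "\<alpha> (Tp k x) = 0" using *(3) by simp
qed

text \<open>The complement of the whole cyclic module generated by \<open>u\<close> under
  \<open>T\<close>, not of the line through \<open>u\<close>; it is therefore stable under
  \<open>T\<close>.\<close>

definition perp :: "'b \<Rightarrow> 'b set" where "perp u = {x. \<forall>k. \<beta> (Tp k u) x = 0}"

definition tsub :: "'b set \<Rightarrow> bool" where "tsub Q \<longleftrightarrow> subspace Q \<and> (\<forall>x\<in>Q. T x \<in> Q)"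

definition nondeg :: "'b set \<Rightarrow> bool" where "nondeg Q \<longleftrightarrow> (\<forall>x\<in>Q. (\<forall>y\<in>Q. \<beta> x y = 0) \<longrightarrow> x = 0)"

text \<open>By self-adjointness the last clause says that \<open>T^i u\<close> and
  \<open>T^j w\<close> pair to 1 if \<open>i + j = m - 1\<close> and to 0 otherwise, as
  \<open>v\<^sub>1\<close> and \<open>v\<^sub>2\<close> do in \<open>*W_l(m)\<close>. The pairings
  within one cyclic module vanish by \<open>Tp_alt\<close>.\<close>

definition hyp :: "nat \<Rightarrow> 'b \<Rightarrow> 'b \<Rightarrow> bool" where
  "hyp m u w \<longleftrightarrow> 1 \<le> m \<and> Tp m u = 0 \<and> Tp m w = 0 \<and> (\<forall>k. \<beta> (Tp k u) w = (if Suc k = m then 1 else 0))"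

definition comb :: "nat \<Rightarrow> (nat \<Rightarrow> 'a) \<Rightarrow> 'b \<Rightarrow> 'b" where
  "comb m a u = (\<Sum>k<m. a k *s Tp k u)"

lemma perpD: "x \<in> perp u \<Longrightarrow> \<beta> (Tp k u) x = 0" by (simp add: perp_def)

lemma perp_Tp: "x \<in> perp u \<Longrightarrow> \<beta> (Tp k u) (Tp j x) = 0" by (simp add: perp_def \<beta>_Tp_Tp)

lemma tsub_subspace: "tsub Q \<Longrightarrow> subspace Q" by (simp add: tsub_def)

lemma tsub_Tp: "tsub Q \<Longrightarrow> x \<in> Q \<Longrightarrow> Tp k x \<in> Q"
  by (induction k) (simp_all add: tsub_def)

lemma tsub_add: "tsub Q \<Longrightarrow> x \<in> Q \<Longrightarrow> y \<in> Q \<Longrightarrow> x + y \<in> Q"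
  and tsub_scale: "tsub Q \<Longrightarrow> x \<in> Q \<Longrightarrow> c *s x \<in> Q"
  and tsub_0: "tsub Q \<Longrightarrow> 0 \<in> Q"
  by (auto simp: tsub_def subspace_def)

lemma tsub_perp: "tsub Q \<Longrightarrow> tsub (Q \<inter> perp u \<inter> perp w)"
  using perp_Tp[of _ _ _ 1] by (auto simp: tsub_def subspace_def perp_def \<beta>_add \<beta>_scale)

lemma tsub_UNIV: "tsub UNIV" by (simp add: tsub_def)

lemma nondeg_UNIV: "nondeg UNIV" using \<beta>_nondeg by (auto simp: nondeg_def)

lemma comb_in: "tsub Q \<Longrightarrow> u \<in> Q \<Longrightarrow> comb m a u \<in> Q"
  unfolding comb_def by (intro subspace_sum tsub_scale tsub_Tp tsub_subspace) auto

lemma hyp_sym: "hyp m u w \<Longrightarrow> hyp m w u"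
  by (auto simp: hyp_def \<beta>_Tp_swap[of _ w u])

lemma \<beta>_comb_perp: "x \<in> perp u \<Longrightarrow> \<beta> x (comb m a u) = 0"
  by (simp add: comb_def \<beta>_sum \<beta>_scale perpD \<beta>_sym[of x])

lemma \<beta>_comb_same: "\<beta> (Tp j u) (comb m a u) = 0"
  by (simp add: comb_def \<beta>_sum \<beta>_scale)

lemma \<beta>_comb:
  assumes "hyp m u w"
  shows "\<beta> (Tp j w) (comb m a u) = (if j < m then a (m - 1 - j) else 0)"
proof -
  have "\<beta> (Tp j w) (comb m a u) = (\<Sum>k<m. a k * \<beta> (Tp (j + k) u) w)"
    by (simp add: comb_def \<beta>_sum \<beta>_scale \<beta>_Tp_Tp \<beta>_Tp_swap[of _ w u])
  also have "\<dots> = (\<Sum>k<m. if k = m - 1 - j then (if j < m then a k else 0) else 0)"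
    using assms by (intro sum.cong) (auto simp: hyp_def)
  also have "\<dots> = (if j < m then a (m - 1 - j) else 0)" by (subst sum.delta) auto
  finally show ?thesis .
qed

text \<open>The vectors \<open>T^(m-1-k) w\<close> and \<open>T^(m-1-k) u\<close> form the dual
  basis of the block, so the coefficients are pairings, and the remainder is orthogonal to both
  cyclic modules.\<close>

lemma hyp_decomp:
  assumes "tsub Q" "u \<in> Q" "w \<in> Q" "hyp m u w" "x \<in> Q"
  obtains a b z where "x = comb m a u + comb m b w + z" "z \<in> Q \<inter> perp u \<inter> perp w"
proof -
  define a where "a = (\<lambda>k. \<beta> (Tp (m - 1 - k) w) x)"
  define b where "b = (\<lambda>k. \<beta> (Tp (m - 1 - k) u) x)"
  define z where "z = x + (comb m a u + comb m b w)"
  have "\<beta> (Tp j w) z = 0" for j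
    using assms(4) Tp_ge[of m w j]
    by (auto simp: z_def \<beta>_add \<beta>_comb[OF assms(4)] \<beta>_comb_same a_def hyp_def)
  moreover have "\<beta> (Tp j u) z = 0" for j
    using assms(4) Tp_ge[of m u j]
    by (auto simp: z_def \<beta>_add \<beta>_comb[OF hyp_sym[OF assms(4)]] \<beta>_comb_same b_def hyp_def)
  moreover have "z \<in> Q" unfolding z_def using assms by (intro tsub_add comb_in) auto
  ultimately have "z \<in> Q \<inter> perp u \<inter> perp w" by (simp add: perp_def)
  moreover have "x = comb m a u + comb m b w + z" by (simp add: z_def add_ac)
  ultimately show thesis using that by blast
qed

lemma nondeg_perp:
  assumes "tsub Q" "nondeg Q" "u \<in> Q" "w \<in> Q" "hyp m u w"
  shows "nondeg (Q \<inter> perp u \<inter> perp w)"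
  unfolding nondeg_def
proof (intro ballI impI)
  fix x assume x: "x \<in> Q \<inter> perp u \<inter> perp w" "\<forall>y\<in>Q \<inter> perp u \<inter> perp w. \<beta> x y = 0"
  have "\<beta> x y = 0" if yQ: "y \<in> Q" for y
  proof -
    obtain a b z where y: "y = comb m a u + comb m b w + z" and z: "z \<in> Q \<inter> perp u \<inter> perp w"
      using hyp_decomp[OF assms(1,3,4,5) yQ] by blast
    show ?thesis using x z by (simp add: y \<beta>_add \<beta>_comb_perp)
  qed
  then show "x = 0" using assms(2) x(1) by (auto simp: nondeg_def)
qed

text \<open>\<open>1 + c T^i\<close> is invertible because \<open>T\<close> is nilpotent, so
  \<open>u\<close> and \<open>u + c T^i u\<close> generate the same cyclic module.\<close>

lemma perp_shift:
  assumes "1 \<le> i"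
  shows "perp (u + c *s Tp i u) = perp u"
proof
  show "perp u \<subseteq> perp (u + c *s Tp i u)"
    by (auto simp: perp_def Tp_add Tp_scale \<beta>_add \<beta>_scale)
  show "perp (u + c *s Tp i u) \<subseteq> perp u"
  proof
    fix x assume x: "x \<in> perp (u + c *s Tp i u)"
    obtain N where N: "Tp N u = 0" using nilpotent by blast
    have "\<beta> (Tp k u) x = 0" for k
    proof (rule shift_recurrence_zero[of "\<lambda>k. \<beta> (Tp k u) x" "(*) c" i 0 N])
      fix k show "\<beta> (Tp k u) x = c * \<beta> (Tp (k + i) u) x"
        using perpD[OF x, of k] by (simp add: Tp_add Tp_scale \<beta>_add \<beta>_scale sum_eq_0_iff)
    qed (use assms Tp_ge[OF N] in auto)
    then show "x \<in> perp u" by (simp add: perp_def)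
  qed
qed

lemma perp_scale: "c \<noteq> 0 \<Longrightarrow> perp (c *s u) = perp u"
  by (auto simp: perp_def Tp_scale \<beta>_scale)

text \<open>A geometric series: after \<open>N\<close> terms the error is
  \<open>c^N T^(i N) w\<close>, which nilpotency removes. The partial sums stay inside
  \<open>Q\<close>.\<close>

lemma unit_inverse:
  assumes "1 \<le> i" "tsub Q" "w \<in> Q"
  obtains w' where "w' \<in> Q" "w' + c *s Tp i w' = w"
proof -
  have "\<exists>w'\<in>Q. w' + c *s Tp i w' = w + c ^ N *s Tp (i * N) w" for N
  proof (induction N)
    case 0 then show ?case using tsub_0[OF assms(2)] by (intro bexI[of _ 0]) simp_all
  next
    case (Suc N)
    then obtain w' where w': "w' \<in> Q" "w' + c *s Tp i w' = w + c ^ N *s Tp (i * N) w" by blast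
    define w'' where "w'' = w' + c ^ N *s Tp (i * N) w"
    have "w'' + c *s Tp i w'' = (w' + c *s Tp i w') + c ^ N *s Tp (i * N) w + c ^ Suc N *s Tp (i * Suc N) w"
      by (simp add: w''_def Tp_add Tp_scale scale_right_distrib add_ac)
    also have "\<dots> = w + c ^ Suc N *s Tp (i * Suc N) w" by (simp add: w'(2) add.assoc)
    finally show ?case using w'(1) assms by (intro bexI[of _ w'']) (auto simp: w''_def intro!: tsub_add tsub_scale tsub_Tp tsub_subspace)
  qed
  moreover obtain N where N: "Tp N w = 0" using nilpotent by blast
  moreover have "Tp (i * N) w = 0" using Tp_ge[OF N, of "i * N"] assms(1) by simp
  ultimately show thesis using that by (metis add.right_neutral scale_zero_right)
qed

lemma unit_cancel:
  assumes "1 \<le> i" "y + c *s Tp i y = 0"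
  shows "y = 0"
proof -
  obtain N where N: "Tp N y = 0" using nilpotent by blast
  have y: "y = c *s Tp i y" using assms(2) by (simp add: vsum_eq_0_iff)
  have "Tp 0 y = 0"
  proof (rule shift_recurrence_zero[of "\<lambda>k. Tp k y" "(*s) c" i 0 N])
    fix k show "Tp k y = c *s Tp (k + i) y" using arg_cong[OF y, of "Tp k"] by (simp add: Tp_scale)
  qed (use assms(1) Tp_ge[OF N] in auto)
  then show ?thesis by simp
qed

text \<open>A block before normalisation: \<open>l - 1\<close> is the last index with
  \<open>\<alpha> (T^k u)\<close> nonzero, while the value there and all lower values are still
  free.\<close>

definition wblk :: "nat \<Rightarrow> nat \<Rightarrow> 'b \<Rightarrow> 'b \<Rightarrow> bool" where
  "wblk l m u w \<longleftrightarrow> hyp m u w \<and> (\<forall>k\<ge>l. \<alpha> (Tp k u) = 0) \<and> (1 \<le> l \<longrightarrow> \<alpha> (Tp (l - 1) u) \<noteq> 0) \<and>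
     (\<forall>k. \<alpha> (Tp k w) = 0)"

definition blk :: "nat \<Rightarrow> nat \<Rightarrow> 'b \<Rightarrow> 'b \<Rightarrow> bool" where
  "blk l m u w \<longleftrightarrow> hyp m u w \<and> (\<forall>k. \<alpha> (Tp k u) = (if Suc k = l then 1 else 0)) \<and> (\<forall>k. \<alpha> (Tp k w) = 0) \<and>
     m div 2 \<le> l \<and> l \<le> m"

text \<open>Replacing \<open>u\<close> by \<open>f(T) u\<close> and \<open>w\<close> by
  \<open>f(T)\<inverse> w\<close> for a unit \<open>f\<close> keeps all pairings, as
  \<open>T\<close> is self-adjoint, and both complements. Since the field has square roots, suitable
  factors \<open>1 + c T^i\<close> correct the values \<open>\<alpha> (T^k u)\<close> from the top
  downwards.\<close>

lemma normalise_block: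
  assumes "wblk l m u w" "tsub Q" "u \<in> Q" "w \<in> Q" "m div 2 \<le> l" "l \<le> m"
  obtains u' w' where "blk l m u' w'" "u' \<in> Q" "w' \<in> Q" "perp u' = perp u" "perp w' = perp w"
proof (cases "l = 0")
  case True
  with assms that[of u w] show thesis by (auto simp: wblk_def blk_def)
next
  case False
  define ok where "ok = (\<lambda>j u' w'. wblk l m u' w' \<and> u' \<in> Q \<and> w' \<in> Q \<and> perp u' = perp u \<and> perp w' = perp w \<and>
      (\<forall>k\<ge>l - 1 - j. \<alpha> (Tp k u') = (if Suc k = l then 1 else 0)))"
  have "j \<le> l - 1 \<Longrightarrow> \<exists>u' w'. ok j u' w'" for j
  proof (induction j)
    case 0
    have "\<alpha> (Tp (l - 1) u) \<noteq> 0" using assms(1) False by (auto simp: wblk_def)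
    then obtain s where "\<alpha> (Tp (l - 1) u) * s\<^sup>2 + 0 * s + 1 = 0" using quadratic_root by blast
    then have s: "s\<^sup>2 * \<alpha> (Tp (l - 1) u) = 1" by (simp add: sum_eq_0_iff mult.commute)
    then have "s \<noteq> 0" by auto
    have "wblk l m (s *s u) (inverse s *s w)"
      using assms(1) \<open>s \<noteq> 0\<close> by (auto simp: wblk_def hyp_def Tp_scale \<beta>_scale \<alpha>_scale)
    moreover have "\<alpha> (Tp k (s *s u)) = (if Suc k = l then 1 else 0)" if "l - 1 \<le> k" for k
    proof (cases "Suc k = l")
      case True with s show ?thesis by (auto simp: Tp_scale \<alpha>_scale)
    next
      case False
      with that have "l \<le> k" by auto
      with assms(1) show ?thesis by (auto simp: Tp_scale \<alpha>_scale wblk_def)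
    qed
    ultimately have "ok 0 (s *s u) (inverse s *s w)"
      using \<open>s \<noteq> 0\<close> assms by (auto simp: ok_def perp_scale intro: tsub_scale)
    then show ?case by blast
  next
    case (Suc j)
    then obtain u1 w1 where 1: "ok j u1 w1" by auto
    then have h: "hyp m u1 w1" and w1: "\<And>k. \<alpha> (Tp k w1) = 0" and Q1: "u1 \<in> Q" "w1 \<in> Q"
      and a: "\<And>k. l - 1 - j \<le> k \<Longrightarrow> \<alpha> (Tp k u1) = (if Suc k = l then 1 else 0)"
      by (auto simp: ok_def wblk_def)
    define i where "i = Suc j"
    have i: "1 \<le> i" "i \<le> l - 1" using Suc.prems by (auto simp: i_def)
    \<comment> \<open>The shift by \<open>i\<close> brings the value 1 from index
      \<open>l - 1\<close> to index \<open>l - 1 - i\<close>, multiplied by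
      \<open>c\<^sup>2\<close>; it has to cancel the value found there.\<close>
    obtain c where "1 * c\<^sup>2 + 0 * c + \<alpha> (Tp (l - 1 - i) u1) = 0" using quadratic_root[of 1] by (metis zero_neq_one)
    then have c: "c\<^sup>2 = \<alpha> (Tp (l - 1 - i) u1)" by (simp add: sum_eq_0_iff)
    define u2 where "u2 = u1 + c *s Tp i u1"
    obtain w2 where w2: "w2 \<in> Q" "w2 + c *s Tp i w2 = w1" using unit_inverse[OF i(1) assms(2) Q1(2)] by blast
    have Tpw: "Tp k w1 = Tp k w2 + c *s Tp (k + i) w2" for k
      using arg_cong[OF w2(2), of "Tp k"] by (simp add: Tp_add Tp_scale)
    have "Tp m w2 = 0" using unit_cancel[OF i(1), of "Tp m w2" c] Tpw[of m] h by (simp add: hyp_def add.commute)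
    moreover have "\<beta> (Tp k u2) w2 = \<beta> (Tp k u1) w1" for k
    proof -
      have "\<beta> (Tp k u2) w2 = \<beta> (Tp k u1) w2 + c * \<beta> (Tp k u1) (Tp i w2)"
        by (simp add: u2_def Tp_add Tp_scale \<beta>_add \<beta>_scale \<beta>_Tp_Tp)
      also have "\<dots> = \<beta> (Tp k u1) w1" by (simp add: w2(2)[symmetric] \<beta>_add \<beta>_scale)
      finally show ?thesis .
    qed
    moreover have "Tp m u2 = 0" using h Tp_ge[of m u1 "m + i"] by (simp add: u2_def Tp_add Tp_scale hyp_def)
    ultimately have h2: "hyp m u2 w2" using h by (simp add: hyp_def)
    \<comment> \<open>As \<open>w1 = w2 + c T^i w2\<close> and the cross term vanishes,
      \<open>\<alpha> (T^k w1) = 0\<close> becomes a recurrence for the values on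
      \<open>w2\<close>.\<close>
    have aw2: "\<alpha> (Tp k w2) = 0" for k
    proof -
      obtain N where N: "Tp N w2 = 0" using nilpotent by blast
      show ?thesis
      proof (rule shift_recurrence_zero[of "\<lambda>k. \<alpha> (Tp k w2)" "(*) (c\<^sup>2)" i 0 N])
        fix k
        have "\<alpha> (Tp k (w2 + c *s Tp i w2)) = \<alpha> (Tp k w2) + c\<^sup>2 * \<alpha> (Tp (k + i) w2)"
          unfolding \<alpha>_Tp_add by (simp add: Tp_scale \<alpha>_scale \<beta>_scale del: funpow.simps)
        then show "\<alpha> (Tp k w2) = c\<^sup>2 * \<alpha> (Tp (k + i) w2)" using w1[of k] by (simp add: w2(2) sum_eq_0_iff)
      qed (use i Tp_ge[OF N] in auto)
    qed
    have au2: "\<alpha> (Tp k u2) = \<alpha> (Tp k u1) + c\<^sup>2 * \<alpha> (Tp (k + i) u1)" for k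
      unfolding u2_def \<alpha>_Tp_add by (simp add: Tp_scale \<alpha>_scale \<beta>_scale del: funpow.simps)
    have au2': "\<alpha> (Tp k u2) = (if Suc k = l then 1 else 0)" if "l - 1 - i \<le> k" for k
    proof (cases "k = l - 1 - i")
      case True
      then have "k + i = l - 1" "Suc k \<noteq> l" using i by auto
      then show ?thesis using a[of "l - 1"] False True by (simp add: au2 c)
    next
      case neq: False
      then have "l - 1 - j \<le> k" "l \<le> k + i" using that i by (auto simp: i_def)
      then show ?thesis using a[of k] a[of "k + i"] by (simp add: au2)
    qed
    have "wblk l m u2 w2" unfolding wblk_def using h2 aw2 au2' False by auto
    moreover have "perp u2 = perp u" using 1 perp_shift[OF i(1)] by (simp add: ok_def u2_def)
    moreover have "perp w2 = perp w" using 1 perp_shift[OF i(1), of w2 c] by (simp add: ok_def w2(2))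
    moreover have "u2 \<in> Q" unfolding u2_def using Q1 assms(2) by (intro tsub_add tsub_scale tsub_Tp tsub_subspace) auto
    ultimately have "ok (Suc j) u2 w2" using w2(1) au2' by (auto simp: ok_def i_def)
    then show ?case by blast
  qed
  from this[of "l - 1"] obtain u' w' where "ok (l - 1) u' w'" by blast
  then show thesis using assms(5,6) by (intro that[of u' w']) (auto simp: ok_def wblk_def blk_def)
qed

end

section \<open>Splitting off a block with \<open>m\<close> and \<open>l\<close> maximal\<close>

context form_mod
begin

lemma exists_not_root:
  fixes a b :: 'a
  assumes "a \<noteq> 0"
  obtains c where "c \<noteq> 0" "a + c * b \<noteq> 0"
proof -
  have "infinite (UNIV - {0, a / b})" using infinite_alg_closed by simp
  then have "UNIV - {0, a / b} \<noteq> {}" by (metis finite.emptyI)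
  then obtain c where c: "c \<in> UNIV - {0, a / b}" by blast
  have "a + c * b \<noteq> 0"
  proof
    assume "a + c * b = 0"
    then have ac: "a = c * b" by (simp add: sum_eq_0_iff)
    then have "b \<noteq> 0" using assms by auto
    then show False using ac c by simp
  qed
  with c that show thesis by blast
qed

lemma ex_min_nat:
  fixes P :: "nat \<Rightarrow> bool"
  assumes "P N"
  obtains m where "P m" "m = 0 \<or> \<not> P (m - 1)"
proof -
  define m where "m = (LEAST m. P m)"
  have "P m" using assms unfolding m_def by (rule LeastI)
  moreover have "m = 0 \<or> \<not> P (m - 1)" using not_less_Least[of "m - 1" P] unfolding m_def by fastforce
  ultimately show thesis by (rule that)
qed

text \<open>The lower coefficients \<open>\<alpha>(T\<^sup>k w)\<close> are killed from the top down. Adding \<open>c T\<^sup>i u\<close> to \<open>w\<close>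
  changes \<open>\<alpha>(T\<^sup>k w)\<close> by \<open>c\<^sup>2 \<alpha>(T\<^bsup>k+i\<^esup> u)\<close> plus a cross term \<open>c\<close> at \<open>2k + i + 2 = m\<close>; \<open>i\<close> is chosen so that
  whichever of the two acts at the largest \<open>k\<close> acts at the coefficient to be killed.\<close>

lemma kill_alpha:
  assumes Q: "tsub Q" "u \<in> Q" "w \<in> Q" and h: "hyp m u w"
    and top: "\<And>k x. l \<le> k \<Longrightarrow> x \<in> Q \<Longrightarrow> \<alpha> (Tp k x) = 0" and au: "1 \<le> l \<Longrightarrow> \<alpha> (Tp (l - 1) u) \<noteq> 0"
  obtains w' where "w' \<in> Q" "hyp m u w'" "\<And>k. \<alpha> (Tp k w') = 0"
proof -
  have "j \<le> l \<Longrightarrow> \<exists>w'\<in>Q. hyp m u w' \<and> (\<forall>k\<ge>l - j. \<alpha> (Tp k w') = 0)" for j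
  proof (induction j)
    case 0 then show ?case using assms by (intro bexI[of _ w]) auto
  next
    case (Suc j)
    then obtain w1 where w1: "w1 \<in> Q" "hyp m u w1" "\<And>k. l - j \<le> k \<Longrightarrow> \<alpha> (Tp k w1) = 0" by auto
    define k0 where "k0 = l - 1 - j"
    have k0: "k0 < l" "l - j = Suc k0" using Suc.prems by (auto simp: k0_def)
    have step: "hyp m u (w1 + c *s Tp i u)"
      "\<alpha> (Tp k (w1 + c *s Tp i u)) = \<alpha> (Tp k w1) + c\<^sup>2 * \<alpha> (Tp (k + i) u) + (if 2 * k + i + 2 = m then c else 0)" for c i k
    proof -
      have "Tp m (Tp i u) = 0" using w1(2) Tp_ge[of m u "m + i"] by (simp add: hyp_def del: funpow.simps)
      then show "hyp m u (w1 + c *s Tp i u)"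
        using w1(2) by (simp add: hyp_def Tp_add Tp_scale \<beta>_add \<beta>_scale del: Tp_Tp)
      have "\<beta> (Tp (2 * k + 1) w1) (Tp i u) = (if 2 * k + i + 2 = m then 1 else 0)"
      proof -
        have "\<beta> (Tp (2 * k + 1) w1) (Tp i u) = \<beta> (Tp (2 * k + 1 + i) u) w1"
          by (simp only: \<beta>_Tp_Tp \<beta>_Tp_swap[of _ w1 u])
        then show ?thesis using w1(2) by (simp add: hyp_def del: funpow.simps)
      qed
      then show "\<alpha> (Tp k (w1 + c *s Tp i u)) = \<alpha> (Tp k w1) + c\<^sup>2 * \<alpha> (Tp (k + i) u) + (if 2 * k + i + 2 = m then c else 0)"
        unfolding \<alpha>_Tp_add by (simp add: Tp_scale \<alpha>_scale \<beta>_scale del: funpow.simps)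
    qed
    have "\<exists>c i. \<forall>k\<ge>k0. \<alpha> (Tp k (w1 + c *s Tp i u)) = 0"
    proof (cases "m \<le> l + 1 + k0")
      case True
      define i where "i = l - 1 - k0"
      \<comment> \<open>\<open>e\<close> records whether the cross term falls on \<open>k0\<close>
        itself; \<open>m \<le> l + 1 + k0\<close> ensures that it does not fall above.\<close>
      define e where "e = (if 2 * k0 + i + 2 = m then 1 else 0 :: 'a)"
      have ki: "k0 + i = l - 1" using k0 by (simp add: i_def)
      have "\<alpha> (Tp (l - 1) u) \<noteq> 0" using au k0 by simp
      then obtain c where "\<alpha> (Tp (l - 1) u) * c\<^sup>2 + e * c + \<alpha> (Tp k0 w1) = 0" using quadratic_root by blast
      then have "\<alpha> (Tp k0 (w1 + c *s Tp i u)) = 0"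
        unfolding step(2) ki by (simp add: e_def add_ac mult.commute split: if_splits)
      moreover have "\<alpha> (Tp k (w1 + c *s Tp i u)) = 0" if "k0 < k" for k
      proof -
        have "l \<le> k + i" "2 * k + i + 2 \<noteq> m" using that ki k0 True by auto
        then show ?thesis unfolding step(2) using w1(3)[of k] top[of "k + i" u] Q(2) that k0 by simp
      qed
      ultimately show ?thesis by (metis le_neq_implies_less)
    next
      case False
      \<comment> \<open>Now the cross term falls on \<open>k0\<close>, while
        \<open>k0 + i = m - 2 - k0 \<ge> l\<close> makes the square term vanish from
        \<open>k0\<close> on. The equation for \<open>c\<close> is linear.\<close>
      define i where "i = m - 2 - 2 * k0"
      define c where "c = \<alpha> (Tp k0 w1)"
      have i: "2 * k0 + i + 2 = m" using False k0 by (simp add: i_def)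
      have "\<alpha> (Tp k (w1 + c *s Tp i u)) = 0" if "k0 \<le> k" for k
      proof -
        have "l \<le> k + i" using that False i by linarith
        then show ?thesis unfolding step(2) using w1(3)[of k] top[of "k + i" u] Q(2) that k0 i
          by (cases "k = k0") (auto simp: c_def)
      qed
      then show ?thesis by blast
    qed
    then obtain c i where ci: "\<And>k. k0 \<le> k \<Longrightarrow> \<alpha> (Tp k (w1 + c *s Tp i u)) = 0" by blast
    have "w1 + c *s Tp i u \<in> Q" using Q w1(1) by (intro tsub_add tsub_scale tsub_Tp) auto
    with step(1)[of c i] ci show ?case unfolding k0_def by (intro bexI[of _ "w1 + c *s Tp i u"]) auto
  qed
  from this[of l] that show thesis by auto
qed

text \<open>Nondegeneracy supplies a vector that pairs nontrivially with \<open>T^(m-1) u\<close>.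
  The other pairings are removed downwards: adding \<open>c T^(j+1) w\<close> affects only the
  pairings with \<open>T^k u\<close> for \<open>k \<le> m - 2 - j\<close>.\<close>

lemma dual_vector:
  assumes Q: "tsub Q" "nondeg Q" "u \<in> Q" and m: "1 \<le> m" "Tp (m - 1) u \<noteq> 0" "\<And>x. x \<in> Q \<Longrightarrow> Tp m x = 0"
  obtains w where "w \<in> Q" "hyp m u w"
proof -
  have "\<exists>y\<in>Q. \<beta> (Tp (m - 1) u) y \<noteq> 0" using Q m(2) tsub_Tp[OF Q(1,3)] by (auto simp: nondeg_def)
  then obtain y where y: "y \<in> Q" "\<beta> (Tp (m - 1) u) y \<noteq> 0" by blast
  have "j \<le> m - 1 \<Longrightarrow> \<exists>w\<in>Q. \<forall>k\<ge>m - 1 - j. \<beta> (Tp k u) w = (if Suc k = m then 1 else 0)" for j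
  proof (induction j)
    case 0
    define w where "w = inverse (\<beta> (Tp (m - 1) u) y) *s y"
    have "\<forall>k\<ge>m - 1 - 0. \<beta> (Tp k u) w = (if Suc k = m then 1 else 0)"
    proof (intro allI impI)
      fix k assume k: "m - 1 - 0 \<le> k"
      show "\<beta> (Tp k u) w = (if Suc k = m then 1 else 0)"
    proof (cases "Suc k = m")
      case True with y(2) show ?thesis by (auto simp: w_def \<beta>_scale)
    next
      case False
      with k have "m \<le> k" by auto
      with Tp_ge[OF m(3)[OF Q(3)]] False show ?thesis by simp
    qed
    qed
    moreover have "w \<in> Q" using y Q(1) by (auto simp: w_def intro: tsub_scale)
    ultimately show ?case by blast
  next
    case (Suc j)
    then obtain w where w: "w \<in> Q" "\<And>k. m - 1 - j \<le> k \<Longrightarrow> \<beta> (Tp k u) w = (if Suc k = m then 1 else 0)" by auto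
    define c where "c = \<beta> (Tp (m - 2 - j) u) w"
    define w' where "w' = w + c *s Tp (Suc j) w"
    have eq: "\<beta> (Tp k u) w' = \<beta> (Tp k u) w + c * \<beta> (Tp (k + Suc j) u) w" for k
      by (simp only: w'_def \<beta>_add \<beta>_scale \<beta>_Tp_Tp)
    have "\<forall>k\<ge>m - 1 - Suc j. \<beta> (Tp k u) w' = (if Suc k = m then 1 else 0)"
    proof (intro allI impI)
      fix k assume k: "m - 1 - Suc j \<le> k"
      show "\<beta> (Tp k u) w' = (if Suc k = m then 1 else 0)"
    proof (cases "k = m - 1 - Suc j")
      case True
      then have "\<beta> (Tp (k + Suc j) u) w = 1" using w(2)[of "k + Suc j"] Suc.prems by simp
      then have "\<beta> (Tp k u) w' = 0" unfolding eq using True by (simp add: c_def numeral_2_eq_2)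
      then show ?thesis using True Suc.prems by auto
    next
      case False
      then have "m - 1 - j \<le> k" using k by auto
      then show ?thesis unfolding eq using w(2)[of k] w(2)[of "k + Suc j"] Suc.prems by simp
    qed
    qed
    moreover have "w' \<in> Q" unfolding w'_def using Q(1) w(1) by (intro tsub_add tsub_scale tsub_Tp) auto
    ultimately show ?case by blast
  qed
  from this[of "m - 1"] obtain w where "w \<in> Q" "\<And>k. \<beta> (Tp k u) w = (if Suc k = m then 1 else 0)" by auto
  with that[of w] m Q(3) show thesis by (auto simp: hyp_def)
qed

text \<open>\<open>m\<close> is the nilpotency index of \<open>T\<close> on \<open>Q\<close>, and
  \<open>l\<close> the least exponent with \<open>\<alpha> \<circ> T^l = 0\<close> on
  \<open>Q\<close>. The point is to find one vector \<open>u\<close> witnessing the minimality of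
  both; its partner comes from \<open>dual_vector\<close> and \<open>kill_alpha\<close>.\<close>

lemma new_block:
  assumes Q: "tsub Q" "nondeg Q" "Q \<noteq> {0}"
  obtains l m u w where "u \<in> Q" "w \<in> Q" "wblk l m u w" "m div 2 \<le> l" "l \<le> m"
    "\<And>x. x \<in> Q \<Longrightarrow> Tp m x = 0" "\<And>x. x \<in> Q \<Longrightarrow> \<alpha> (Tp l x) = 0"
proof -
  obtain N where N: "\<And>v. Tp N v = 0" using nilpotent by blast
  have "\<forall>x\<in>Q. Tp N x = 0" by (simp add: N)
  then obtain m where "\<forall>x\<in>Q. Tp m x = 0" "m = 0 \<or> \<not> (\<forall>x\<in>Q. Tp (m - 1) x = 0)"
    by (rule ex_min_nat[of "\<lambda>m. \<forall>x\<in>Q. Tp m x = 0"])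
  then have m: "\<And>x. x \<in> Q \<Longrightarrow> Tp m x = 0" "m = 0 \<or> (\<exists>x\<in>Q. Tp (m - 1) x \<noteq> 0)" by blast+
  have "\<forall>x\<in>Q. \<alpha> (Tp N x) = 0" by (simp add: N)
  then obtain l where "\<forall>x\<in>Q. \<alpha> (Tp l x) = 0" "l = 0 \<or> \<not> (\<forall>x\<in>Q. \<alpha> (Tp (l - 1) x) = 0)"
    by (rule ex_min_nat[of "\<lambda>m. \<forall>x\<in>Q. \<alpha> (Tp m x) = 0"])
  then have l: "\<And>x. x \<in> Q \<Longrightarrow> \<alpha> (Tp l x) = 0" "l = 0 \<or> (\<exists>x\<in>Q. \<alpha> (Tp (l - 1) x) \<noteq> 0)" by blast+
  have QT: "\<And>x. x \<in> Q \<Longrightarrow> T x \<in> Q" using Q(1) by (simp add: tsub_def)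
  have top: "\<And>k x. l \<le> k \<Longrightarrow> x \<in> Q \<Longrightarrow> \<alpha> (Tp k x) = 0" using \<alpha>_Tp_ge[OF QT l(1)] by blast
  have "m \<noteq> 0"
  proof
    assume "m = 0" then show False using m(1) Q(3) tsub_0[OF Q(1)] by auto
  qed
  then obtain u0 where u0: "u0 \<in> Q" "Tp (m - 1) u0 \<noteq> 0" using m(2) by blast
  have "l \<le> m"
  proof (rule ccontr)
    assume lm: "\<not> l \<le> m"
    then obtain x where x: "x \<in> Q" "\<alpha> (Tp (l - 1) x) \<noteq> 0" using l(2) by auto
    have "Tp (l - 1) x = 0" using lm by (intro Tp_ge[OF m(1)[OF x(1)]]) simp
    then show False using x(2) by simp
  qed
  \<comment> \<open>Polarising \<open>\<alpha> \<circ> T^l = 0\<close> shows that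
    \<open>T^(2l+1) u0\<close> is orthogonal to \<open>Q\<close>, hence zero.\<close>
  have "m \<le> 2 * l + 1"
  proof (rule ccontr)
    assume neg: "\<not> m \<le> 2 * l + 1"
    have "\<beta> (Tp (2 * l + 1) u0) y = 0" if y: "y \<in> Q" for y
      using \<alpha>_Tp_add[of l u0 y] l(1)[OF tsub_add[OF Q(1) u0(1) y]] l(1)[OF u0(1)] l(1)[OF y] by simp
    then have "Tp (2 * l + 1) u0 = 0" using Q(2) tsub_Tp[OF Q(1) u0(1), of "2 * l + 1"] by (auto simp: nondeg_def)
    then show False using Tp_ge[of "2 * l + 1" u0 "m - 1"] neg u0(2) by simp
  qed
  then have ml: "m div 2 \<le> l" by linarith
  obtain u where u: "u \<in> Q" "Tp (m - 1) u \<noteq> 0" "1 \<le> l \<Longrightarrow> \<alpha> (Tp (l - 1) u) \<noteq> 0"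
  proof (cases "l = 0 \<or> \<alpha> (Tp (l - 1) u0) \<noteq> 0")
    case True with u0 that[of u0] show thesis by auto
  next
    case False
    then obtain u1 where u1: "u1 \<in> Q" "\<alpha> (Tp (l - 1) u1) \<noteq> 0" using l(2) by auto
    show thesis
    proof (cases "Tp (m - 1) u1 = 0")
      case False with u1 that[of u1] show thesis by auto
    next
      case True
      \<comment> \<open>Since \<open>\<alpha> (T^(l-1) u0) = 0\<close> in this case, the value at
        \<open>u1 + c u0\<close> is affine in \<open>c\<close> with nonzero constant term. An
        infinite field has a \<open>c\<close> avoiding its zero, and \<open>c \<noteq> 0\<close>
        keeps \<open>T^(m-1)\<close> of the sum nonzero.\<close>
      obtain c where c: "c \<noteq> 0" "\<alpha> (Tp (l - 1) u1) + c * \<beta> (Tp (2 * (l - 1) + 1) u1) u0 \<noteq> 0"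
        using exists_not_root[OF u1(2)] by blast
      have "\<alpha> (Tp (l - 1) (u1 + c *s u0)) = \<alpha> (Tp (l - 1) u1) + c * \<beta> (Tp (2 * (l - 1) + 1) u1) u0"
        unfolding \<alpha>_Tp_add using False by (simp add: Tp_scale \<alpha>_scale \<beta>_scale del: funpow.simps)
      with c have "\<alpha> (Tp (l - 1) (u1 + c *s u0)) \<noteq> 0" by simp
      moreover have "Tp (m - 1) (u1 + c *s u0) \<noteq> 0" using True c(1) u0(2) by (simp add: Tp_add Tp_scale)
      moreover have "u1 + c *s u0 \<in> Q" using Q(1) u0(1) u1(1) by (intro tsub_add tsub_scale)
      ultimately show thesis using that by blast
    qed
  qed
  obtain w0 where w0: "w0 \<in> Q" "hyp m u w0" using dual_vector[OF Q(1,2) u(1) _ u(2) m(1)] \<open>m \<noteq> 0\<close> by auto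
  obtain w where w: "w \<in> Q" "hyp m u w" "\<And>k. \<alpha> (Tp k w) = 0"
    using kill_alpha[OF Q(1) u(1) w0 top u(3)] by blast
  have "wblk l m u w" unfolding wblk_def using w u top by auto
  from that[OF u(1) w(1) this ml \<open>l \<le> m\<close> m(1) l(1)] show thesis by simp
qed

text \<open>Nesting the complements, instead of stating one direct sum, makes the tail of a
  splitting of \<open>Q\<close> a splitting of \<open>Q \<inter> perp u \<inter> perp w\<close>; the
  later inductions follow the list.\<close>

fun complete :: "(nat \<times> nat \<times> 'b \<times> 'b) list \<Rightarrow> 'b set \<Rightarrow> bool" where
  "complete [] Q \<longleftrightarrow> Q = {0}"
| "complete ((l, m, u, w) # S) Q \<longleftrightarrow> u \<in> Q \<and> w \<in> Q \<and> blk l m u w \<and> complete S (Q \<inter> perp u \<inter> perp w)"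

definition shape :: "(nat \<times> nat \<times> 'b \<times> 'b) list \<Rightarrow> (nat \<times> nat) list" where
  "shape S = map (\<lambda>(l, m, u, w). (l, m)) S"

lemma shape_simps [simp]: "shape [] = []" "shape ((l, m, u, w) # S) = (l, m) # shape S"
  by (simp_all add: shape_def)

lemma blkD:
  assumes "blk l m u w"
  shows "hyp m u w" "1 \<le> m" "m div 2 \<le> l" "l \<le> m" "\<beta> (Tp (m - 1) u) w = 1" "u \<notin> perp w"
    "Tp m u = 0" "Tp m w = 0"
proof -
  show 1: "\<beta> (Tp (m - 1) u) w = 1" using assms by (auto simp: blk_def hyp_def)
  then have "\<beta> (Tp (m - 1) w) u = 1" by (simp add: \<beta>_Tp_swap[of _ w])
  then show "u \<notin> perp w" by (auto simp: perp_def intro!: exI[of _ "m - 1"])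
qed (use assms in \<open>auto simp: blk_def hyp_def\<close>)

text \<open>\<open>u\<close> itself lies outside the complement. The drop in dimension is the
  induction measure of \<open>complete_extend\<close>.\<close>

lemma dim_perp_less:
  assumes "tsub Q" "u \<in> Q" "u \<notin> perp w"
  shows "dim (Q \<inter> perp u \<inter> perp w) < dim Q"
proof (rule dim_psubset)
  have sp: "span (Q \<inter> perp u \<inter> perp w) = Q \<inter> perp u \<inter> perp w" "span Q = Q"
    using tsub_subspace[OF tsub_perp[OF assms(1)]] tsub_subspace[OF assms(1)] by (simp_all add: span_eq_iff)
  show "span (Q \<inter> perp u \<inter> perp w) \<subset> span Q" unfolding sp using assms(2,3) by auto
qed

lemma normal_sequence_Cons:
  assumes "normal_sequence ((l, m) # ps)" "m \<le> M" "l \<le> L" "m - l \<le> M - L" "1 \<le> M" "M div 2 \<le> L" "L \<le> M"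
  shows "normal_sequence ((L, M) # (l, m) # ps)"
proof -
  have "m' \<le> M \<and> l' \<le> L \<and> m' - l' \<le> M - L" if "(l', m') \<in> set ps" for l' m'
    using assms(1-4) that unfolding normal_sequence_def by fastforce
  with assms show ?thesis unfolding normal_sequence_def by auto
qed

text \<open>The block \<open>(U, W)\<close> is split off; a block \<open>(u, w)\<close> of its complement with maximal \<open>m\<close> and \<open>l\<close> is
  added. If \<open>m - l > M - L\<close>, then replacing \<open>u\<close> by \<open>u + T\<^bsup>M-m\<^esup> U\<close> increases \<open>l\<close> until \<open>m - l = M - L\<close>,
  and replacing \<open>W\<close> by \<open>W + w\<close> restores orthogonality.\<close>

lemma complete_extend:
  assumes "tsub Q" "nondeg Q" "U \<in> Q" "W \<in> Q" "blk L M U W"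
    and "\<And>x. x \<in> Q \<inter> perp U \<inter> perp W \<Longrightarrow> Tp M x = 0"
    and "\<And>x. x \<in> Q \<inter> perp U \<inter> perp W \<Longrightarrow> \<alpha> (Tp L x) = 0"
  shows "\<exists>W' S. complete ((L, M, U, W') # S) Q \<and> normal_sequence ((L, M) # shape S)"
  using assms
proof (induction "dim Q" arbitrary: Q L M U W rule: less_induct)
  case less
  note Q = less.prems(1,2) and UW = less.prems(3,4) and blk = less.prems(5)
  define P where "P = Q \<inter> perp U \<inter> perp W"
  have h: "hyp M U W" and LM: "1 \<le> M" "M div 2 \<le> L" "L \<le> M" using blkD[OF blk] by auto
  have P: "tsub P" "nondeg P" unfolding P_def using tsub_perp[OF Q(1)] nondeg_perp[OF Q UW h] by auto
  have PM: "\<And>x. x \<in> P \<Longrightarrow> Tp M x = 0" and PL: "\<And>x. x \<in> P \<Longrightarrow> \<alpha> (Tp L x) = 0"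
    using less.prems(6,7) by (auto simp: P_def)
  have PT: "\<And>x. x \<in> P \<Longrightarrow> T x \<in> P" using P(1) by (simp add: tsub_def)
  show ?case
  proof (cases "P = {0}")
    case True
    then have "complete [(L, M, U, W)] Q" using UW blk by (simp add: P_def)
    moreover have "normal_sequence [(L, M)]" using LM by (simp add: normal_sequence_def)
    ultimately show ?thesis by (intro exI[of _ W] exI[of _ "[]"]) simp
  next
    case False
    obtain l m u w where b: "u \<in> P" "w \<in> P" "wblk l m u w" "m div 2 \<le> l" "l \<le> m"
      "\<And>x. x \<in> P \<Longrightarrow> Tp m x = 0" "\<And>x. x \<in> P \<Longrightarrow> \<alpha> (Tp l x) = 0"
      using new_block[OF P False] by metis
    have hu: "hyp m u w" and m1: "1 \<le> m" "\<beta> (Tp (m - 1) u) w = 1" using b(3) by (auto simp: wblk_def hyp_def)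
    have uw: "u \<in> Q" "w \<in> Q" "u \<in> perp U" "w \<in> perp U" "u \<in> perp W" "w \<in> perp W" using b(1,2) by (auto simp: P_def)
    have mM: "m \<le> M"
    proof (rule ccontr)
      assume "\<not> m \<le> M"
      then have "Tp (m - 1) u = 0" using Tp_ge[OF PM[OF b(1)], of "m - 1"] by simp
      then show False using m1 by simp
    qed
    have lL: "l \<le> L"
    proof (rule ccontr)
      assume neg: "\<not> l \<le> L"
      then have "\<alpha> (Tp (l - 1) u) \<noteq> 0" using b(3) by (auto simp: wblk_def)
      moreover have "\<alpha> (Tp (l - 1) u) = 0" using neg by (intro \<alpha>_Tp_ge[OF PT PL _ b(1)]) auto
      ultimately show False by simp
    qed
    show ?thesis
    proof (cases "m - l \<le> M - L")
      case True
      obtain u' w' where n: "blk l m u' w'" "u' \<in> P" "w' \<in> P" "perp u' = perp u" "perp w' = perp w"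
        using normalise_block[OF b(3) P(1) b(1,2,4,5)] by blast
      have "dim P < dim Q" unfolding P_def by (rule dim_perp_less[OF Q(1) UW(1)]) (rule blkD(6)[OF blk])
      from less.hyps[OF this P n(2,3,1)] b(6,7)
      obtain W' S where WS: "complete ((l, m, u', W') # S) P" "normal_sequence ((l, m) # shape S)" by auto
      have "complete ((L, M, U, W) # (l, m, u', W') # S) Q" using WS(1) UW blk by (simp add: P_def)
      moreover have "normal_sequence ((L, M) # shape ((l, m, u', W') # S))"
        using normal_sequence_Cons[OF WS(2) mM lL True LM] by simp
      ultimately show ?thesis by blast
    next
      case False
      define d where "d = M - m"
      \<comment> \<open>Then \<open>l' + d = L\<close> and \<open>m - l' = M - L\<close>. The
        nonzero value of \<open>\<alpha>\<close> at \<open>T^(L-1) U\<close> reappears at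
        \<open>T^(l'-1) u1\<close>, above all nonzero values coming from \<open>u\<close>, because
        \<open>l < l'\<close>.\<close>
      define l' where "l' = m - (M - L)"
      have l': "l < l'" "l' + d = L" "l' \<le> m" using False mM LM by (auto simp: l'_def d_def)
      define u1 where "u1 = u + Tp d U"
      define W1 where "W1 = W + w"
      define P1 where "P1 = Q \<inter> perp U \<inter> perp W1"
      have TpU: "\<beta> (Tp k U) W = (if Suc k = M then 1 else 0)" "Tp M U = 0" "Tp M W = 0"
        "\<alpha> (Tp k U) = (if Suc k = L then 1 else 0)" "\<alpha> (Tp k W) = 0" for k
        using blk by (auto simp: blk_def hyp_def)
      have z: "\<beta> (Tp k U) u = 0" "\<beta> (Tp k U) w = 0" "\<beta> (Tp k W) u = 0" "\<beta> (Tp k W) w = 0" for k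
        using uw by (auto simp: perp_def)
      have z': "\<beta> (Tp k u) U = 0" "\<beta> (Tp k w) U = 0" "\<beta> (Tp k u) W = 0" "\<beta> (Tp k w) W = 0" for k
        using z by (simp_all add: \<beta>_Tp_swap[of _ u] \<beta>_Tp_swap[of _ w])
      have hu1: "hyp m u1 w"
      proof -
        have "Tp m u1 = 0" using hu TpU(2) mM by (simp add: u1_def Tp_add hyp_def d_def)
        moreover have "\<beta> (Tp k u1) w = \<beta> (Tp k u) w" for k by (simp add: u1_def Tp_add \<beta>_add z)
        ultimately show ?thesis using hu by (simp add: hyp_def)
      qed
      have au1: "\<alpha> (Tp k u1) = \<alpha> (Tp k u) + (if Suc (k + d) = L then 1 else 0)" for k
      proof -
        have "\<beta> (Tp (2 * k + 1) u) (Tp d U) = 0" by (simp only: \<beta>_Tp_Tp z')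
        then show ?thesis unfolding u1_def \<alpha>_Tp_add by (simp add: TpU del: funpow.simps)
      qed
      have aw: "\<alpha> (Tp k w) = 0" for k using b(3) by (simp add: wblk_def)
      have au: "\<alpha> (Tp k u) = 0" if "l \<le> k" for k using b(3) that by (simp add: wblk_def)
      have wb: "wblk l' m u1 w"
        unfolding wblk_def using hu1 aw au l' by (auto simp: au1)
      have hW1: "blk L M U W1"
      proof -
        have "Tp M w = 0" using hu Tp_ge[OF _ mM] by (auto simp: hyp_def)
        then have "Tp M W1 = 0" by (simp add: W1_def Tp_add TpU)
        moreover have "\<beta> (Tp k U) W1 = \<beta> (Tp k U) W" for k by (simp add: W1_def \<beta>_add z)
        moreover have "\<alpha> (Tp k W1) = 0" for k unfolding W1_def \<alpha>_Tp_add by (simp only: TpU aw z add_0)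
        ultimately show ?thesis using blk by (simp add: blk_def hyp_def)
      qed
      have u1P1: "u1 \<in> P1"
      proof -
        have "u1 \<in> Q" unfolding u1_def using uw UW Q(1) by (intro tsub_add tsub_Tp) auto
        moreover have "\<beta> (Tp k U) u1 = 0" for k by (simp add: u1_def \<beta>_add z)
        \<comment> \<open>\<open>T^d U\<close> pairs with \<open>T^k W\<close> exactly as
          \<open>u\<close> pairs with \<open>T^k w\<close>, so the two contributions cancel in
          characteristic 2.\<close>
        moreover have "\<beta> (Tp k W1) u1 = 0" for k
        proof -
          have "\<beta> (Tp k W1) u1 = \<beta> (Tp (k + d) W) U + \<beta> (Tp k w) u"
            by (simp add: u1_def W1_def \<beta>_add Tp_add z z' \<beta>_Tp_Tp)
          also have "\<beta> (Tp (k + d) W) U = (if Suc k = m then 1 else 0)"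
          proof -
            have "Suc (k + d) = M \<longleftrightarrow> Suc k = m" using mM by (auto simp: d_def)
            then show ?thesis using TpU(1)[of "k + d"] by (simp add: \<beta>_Tp_swap[of _ W])
          qed
          also have "\<beta> (Tp k w) u = (if Suc k = m then 1 else 0)"
            using hu by (simp add: \<beta>_Tp_swap[of _ w] hyp_def)
          finally show ?thesis by simp
        qed
        ultimately show ?thesis by (simp add: P1_def perp_def)
      qed
      have wP1: "w \<in> P1" using uw by (simp add: P1_def perp_def W1_def Tp_add \<beta>_add z)
      have W1Q: "W1 \<in> Q" unfolding W1_def using uw UW Q(1) by (intro tsub_add) auto
      have P1: "tsub P1" "nondeg P1" unfolding P1_def
        using tsub_perp[OF Q(1)] nondeg_perp[OF Q UW(1) W1Q blkD(1)[OF hW1]] by auto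
      have l'2: "m div 2 \<le> l'" using b(4) l' by simp
      obtain u' w' where n: "blk l' m u' w'" "u' \<in> P1" "w' \<in> P1" "perp u' = perp u1" "perp w' = perp w"
        using normalise_block[OF wb P1(1) u1P1 wP1 l'2 l'(3)] by blast
      \<comment> \<open>Orthogonality to \<open>W1 = W + w\<close> and to \<open>w\<close> gives
        orthogonality to \<open>W\<close>. Thus the bounds known on \<open>P\<close> pass to the new
        complement.\<close>
      have sub: "x \<in> P" if "x \<in> P1 \<inter> perp u' \<inter> perp w'" for x
      proof -
        have x: "x \<in> Q" "\<And>k. \<beta> (Tp k U) x = 0" "\<And>k. \<beta> (Tp k W1) x = 0" "\<And>k. \<beta> (Tp k w) x = 0"
          using that n(5) by (auto simp: P1_def perp_def)
        have "\<beta> (Tp k W) x = 0" for k using x(3)[of k] x(4)[of k] by (simp add: W1_def Tp_add \<beta>_add)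
        with x show ?thesis by (simp add: P_def perp_def)
      qed
      have "dim P1 < dim Q" unfolding P1_def by (rule dim_perp_less[OF Q(1) UW(1)]) (rule blkD(6)[OF hW1])
      moreover have "\<alpha> (Tp l' x) = 0" if "x \<in> P" for x
        using l'(1) by (intro \<alpha>_Tp_ge[OF PT b(7) _ that]) auto
      ultimately obtain W' S where WS: "complete ((l', m, u', W') # S) P1" "normal_sequence ((l', m) # shape S)"
        using less.hyps[OF _ P1 n(2,3,1)] b(6) sub by blast
      have "complete ((L, M, U, W1) # (l', m, u', W') # S) Q" using WS(1) UW W1Q hW1 by (simp add: P1_def)
      moreover have "normal_sequence ((L, M) # shape ((l', m, u', W') # S))"
        using normal_sequence_Cons[OF WS(2) mM _ _ LM] l' LM by (simp add: l'_def)
      ultimately show ?thesis by blast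
    qed
  qed
qed

lemma exists_complete:
  obtains S where "complete S UNIV" "normal_sequence (shape S)"
proof (cases "(UNIV :: 'b set) = {0}")
  case True
  then show thesis using that[of "[]"] by (simp add: normal_sequence_def)
next
  case False
  obtain l m u w where b: "wblk l m u w" "m div 2 \<le> l" "l \<le> m" "\<And>x. Tp m x = 0" "\<And>x. \<alpha> (Tp l x) = 0"
    by (rule new_block[OF tsub_UNIV nondeg_UNIV False]) simp
  obtain u' w' where n: "blk l m u' w'" "u' \<in> UNIV" "w' \<in> UNIV" "perp u' = perp u" "perp w' = perp w"
    by (rule normalise_block[OF b(1) tsub_UNIV UNIV_I UNIV_I b(2,3)])
  obtain W' S where "complete ((l, m, u', W') # S) UNIV" "normal_sequence ((l, m) # shape S)"
    using complete_extend[OF tsub_UNIV nondeg_UNIV UNIV_I UNIV_I n(1) b(4,5)] by blast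
  with that[of "(l, m, u', W') # S"] show thesis by simp
qed

end

section \<open>Equivalence of form modules\<close>

text \<open>\<open>fm_equiv\<close> does not make the carriers subspaces; closure of the source is
  what transfers additivity and homogeneity to the inverse map.\<close>

lemma fm_equiv_sym:
  assumes closed: "\<And>v w. v \<in> fm_carrier M \<Longrightarrow> w \<in> fm_carrier M \<Longrightarrow> v + w \<in> fm_carrier M"
    "\<And>c v. v \<in> fm_carrier M \<Longrightarrow> fm_scale M c v \<in> fm_carrier M"
    and "fm_equiv M N"
  shows "fm_equiv N M"
proof -
  obtain f where f: "bij_betw f (fm_carrier M) (fm_carrier N)"
    "\<And>v w. v \<in> fm_carrier M \<Longrightarrow> w \<in> fm_carrier M \<Longrightarrow> f (v + w) = f v + f w"
    "\<And>c v. v \<in> fm_carrier M \<Longrightarrow> f (fm_scale M c v) = fm_scale N c (f v)"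
    "\<And>v w. v \<in> fm_carrier M \<Longrightarrow> w \<in> fm_carrier M \<Longrightarrow> fm_bilin N (f v) (f w) = fm_bilin M v w"
    "\<And>v. v \<in> fm_carrier M \<Longrightarrow> fm_quad N (f v) = fm_quad M v"
    using assms(3) unfolding fm_equiv_def by blast
  define g where "g = inv_into (fm_carrier M) f"
  have g: "bij_betw g (fm_carrier N) (fm_carrier M)" unfolding g_def by (rule bij_betw_inv_into[OF f(1)])
  have gM: "g x \<in> fm_carrier M" if "x \<in> fm_carrier N" for x using g that by (auto simp: bij_betw_def)
  have fg: "f (g x) = x" if "x \<in> fm_carrier N" for x
    unfolding g_def using f(1) that by (rule bij_betw_inv_into_right)
  have gf: "g (f v) = v" if "v \<in> fm_carrier M" for v
    unfolding g_def using f(1) that by (rule bij_betw_inv_into_left)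
  have "g (x + y) = g x + g y" if "x \<in> fm_carrier N" "y \<in> fm_carrier N" for x y
    using gf[OF closed(1)[OF gM gM, OF that]] f(2)[OF gM gM, OF that] that by (simp add: fg)
  moreover have "g (fm_scale N c x) = fm_scale M c (g x)" if "x \<in> fm_carrier N" for c x
    using gf[OF closed(2)[OF gM, OF that, of c]] f(3)[OF gM, OF that] that by (simp add: fg)
  moreover have "fm_bilin M (g x) (g y) = fm_bilin N x y" if "x \<in> fm_carrier N" "y \<in> fm_carrier N" for x y
    using f(4)[OF gM gM, OF that] that by (simp add: fg)
  moreover have "fm_quad M (g x) = fm_quad N x" if "x \<in> fm_carrier N" for x
    using f(5)[OF gM, OF that] that by (simp add: fg)
  ultimately show ?thesis unfolding fm_equiv_def using g by blast
qed

lemma fm_equiv_trans: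
  assumes "fm_equiv M N" "fm_equiv N K"
  shows "fm_equiv M K"
proof -
  obtain f where f: "bij_betw f (fm_carrier M) (fm_carrier N)"
    "\<And>v w. v \<in> fm_carrier M \<Longrightarrow> w \<in> fm_carrier M \<Longrightarrow> f (v + w) = f v + f w"
    "\<And>c v. v \<in> fm_carrier M \<Longrightarrow> f (fm_scale M c v) = fm_scale N c (f v)"
    "\<And>v w. v \<in> fm_carrier M \<Longrightarrow> w \<in> fm_carrier M \<Longrightarrow> fm_bilin N (f v) (f w) = fm_bilin M v w"
    "\<And>v. v \<in> fm_carrier M \<Longrightarrow> fm_quad N (f v) = fm_quad M v"
    using assms(1) unfolding fm_equiv_def by blast
  obtain g where g: "bij_betw g (fm_carrier N) (fm_carrier K)"
    "\<And>v w. v \<in> fm_carrier N \<Longrightarrow> w \<in> fm_carrier N \<Longrightarrow> g (v + w) = g v + g w"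
    "\<And>c v. v \<in> fm_carrier N \<Longrightarrow> g (fm_scale N c v) = fm_scale K c (g v)"
    "\<And>v w. v \<in> fm_carrier N \<Longrightarrow> w \<in> fm_carrier N \<Longrightarrow> fm_bilin K (g v) (g w) = fm_bilin N v w"
    "\<And>v. v \<in> fm_carrier N \<Longrightarrow> fm_quad K (g v) = fm_quad N v"
    using assms(2) unfolding fm_equiv_def by blast
  have fN: "f v \<in> fm_carrier N" if "v \<in> fm_carrier M" for v using f(1) that by (auto simp: bij_betw_def)
  have "bij_betw (g \<circ> f) (fm_carrier M) (fm_carrier K)" by (rule bij_betw_trans[OF f(1) g(1)])
  then show ?thesis unfolding fm_equiv_def using f(2-5) g(2-5) fN by (intro exI[of _ "g \<circ> f"]) simp
qed

lemma ball_nat_Suc: "(\<forall>i\<ge>Suc n. P i) \<longleftrightarrow> (\<forall>i\<ge>n. P (Suc i))"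
  by (auto, metis Suc_le_D Suc_le_mono)

lemma W_sum_Nil: "fm_carrier (W_sum []) = {0}"
  by (auto simp: W_sum_def fm_direct_sum_def fun_eq_iff)

text \<open>Splitting the component of index 0 from the shifted family turns statements about
  \<open>W_sum\<close> into inductions over the list.\<close>

lemma W_sum_Cons:
  shows W_sum_carrier: "v \<in> fm_carrier (W_sum ((l, m) # ps)) \<longleftrightarrow>
      v 0 \<in> W_carrier m \<and> (\<lambda>i. v (Suc i)) \<in> fm_carrier (W_sum ps)"
    and W_sum_scale: "fm_scale (W_sum ((l, m) # ps)) c v 0 = W_scale c (v 0)"
      "fm_scale (W_sum ((l, m) # ps)) c v (Suc i) = fm_scale (W_sum ps) c (\<lambda>i. v (Suc i)) i"
    and W_sum_bilin: "fm_bilin (W_sum ((l, m) # ps)) v w =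
      W_bilin m (v 0) (w 0) + fm_bilin (W_sum ps) (\<lambda>i. v (Suc i)) (\<lambda>i. w (Suc i))"
    and W_sum_quad: "fm_quad (W_sum ((l, m) # ps)) v = W_quad l m (v 0) + fm_quad (W_sum ps) (\<lambda>i. v (Suc i))"
  unfolding W_sum_def fm_direct_sum_def
  by (simp_all only: form_module.simps list.map length_Cons length_map ball_nat_Suc All_less_Suc2
      sum.lessThan_Suc_shift nth_Cons_0 nth_Cons_Suc W_module_def prod.case mem_Collect_eq Suc_less_eq zero_less_Suc if_True)
    auto

lemma W_carrier_closed:
  "x \<in> W_carrier m \<Longrightarrow> y \<in> W_carrier m \<Longrightarrow> x + y \<in> W_carrier m"
  "x \<in> W_carrier m \<Longrightarrow> W_scale c x \<in> W_carrier m" "0 \<in> W_carrier m"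
  by (auto simp: W_carrier_def W_scale_def plus_prod_def zero_prod_def)

lemma W_sum_closed:
  fixes v w :: "nat \<Rightarrow> 'k::field W_vec"
  assumes "v \<in> fm_carrier (W_sum ps)"
  shows "w \<in> fm_carrier (W_sum ps) \<Longrightarrow> v + w \<in> fm_carrier (W_sum ps)"
    and "fm_scale (W_sum ps) c v \<in> fm_carrier (W_sum ps)"
proof -
  have "\<forall>v w. v \<in> fm_carrier (W_sum ps) \<longrightarrow> w \<in> fm_carrier (W_sum ps) \<longrightarrow> v + w \<in> fm_carrier (W_sum ps) \<and>
      fm_scale (W_sum ps) c v \<in> fm_carrier (W_sum ps :: ('k, nat \<Rightarrow> 'k W_vec) form_module)"
  proof (induction ps)
    case Nil
    then show ?case by (auto simp: W_sum_def fm_direct_sum_def fun_eq_iff)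
  next
    case (Cons p ps)
    obtain l m where [simp]: "p = (l, m)" by force
    show ?case
    proof (intro allI impI)
      fix v w :: "nat \<Rightarrow> 'k W_vec"
      assume "v \<in> fm_carrier (W_sum (p # ps))" "w \<in> fm_carrier (W_sum (p # ps))"
      then have h: "v 0 \<in> W_carrier m" "w 0 \<in> W_carrier m" "(\<lambda>i. v (Suc i)) \<in> fm_carrier (W_sum ps)"
        "(\<lambda>i. w (Suc i)) \<in> fm_carrier (W_sum ps)" by (auto simp: W_sum_carrier)
      have "(\<lambda>i. v (Suc i)) + (\<lambda>i. w (Suc i)) = (\<lambda>i. (v + w) (Suc i))" by (auto simp: fun_eq_iff)
      with h Cons.IH have "v + w \<in> fm_carrier (W_sum (p # ps))"
        by (auto simp: W_sum_carrier intro!: W_carrier_closed)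
      moreover have "fm_scale (W_sum (p # ps)) c v \<in> fm_carrier (W_sum (p # ps))"
        using h Cons.IH by (auto simp: W_sum_carrier W_sum_scale intro!: W_carrier_closed)
      ultimately show "v + w \<in> fm_carrier (W_sum (p # ps)) \<and>
          fm_scale (W_sum (p # ps)) c v \<in> fm_carrier (W_sum (p # ps))" ..
    qed
  qed
  then show "w \<in> fm_carrier (W_sum ps) \<Longrightarrow> v + w \<in> fm_carrier (W_sum ps)"
    "fm_scale (W_sum ps) c v \<in> fm_carrier (W_sum ps)" using assms by blast+
qed

lemma W_sum_0: "0 \<in> fm_carrier (W_sum ps)"
proof (induction ps)
  case (Cons p ps)
  have "(\<lambda>i. (0 :: nat \<Rightarrow> 'a W_vec) (Suc i)) = 0" by (simp add: fun_eq_iff)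
  with Cons show ?case by (cases p) (simp add: W_sum_carrier W_carrier_closed)
qed (simp only: W_sum_Nil singletonI)

lemma W_bilin_alt:
  "W_bilin m v w = (\<Sum>i<m. fst v i * snd w (m - 1 - i) - snd v i * fst w (m - 1 - i))"
  unfolding W_bilin_def
proof (rule sum.cong)
  fix i assume "i \<in> {..<m}"
  then have "(\<Sum>j<m. if Suc (i + j) = m then fst v i * snd w j - snd v i * fst w j else 0) =
      (\<Sum>j<m. if j = m - 1 - i then fst v i * snd w j - snd v i * fst w j else 0)"
    by (intro sum.cong) auto
  also have "\<dots> = fst v i * snd w (m - 1 - i) - snd v i * fst w (m - 1 - i)"
    using \<open>i \<in> {..<m}\<close> by (subst sum.delta) auto
  finally show "(\<Sum>j<m. if Suc (i + j) = m then fst v i * snd w j - snd v i * fst w j else 0) =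
      fst v i * snd w (m - 1 - i) - snd v i * fst w (m - 1 - i)" .
qed simp

section \<open>From a splitting to an isomorphism with \<open>W_sum\<close>\<close>

context form_mod
begin

definition fmQ :: "'b set \<Rightarrow> ('a, 'b) form_module" where
  "fmQ Q = \<lparr>fm_carrier = Q, fm_scale = scale, fm_bilin = \<beta>, fm_quad = \<alpha>\<rparr>"

lemma fmQ_simps [simp]: "fm_carrier (fmQ Q) = Q" "fm_scale (fmQ Q) = scale" "fm_bilin (fmQ Q) = \<beta>"
  "fm_quad (fmQ Q) = \<alpha>"
  by (simp_all add: fmQ_def)

lemma comb_add: "comb m (\<lambda>k. a k + b k) u = comb m a u + comb m b u"
  by (simp add: comb_def scale_left_distrib sum.distrib)

lemma comb_scale: "comb m (\<lambda>k. c * a k) u = c *s comb m a u"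
  by (simp add: comb_def scale_sum_right)

lemma comb_cong: "(\<And>k. k < m \<Longrightarrow> a k = b k) \<Longrightarrow> comb m a u = comb m b u"
  by (simp add: comb_def)

lemma comb_0 [simp]: "comb m (\<lambda>_. 0) u = 0" "comb m 0 u = 0" by (simp_all add: comb_def)

lemma T_comb:
  assumes "Tp m u = 0"
  shows "T (comb m a u) = comb m (\<lambda>k. if 0 < k \<and> k < m then a (k - 1) else 0) u"
proof (cases m)
  case (Suc m')
  have "T (comb m a u) = (\<Sum>k<m. a k *s Tp (Suc k) u)"
    using Tp_sum[of 1 "\<lambda>k. a k *s Tp k u" "{..<m}"] by (simp add: comb_def T_scale)
  also have "\<dots> = (\<Sum>k<m'. a k *s Tp (Suc k) u)" using assms by (simp add: Suc)
  also have "\<dots> = comb m (\<lambda>k. if 0 < k \<and> k < m then a (k - 1) else 0) u"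
    unfolding comb_def Suc by (subst sum.lessThan_Suc_shift) simp
  finally show ?thesis .
qed (simp add: comb_def)

text \<open>On one cyclic module the polar form of \<open>\<alpha>\<close> vanishes by
  \<open>Tp_alt\<close>, so \<open>\<alpha>\<close> is additive there and only squares of
  coefficients remain.\<close>

lemma \<alpha>_comb: "\<alpha> (comb m a u) = (\<Sum>k<m. (a k)\<^sup>2 * \<alpha> (Tp k u))"
proof (induction m)
  case (Suc m)
  have "\<beta> (T (comb m a u)) (Tp m u) = 0"
    by (simp only: T_adj[of "comb m a u"]) (simp only: T_Tp \<beta>_sym[of "comb m a u"] \<beta>_comb_same)
  then show ?case using Suc by (simp add: comb_def \<alpha>_add \<alpha>_scale \<beta>_scale)
qed (simp add: comb_def)

text \<open>Interprets the coordinates of \<open>W_module l m\<close> in the block generated by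
  \<open>u\<close> and \<open>w\<close>. \<open>bl_bilin\<close>, \<open>bl_T\<close> and
  \<open>bl_quad\<close> show that both forms and the operator are carried over,
  \<open>bl_coeff\<close> that the coordinates can be recovered.\<close>

definition bl :: "nat \<Rightarrow> 'b \<Rightarrow> 'b \<Rightarrow> 'a W_vec \<Rightarrow> 'b" where
  "bl m u w x = comb m (fst x) u + comb m (snd x) w"

lemma bl_add: "bl m u w (x + y) = bl m u w x + bl m u w y"
  by (simp add: bl_def comb_add plus_fun_def add_ac)

lemma bl_scale: "bl m u w (W_scale c x) = c *s bl m u w x"
  by (simp add: bl_def W_scale_def comb_scale scale_right_distrib)

lemma bl_perp: "z \<in> perp u \<inter> perp w \<Longrightarrow> \<beta> (bl m u w x) z = 0"
  using \<beta>_comb_perp[of z u] \<beta>_comb_perp[of z w] by (simp add: bl_def \<beta>_add \<beta>_sym[of _ z])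

lemma bl_coeff:
  assumes "hyp m u w" "k < m" "z \<in> perp u \<inter> perp w"
  shows "\<beta> (Tp (m - 1 - k) w) (bl m u w x + z) = fst x k" "\<beta> (Tp (m - 1 - k) u) (bl m u w x + z) = snd x k"
  using assms perpD[of z u] perpD[of z w]
  by (simp_all add: bl_def \<beta>_add \<beta>_comb[OF assms(1)] \<beta>_comb[OF hyp_sym[OF assms(1)]] \<beta>_comb_same)

lemma bl_bilin:
  assumes "hyp m u w"
  shows "\<beta> (bl m u w x) (bl m u w y) = W_bilin m x y"
proof -
  have 1: "\<beta> (comb m a v) z = (\<Sum>k<m. a k * \<beta> (Tp k v) z)" for a v z
    by (simp add: comb_def \<beta>_sum \<beta>_scale)
  have "\<beta> (bl m u w x) (bl m u w y) =
      (\<Sum>k<m. fst x k * snd y (m - 1 - k)) + (\<Sum>k<m. snd x k * fst y (m - 1 - k))"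
    unfolding bl_def[of m u w x] \<beta>_add 1
    by (simp add: bl_def \<beta>_add \<beta>_comb[OF assms] \<beta>_comb[OF hyp_sym[OF assms]] \<beta>_comb_same)
  then show ?thesis by (simp add: W_bilin_alt sum.distrib)
qed

lemma bl_T:
  assumes "hyp m u w"
  shows "T (bl m u w x) = bl m u w (W_T m x)"
  using assms by (simp add: bl_def T_add T_comb hyp_def W_T_def)

lemma bl_quad:
  assumes "blk l m u w"
  shows "\<alpha> (bl m u w x) = W_quad l m x"
proof -
  have h: "hyp m u w" using assms by (simp add: blk_def)
  have "\<alpha> (bl m u w x) = \<alpha> (comb m (fst x) u) + \<alpha> (comb m (snd x) w) + \<beta> (T (comb m (fst x) u)) (comb m (snd x) w)"
    by (simp add: bl_def \<alpha>_add)
  also have "\<alpha> (comb m (fst x) u) = (\<Sum>i<m. if Suc i = l then (fst x i)\<^sup>2 else 0)"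
    unfolding \<alpha>_comb using assms by (intro sum.cong) (auto simp: blk_def)
  also have "\<alpha> (comb m (snd x) w) = 0" unfolding \<alpha>_comb using assms by (simp add: blk_def)
  also have "\<beta> (T (comb m (fst x) u)) (comb m (snd x) w) = W_bilin m (W_T m (fst x, \<lambda>_. 0)) (\<lambda>_. 0, snd x)"
    using bl_bilin[OF h, of "W_T m (fst x, \<lambda>_. 0)" "(\<lambda>_. 0, snd x)"] bl_T[OF h, of "(fst x, \<lambda>_. 0)"]
    by (simp add: bl_def)
  finally show ?thesis by (simp add: W_quad_def)
qed

text \<open>The map glues the coordinates on the block with the isomorphism on its complement. All
  mixed terms vanish, because the two parts are orthogonal and \<open>T\<close> preserves the
  complement.\<close>

lemma block_equiv:
  assumes Q: "tsub Q" "u \<in> Q" "w \<in> Q" and blk: "blk l m u w"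
    and eq: "fm_equiv (W_sum ps) (fmQ (Q \<inter> perp u \<inter> perp w))"
  shows "fm_equiv (W_sum ((l, m) # ps)) (fmQ Q)"
proof -
  have h: "hyp m u w" using blk by (simp add: blk_def)
  define P where "P = Q \<inter> perp u \<inter> perp w"
  have P: "tsub P" unfolding P_def by (rule tsub_perp[OF Q(1)])
  define C where "C = fm_carrier (W_sum ps :: ('a, nat \<Rightarrow> 'a W_vec) form_module)"
  obtain f where f: "bij_betw f C P"
    "\<And>v w. v \<in> C \<Longrightarrow> w \<in> C \<Longrightarrow> f (v + w) = f v + f w"
    "\<And>c v. v \<in> C \<Longrightarrow> f (fm_scale (W_sum ps) c v) = c *s f v"
    "\<And>v w. v \<in> C \<Longrightarrow> w \<in> C \<Longrightarrow> \<beta> (f v) (f w) = fm_bilin (W_sum ps) v w"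
    "\<And>v. v \<in> C \<Longrightarrow> \<alpha> (f v) = fm_quad (W_sum ps) v"
    using eq unfolding fm_equiv_def C_def P_def by auto
  define tl where "tl = (\<lambda>v :: nat \<Rightarrow> 'a W_vec. \<lambda>i. v (Suc i))"
  define g where "g = (\<lambda>v. bl m u w (v 0) + f (tl v))"
  have fP: "f v \<in> P" if "v \<in> C" for v using f(1) that by (auto simp: bij_betw_def)
  have car: "v \<in> fm_carrier (W_sum ((l, m) # ps)) \<longleftrightarrow> v 0 \<in> W_carrier m \<and> tl v \<in> C" for v :: "nat \<Rightarrow> 'a W_vec"
    by (simp add: W_sum_carrier C_def tl_def)
  have pp: "f v \<in> perp u \<inter> perp w" "T (f v) \<in> perp u \<inter> perp w" if "v \<in> C" for v
    using fP[OF that] tsub_Tp[OF P fP[OF that], of 1] by (auto simp: P_def)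
  have "inj_on g (fm_carrier (W_sum ((l, m) # ps)))"
  proof (rule inj_onI)
    fix v v' assume v: "v \<in> fm_carrier (W_sum ((l, m) # ps))" "v' \<in> fm_carrier (W_sum ((l, m) # ps))" and eq: "g v = g v'"
    have hv: "v 0 \<in> W_carrier m" "tl v \<in> C" "v' 0 \<in> W_carrier m" "tl v' \<in> C" using v by (auto simp: car)
    have "fst (v 0) k = fst (v' 0) k \<and> snd (v 0) k = snd (v' 0) k" for k
    proof (cases "k < m")
      case True
      then show ?thesis
        using bl_coeff[OF h True pp(1)[OF hv(2)], of "v 0"] bl_coeff[OF h True pp(1)[OF hv(4)], of "v' 0"] eq
        by (simp add: g_def)
    next
      case False
      then show ?thesis using hv(1,3) by (auto simp: W_carrier_def)
    qed
    then have v0: "v 0 = v' 0" by (auto intro!: prod_eqI)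
    then have "f (tl v) = f (tl v')" using eq by (simp add: g_def)
    then have "tl v = tl v'" using f(1) hv(2,4) by (auto simp: bij_betw_def inj_on_def)
    then have "v (Suc i) = v' (Suc i)" for i by (simp add: tl_def fun_eq_iff)
    then show "v = v'" using v0 by (metis ext not0_implies_Suc)
  qed
  moreover have "g ` fm_carrier (W_sum ((l, m) # ps)) = Q"
  proof
    show "g ` fm_carrier (W_sum ((l, m) # ps)) \<subseteq> Q"
      using fP Q by (auto simp: g_def car bl_def P_def intro!: tsub_add comb_in)
    show "Q \<subseteq> g ` fm_carrier (W_sum ((l, m) # ps))"
    proof
      fix x assume "x \<in> Q"
      then obtain a b z where x: "x = comb m a u + comb m b w + z" "z \<in> P"
        using hyp_decomp[OF Q h] unfolding P_def by blast
      then obtain v where v: "v \<in> C" "f v = z" using f(1) by (auto simp: bij_betw_def)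
      define v' where "v' = (\<lambda>i. case i of 0 \<Rightarrow> (\<lambda>k. if k < m then a k else 0, \<lambda>k. if k < m then b k else 0) | Suc j \<Rightarrow> v j)"
      have "v' \<in> fm_carrier (W_sum ((l, m) # ps))" using v(1) by (auto simp: car v'_def tl_def W_carrier_def)
      moreover have "g v' = x"
        using x v(2) comb_cong[of m "\<lambda>k. if k < m then a k else 0" a] comb_cong[of m "\<lambda>k. if k < m then b k else 0" b]
        by (simp add: g_def v'_def tl_def bl_def)
      ultimately show "x \<in> g ` fm_carrier (W_sum ((l, m) # ps))" by blast
    qed
  qed
  moreover have "g (v + v') = g v + g v'"
    if "v \<in> fm_carrier (W_sum ((l, m) # ps))" "v' \<in> fm_carrier (W_sum ((l, m) # ps))" for v v'
  proof -
    have "tl (v + v') = tl v + tl v'" by (auto simp: tl_def)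
    then show ?thesis using that by (simp add: g_def car bl_add f(2) add_ac)
  qed
  moreover have "g (fm_scale (W_sum ((l, m) # ps)) c v) = c *s g v"
    if "v \<in> fm_carrier (W_sum ((l, m) # ps))" for c v
  proof -
    have "tl (fm_scale (W_sum ((l, m) # ps)) c v) = fm_scale (W_sum ps) c (tl v)"
      by (simp add: tl_def W_sum_scale fun_eq_iff)
    then show ?thesis using that by (simp add: g_def car bl_scale W_sum_scale f(3) scale_right_distrib)
  qed
  moreover have "\<beta> (g v) (g v') = fm_bilin (W_sum ((l, m) # ps)) v v'"
    if "v \<in> fm_carrier (W_sum ((l, m) # ps))" "v' \<in> fm_carrier (W_sum ((l, m) # ps))" for v v'
    using that bl_perp[OF pp(1), of "tl v" m "v' 0"] bl_perp[OF pp(1), of "tl v'" m "v 0"]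
    by (simp add: g_def car \<beta>_add bl_bilin[OF h] f(4) W_sum_bilin tl_def \<beta>_sym[of "f _" "bl _ _ _ _"])
  moreover have "\<alpha> (g v) = fm_quad (W_sum ((l, m) # ps)) v"
    if "v \<in> fm_carrier (W_sum ((l, m) # ps))" for v
    using that bl_perp[OF pp(2), of "tl v" m "v 0"]
    by (simp add: g_def car \<alpha>_add bl_quad[OF blk] f(5) W_sum_quad tl_def T_adj)
  ultimately show ?thesis unfolding fm_equiv_def by (intro exI[of _ g]) (auto simp: bij_betw_def)
qed

lemma complete_imp_equiv:
  "complete S Q \<Longrightarrow> tsub Q \<Longrightarrow> fm_equiv (W_sum (shape S)) (fmQ Q)"
proof (induction S arbitrary: Q)
  case Nil
  then show ?case
    unfolding fm_equiv_def
    by (intro exI[of _ "\<lambda>_. 0"]) (auto simp: W_sum_Nil bij_betw_def, auto simp: W_sum_def fm_direct_sum_def)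
next
  case (Cons p S)
  obtain l m u w where [simp]: "p = (l, m, u, w)" by (metis prod_cases4)
  show ?case using Cons.prems by (auto intro!: block_equiv[of Q u w] Cons.IH tsub_perp)
qed

text \<open>Confirms that the coordinate formula for \<open>W_quad\<close> has the prescribed polar
  form. Reversing the index shows that \<open>h\<close> is symmetric, and squares are additive in
  characteristic 2.\<close>

lemma W_polar:
  assumes "x \<in> W_carrier m" "y \<in> W_carrier m"
  shows "W_quad l m (x + y) = W_quad l m x + W_quad l m y + (W_bilin m (W_T m x) y :: 'a)"
proof -
  have sq: "(\<Sum>i<m. if Suc i = l then (fst (x + y) i)\<^sup>2 else 0) =
      (\<Sum>i<m. if Suc i = l then (fst x i)\<^sup>2 else 0) + (\<Sum>i<m. if Suc i = l then (fst y i :: 'a)\<^sup>2 else 0)"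
    unfolding sum.distrib[symmetric] by (intro sum.cong) (auto simp: power2_add)
  define h where "h = (\<lambda>a b :: nat \<Rightarrow> 'a. \<Sum>i<m. (if 0 < i \<and> i < m then a (i - 1) else 0) * b (m - 1 - i))"
  have h_sym: "h a b = h b a" for a b
  proof (cases m)
    case (Suc m')
    have "h a b = (\<Sum>i<m'. a i * b (m' - Suc i))" for a b
      unfolding h_def Suc by (subst sum.lessThan_Suc_shift) simp
    then show ?thesis
      using sum.nat_diff_reindex[of "\<lambda>i. b i * a (m' - Suc i)" m'] by (simp add: mult.commute)
  qed (simp add: h_def)
  have h_add: "h (a + a') b = h a b + h a' b" "h a (b + b') = h a b + h a b'" for a a' b b'
    unfolding h_def sum.distrib[symmetric] by (intro sum.cong; simp add: algebra_simps)+
  have q: "W_bilin m (W_T m (fst z, \<lambda>_. 0)) (\<lambda>_. 0, snd z) = h (fst z) (snd z)" for z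
    by (simp add: W_bilin_alt W_T_def h_def cong: if_cong)
  have "W_bilin m (W_T m x) y = h (fst x) (snd y) + h (snd x) (fst y)"
    by (simp add: W_bilin_alt W_T_def h_def sum.distrib)
  then show ?thesis unfolding W_quad_def q sq by (simp add: h_add h_sym[of "fst y"] add_ac)
qed

end

lemma W_zero:
  shows "W_bilin m 0 y = 0" "W_bilin m y 0 = 0" "W_T m 0 = 0" "W_quad l m (0 :: 'k::field W_vec) = 0"
proof -
  have "W_T m (fst (0 :: 'k W_vec), \<lambda>_. 0) = 0" by (auto simp: W_T_def prod_eq_iff fun_eq_iff)
  then show "W_quad l m (0 :: 'k W_vec) = 0" by (simp add: W_quad_def W_bilin_alt cong: if_cong)
qed (auto simp: W_bilin_alt W_T_def prod_eq_iff fun_eq_iff)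

lemma W_sum_zero:
  fixes v :: "nat \<Rightarrow> 'k::field W_vec"
  shows "fm_quad (W_sum ps) (0 :: nat \<Rightarrow> 'k W_vec) = 0" "fm_bilin (W_sum ps) 0 v = 0"
proof -
  have 0: "(\<lambda>i. (0 :: nat \<Rightarrow> 'k W_vec) (Suc i)) = 0" by (simp add: fun_eq_iff)
  show "fm_quad (W_sum ps) (0 :: nat \<Rightarrow> 'k W_vec) = 0"
  proof (induction ps)
    case (Cons p ps)
    then show ?case by (cases p) (simp add: W_sum_quad 0 W_zero)
  qed (simp add: W_sum_def fm_direct_sum_def)
  show "fm_bilin (W_sum ps) 0 v = 0"
  proof (induction ps arbitrary: v)
    case (Cons p ps)
    then show ?case by (cases p) (simp add: W_sum_bilin 0 W_zero)
  qed (simp add: W_sum_def fm_direct_sum_def)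
qed

lemma W_T_closed: "W_T m x \<in> W_carrier m" by (simp add: W_T_def W_carrier_def)

text \<open>The vectors \<open>T^k v\<^sub>1\<close>, with \<open>T^m v\<^sub>1 = 0\<close> built in
  by the value 0 for \<open>k \<ge> m\<close>.\<close>

definition W_e :: "nat \<Rightarrow> nat \<Rightarrow> 'k::field W_vec" where
  "W_e m k = (\<lambda>j. if j = k \<and> k < m then 1 else 0, \<lambda>_. 0)"

definition W_f :: "nat \<Rightarrow> nat \<Rightarrow> 'k::field W_vec" where
  "W_f m k = (\<lambda>_. 0, \<lambda>j. if j = k \<and> k < m then 1 else 0)"

lemma W_ef:
  shows "W_e m k \<in> W_carrier m" "W_f m k \<in> W_carrier m"
    "W_T m (W_e m k) = W_e m (Suc k)" "W_T m (W_f m k) = W_f m (Suc k)"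
    "m \<le> k \<Longrightarrow> W_e m k = 0" "m \<le> k \<Longrightarrow> W_f m k = 0"
  by (auto simp: W_e_def W_f_def W_carrier_def W_T_def fun_eq_iff prod_eq_iff)

lemma W_bilin_ef:
  "W_bilin m (W_e m k) y = (if k < m then snd y (m - 1 - k) else 0)"
  "W_bilin m (W_f m k) y = (if k < m then - fst y (m - 1 - k) else 0)"
proof -
  have "W_bilin m (W_e m k) y = (\<Sum>i<m. if i = k then snd y (m - 1 - i) else 0)"
    unfolding W_bilin_alt by (intro sum.cong) (auto simp: W_e_def)
  then show "W_bilin m (W_e m k) y = (if k < m then snd y (m - 1 - k) else 0)" by simp
  have "W_bilin m (W_f m k) y = (\<Sum>i<m. if i = k then - fst y (m - 1 - i) else 0)"
    unfolding W_bilin_alt by (intro sum.cong) (auto simp: W_f_def)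
  then show "W_bilin m (W_f m k) y = (if k < m then - fst y (m - 1 - k) else 0)" by simp
qed

lemma W_quad_ef:
  assumes "l \<le> m"
  shows "W_quad l m (W_e m k :: 'k::field W_vec) = (if Suc k = l then 1 else 0)" "W_quad l m (W_f m k :: 'k W_vec) = 0"
proof -
  have 0: "((\<lambda>_. 0, \<lambda>_. 0) :: 'k W_vec) = 0" by (simp add: prod_eq_iff fun_eq_iff)
  have A: "W_bilin m (W_T m (fst (W_e m k :: 'k W_vec), \<lambda>_. 0)) (\<lambda>_. 0, snd (W_e m k)) = 0"
    by (simp add: W_e_def 0 W_zero)
  have "W_quad l m (W_e m k :: 'k W_vec) = (\<Sum>i<m. if i = k then (if Suc k = l then 1 else 0) else 0)"
    unfolding W_quad_def A add_0_right by (intro sum.cong) (auto simp: W_e_def)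
  also have "\<dots> = (if Suc k = l then 1 else 0)" using assms by simp
  finally show "W_quad l m (W_e m k :: 'k W_vec) = (if Suc k = l then 1 else 0)" .
  show "W_quad l m (W_f m k :: 'k W_vec) = 0"
    unfolding W_quad_def by (simp add: W_f_def[of m k, THEN arg_cong[of _ _ fst]] 0 W_zero cong: if_cong)
qed

section \<open>Recovering a splitting from an isomorphism, and its invariants\<close>

context form_mod
begin

text \<open>An isomorphism is only known to preserve the two forms, but on a nondegenerate space
  these determine \<open>T\<close>. So the images of \<open>v\<^sub>1\<close> and
  \<open>v\<^sub>2\<close> generate a block, and the other summands map onto its complement.\<close>

lemma equiv_imp_complete:
  assumes "tsub Q" "nondeg Q" "fm_equiv (W_sum ps) (fmQ Q)" "\<forall>(l, m)\<in>set ps. 1 \<le> m \<and> m div 2 \<le> l \<and> l \<le> m"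
  shows "\<exists>S. complete S Q \<and> shape S = ps"
  using assms
proof (induction ps arbitrary: Q)
  case Nil
  then obtain f where "bij_betw f {0 :: nat \<Rightarrow> 'a W_vec} Q" by (auto simp: fm_equiv_def W_sum_Nil)
  then have "Q = {f 0}" by (auto simp: bij_betw_def)
  moreover have "0 \<in> Q" by (rule tsub_0[OF Nil.prems(1)])
  ultimately have "complete [] Q" by simp
  then show ?case by (intro exI[of _ "[]"]) simp
next
  case (Cons p ps)
  obtain l m where [simp]: "p = (l, m)" by force
  have lm: "1 \<le> m" "m div 2 \<le> l" "l \<le> m" using Cons.prems(4) by auto
  note Q = Cons.prems(1,2)
  define C where "C = fm_carrier (W_sum ps :: ('a, nat \<Rightarrow> 'a W_vec) form_module)"
  define C1 where "C1 = fm_carrier (W_sum ((l, m) # ps) :: ('a, nat \<Rightarrow> 'a W_vec) form_module)"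
  obtain g where g: "bij_betw g C1 Q"
    "\<And>v w. v \<in> C1 \<Longrightarrow> w \<in> C1 \<Longrightarrow> g (v + w) = g v + g w"
    "\<And>c v. v \<in> C1 \<Longrightarrow> g (fm_scale (W_sum ((l, m) # ps)) c v) = c *s g v"
    "\<And>v w. v \<in> C1 \<Longrightarrow> w \<in> C1 \<Longrightarrow> \<beta> (g v) (g w) = fm_bilin (W_sum ((l, m) # ps)) v w"
    "\<And>v. v \<in> C1 \<Longrightarrow> \<alpha> (g v) = fm_quad (W_sum ((l, m) # ps)) v"
    using Cons.prems(3) unfolding fm_equiv_def C1_def by auto
  define tl where "tl = (\<lambda>v :: nat \<Rightarrow> 'a W_vec. \<lambda>i. v (Suc i))"
  define single where "single = (\<lambda>x :: 'a W_vec. \<lambda>i :: nat. if i = 0 then x else 0)"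
  define shift where "shift = (\<lambda>v :: nat \<Rightarrow> 'a W_vec. \<lambda>i. case i of 0 \<Rightarrow> 0 | Suc j \<Rightarrow> v j)"
  have car: "v \<in> C1 \<longleftrightarrow> v 0 \<in> W_carrier m \<and> tl v \<in> C" for v
    by (simp add: W_sum_carrier C_def C1_def tl_def)
  have bil: "\<beta> (g v) (g w) = W_bilin m (v 0) (w 0) + fm_bilin (W_sum ps) (tl v) (tl w)" if "v \<in> C1" "w \<in> C1" for v w
    by (simp add: g(4)[OF that] W_sum_bilin tl_def)
  have quad: "\<alpha> (g v) = W_quad l m (v 0) + fm_quad (W_sum ps) (tl v)" if "v \<in> C1" for v
    by (simp add: g(5)[OF that] W_sum_quad tl_def)
  have single: "single x 0 = x" "tl (single x) = 0" "single 0 = 0" "tl (single x + v) = tl v" for x v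
    by (auto simp: single_def tl_def fun_eq_iff)
  have shift: "shift v 0 = 0" "tl (shift v) = v" for v by (auto simp: shift_def tl_def)
  have C0: "0 \<in> C" unfolding C_def by (rule W_sum_0)
  have sC: "single x \<in> C1" if "x \<in> W_carrier m" for x using that C0 by (simp add: car single)
  have hC: "shift v \<in> C1 \<longleftrightarrow> v \<in> C" for v by (simp add: car shift W_carrier_closed)
  have C1_add: "v + w \<in> C1" if "v \<in> C1" "w \<in> C1" for v w using W_sum_closed(1) that unfolding C1_def by blast
  have gQ: "g v \<in> Q" if "v \<in> C1" for v using g(1) that by (auto simp: bij_betw_def)
  have Qg: "\<exists>v\<in>C1. x = g v" if "x \<in> Q" for x using g(1) that by (auto simp: bij_betw_def)
  have "0 \<in> C1" using sC[OF W_carrier_closed(3)] by (simp add: single)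
  then have g0: "g 0 = 0" using g(2)[of 0 0] by simp
  \<comment> \<open>Both vectors pair equally with all of \<open>Q\<close>: since
    \<open>\<alpha>\<close> is preserved, so is its polar form, which is given by \<open>T\<close>
    on one side and by \<open>W_T\<close> on the other.\<close>
  have gT: "T (g (single x)) = g (single (W_T m x))" if x: "x \<in> W_carrier m" for x
  proof -
    have in_Q: "T (g (single x)) \<in> Q" "g (single (W_T m x)) \<in> Q"
      using tsub_Tp[OF Q(1) gQ[OF sC[OF x]], of 1] gQ[OF sC[OF W_T_closed]] by auto
    have "\<beta> (T (g (single x)) + g (single (W_T m x))) y = 0" if y: "y \<in> Q" for y
    proof -
      obtain v where v: "v \<in> C1" "y = g v" using Qg[OF y] by blast
      have v0: "v 0 \<in> W_carrier m" using v(1) car by simp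
      have "\<alpha> (g (single x + v)) = \<alpha> (g (single x)) + \<alpha> (g v) + \<beta> (T (g (single x))) (g v)"
        by (simp add: g(2)[OF sC[OF x] v(1)] \<alpha>_add)
      moreover have "\<alpha> (g (single x + v)) = W_quad l m (x + v 0) + fm_quad (W_sum ps) (tl v)"
        using quad[OF C1_add[OF sC[OF x] v(1)]] by (simp add: single)
      ultimately have "\<beta> (T (g (single x))) (g v) = W_bilin m (W_T m x) (v 0)"
        using quad[OF sC[OF x]] quad[OF v(1)] by (simp add: single W_sum_zero W_polar[OF x v0] add_ac)
      moreover have "\<beta> (g (single (W_T m x))) (g v) = W_bilin m (W_T m x) (v 0)"
        using bil[OF sC[OF W_T_closed] v(1)] by (simp add: single W_sum_zero)
      ultimately show ?thesis by (simp add: \<beta>_add v(2))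
    qed
    moreover have "T (g (single x)) + g (single (W_T m x)) \<in> Q" using in_Q by (rule tsub_add[OF Q(1)])
    ultimately have "T (g (single x)) + g (single (W_T m x)) = 0" using Q(2) by (auto simp: nondeg_def)
    then show ?thesis by (simp add: vsum_eq_0_iff)
  qed
  define u where "u = g (single (W_e m 0))"
  define w where "w = g (single (W_f m 0))"
  have Tu: "Tp k u = g (single (W_e m k))" and Tw: "Tp k w = g (single (W_f m k))" for k
    by (induction k) (simp_all add: u_def w_def gT W_ef)
  have uw: "u \<in> Q" "w \<in> Q" unfolding u_def w_def by (intro gQ sC W_ef)+
  have \<beta>u: "\<beta> (Tp k u) (g v) = (if k < m then snd (v 0) (m - 1 - k) else 0)"
    and \<beta>w: "\<beta> (Tp k w) (g v) = (if k < m then fst (v 0) (m - 1 - k) else 0)" if "v \<in> C1" for k v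
    using bil[OF sC that, of "W_e m k"] bil[OF sC that, of "W_f m k"]
    by (simp_all add: Tu Tw W_ef single W_sum_zero W_bilin_ef)
  have "\<beta> (Tp k u) w = (if Suc k = m then 1 else 0)" for k
    unfolding w_def \<beta>u[OF sC[OF W_ef(2)]] using lm(1) by (auto simp: single W_f_def)
  then have h: "hyp m u w" using lm(1) Tu[of m] Tw[of m] by (simp add: hyp_def W_ef single g0)
  have "\<alpha> (Tp k u) = (if Suc k = l then 1 else 0)" "\<alpha> (Tp k w) = 0" for k
    using quad[OF sC[OF W_ef(1)], of k] quad[OF sC[OF W_ef(2)], of k] lm
    by (simp_all add: Tu Tw single W_sum_zero W_quad_ef)
  with h lm have blk: "blk l m u w" by (simp add: blk_def)
  define P where "P = Q \<inter> perp u \<inter> perp w"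
  \<comment> \<open>The coordinates in the first summand are the pairings with the
    \<open>T^k u\<close> and \<open>T^k w\<close>, so the complement is where they all
    vanish.\<close>
  have memP: "g v \<in> P \<longleftrightarrow> v 0 = 0" if "v \<in> C1" for v
  proof
    assume "v 0 = 0"
    then show "g v \<in> P" using gQ[OF that] by (simp add: P_def perp_def \<beta>u[OF that] \<beta>w[OF that])
  next
    assume "g v \<in> P"
    then have *: "\<beta> (Tp k u) (g v) = 0" "\<beta> (Tp k w) (g v) = 0" for k by (auto simp: P_def perp_def)
    have "fst (v 0) j = 0 \<and> snd (v 0) j = 0" for j
    proof (cases "j < m")
      case True
      then show ?thesis using *(1)[of "m - 1 - j"] *(2)[of "m - 1 - j"] by (simp add: \<beta>u[OF that] \<beta>w[OF that])
    next
      case False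
      moreover have "v 0 \<in> W_carrier m" using that car by simp
      ultimately show ?thesis by (auto simp: W_carrier_def)
    qed
    then show "v 0 = 0" by (simp add: prod_eq_iff fun_eq_iff)
  qed
  have "fm_equiv (W_sum ps) (fmQ P)"
    unfolding fm_equiv_def fmQ_simps C_def[symmetric]
  proof (intro exI[of _ "\<lambda>v. g (shift v)"] conjI ballI allI)
    show "bij_betw (\<lambda>v. g (shift v)) C P"
    proof (rule bij_betw_imageI)
      show "inj_on (\<lambda>v. g (shift v)) C"
      proof (rule inj_onI)
        fix v v' assume "v \<in> C" "v' \<in> C" "g (shift v) = g (shift v')"
        then have "shift v = shift v'" using g(1) hC by (auto simp: bij_betw_def inj_on_def)
        then have "tl (shift v) = tl (shift v')" by simp
        then show "v = v'" by (simp only: shift(2))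
      qed
      show "(\<lambda>v. g (shift v)) ` C = P"
      proof
        show "(\<lambda>v. g (shift v)) ` C \<subseteq> P" using memP hC by (auto simp: shift)
        show "P \<subseteq> (\<lambda>v. g (shift v)) ` C"
        proof
          fix x assume x: "x \<in> P"
          then have "x \<in> Q" by (simp add: P_def)
          then obtain v where v: "v \<in> C1" "x = g v" using Qg by blast
          then have "v 0 = 0" using memP x by simp
          then have "v i = shift (tl v) i" for i by (cases i) (simp_all add: shift_def tl_def)
          then have "v = shift (tl v)" by (rule ext)
          then have "x = g (shift (tl v))" using v(2) by simp
          moreover have "tl v \<in> C" using v(1) car by simp
          ultimately show "x \<in> (\<lambda>v. g (shift v)) ` C" by (rule image_eqI)
        qed
      qed
    qed
  next
    fix v w assume "v \<in> C" "w \<in> C"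
    have "shift (v + w) = shift v + shift w" by (auto simp: shift_def fun_eq_iff split: nat.split)
    then show "g (shift (v + w)) = g (shift v) + g (shift w)" using \<open>v \<in> C\<close> \<open>w \<in> C\<close> by (simp add: g(2) hC)
  next
    fix c v assume "v \<in> C"
    have "fm_scale (W_sum ((l, m) # ps)) c (shift v) = shift (fm_scale (W_sum ps) c v)"
    proof
      fix i show "fm_scale (W_sum ((l, m) # ps)) c (shift v) i = shift (fm_scale (W_sum ps) c v) i"
        by (cases i) (auto simp: W_sum_scale shift_def W_scale_def prod_eq_iff fun_eq_iff)
    qed
    then show "g (shift (fm_scale (W_sum ps) c v)) = c *s g (shift v)"
      using g(3)[of "shift v" c] \<open>v \<in> C\<close> by (simp add: hC)
  next
    fix v w assume "v \<in> C" "w \<in> C"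
    then show "\<beta> (g (shift v)) (g (shift w)) = fm_bilin (W_sum ps) v w"
      by (simp add: bil hC shift W_zero)
  next
    fix v assume "v \<in> C"
    then show "\<alpha> (g (shift v)) = fm_quad (W_sum ps) v" by (simp add: quad hC shift W_zero)
  qed
  moreover have "tsub P" "nondeg P" unfolding P_def using tsub_perp[OF Q(1)] nondeg_perp[OF Q uw h] by auto
  moreover have "\<forall>(l, m)\<in>set ps. 1 \<le> m \<and> m div 2 \<le> l \<and> l \<le> m" using Cons.prems(4) by simp
  ultimately obtain S where "complete S P" "shape S = ps" using Cons.IH[of P] by blast
  then have "complete ((l, m, u, w) # S) Q" "shape ((l, m, u, w) # S) = p # ps" using uw blk by (simp_all add: P_def)
  then show ?case by blast
qed

text \<open>In a block the image of \<open>T^k\<close> is spanned by the \<open>T^j u\<close> and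
  \<open>T^j w\<close> with \<open>k \<le> j < m\<close>, and the dual family
  \<open>T^(m-1-j) w\<close>, \<open>T^(m-1-j) u\<close> proves independence. The left side does not
  mention the splitting, so the sums on the right are invariants.\<close>

lemma complete_dim:
  assumes "complete S Q" "tsub Q"
  shows "dim (Tp k ` Q) = 2 * sum_list (map (\<lambda>(l, m). m - k) (shape S))"
  using assms
proof (induction S arbitrary: Q)
  case Nil
  then show ?case by simp
next
  case (Cons p S)
  obtain l m u w where [simp]: "p = (l, m, u, w)" by (metis prod_cases4)
  define P where "P = Q \<inter> perp u \<inter> perp w"
  have h: "u \<in> Q" "w \<in> Q" "blk l m u w" "complete S P" using Cons.prems by (auto simp: P_def)
  have hyp: "hyp m u w" using h(3) by (simp add: blk_def)
  have P: "tsub P" unfolding P_def by (rule tsub_perp[OF Cons.prems(2)])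
  have pP: "\<beta> (Tp i u) (Tp j z) = 0" "\<beta> (Tp i w) (Tp j z) = 0" if "z \<in> P" for i j z
    using that perp_Tp by (auto simp: P_def)
  define X where "X = Tp k ` P \<union> (\<lambda>j. Tp j u) ` {k..<m}"
  define Y where "Y = X \<union> (\<lambda>j. Tp j w) ` {k..<m}"
  have dual: "\<beta> (Tp (m - Suc i) w) (Tp j u) = (if i = j then 1 else 0)"
    "\<beta> (Tp (m - Suc i) u) (Tp j w) = (if i = j then 1 else 0)" if "i \<in> {k..<m}" "j \<in> {k..<m}" for i j
  proof -
    have "Suc (m - Suc i + j) = m \<longleftrightarrow> i = j" using that by auto
    then show "\<beta> (Tp (m - Suc i) w) (Tp j u) = (if i = j then 1 else 0)"
      "\<beta> (Tp (m - Suc i) u) (Tp j w) = (if i = j then 1 else 0)"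
      using hyp by (simp_all add: \<beta>_Tp_Tp \<beta>_Tp_swap[of _ w u] hyp_def)
  qed
  have "dim X = dim (Tp k ` P) + card {k..<m}" unfolding X_def
    by (rule dim_dual_family[where y = "\<lambda>i. Tp (m - Suc i) w"]) (auto simp: dual pP)
  moreover have "dim Y = dim X + card {k..<m}" unfolding Y_def
    by (rule dim_dual_family[where y = "\<lambda>i. Tp (m - Suc i) u"]) (auto simp: dual pP X_def)
  moreover have "span Y = Tp k ` Q"
  proof
    have "subspace (Tp k ` Q)"
    proof -
      have "x + y \<in> Q" "c *s x \<in> Q" "0 \<in> Q" if "x \<in> Q" "y \<in> Q" for x y c
        using that Cons.prems(2) tsub_add tsub_scale tsub_0 by auto
      then show ?thesis using h(1) unfolding subspace_def
        by (auto simp: Tp_add[symmetric] Tp_scale[symmetric] image_iff intro: bexI[of _ 0])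
    qed
    moreover have "Y \<subseteq> Tp k ` Q"
    proof -
      have "Tp j x \<in> Tp k ` Q" if "k \<le> j" "x \<in> Q" for j x
        using that tsub_Tp[OF Cons.prems(2) that(2), of "j - k"] Tp_Tp[of k "j - k" x] by (intro image_eqI[of _ _ "Tp (j - k) x"]) auto
      then show ?thesis using h(1,2) by (auto simp: X_def Y_def P_def)
    qed
    ultimately show "span Y \<subseteq> Tp k ` Q" by (simp add: span_minimal)
    have comb_span: "Tp k (comb m a v) \<in> span Y" if "\<And>j. k \<le> j \<Longrightarrow> j < m \<Longrightarrow> Tp j v \<in> Y" "Tp m v = 0" for a v
      unfolding comb_def Tp_sum Tp_scale
    proof (intro span_sum span_scale)
      fix i assume "i \<in> {..<m}"
      show "Tp k (Tp i v) \<in> span Y"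
      proof (cases "k + i < m")
        case True then show ?thesis using that(1)[of "k + i"] by (auto intro: span_base)
      next
        case False then show ?thesis using Tp_ge[OF that(2), of "k + i"] by (simp add: span_zero)
      qed
    qed
    show "Tp k ` Q \<subseteq> span Y"
    proof clarify
      fix x assume "x \<in> Q"
      then obtain a b z where x: "x = comb m a u + comb m b w + z" "z \<in> P"
        using hyp_decomp[OF Cons.prems(2) h(1,2) hyp] unfolding P_def by blast
      have "Tp k z \<in> span Y" using x(2) by (auto simp: X_def Y_def intro: span_base)
      moreover have "Tp k (comb m a u) \<in> span Y" "Tp k (comb m b w) \<in> span Y"
        using hyp by (intro comb_span; auto simp: X_def Y_def hyp_def)+
      ultimately show "Tp k x \<in> span Y" by (simp add: x(1) Tp_add span_add)
    qed
  qed
  then have "dim (Tp k ` Q) = dim Y" by (metis dim_span)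
  ultimately show ?case using Cons.IH[OF h(4) P] by simp
qed

lemma \<alpha>_Tp_comb: "\<alpha> (Tp k (comb m a u)) = (\<Sum>j<m. (a j)\<^sup>2 * \<alpha> (Tp (k + j) u))"
proof (induction m)
  case (Suc m)
  have "\<beta> (Tp (2 * k + 1) (comb m a u)) (Tp m u) = 0"
    by (simp only: Tp_adj Tp_Tp) (simp only: \<beta>_sym[of "comb m a u"] \<beta>_comb_same)
  moreover have "comb (Suc m) a u = comb m a u + a m *s Tp m u" by (simp add: comb_def)
  ultimately show ?case using Suc by (simp only: \<alpha>_Tp_add Tp_scale \<alpha>_scale \<beta>_scale Tp_Tp) simp
qed (simp add: comb_def)

text \<open>In a block the kernel of \<open>T^p\<close> is spanned by the \<open>T^j u\<close> and
  \<open>T^j w\<close> with \<open>j \<ge> m - p\<close>, and \<open>\<alpha> \<circ> T^k\<close>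
  vanishes on it exactly when \<open>l \<le> k + (m - p)\<close>. This is the invariant from which
  \<open>normal_sequence_eqI\<close> recovers the \<open>l\<close>.\<close>

lemma complete_chi:
  assumes "complete S Q" "tsub Q"
  shows "(\<forall>x\<in>Q. Tp p x = 0 \<longrightarrow> \<alpha> (Tp k x) = 0) \<longleftrightarrow> (\<forall>(l, m)\<in>set (shape S). l \<le> k + (m - p))"
  using assms
proof (induction S arbitrary: Q)
  case Nil
  then show ?case by simp
next
  case (Cons q S)
  obtain l m u w where [simp]: "q = (l, m, u, w)" by (metis prod_cases4)
  define P where "P = Q \<inter> perp u \<inter> perp w"
  have h: "u \<in> Q" "w \<in> Q" "blk l m u w" "complete S P" using Cons.prems by (auto simp: P_def)
  have hyp: "hyp m u w" and lm: "m div 2 \<le> l" "l \<le> m" using h(3) by (auto simp: blk_def)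
  have P: "tsub P" unfolding P_def by (rule tsub_perp[OF Cons.prems(2)])
  note IH = Cons.IH[OF h(4) P]
  show ?case
  proof
    assume all: "\<forall>x\<in>Q. Tp p x = 0 \<longrightarrow> \<alpha> (Tp k x) = 0"
    have "l \<le> k + (m - p)"
    proof (rule ccontr)
      assume neg: "\<not> l \<le> k + (m - p)"
      \<comment> \<open>\<open>T^k x = T^(l-1) u\<close> has \<open>\<alpha>\<close>-value 1, while
        \<open>T^p x = 0\<close> because \<open>p + (l - 1 - k) \<ge> m\<close>.\<close>
      define x where "x = Tp (l - 1 - k) u"
      have "x \<in> Q" unfolding x_def by (rule tsub_Tp[OF Cons.prems(2) h(1)])
      moreover have "Tp p x = 0"
      proof -
        have "Tp m u = 0" using hyp by (simp add: hyp_def)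
        moreover have "m \<le> p + (l - 1 - k)" using neg by linarith
        ultimately show ?thesis unfolding x_def Tp_Tp by (rule Tp_ge)
      qed
      moreover have "\<alpha> (Tp k x) = 1"
      proof -
        have "Suc (k + (l - 1 - k)) = l" using neg by linarith
        then show ?thesis unfolding x_def Tp_Tp using h(3) by (simp add: blk_def)
      qed
      ultimately show False using all zero_neq_one by metis
    qed
    moreover have "\<forall>x\<in>P. Tp p x = 0 \<longrightarrow> \<alpha> (Tp k x) = 0" using all by (simp add: P_def)
    ultimately show "\<forall>(l, m)\<in>set (shape (q # S)). l \<le> k + (m - p)" using IH by auto
  next
    assume all: "\<forall>(l, m)\<in>set (shape (q # S)). l \<le> k + (m - p)"
    then have l: "l \<le> k + (m - p)" and allP: "\<forall>x\<in>P. Tp p x = 0 \<longrightarrow> \<alpha> (Tp k x) = 0" using IH by auto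
    show "\<forall>x\<in>Q. Tp p x = 0 \<longrightarrow> \<alpha> (Tp k x) = 0"
    proof (intro ballI impI)
      fix x assume xQ: "x \<in> Q" and x0: "Tp p x = 0"
      obtain a b z where x: "x = comb m a u + comb m b w + z" and z: "z \<in> P"
        using hyp_decomp[OF Cons.prems(2) h(1,2) hyp xQ] unfolding P_def by blast
      have zp: "\<beta> (Tp i u) z = 0" "\<beta> (Tp i w) z = 0" for i using z by (auto simp: P_def perp_def)
      have zero: "\<beta> (Tp i v) x = 0" if "p \<le> i" for i v
        using Tp_adj[of "i" v x] Tp_ge[OF x0 that] by simp
      have ab: "a j = 0" "b j = 0" if "j + p < m" for j
        using zero[of "m - 1 - j" w] zero[of "m - 1 - j" u] that zp
        by (simp_all add: x \<beta>_add \<beta>_comb[OF hyp] \<beta>_comb[OF hyp_sym[OF hyp]] \<beta>_comb_same)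
      have T0: "Tp p (comb m c v) = 0" if "\<And>j. j + p < m \<Longrightarrow> c j = 0" "Tp m v = 0" for c v
        unfolding comb_def Tp_sum Tp_scale
      proof (intro sum.neutral ballI)
        fix j show "c j *s Tp p (Tp j v) = 0"
          using that(1)[of j] Tp_ge[OF that(2), of "p + j"] by (cases "j + p < m") auto
      qed
      have "Tp m u = 0" "Tp m w = 0" using hyp by (simp_all add: hyp_def)
      then have "Tp p (comb m a u) = 0" "Tp p (comb m b w) = 0" by (simp_all only: T0[OF ab(1)] T0[OF ab(2)])
      then have "Tp p z = 0" using x0 unfolding x Tp_add by (simp only: add_0_left)
      then have az: "\<alpha> (Tp k z) = 0" using allP z by blast
      have au: "\<alpha> (Tp (k + j) u) = 0" if "\<not> j + p < m" for j using h(3) that l by (auto simp: blk_def)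
      have 1: "\<alpha> (Tp k (comb m a u)) = 0"
        unfolding \<alpha>_Tp_comb using ab(1) au by (intro sum.neutral) auto
      have 2: "\<alpha> (Tp k (comb m b w)) = 0"
        unfolding \<alpha>_Tp_comb using h(3) by (simp add: blk_def)
      \<comment> \<open>The mixed term vanishes by \<open>m \<le> 2 * l + 1\<close> and
        \<open>l \<le> k + (m - p)\<close>: wherever \<open>a j\<close> may be nonzero, the
        coefficient of \<open>b\<close> paired with it has index below \<open>m - p\<close>.\<close>
      have 3: "\<beta> (Tp (2 * k + 1) (comb m a u)) (comb m b w) = 0"
        unfolding comb_def[of m a u] Tp_sum Tp_scale \<beta>_sum \<beta>_scale
      proof (intro sum.neutral ballI)
        fix j
        have "b (m - 1 - (2 * k + 1 + j)) = 0" if "\<not> j + p < m" "2 * k + 1 + j < m"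
          using that l lm by (intro ab(2)) linarith
        then show "a j * \<beta> (Tp (2 * k + 1) (Tp j u)) (comb m b w) = 0"
          unfolding Tp_Tp \<beta>_comb[OF hyp_sym[OF hyp]] using ab(1)[of j]
          by (cases "j + p < m"; cases "2 * k + 1 + j < m") simp_all
      qed
      have 4: "\<beta> (Tp (2 * k + 1) (comb m c v)) z = 0" if "\<And>i. \<beta> (Tp i v) z = 0" for c v
        unfolding comb_def Tp_sum Tp_scale \<beta>_sum \<beta>_scale Tp_Tp by (simp only: that) simp
      have "\<alpha> (Tp k (comb m a u + comb m b w)) = 0" by (simp only: \<alpha>_Tp_add 1 2 3) simp
      moreover have "\<beta> (Tp (2 * k + 1) (comb m a u + comb m b w)) z = 0"
        unfolding Tp_add \<beta>_add 4[OF zp(1)] 4[OF zp(2)] by simp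
      ultimately show "\<alpha> (Tp k x) = 0" unfolding x by (simp only: \<alpha>_Tp_add[of k _ z] az) simp
    qed
  qed
qed

lemma fmQ_equiv_sym: "fm_equiv (W_sum ps) (fmQ Q) \<Longrightarrow> fm_equiv (fmQ Q) (W_sum ps)"
  by (rule fm_equiv_sym[rotated 2]) (auto intro: W_sum_closed)

lemma normal_equiv_complete:
  assumes "normal_sequence ps" "fm_equiv (fmQ UNIV) (W_sum ps)"
  obtains S where "complete S UNIV" "shape S = ps"
proof -
  have "fm_equiv (W_sum ps) (fmQ UNIV)" using assms(2) by (intro fm_equiv_sym[OF _ _ assms(2)]) auto
  then have "\<exists>S. complete S UNIV \<and> shape S = ps"
    using assms(1) by (intro equiv_imp_complete tsub_UNIV nondeg_UNIV) (auto simp: normal_sequence_def)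
  with that show thesis by blast
qed

theorem normal_form: "\<exists>!ps. normal_sequence ps \<and> fm_equiv (fmQ UNIV) (W_sum ps)"
proof (rule ex_ex1I)
  obtain S where S: "complete S UNIV" "normal_sequence (shape S)" by (rule exists_complete)
  have "fm_equiv (fmQ UNIV) (W_sum (shape S))"
    by (rule fmQ_equiv_sym[OF complete_imp_equiv[OF S(1) tsub_UNIV]])
  with S(2) show "\<exists>ps. normal_sequence ps \<and> fm_equiv (fmQ UNIV) (W_sum ps)" by blast
next
  fix ps qs
  assume ps: "normal_sequence ps \<and> fm_equiv (fmQ UNIV) (W_sum ps)"
    and qs: "normal_sequence qs \<and> fm_equiv (fmQ UNIV) (W_sum qs)"
  obtain S where S: "complete S UNIV" "shape S = ps" using ps normal_equiv_complete by blast
  obtain R where R: "complete R UNIV" "shape R = qs" using qs normal_equiv_complete by blast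
  show "ps = qs"
  proof (rule normal_sequence_eqI)
    fix k show "sum_list (map (\<lambda>(l, m). m - k) ps) = sum_list (map (\<lambda>(l, m). m - k) qs)"
      using complete_dim[OF S(1) tsub_UNIV, of k] complete_dim[OF R(1) tsub_UNIV, of k] S(2) R(2) by simp
  next
    fix p k show "(\<forall>(l, m)\<in>set ps. l \<le> k + (m - p)) = (\<forall>(l, m)\<in>set qs. l \<le> k + (m - p))"
      using complete_chi[OF S(1) tsub_UNIV, of p k] complete_chi[OF R(1) tsub_UNIV, of p k] S(2) R(2) by simp
  qed (use ps qs in auto)
qed

lemma normal_form_rank:
  assumes "normal_sequence ps" "fm_equiv (fmQ UNIV) (W_sum ps)"
  shows "card Basis = 2 * total_rank ps"
proof -
  obtain S where S: "complete S UNIV" "shape S = ps" by (rule normal_equiv_complete[OF assms])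
  have "card Basis = dim (Tp 0 ` UNIV)" by (simp add: dim_UNIV)
  also have "\<dots> = 2 * sum_list (map (\<lambda>(l, m). m - 0) (shape S))" by (rule complete_dim[OF S(1) tsub_UNIV])
  also have "map (\<lambda>(l, m). m - 0) (shape S) = map snd ps" by (auto simp: S(2))
  finally show ?thesis by (simp add: total_rank_def)
qed

end

section \<open>Functionals on the symplectic Lie algebra and quadratic forms\<close>

lemma sum_square_split:
  fixes F :: "nat \<Rightarrow> nat \<Rightarrow> 'a::comm_monoid_add"
  shows "(\<Sum>i<N. \<Sum>j<N. F i j) = (\<Sum>i<N. F i i) + (\<Sum>j<N. \<Sum>i<j. F i j + F j i)"
proof (induction N)
  case (Suc N)
  have "(\<Sum>i<Suc N. \<Sum>j<Suc N. F i j) = (\<Sum>i<N. \<Sum>j<N. F i j) + (\<Sum>i<N. F i N) + ((\<Sum>j<N. F N j) + F N N)"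
    by (simp add: sum.distrib add_ac)
  then show ?case unfolding Suc by (simp add: sum.distrib add_ac)
qed simp

context symp
begin

definition pol :: "('v \<Rightarrow> 'k) \<Rightarrow> 'v \<Rightarrow> 'v \<Rightarrow> 'k" where
  "pol q v w = q (v + w) + q v + q w"

definition quadr :: "('v \<Rightarrow> 'k) \<Rightarrow> bool" where
  "quadr q \<longleftrightarrow> (\<forall>c v. q (c *s v) = c\<^sup>2 * q v) \<and> (\<forall>u v w. pol q (u + v) w = pol q u w + pol q v w) \<and>
     (\<forall>c v w. pol q (c *s v) w = c * pol q v w)"

lemma pol_sym: "pol q v w = pol q w v" by (simp add: pol_def add_ac)

lemma pol_0: "quadr q \<Longrightarrow> pol q v 0 = 0"
  using scale_zero_left unfolding quadr_def by (metis mult_zero_left pol_sym)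

lemma pol_bilinear:
  assumes "quadr q"
  shows "pol q (u + v) w = pol q u w + pol q v w" "pol q (c *s v) w = c * pol q v w"
    "pol q w (u + v) = pol q w u + pol q w v" "pol q w (c *s v) = c * pol q w v"
  using assms pol_sym[of q w] by (simp_all add: quadr_def)

lemma pol_sum: "quadr q \<Longrightarrow> pol q v (\<Sum>i\<in>A. c i *s x i) = (\<Sum>i\<in>A. c i * pol q v (x i))"
  by (induction A rule: infinite_finite_induct) (simp_all add: pol_bilinear pol_0)

lemma q_add: "q (v + w) = q v + q w + pol q v w"
  by (simp add: pol_def add_ac)

lemma quadr_sum:
  fixes c :: "nat \<Rightarrow> 'k" and x :: "nat \<Rightarrow> 'v"
  assumes "quadr q"
  shows "q (\<Sum>i<N. c i *s x i) = (\<Sum>i<N. (c i)\<^sup>2 * q (x i)) + (\<Sum>j<N. \<Sum>i<j. c i * c j * pol q (x i) (x j))"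
proof (induction N)
  case 0
  have "q (0 *s 0) = 0" using assms by (simp only: quadr_def) simp
  then show ?case by simp
next
  case (Suc N)
  have "pol q (\<Sum>i<N. c i *s x i) (c N *s x N) = (\<Sum>i<N. c i * c N * pol q (x i) (x N))"
    using assms by (simp only: pol_bilinear pol_sym[of q "sum _ _"] pol_sum sum_distrib_left)
      (simp add: pol_sym[of q "x N"] mult_ac)
  moreover have "q (c N *s x N) = (c N)\<^sup>2 * q (x N)" using assms by (simp add: quadr_def)
  ultimately show ?case unfolding sum.lessThan_Suc q_add[of q "sum _ _"] Suc by (simp add: add_ac)
qed

lemma sp_iff:
  "x \<in> sp scale \<beta> \<longleftrightarrow> (\<forall>v w. x (v + w) = x v + x w) \<and> (\<forall>c v. x (c *s v) = c *s x v) \<and> (\<forall>v w. \<beta> (x v) w = \<beta> v (x w))"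
  by (simp add: sp_def gl_iff sum_eq_0_iff)

lemma sp_add: "x \<in> sp scale \<beta> \<Longrightarrow> y \<in> sp scale \<beta> \<Longrightarrow> (\<lambda>v. x v + y v) \<in> sp scale \<beta>"
  and sp_scale: "x \<in> sp scale \<beta> \<Longrightarrow> (\<lambda>v. c *s x v) \<in> sp scale \<beta>"
  and sp_0: "(\<lambda>v. 0) \<in> sp scale \<beta>"
  by (auto simp: sp_iff \<beta>_add \<beta>_scale algebra_simps scale_right_distrib)

lemma sp_sum: "(\<And>i. i \<in> A \<Longrightarrow> x i \<in> sp scale \<beta>) \<Longrightarrow> (\<lambda>v. \<Sum>i\<in>A. x i v) \<in> sp scale \<beta>"
  by (induction A rule: infinite_finite_induct) (simp_all add: sp_0 sp_add)

lemma sp_dual_add: "\<xi> \<in> sp_dual scale \<beta> \<Longrightarrow> x \<in> sp scale \<beta> \<Longrightarrow> y \<in> sp scale \<beta> \<Longrightarrow> \<xi> (\<lambda>v. x v + y v) = \<xi> x + \<xi> y"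
  and sp_dual_scale: "\<xi> \<in> sp_dual scale \<beta> \<Longrightarrow> x \<in> sp scale \<beta> \<Longrightarrow> \<xi> (\<lambda>v. c *s x v) = c * \<xi> x"
  by (auto simp: sp_dual_def)

lemma sp_dual_0: "\<xi> \<in> sp_dual scale \<beta> \<Longrightarrow> \<xi> (\<lambda>v. 0) = 0"
  using sp_dual_scale[OF _ sp_0, of \<xi> 0] by simp

lemma sp_dual_sum:
  "\<xi> \<in> sp_dual scale \<beta> \<Longrightarrow> (\<And>i. i \<in> A \<Longrightarrow> x i \<in> sp scale \<beta>) \<Longrightarrow> \<xi> (\<lambda>v. \<Sum>i\<in>A. x i v) = (\<Sum>i\<in>A. \<xi> (x i))"
proof (induction A rule: infinite_finite_induct)
  case (insert i A)
  have "\<xi> (\<lambda>v. x i v + (\<Sum>i\<in>A. x i v)) = \<xi> (x i) + \<xi> (\<lambda>v. \<Sum>i\<in>A. x i v)"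
    using insert.prems by (intro sp_dual_add sp_sum) auto
  then show ?case using insert by simp
qed (simp_all add: sp_dual_0)

text \<open>The Lie algebra \<open>sp\<close> is the space of symmetric tensors: \<open>sq u\<close> and \<open>sym u w\<close> are \<open>u \<otimes> u\<close> and
  \<open>u \<otimes> w + w \<otimes> u\<close>. Hence its dual is the space of quadratic forms.\<close>

definition sq :: "'v \<Rightarrow> 'v \<Rightarrow> 'v" where "sq u = (\<lambda>v. \<beta> u v *s u)"

definition sym :: "'v \<Rightarrow> 'v \<Rightarrow> 'v \<Rightarrow> 'v" where "sym u w = (\<lambda>v. \<beta> u v *s w + \<beta> w v *s u)"

lemma sq_sp: "sq u \<in> sp scale \<beta>" and sym_sp: "sym u w \<in> sp scale \<beta>"
  by (auto simp: sp_iff sq_def sym_def \<beta>_add \<beta>_scale scale_left_distrib scale_right_distrib mult_ac add_ac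
      \<beta>_sym[of _ u] \<beta>_sym[of _ w])

text \<open>This is the form \<open>\<alpha>_\<xi>\<close>, as \<open>alpha_form_eq\<close> shows,
  expressed without a representing \<open>X\<close>: the evaluation of \<open>\<xi>\<close> on the
  tensors \<open>u \<otimes> u\<close>.\<close>

definition qf :: "(('v \<Rightarrow> 'v) \<Rightarrow> 'k) \<Rightarrow> 'v \<Rightarrow> 'k" where "qf \<xi> u = \<xi> (sq u)"

lemma pol_qf:
  assumes "\<xi> \<in> sp_dual scale \<beta>"
  shows "pol (qf \<xi>) u w = \<xi> (sym u w)"
proof -
  have "sq (u + w) = (\<lambda>v. (sq u v + sq w v) + sym u w v)"
    by (auto simp: sq_def sym_def fun_eq_iff \<beta>_add scale_left_distrib scale_right_distrib add_ac)
  then have "\<xi> (sq (u + w)) = \<xi> (sq u) + \<xi> (sq w) + \<xi> (sym u w)"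
    by (simp only: sp_dual_add[OF assms] sp_add sq_sp sym_sp)
  then show ?thesis by (simp add: pol_def qf_def add_ac)
qed

lemma quadr_qf:
  assumes "\<xi> \<in> sp_dual scale \<beta>"
  shows "quadr (qf \<xi>)"
  unfolding quadr_def pol_qf[OF assms]
proof (intro conjI allI)
  fix c u v w
  have "sq (c *s v) = (\<lambda>x. c\<^sup>2 *s sq v x)" by (auto simp: sq_def \<beta>_scale power2_eq_square)
  then show "qf \<xi> (c *s v) = c\<^sup>2 * qf \<xi> v" unfolding qf_def by (simp only: sp_dual_scale[OF assms sq_sp])
  have "sym (u + v) w = (\<lambda>x. sym u w x + sym v w x)"
    by (auto simp: sym_def \<beta>_add scale_left_distrib scale_right_distrib add_ac)
  then show "\<xi> (sym (u + v) w) = \<xi> (sym u w) + \<xi> (sym v w)" by (simp only: sp_dual_add[OF assms sym_sp sym_sp])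
  have "sym (c *s v) w = (\<lambda>x. c *s sym v w x)" by (auto simp: sym_def \<beta>_scale scale_right_distrib mult_ac)
  then show "\<xi> (sym (c *s v) w) = c * \<xi> (sym v w)" by (simp only: sp_dual_scale[OF assms sym_sp])
qed

lemma endo_trace_add: "endo_trace scale Basis (\<lambda>v. f v + g v) = endo_trace scale Basis f + endo_trace scale Basis g"
  and endo_trace_scale: "endo_trace scale Basis (\<lambda>v. c *s f v) = c * endo_trace scale Basis f"
  by (simp_all add: endo_trace_def representation_add representation_scale independent_Basis span_Basis
      sum.distrib sum_distrib_left)

lemma endo_trace_sum: "endo_trace scale Basis (\<lambda>v. \<Sum>i\<in>A. f i v) = (\<Sum>i\<in>A. endo_trace scale Basis (f i))"
proof (induction A rule: infinite_finite_induct)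
  case (insert i A) then show ?case by (simp add: endo_trace_add)
qed (simp_all add: endo_trace_def representation_zero)

text \<open>The trace of the rank one map \<open>\<phi> \<otimes> a\<close> is
  \<open>\<phi> a\<close>. This ties the trace taken in \<open>Basis\<close> to expressions free of
  any basis.\<close>

lemma endo_trace_rank1:
  assumes "\<And>v w. \<phi> (v + w) = \<phi> v + \<phi> w" "\<And>c v. \<phi> (c *s v) = c * \<phi> v"
  shows "endo_trace scale Basis (\<lambda>v. \<phi> v *s a) = \<phi> a"
proof -
  have 0: "\<phi> 0 = 0" using assms(2)[of 0 0] by simp
  have sum: "\<phi> (\<Sum>i\<in>A. f i) = (\<Sum>i\<in>A. \<phi> (f i))" for A :: "'v set" and f
    by (induction A rule: infinite_finite_induct) (simp_all add: 0 assms(1))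
  have "endo_trace scale Basis (\<lambda>v. \<phi> v *s a) = (\<Sum>b\<in>Basis. \<phi> (representation Basis a b *s b))"
    by (simp add: endo_trace_def representation_scale independent_Basis span_Basis assms(2) mult.commute)
  also have "\<dots> = \<phi> (\<Sum>b\<in>Basis. representation Basis a b *s b)" by (simp only: sum)
  also have "(\<Sum>b\<in>Basis. representation Basis a b *s b) = a"
    by (rule sum_representation_eq) (simp_all add: independent_Basis span_Basis finite_Basis)
  finally show ?thesis .
qed

section \<open>The symplectic group and its coadjoint action\<close>

lemma group_Sp: "group (Sp scale \<beta>)"
proof (rule groupI)
  fix g assume g: "g \<in> carrier (Sp scale \<beta>)"
  then have b: "bij g" and lin: "\<And>v w. g (v + w) = g v + g w" "\<And>c v. g (c *s v) = c *s g v"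
    and iso: "\<And>v w. \<beta> (g v) (g w) = \<beta> v w" by (auto simp: Sp_def gl_iff)
  have gi: "g (inv_into UNIV g v) = v" "inv_into UNIV g (g v) = v" for v using b by (simp_all add: bij_is_surj surj_f_inv_f bij_is_inj)
  have "inv_into UNIV g (v + w) = inv_into UNIV g v + inv_into UNIV g w" for v w using lin(1)[of "inv_into UNIV g v" "inv_into UNIV g w"] gi by metis
  moreover have "inv_into UNIV g (c *s v) = c *s inv_into UNIV g v" for c v using lin(2)[of c "inv_into UNIV g v"] gi by metis
  moreover have "\<beta> (inv_into UNIV g v) (inv_into UNIV g w) = \<beta> v w" for v w using iso[of "inv_into UNIV g v" "inv_into UNIV g w"] gi by simp
  ultimately have "inv_into UNIV g \<in> carrier (Sp scale \<beta>)" using b by (simp add: Sp_def gl_iff bij_imp_bij_inv)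
  moreover have "inv_into UNIV g \<circ> g = id" using gi by auto
  ultimately show "\<exists>h\<in>carrier (Sp scale \<beta>). h \<otimes>\<^bsub>Sp scale \<beta>\<^esub> g = \<one>\<^bsub>Sp scale \<beta>\<^esub>" by (auto simp: Sp_def)
qed (auto simp: Sp_def gl_iff bij_comp)

lemma Sp_simps [simp]: "x \<otimes>\<^bsub>Sp scale \<beta>\<^esub> y = x \<circ> y" "\<one>\<^bsub>Sp scale \<beta>\<^esub> = id"
  by (simp_all add: Sp_def)

lemma SpD:
  assumes "g \<in> carrier (Sp scale \<beta>)"
  shows "g (v + w) = g v + g w" "g (c *s v) = c *s g v" "\<beta> (g v) (g w) = \<beta> v w" "bij g" "g \<in> gl scale"
  using assms by (auto simp: Sp_def gl_iff)

lemma Sp_inv: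
  assumes "g \<in> carrier (Sp scale \<beta>)"
  shows "inv\<^bsub>Sp scale \<beta>\<^esub> g \<in> carrier (Sp scale \<beta>)" "g ((inv\<^bsub>Sp scale \<beta>\<^esub> g) v) = v" "(inv\<^bsub>Sp scale \<beta>\<^esub> g) (g v) = v"
  using group.inv_closed[OF group_Sp assms] fun_cong[OF group.r_inv[OF group_Sp assms], of v]
    fun_cong[OF group.l_inv[OF group_Sp assms], of v] by simp_all

lemma SpI:
  assumes "\<And>v w. g (v + w) = g v + g w" "\<And>c v. g (c *s v) = c *s g v" "\<And>v w. \<beta> (g v) (g w) = \<beta> v w"
  shows "g \<in> carrier (Sp scale \<beta>)"
proof -
  have lin: "Vector_Spaces.linear scale scale g" using assms(1,2) gl_iff by (simp add: gl_def)
  have "inj g"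
  proof (rule injI)
    fix v w assume "g v = g w"
    then have "g (v + w) = 0" by (simp add: assms(1))
    then have "\<beta> (v + w) z = 0" for z using assms(3)[of "v + w" z] by simp
    then have "v + w = 0" by (rule \<beta>_nondeg)
    then show "v = w" by (simp add: vsum_eq_0_iff)
  qed
  moreover have "surj g" by (rule linear_inj_imp_surj[OF lin \<open>inj g\<close>])
  ultimately show ?thesis using lin assms(3) by (simp add: Sp_def gl_def bij_def)
qed

text \<open>\<open>g\<inverse> \<circ> sq (g v) \<circ> g = sq v\<close> because \<open>g\<close> is
  an isometry; hence \<open>qf\<close> turns the coadjoint action into transport of quadratic forms
  along \<open>g\<close>.\<close>

lemma coadjoint_dual:
  assumes g: "g \<in> carrier (Sp scale \<beta>)" and \<xi>: "\<xi> \<in> sp_dual scale \<beta>"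
  shows "coadjoint scale \<beta> g \<xi> \<in> sp_dual scale \<beta>" "qf (coadjoint scale \<beta> g \<xi>) (g v) = qf \<xi> v"
proof -
  define h where "h = inv\<^bsub>Sp scale \<beta>\<^esub> g"
  note gi = Sp_inv[OF g, folded h_def]
  note hD = SpD[OF gi(1)] and gD = SpD[OF g]
  have adj: "\<beta> (h v) w = \<beta> v (g w)" for v w using gD(3)[of "h v" w] by (simp add: gi)
  have ad: "(\<lambda>v. h (x (g v))) \<in> sp scale \<beta>" if "x \<in> sp scale \<beta>" for x
    using that by (auto simp: sp_iff hD gD adj) (metis adj \<beta>_sym)
  have ev: "coadjoint scale \<beta> g \<xi> x = \<xi> (\<lambda>v. h (x (g v)))" if "x \<in> sp scale \<beta>" for x
    using that by (simp add: coadjoint_def h_def o_def)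
  show "coadjoint scale \<beta> g \<xi> \<in> sp_dual scale \<beta>"
    unfolding sp_dual_def mem_Collect_eq
  proof (intro conjI ballI allI)
    show "coadjoint scale \<beta> g \<xi> \<in> extensional (sp scale \<beta>)" by (simp add: coadjoint_def)
    fix x y c assume x: "x \<in> sp scale \<beta>"
    show "coadjoint scale \<beta> g \<xi> (\<lambda>v. c *s x v) = c * coadjoint scale \<beta> g \<xi> x"
      using sp_dual_scale[OF \<xi> ad[OF x], of c] by (simp add: ev x sp_scale hD)
    assume y: "y \<in> sp scale \<beta>"
    show "coadjoint scale \<beta> g \<xi> (\<lambda>v. x v + y v) = coadjoint scale \<beta> g \<xi> x + coadjoint scale \<beta> g \<xi> y"
      using sp_dual_add[OF \<xi> ad[OF x] ad[OF y]] by (simp add: ev x y sp_add hD)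
  qed
  have "(\<lambda>w. h (sq (g v) (g w))) = sq v" by (simp add: sq_def hD gD gi fun_eq_iff)
  then show "qf (coadjoint scale \<beta> g \<xi>) (g v) = qf \<xi> v" by (simp add: qf_def ev sq_sp)
qed

end

text \<open>A symplectic basis ordered so that \<open>b i\<close> is dual to
  \<open>b (2 * n - 1 - i)\<close>. The spans of its initial segments then form a complete flag that
  is closed under orthogonal complements. \<open>total\<close> expresses spanning in the shape in
  which a maximal isotropic flag delivers it.\<close>

locale adapted = symp scale Basis \<beta>
  for scale :: "'k::alg_closed_field \<Rightarrow> 'v::ab_group_add \<Rightarrow> 'v" (infixr "*s" 75) and Basis and \<beta> +
  fixes n :: nat and b :: "nat \<Rightarrow> 'v"
  assumes gram: "i < 2 * n \<Longrightarrow> j < 2 * n \<Longrightarrow> \<beta> (b i) (b j) = (if i + j + 1 = 2 * n then 1 else 0)"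
    and total: "(\<And>i. i < 2 * n \<Longrightarrow> \<beta> (b i) x = 0) \<Longrightarrow> x = 0"
begin

definition op :: "nat \<Rightarrow> nat" where "op i = 2 * n - 1 - i"

lemma op: "i < 2 * n \<Longrightarrow> op i < 2 * n" "i < 2 * n \<Longrightarrow> op (op i) = i" by (auto simp: op_def)

lemma gram': "i < 2 * n \<Longrightarrow> j < 2 * n \<Longrightarrow> \<beta> (b i) (b j) = (if j = op i then 1 else 0)"
  using gram[of i j] by (auto simp: op_def)

lemma expand: "x = (\<Sum>i<2 * n. \<beta> (b (op i)) x *s b i)"
proof -
  have "x + (\<Sum>i<2 * n. \<beta> (b (op i)) x *s b i) = 0"
  proof (rule total)
    fix j assume j: "j < 2 * n"
    have "\<beta> (b j) (\<Sum>i<2 * n. \<beta> (b (op i)) x *s b i) = (\<Sum>i<2 * n. if i = op j then \<beta> (b (op i)) x else 0)"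
      unfolding \<beta>_sum using j by (intro sum.cong) (auto simp: \<beta>_scale gram')
    also have "\<dots> = \<beta> (b (op (op j))) x" using op(1)[OF j] by simp
    finally show "\<beta> (b j) (x + (\<Sum>i<2 * n. \<beta> (b (op i)) x *s b i)) = 0" using op(2)[OF j] by (simp add: \<beta>_add)
  qed
  then show ?thesis by (simp only: vsum_eq_0_iff)
qed

lemma expand': "x = (\<Sum>i<2 * n. \<beta> (b i) x *s b (op i))"
proof -
  have "x = (\<Sum>i<2 * n. \<beta> (b (op i)) x *s b i)" by (rule expand)
  also have "\<dots> = (\<Sum>i<2 * n. \<beta> (b i) x *s b (op i))"
    by (rule sum.reindex_bij_witness[of _ op op]) (auto simp: op)
  finally show ?thesis .
qed

text \<open>The coefficient of \<open>b i \<otimes> b j\<close> in \<open>x\<close> read as a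
  tensor.\<close>

definition mc :: "('v \<Rightarrow> 'v) \<Rightarrow> nat \<Rightarrow> nat \<Rightarrow> 'k" where
  "mc x i j = \<beta> (x (b (op j))) (b (op i))"

lemma mc_sym: "x \<in> sp scale \<beta> \<Longrightarrow> mc x i j = mc x j i"
  unfolding mc_def sp_iff by (metis \<beta>_sym)

text \<open>A symmetric coefficient matrix is its diagonal plus symmetric pairs. In characteristic 2
  \<open>sym u u = 0\<close>, so the diagonal part is not spanned by such pairs; this is why a
  functional carries a quadratic form and not just a bilinear one.\<close>

lemma sp_expand:
  assumes "x \<in> sp scale \<beta>"
  shows "x = (\<lambda>v. (\<Sum>i<2 * n. mc x i i *s sq (b i) v) + (\<Sum>j<2 * n. \<Sum>i<j. mc x i j *s sym (b i) (b j) v))"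
proof
  fix v
  have c: "\<beta> (b (op j)) (x v) = (\<Sum>i<2 * n. \<beta> (b i) v * mc x i j)" for j
  proof -
    have "\<beta> (b (op j)) (x v) = \<beta> (x (b (op j))) v" using assms by (simp add: sp_iff)
    also have "\<dots> = (\<Sum>i<2 * n. \<beta> (b i) v * mc x i j)"
      by (subst expand'[of v]) (simp add: \<beta>_sum \<beta>_scale mc_def)
    finally show ?thesis .
  qed
  have "x v = (\<Sum>j<2 * n. \<beta> (b (op j)) (x v) *s b j)" by (rule expand)
  also have "\<dots> = (\<Sum>j<2 * n. \<Sum>i<2 * n. (mc x i j * \<beta> (b i) v) *s b j)"
    unfolding c by (simp add: scale_sum_left mult.commute)
  also have "\<dots> = (\<Sum>i<2 * n. \<Sum>j<2 * n. (mc x i j * \<beta> (b i) v) *s b j)" by (rule sum.swap)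
  also have "\<dots> = (\<Sum>i<2 * n. mc x i i *s sq (b i) v) + (\<Sum>j<2 * n. \<Sum>i<j. mc x i j *s sym (b i) (b j) v)"
    unfolding sum_square_split using mc_sym[OF assms]
    by (intro arg_cong2[of _ _ _ _ plus] sum.cong) (auto simp: sq_def sym_def scale_right_distrib)
  finally show "x v = (\<Sum>i<2 * n. mc x i i *s sq (b i) v) + (\<Sum>j<2 * n. \<Sum>i<j. mc x i j *s sym (b i) (b j) v)" .
qed

lemma dual_expand:
  assumes \<xi>: "\<xi> \<in> sp_dual scale \<beta>" and x: "x \<in> sp scale \<beta>"
  shows "\<xi> x = (\<Sum>i<2 * n. mc x i i * qf \<xi> (b i)) + (\<Sum>j<2 * n. \<Sum>i<j. mc x i j * pol (qf \<xi>) (b i) (b j))"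
proof -
  have "\<xi> x = \<xi> (\<lambda>v. (\<Sum>i<2 * n. mc x i i *s sq (b i) v) + (\<Sum>j<2 * n. \<Sum>i<j. mc x i j *s sym (b i) (b j) v))"
    using arg_cong[OF sp_expand[OF x], of \<xi>] .
  also have "\<dots> = \<xi> (\<lambda>v. \<Sum>i<2 * n. mc x i i *s sq (b i) v) + \<xi> (\<lambda>v. \<Sum>j<2 * n. \<Sum>i<j. mc x i j *s sym (b i) (b j) v)"
    by (intro sp_dual_add[OF \<xi>] sp_sum sp_scale sq_sp sym_sp)
  also have "\<xi> (\<lambda>v. \<Sum>i<2 * n. mc x i i *s sq (b i) v) = (\<Sum>i<2 * n. \<xi> (\<lambda>v. mc x i i *s sq (b i) v))"
    by (intro sp_dual_sum[OF \<xi>] sp_scale sq_sp)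
  also have "\<xi> (\<lambda>v. \<Sum>j<2 * n. \<Sum>i<j. mc x i j *s sym (b i) (b j) v) =
      (\<Sum>j<2 * n. \<xi> (\<lambda>v. \<Sum>i<j. mc x i j *s sym (b i) (b j) v))"
    by (intro sp_dual_sum[OF \<xi>] sp_sum sp_scale sym_sp)
  also have "\<dots> = (\<Sum>j<2 * n. \<Sum>i<j. \<xi> (\<lambda>v. mc x i j *s sym (b i) (b j) v))"
    by (intro sum.cong refl sp_dual_sum[OF \<xi>] sp_scale sym_sp)
  finally show ?thesis by (simp only: sp_dual_scale[OF \<xi>] sq_sp sym_sp qf_def pol_qf[OF \<xi>])
qed

lemma dual_eqI:
  assumes "\<xi> \<in> sp_dual scale \<beta>" "\<eta> \<in> sp_dual scale \<beta>" "qf \<xi> = qf \<eta>"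
  shows "\<xi> = \<eta>"
proof
  fix x show "\<xi> x = \<eta> x"
  proof (cases "x \<in> sp scale \<beta>")
    case True then show ?thesis using assms by (simp add: dual_expand)
  next
    case False
    have "\<xi> \<in> extensional (sp scale \<beta>)" "\<eta> \<in> extensional (sp scale \<beta>)" using assms by (auto simp: sp_dual_def)
    then show ?thesis using False by (simp add: extensional_def)
  qed
qed

text \<open>The inverse of \<open>qf\<close> on quadratic forms, modelled on
  \<open>dual_expand\<close>.\<close>

definition dual_of :: "('v \<Rightarrow> 'k) \<Rightarrow> ('v \<Rightarrow> 'v) \<Rightarrow> 'k" where
  "dual_of q = restrict (\<lambda>x. (\<Sum>i<2 * n. mc x i i * q (b i)) + (\<Sum>j<2 * n. \<Sum>i<j. mc x i j * pol q (b i) (b j))) (sp scale \<beta>)"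

lemma dual_of: "dual_of q \<in> sp_dual scale \<beta>"
  unfolding sp_dual_def mem_Collect_eq
proof (intro conjI ballI allI)
  show "dual_of q \<in> extensional (sp scale \<beta>)" by (simp add: dual_of_def)
  fix x y c assume x: "x \<in> sp scale \<beta>"
  have "mc (\<lambda>v. c *s x v) i j = c * mc x i j" for i j by (simp add: mc_def \<beta>_scale)
  then show "dual_of q (\<lambda>v. c *s x v) = c * dual_of q x"
    using x by (simp add: dual_of_def sp_scale distrib_left sum_distrib_left mult.assoc)
  assume y: "y \<in> sp scale \<beta>"
  have "mc (\<lambda>v. x v + y v) i j = mc x i j + mc y i j" for i j by (simp add: mc_def \<beta>_add)
  then show "dual_of q (\<lambda>v. x v + y v) = dual_of q x + dual_of q y"
    using x y by (simp add: dual_of_def sp_add distrib_right sum.distrib add_ac)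
qed

lemma qf_dual_of:
  assumes "quadr q"
  shows "qf (dual_of q) = q"
proof
  fix u
  define c where "c = (\<lambda>i. \<beta> (b (op i)) u)"
  have mc: "mc (sq u) i j = c i * c j" for i j
    by (simp add: mc_def sq_def \<beta>_scale c_def \<beta>_sym[of u] mult.commute)
  have "qf (dual_of q) u = (\<Sum>i<2 * n. (c i)\<^sup>2 * q (b i)) + (\<Sum>j<2 * n. \<Sum>i<j. c i * c j * pol q (b i) (b j))"
    by (simp add: qf_def dual_of_def sq_sp mc power2_eq_square)
  also have "\<dots> = q (\<Sum>i<2 * n. c i *s b i)" by (rule quadr_sum[OF assms, symmetric])
  also have "(\<Sum>i<2 * n. c i *s b i) = u" unfolding c_def by (rule expand[symmetric])
  finally show "qf (dual_of q) u = q u" .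
qed

text \<open>Each coefficient \<open>mc x i j\<close> is the trace of \<open>Y i j \<circ> x\<close>
  for a rank one map \<open>Y i j\<close>; the combination of the \<open>Y i j\<close> dictated by
  \<open>dual_expand\<close> represents \<open>\<xi>\<close>.\<close>

lemma trace_form_exists:
  assumes \<xi>: "\<xi> \<in> sp_dual scale \<beta>"
  shows "\<exists>X. X \<in> gl scale \<and> (\<forall>x\<in>sp scale \<beta>. \<xi> x = endo_trace scale Basis (X \<circ> x))"
proof -
  define Y where "Y = (\<lambda>i j v. \<beta> v (b (op i)) *s b (op j))"
  have Y: "Y i j (v + w) = Y i j v + Y i j w" "Y i j (c *s v) = c *s Y i j v" for i j v w c
    by (simp_all add: Y_def \<beta>_add \<beta>_scale scale_left_distrib)
  have trY: "endo_trace scale Basis (\<lambda>v. Y i j (x v)) = mc x i j" if "x \<in> sp scale \<beta>" for x i j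
    using that endo_trace_rank1[of "\<lambda>v. \<beta> (x v) (b (op i))" "b (op j)"]
    by (simp add: Y_def mc_def sp_iff \<beta>_add \<beta>_scale)
  define X where "X = (\<lambda>v. (\<Sum>i<2 * n. qf \<xi> (b i) *s Y i i v) + (\<Sum>j<2 * n. \<Sum>i<j. pol (qf \<xi>) (b i) (b j) *s Y i j v))"
  have "X \<in> gl scale" unfolding gl_iff
    by (auto simp: X_def Y scale_right_distrib sum.distrib scale_sum_right mult.commute add_ac)
  moreover have "\<xi> x = endo_trace scale Basis (X \<circ> x)" if x: "x \<in> sp scale \<beta>" for x
    unfolding dual_expand[OF \<xi> x] X_def o_def
    by (simp only: endo_trace_add endo_trace_sum endo_trace_scale trY[OF x] mult.commute)
  ultimately show ?thesis by blast
qed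

text \<open>Whatever \<open>X\<close> the choice operator returns, \<open>\<beta> u (X u)\<close> is
  the trace of \<open>X \<circ> sq u\<close>, that is \<open>\<xi> (sq u)\<close>. This is the
  independence of \<open>X\<close>.\<close>

lemma alpha_form_eq:
  assumes \<xi>: "\<xi> \<in> sp_dual scale \<beta>"
  shows "alpha_form scale Basis \<beta> \<xi> = qf \<xi>"
proof
  fix u
  define X where "X = (SOME X. X \<in> gl scale \<and> (\<forall>x\<in>sp scale \<beta>. \<xi> x = endo_trace scale Basis (X \<circ> x)))"
  have X: "X \<in> gl scale" "\<And>x. x \<in> sp scale \<beta> \<Longrightarrow> \<xi> x = endo_trace scale Basis (X \<circ> x)"
    using someI_ex[OF trace_form_exists[OF \<xi>]] unfolding X_def by blast+
  have "qf \<xi> u = endo_trace scale Basis (\<lambda>v. \<beta> u v *s X u)"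
    using X(2)[OF sq_sp, of u] X(1) by (simp add: qf_def o_def sq_def gl_iff)
  also have "\<dots> = \<beta> u (X u)" by (rule endo_trace_rank1) (simp_all add: \<beta>_add \<beta>_scale)
  finally show "alpha_form scale Basis \<beta> \<xi> u = qf \<xi> u" unfolding alpha_form_def X_def[symmetric] by (simp add: Let_def)
qed

lemma polar_operator:
  assumes "quadr q"
  obtains T where "T \<in> gl scale" "\<And>v w. \<beta> (T v) w = pol q v w"
proof -
  define T where "T = (\<lambda>v. \<Sum>i<2 * n. pol q v (b i) *s b (op i))"
  have "T \<in> gl scale"
    by (auto simp: gl_iff T_def pol_bilinear[OF assms] scale_left_distrib sum.distrib scale_sum_right)
  moreover have "\<beta> (T v) w = pol q v w" for v w
  proof -
    have "\<beta> (T v) w = pol q v (\<Sum>i<2 * n. \<beta> (b (op i)) w *s b i)"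
      by (simp add: T_def \<beta>_sum \<beta>_scale pol_sum[OF assms] mult.commute)
    then show ?thesis by (simp only: expand[symmetric])
  qed
  ultimately show thesis by (rule that)
qed

lemma orbit_eq:
  assumes \<xi>: "\<xi> \<in> sp_dual scale \<beta>"
  shows "orbit (Sp scale \<beta>) (coadjoint scale \<beta>) \<xi> =
    {\<eta> \<in> sp_dual scale \<beta>. \<exists>f\<in>carrier (Sp scale \<beta>). \<forall>v. qf \<eta> (f v) = qf \<xi> v}"
proof
  show "orbit (Sp scale \<beta>) (coadjoint scale \<beta>) \<xi> \<subseteq>
      {\<eta> \<in> sp_dual scale \<beta>. \<exists>f\<in>carrier (Sp scale \<beta>). \<forall>v. qf \<eta> (f v) = qf \<xi> v}"
    using coadjoint_dual[OF _ \<xi>] by (auto simp: orbit_def)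
  show "{\<eta> \<in> sp_dual scale \<beta>. \<exists>f\<in>carrier (Sp scale \<beta>). \<forall>v. qf \<eta> (f v) = qf \<xi> v} \<subseteq>
      orbit (Sp scale \<beta>) (coadjoint scale \<beta>) \<xi>"
  proof clarify
    fix \<eta> f assume \<eta>: "\<eta> \<in> sp_dual scale \<beta>" and f: "f \<in> carrier (Sp scale \<beta>)" and eq: "\<forall>v. qf \<eta> (f v) = qf \<xi> v"
    have "qf (coadjoint scale \<beta> f \<xi>) = qf \<eta>"
    proof
      fix v
      obtain w where w: "v = f w" using SpD(4)[OF f] by (metis bij_pointE)
      show "qf (coadjoint scale \<beta> f \<xi>) v = qf \<eta> v" unfolding w coadjoint_dual(2)[OF f \<xi>] using eq by simp
    qed
    then have "coadjoint scale \<beta> f \<xi> = \<eta>" by (rule dual_eqI[OF coadjoint_dual(1)[OF f \<xi>] \<eta>])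
    with f show "\<eta> \<in> orbit (Sp scale \<beta>) (coadjoint scale \<beta>) \<xi>" by (auto simp: orbit_def)
  qed
qed

text \<open>A linear bijection preserving \<open>\<beta>\<close> is an element of \<open>Sp\<close>,
  so an equivalence is an element of the group carrying one \<open>qf\<close> to the other.\<close>

lemma form_module_of_equiv_iff:
  assumes \<xi>: "\<xi> \<in> sp_dual scale \<beta>" and \<eta>: "\<eta> \<in> sp_dual scale \<beta>"
  shows "fm_equiv (form_module_of scale Basis \<beta> \<xi>) (form_module_of scale Basis \<beta> \<eta>) \<longleftrightarrow>
    orbit (Sp scale \<beta>) (coadjoint scale \<beta>) \<xi> = orbit (Sp scale \<beta>) (coadjoint scale \<beta>) \<eta>"
proof -
  have iff: "fm_equiv (form_module_of scale Basis \<beta> \<xi>) (form_module_of scale Basis \<beta> \<eta>) \<longleftrightarrow>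
      (\<exists>f\<in>carrier (Sp scale \<beta>). \<forall>v. qf \<eta> (f v) = qf \<xi> v)"
    unfolding fm_equiv_def form_module_of_def alpha_form_eq[OF \<xi>] alpha_form_eq[OF \<eta>]
    by (auto simp: Sp_def gl_iff)
  show ?thesis
  proof
    assume "orbit (Sp scale \<beta>) (coadjoint scale \<beta>) \<xi> = orbit (Sp scale \<beta>) (coadjoint scale \<beta>) \<eta>"
    moreover have "\<eta> \<in> orbit (Sp scale \<beta>) (coadjoint scale \<beta>) \<eta>"
      unfolding orbit_eq[OF \<eta>] using \<eta> monoid.one_closed[OF group.is_monoid[OF group_Sp]]
      by (intro CollectI conjI bexI[of _ id]) simp_all
    ultimately have "\<eta> \<in> orbit (Sp scale \<beta>) (coadjoint scale \<beta>) \<xi>" by simp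
    then show "fm_equiv (form_module_of scale Basis \<beta> \<xi>) (form_module_of scale Basis \<beta> \<eta>)"
      unfolding iff orbit_eq[OF \<xi>] by blast
  next
    assume "fm_equiv (form_module_of scale Basis \<beta> \<xi>) (form_module_of scale Basis \<beta> \<eta>)"
    then obtain f where f: "f \<in> carrier (Sp scale \<beta>)" "\<And>v. qf \<eta> (f v) = qf \<xi> v" unfolding iff by blast
    note inv = Sp_inv[OF f(1)]
    show "orbit (Sp scale \<beta>) (coadjoint scale \<beta>) \<xi> = orbit (Sp scale \<beta>) (coadjoint scale \<beta>) \<eta>"
      unfolding orbit_eq[OF \<xi>] orbit_eq[OF \<eta>]
    proof (intro Collect_cong conj_cong refl iffI)
      fix \<zeta> assume "\<exists>g\<in>carrier (Sp scale \<beta>). \<forall>v. qf \<zeta> (g v) = qf \<xi> v"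
      then obtain g where g: "g \<in> carrier (Sp scale \<beta>)" "\<forall>v. qf \<zeta> (g v) = qf \<xi> v" by blast
      have "qf \<zeta> ((g \<circ> inv\<^bsub>Sp scale \<beta>\<^esub> f) v) = qf \<eta> v" for v
        using g(2) f(2)[of "(inv\<^bsub>Sp scale \<beta>\<^esub> f) v"] by (simp add: inv(2))
      then show "\<exists>g\<in>carrier (Sp scale \<beta>). \<forall>v. qf \<zeta> (g v) = qf \<eta> v"
        using group.is_monoid[OF group_Sp, THEN monoid.m_closed, OF g(1) inv(1)]
        by (auto intro!: bexI[of _ "g \<circ> inv\<^bsub>Sp scale \<beta>\<^esub> f"])
    next
      fix \<zeta> assume "\<exists>g\<in>carrier (Sp scale \<beta>). \<forall>v. qf \<zeta> (g v) = qf \<eta> v"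
      then obtain g where g: "g \<in> carrier (Sp scale \<beta>)" "\<forall>v. qf \<zeta> (g v) = qf \<eta> v" by blast
      have "qf \<zeta> ((g \<circ> f) v) = qf \<xi> v" for v using g(2) f(2)[of v] by simp
      then show "\<exists>g\<in>carrier (Sp scale \<beta>). \<forall>v. qf \<zeta> (g v) = qf \<xi> v"
        using group.is_monoid[OF group_Sp, THEN monoid.m_closed, OF g(1) f(1)]
        by (auto intro!: bexI[of _ "g \<circ> f"])
    qed
  qed
qed

end

section \<open>The Zariski topology\<close>

context symp
begin

abbreviation "zar \<equiv> zariski scale"
abbreviation "polys \<equiv> poly_funs scale"
abbreviation "SpG \<equiv> Sp scale \<beta>"

definition functional :: "('v \<Rightarrow> 'k) \<Rightarrow> bool" where
  "functional \<phi> \<longleftrightarrow> (\<forall>v w. \<phi> (v + w) = \<phi> v + \<phi> w) \<and> (\<forall>c v. \<phi> (c *s v) = c * \<phi> v)"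

lemma coord_poly: "functional \<phi> \<Longrightarrow> (\<lambda>x. \<phi> (x v)) \<in> polys"
  by (rule poly_funs.coord) (simp add: functional_iff functional_def)

lemma functional_\<beta>: "functional (\<beta> z)" by (simp add: functional_def \<beta>_add \<beta>_scale)

lemma functional_sum: "functional \<phi> \<Longrightarrow> \<phi> (\<Sum>i\<in>A. c i *s x i) = (\<Sum>i\<in>A. c i * \<phi> (x i))"
proof (induction A rule: infinite_finite_induct)
  have "\<phi> 0 = 0" if "functional \<phi>" using that unfolding functional_def by (metis mult_zero_left scale_zero_left)
  then show "functional \<phi> \<Longrightarrow> \<phi> (\<Sum>i\<in>{}. c i *s x i) = (\<Sum>i\<in>{}. c i * \<phi> (x i))"
    "\<And>A. infinite A \<Longrightarrow> functional \<phi> \<Longrightarrow> \<phi> (\<Sum>i\<in>A. c i *s x i) = (\<Sum>i\<in>A. c i * \<phi> (x i))" by simp_all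
qed (auto simp: functional_def)

lemma poly_sum: "(\<And>i. i \<in> A \<Longrightarrow> f i \<in> polys) \<Longrightarrow> (\<lambda>x. \<Sum>i\<in>A. f i x) \<in> polys"
proof (induction A rule: infinite_finite_induct)
  case (insert i A) then show ?case using poly_funs.add[of "f i" scale "\<lambda>x. \<Sum>i\<in>A. f i x"] by simp
qed (simp_all add: poly_funs.const)

lemma poly_prod: "(\<And>i. i \<in> A \<Longrightarrow> f i \<in> polys) \<Longrightarrow> (\<lambda>x. \<Prod>i\<in>A. f i x) \<in> polys"
proof (induction A rule: infinite_finite_induct)
  case (insert i A) then show ?case using poly_funs.mult[of "f i" scale "\<lambda>x. \<Prod>i\<in>A. f i x"] by simp
qed (simp_all add: poly_funs.const)

lemma representation_functional: "functional (\<lambda>x. representation Basis x b)"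
  by (simp add: functional_def representation_add representation_scale independent_Basis span_Basis)

lemma representation_expand: "(\<Sum>b\<in>Basis. representation Basis x b *s b) = x"
  by (rule sum_representation_eq) (simp_all add: independent_Basis span_Basis finite_Basis)

lemma bilinear_poly:
  assumes "functional \<phi>" "\<And>v w. h (v + w) = h v + h w" "\<And>c v. h (c *s v) = c *s h v"
  shows "(\<lambda>g. \<beta> (g z) (h (g y))) \<in> polys"
proof -
  have "\<beta> (g z) (h (g y)) = (\<Sum>b\<in>Basis. representation Basis (g z) b * \<beta> b (h (g y)))" for g
    by (subst (1) representation_expand[of "g z", symmetric]) (simp only: \<beta>_sum \<beta>_scale)
  moreover have "(\<lambda>g. \<Sum>b\<in>Basis. representation Basis (g z) b * \<beta> b (h (g y))) \<in> polys"
  proof (intro poly_sum poly_funs.mult)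
    fix b
    show "(\<lambda>g. representation Basis (g z) b) \<in> polys" by (rule coord_poly[OF representation_functional])
    have "functional (\<lambda>v. \<beta> b (h v))" using assms by (simp add: functional_def \<beta>_add \<beta>_scale)
    then show "(\<lambda>g. \<beta> b (h (g y))) \<in> polys" by (rule coord_poly)
  qed
  ultimately show ?thesis by simp
qed

text \<open>The map from \<open>z\<close> to the functional \<open>\<beta> z\<close>, read in
  coordinates, is injective by nondegeneracy and hence surjective. It later expresses the
  coordinates of \<open>g\<inverse> v\<close> through \<open>g\<close>.\<close>

lemma riesz:
  assumes "functional \<phi>"
  obtains z where "\<And>v. \<phi> v = \<beta> z v"
proof -
  define F where "F = (\<lambda>z. \<Sum>b\<in>Basis. \<beta> z b *s b)"
  have lin: "Vector_Spaces.linear scale scale F"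
    using gl_iff[of F] by (simp add: gl_def F_def \<beta>_add \<beta>_scale scale_left_distrib sum.distrib scale_sum_right)
  have coeff: "c b = d b" if "(\<Sum>b\<in>Basis. c b *s b) = (\<Sum>b\<in>Basis. d b *s b)" "b \<in> Basis" for c d b
  proof -
    have "(\<Sum>b\<in>Basis. (c b + d b) *s b) = 0" using that(1) by (simp add: scale_left_distrib sum.distrib)
    then have "c b + d b = 0" by (rule independentD[OF independent_Basis finite_Basis subset_refl _ that(2), of "\<lambda>b. c b + d b"])
    then show ?thesis by (simp add: sum_eq_0_iff)
  qed
  have ext: "\<phi> = \<psi>" if "functional \<phi>" "functional \<psi>" "\<And>b. b \<in> Basis \<Longrightarrow> \<phi> b = \<psi> b" for \<phi> \<psi>
  proof
    fix v
    have "\<phi> (\<Sum>b\<in>Basis. representation Basis v b *s b) = \<psi> (\<Sum>b\<in>Basis. representation Basis v b *s b)"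
      unfolding functional_sum[OF that(1)] functional_sum[OF that(2)] using that(3) by simp
    then show "\<phi> v = \<psi> v" by (simp only: representation_expand)
  qed
  have "inj F"
  proof (rule injI)
    fix y z assume "F y = F z"
    then have "\<beta> y b = \<beta> z b" if "b \<in> Basis" for b unfolding F_def using coeff that by blast
    then have "\<beta> y = \<beta> z" by (rule ext[OF functional_\<beta> functional_\<beta>])
    then have "\<beta> (y + z) w = 0" for w by (simp add: \<beta>_add)
    then have "y + z = 0" by (rule \<beta>_nondeg)
    then show "y = z" by (simp add: vsum_eq_0_iff)
  qed
  then have "surj F" by (rule linear_inj_imp_surj[OF lin])
  then obtain z where z: "(\<Sum>b\<in>Basis. \<phi> b *s b) = F z" by (metis surj_def)
  then have "\<phi> b = \<beta> z b" if "b \<in> Basis" for b using coeff that unfolding F_def by blast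
  then have "\<phi> = \<beta> z" by (rule ext[OF assms functional_\<beta>])
  then show thesis using that by simp
qed

lemma separating_vector:
  assumes "subspace U" "v \<notin> U"
  obtains z where "\<beta> z v = 1" "\<And>u. u \<in> U \<Longrightarrow> \<beta> z u = 0"
proof -
  obtain C where C: "C \<subseteq> U" "independent C" "U \<subseteq> span C" using maximal_independent_subset[of U] by metis
  have "span C = U" using C assms(1) by (simp add: span_minimal subset_antisym)
  then have ind: "independent (insert v C)" using C(2) assms(2) by (simp add: independent_insertI)
  interpret vp: vector_space_pair scale "(*) :: 'k \<Rightarrow> 'k \<Rightarrow> 'k"
    by unfold_locales (simp_all add: algebra_simps)
  obtain \<phi> where \<phi>: "Vector_Spaces.linear scale (*) \<phi>" "\<forall>x\<in>insert v C. \<phi> x = (if x = v then 1 else 0)"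
    using vp.linear_independent_extend[OF ind, of "\<lambda>x. if x = v then 1 else 0"] by blast
  have f: "functional \<phi>" using \<phi>(1) by (simp add: functional_iff functional_def)
  obtain z where z: "\<And>v. \<phi> v = \<beta> z v" using riesz[OF f] by blast
  have "\<beta> z u = 0" if "u \<in> U" for u
  proof -
    have "C \<subseteq> {u. \<beta> z u = 0}" using \<phi>(2) C(1) assms(2) by (auto simp: z)
    moreover have "subspace {u. \<beta> z u = 0}" by (auto simp: subspace_def \<beta>_add \<beta>_scale)
    ultimately have "span C \<subseteq> {u. \<beta> z u = 0}" by (rule span_minimal)
    then show ?thesis using that \<open>span C = U\<close> by auto
  qed
  moreover have "\<beta> z v = 1" using \<phi>(2) by (simp add: z)
  ultimately show thesis using that by blast
qed

lemma topspace_zar: "topspace zar = gl scale"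
proof -
  have "\<Union> {{x \<in> gl scale. f x \<noteq> 0} |f. f \<in> polys} = gl scale"
  proof
    have mem: "{x \<in> gl scale. (1 :: 'k) \<noteq> 0} \<in> {{x \<in> gl scale. f x \<noteq> 0} |f. f \<in> polys}"
      by (rule CollectI, rule exI[of _ "\<lambda>_. 1"]) (simp add: poly_funs.const)
    show "gl scale \<subseteq> \<Union> {{x \<in> gl scale. f x \<noteq> 0} |f. f \<in> polys}"
      by (rule subsetI, rule UnionI[OF mem]) simp
  qed blast
  then show ?thesis by (simp add: zariski_def)
qed

lemma openin_zar: "f \<in> polys \<Longrightarrow> openin zar {x \<in> gl scale. f x \<noteq> 0}"
  unfolding zariski_def by (rule topology_generated_by_Basis) blast

text \<open>Multiplying functions shows that the principal open sets are closed under intersection,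
  so they are a base and not merely a subbase.\<close>

lemma zar_basis:
  assumes "openin zar E" "x \<in> E"
  obtains f where "f \<in> polys" "f x \<noteq> 0" "\<And>y. y \<in> gl scale \<Longrightarrow> f y \<noteq> 0 \<Longrightarrow> y \<in> E"
proof -
  have "generate_topology_on {{x \<in> gl scale. f x \<noteq> 0} |f. f \<in> polys} E"
    using assms(1) unfolding zariski_def by (rule openin_topology_generated_by)
  then have "x \<in> E \<longrightarrow> (\<exists>f\<in>polys. f x \<noteq> 0 \<and> (\<forall>y\<in>gl scale. f y \<noteq> 0 \<longrightarrow> y \<in> E))"
  proof (induction rule: generate_topology_on.induct)
    case (Int a b)
    show ?case
    proof
      assume "x \<in> a \<inter> b"
      then have "x \<in> a" "x \<in> b" by auto
      from Int.IH(1)[rule_format, OF this(1)] Int.IH(2)[rule_format, OF this(2)]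
      obtain f h where "f \<in> polys" "f x \<noteq> 0" "\<forall>y\<in>gl scale. f y \<noteq> 0 \<longrightarrow> y \<in> a"
        "h \<in> polys" "h x \<noteq> 0" "\<forall>y\<in>gl scale. h y \<noteq> 0 \<longrightarrow> y \<in> b" by auto
      then show "\<exists>f\<in>polys. f x \<noteq> 0 \<and> (\<forall>y\<in>gl scale. f y \<noteq> 0 \<longrightarrow> y \<in> a \<inter> b)"
        by (intro bexI[of _ "\<lambda>x. f x * h x"] poly_funs.mult) auto
    qed
  next
    case (UN K)
    show ?case
    proof
      assume "x \<in> \<Union>K"
      then obtain k where k: "k \<in> K" "x \<in> k" by blast
      then obtain f where "f \<in> polys" "f x \<noteq> 0" "\<forall>y\<in>gl scale. f y \<noteq> 0 \<longrightarrow> y \<in> k" using UN.IH by blast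
      then show "\<exists>f\<in>polys. f x \<noteq> 0 \<and> (\<forall>y\<in>gl scale. f y \<noteq> 0 \<longrightarrow> y \<in> \<Union>K)" using k(1) by (intro bexI[of _ f]) auto
    qed
  next
    case (Basis s)
    then obtain f where f: "f \<in> polys" "s = {x \<in> gl scale. f x \<noteq> 0}" by blast
    show ?case
    proof
      assume "x \<in> s"
      then show "\<exists>f\<in>polys. f x \<noteq> 0 \<and> (\<forall>y\<in>gl scale. f y \<noteq> 0 \<longrightarrow> y \<in> s)" using f by (intro bexI[of _ f]) auto
    qed
  qed simp
  then obtain f where "f \<in> polys" "f x \<noteq> 0" "\<forall>y\<in>gl scale. f y \<noteq> 0 \<longrightarrow> y \<in> E" using assms(2) by blast
  then show thesis by (intro that[of f]) auto
qed

text \<open>Regularity is tested on the values \<open>\<phi> (\<gamma> g v)\<close> and only along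
  \<open>S\<close>. This admits maps that involve inverses, which agree with polynomials on the
  symplectic group.\<close>

lemma connected_regular_image:
  assumes S: "connectedin zar S" and \<gamma>: "\<And>g. g \<in> S \<Longrightarrow> \<gamma> g \<in> gl scale"
    and reg: "\<And>\<phi> v. functional \<phi> \<Longrightarrow> \<exists>h\<in>polys. \<forall>g\<in>S. \<phi> (\<gamma> g v) = h g"
  shows "connectedin zar (\<gamma> ` S)"
proof -
  have Sgl: "S \<subseteq> gl scale" using S topspace_zar by (simp add: connectedin)
  have comp: "\<exists>h\<in>polys. \<forall>g\<in>S. f (\<gamma> g) = h g" if "f \<in> polys" for f
    using that
  proof induction
    case (const c) then show ?case by (intro bexI[of _ "\<lambda>_. c"] poly_funs.const) auto
  next
    case (coord \<phi> v) then show ?case using reg[of \<phi> v] by (simp add: functional_iff functional_def)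
  next
    case (add f h)
    then obtain f' h' where "f' \<in> polys" "h' \<in> polys" "\<forall>g\<in>S. f (\<gamma> g) = f' g" "\<forall>g\<in>S. h (\<gamma> g) = h' g" by blast
    then show ?case by (intro bexI[of _ "\<lambda>x. f' x + h' x"] poly_funs.add) auto
  next
    case (mult f h)
    then obtain f' h' where "f' \<in> polys" "h' \<in> polys" "\<forall>g\<in>S. f (\<gamma> g) = f' g" "\<forall>g\<in>S. h (\<gamma> g) = h' g" by blast
    then show ?case by (intro bexI[of _ "\<lambda>x. f' x * h' x"] poly_funs.mult) auto
  qed
  have top: "topspace (subtopology zar S) = S" using Sgl by (simp add: topspace_zar inf_absorb2)
  have "continuous_map (subtopology zar S) zar \<gamma>"
    unfolding zariski_def[of scale] continuous_on_generated_topo_iff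
    unfolding zariski_def[symmetric] top
  proof (intro conjI allI impI)
    fix E assume "E \<in> {{x \<in> gl scale. f x \<noteq> 0} |f. f \<in> polys}"
    then obtain f where f: "f \<in> polys" "E = {x \<in> gl scale. f x \<noteq> 0}" by blast
    obtain h where h: "h \<in> polys" "\<forall>g\<in>S. f (\<gamma> g) = h g" using comp[OF f(1)] by blast
    have "\<gamma> -` E \<inter> S = {x \<in> gl scale. h x \<noteq> 0} \<inter> S" using h(2) \<gamma> Sgl by (auto simp: f(2))
    then show "openin (subtopology zar S) (\<gamma> -` E \<inter> S)"
      using openin_zar[OF h(1)] by (auto simp: openin_subtopology)
  next
    have "\<Union> {{x \<in> gl scale. f x \<noteq> 0} |f. f \<in> polys} = gl scale"
      using topspace_zar by (simp add: zariski_def)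
    then show "\<gamma> ` S \<subseteq> \<Union> {{x \<in> gl scale. f x \<noteq> 0} |f. f \<in> polys}" using \<gamma> by auto
  qed
  then show ?thesis
    by (rule connectedin_continuous_map_image) (use S in \<open>simp add: connectedin_subtopology\<close>)
qed

text \<open>A nonempty open part of the curve omits only finitely many parameters, namely zeros of a
  nonzero polynomial, and two such parts meet in an infinite field. Only zero sets are compared with
  those of \<open>p\<close>, so that curves with denominators are covered.\<close>

lemma connected_curve:
  fixes \<gamma> :: "'k \<Rightarrow> 'v \<Rightarrow> 'v"
  assumes C: "finite (- C)" and \<gamma>: "\<And>s. s \<in> C \<Longrightarrow> \<gamma> s \<in> gl scale"
    and fin: "\<And>f. f \<in> polys \<Longrightarrow> \<exists>p. \<forall>s\<in>C. f (\<gamma> s) = 0 \<longleftrightarrow> poly p s = 0"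
  shows "connectedin zar (\<gamma> ` C)"
  unfolding connectedin topspace_zar
proof (intro conjI notI)
  show "\<gamma> ` C \<subseteq> gl scale" using \<gamma> by auto
  assume "\<exists>E1 E2. openin zar E1 \<and> openin zar E2 \<and> \<gamma> ` C \<subseteq> E1 \<union> E2 \<and> E1 \<inter> E2 \<inter> \<gamma> ` C = {} \<and>
      E1 \<inter> \<gamma> ` C \<noteq> {} \<and> E2 \<inter> \<gamma> ` C \<noteq> {}"
  then obtain E1 E2 s1 s2 where E: "openin zar E1" "openin zar E2" "E1 \<inter> E2 \<inter> \<gamma> ` C = {}"
    "s1 \<in> C" "\<gamma> s1 \<in> E1" "s2 \<in> C" "\<gamma> s2 \<in> E2" by blast
  have cof: "finite {s \<in> C. \<gamma> s \<notin> E}" if op: "openin zar E" "\<gamma> s0 \<in> E" "s0 \<in> C" for E s0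
  proof -
    obtain f where f: "f \<in> polys" "f (\<gamma> s0) \<noteq> 0" "\<And>y. y \<in> gl scale \<Longrightarrow> f y \<noteq> 0 \<Longrightarrow> y \<in> E"
      using zar_basis[OF op(1,2)] by blast
    obtain p where p: "\<forall>s\<in>C. f (\<gamma> s) = 0 \<longleftrightarrow> poly p s = 0" using fin[OF f(1)] by blast
    have "f (\<gamma> s0) = 0 \<longleftrightarrow> poly p s0 = 0" using p op(3) by (rule bspec)
    then have "p \<noteq> 0" using f(2) by force
    then have "finite {s. poly p s = 0}" by (rule poly_roots_finite)
    moreover have "{s \<in> C. \<gamma> s \<notin> E} \<subseteq> {s. poly p s = 0}"
    proof clarify
      fix s assume s: "s \<in> C" "\<gamma> s \<notin> E"
      then have "f (\<gamma> s) = 0" using f(3)[OF \<gamma>[OF s(1)]] by blast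
      then show "poly p s = 0" using bspec[OF p s(1)] by simp
    qed
    ultimately show ?thesis by (rule rev_finite_subset)
  qed
  have "finite (- C \<union> {s \<in> C. \<gamma> s \<notin> E1} \<union> {s \<in> C. \<gamma> s \<notin> E2})"
    using C cof[OF E(1,5,4)] cof[OF E(2,7,6)] by simp
  then have "- C \<union> {s \<in> C. \<gamma> s \<notin> E1} \<union> {s \<in> C. \<gamma> s \<notin> E2} \<noteq> UNIV" using infinite_alg_closed by metis
  then obtain s where "s \<in> C" "\<gamma> s \<in> E1" "\<gamma> s \<in> E2" by blast
  then show False using E(3) by blast
qed

text \<open>The places where \<open>f\<close> differs from the value \<open>f g\<close>, and those
  where it differs from all its other values on \<open>S\<close>, are open and would disconnect
  \<open>S\<close>.\<close>

lemma connected_finite_values: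
  assumes S: "connectedin zar S" and f: "f \<in> polys" "finite (f ` S)" and g: "g \<in> S" "g' \<in> S"
  shows "f g = f g'"
proof (rule ccontr)
  assume neq: "f g \<noteq> f g'"
  have Sgl: "S \<subseteq> gl scale" using S topspace_zar by (simp add: connectedin)
  define h1 where "h1 = (\<lambda>x. f x + f g)"
  define h2 where "h2 = (\<lambda>x. \<Prod>c\<in>f ` S - {f g}. f x + c)"
  have h: "h1 \<in> polys" "h2 \<in> polys" unfolding h1_def h2_def by (intro poly_prod poly_funs.add f poly_funs.const)+
  have z1: "h1 x \<noteq> 0 \<longleftrightarrow> f x \<noteq> f g" for x by (simp add: h1_def sum_eq_0_iff)
  have z2: "h2 x \<noteq> 0 \<longleftrightarrow> f x = f g" if "x \<in> S" for x
    using f(2) that by (auto simp: h2_def prod_zero_iff sum_eq_0_iff)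
  have "\<exists>E1 E2. openin zar E1 \<and> openin zar E2 \<and> S \<subseteq> E1 \<union> E2 \<and> E1 \<inter> E2 \<inter> S = {} \<and> E1 \<inter> S \<noteq> {} \<and> E2 \<inter> S \<noteq> {}"
  proof (intro exI conjI)
    show "openin zar {x \<in> gl scale. h1 x \<noteq> 0}" "openin zar {x \<in> gl scale. h2 x \<noteq> 0}"
      by (intro openin_zar h)+
    show "S \<subseteq> {x \<in> gl scale. h1 x \<noteq> 0} \<union> {x \<in> gl scale. h2 x \<noteq> 0}"
      "{x \<in> gl scale. h1 x \<noteq> 0} \<inter> {x \<in> gl scale. h2 x \<noteq> 0} \<inter> S = {}"
      "{x \<in> gl scale. h2 x \<noteq> 0} \<inter> S \<noteq> {}" using z1 z2 Sgl g by auto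
    show "{x \<in> gl scale. h1 x \<noteq> 0} \<inter> S \<noteq> {}" using z1[of g'] Sgl g neq by auto
  qed
  then show False using S unfolding connectedin by blast
qed

section \<open>Connected solvable groups of linear maps\<close>

lemma Sp_mult: "g \<in> carrier SpG \<Longrightarrow> h \<in> carrier SpG \<Longrightarrow> g \<circ> h \<in> carrier SpG"
  using monoid.m_closed[OF group.is_monoid[OF group_Sp]] by simp

lemma Sp_inv_adj:
  assumes "g \<in> carrier SpG"
  shows "\<beta> ((inv\<^bsub>SpG\<^esub> g) v) w = \<beta> v (g w)" "\<beta> v ((inv\<^bsub>SpG\<^esub> g) w) = \<beta> (g v) w"
  using SpD(3)[OF assms, of "(inv\<^bsub>SpG\<^esub> g) v" w] SpD(3)[OF assms, of v "(inv\<^bsub>SpG\<^esub> g) w"]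
  by (simp_all add: Sp_inv[OF assms])

text \<open>The map \<open>g \<mapsto> g h g\<inverse> h\<inverse>\<close> is regular because \<open>g\<inverse>\<close> is the adjoint of \<open>g\<close>.\<close>

lemma commutator_connected:
  assumes H: "connectedin zar H" "H \<subseteq> carrier SpG" and h: "h \<in> carrier SpG"
  shows "connectedin zar ((\<lambda>g. g \<circ> h \<circ> inv\<^bsub>SpG\<^esub> g \<circ> inv\<^bsub>SpG\<^esub> h) ` H)"
proof (rule connected_regular_image[OF H(1)])
  fix g assume "g \<in> H"
  then have g: "g \<in> carrier SpG" using H(2) by auto
  have "g \<circ> h \<circ> inv\<^bsub>SpG\<^esub> g \<circ> inv\<^bsub>SpG\<^esub> h \<in> carrier SpG" by (intro Sp_mult g h Sp_inv)
  then show "g \<circ> h \<circ> inv\<^bsub>SpG\<^esub> g \<circ> inv\<^bsub>SpG\<^esub> h \<in> gl scale" by (rule SpD)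
next
  fix \<phi> v assume \<phi>: "functional \<phi>"
  define y where "y = (inv\<^bsub>SpG\<^esub> h) v"
  have "\<exists>d. \<forall>x. representation Basis x b = \<beta> d x" for b
    using riesz[OF representation_functional] by metis
  then obtain d where d: "\<And>b x. representation Basis x b = \<beta> (d b) x" by metis
  define P where "P = (\<lambda>g. \<Sum>b\<in>Basis. \<beta> (g (d b)) y * \<phi> (g (h b)))"
  have "(\<lambda>g. \<beta> (g (d b)) y) \<in> polys" for b
  proof -
    have "functional (\<lambda>x. \<beta> x y)" by (simp add: functional_def \<beta>_add \<beta>_scale)
    then show ?thesis by (rule coord_poly)
  qed
  then have "P \<in> polys" unfolding P_def by (intro poly_sum poly_funs.mult coord_poly[OF \<phi>])
  moreover have "\<phi> ((g \<circ> h \<circ> inv\<^bsub>SpG\<^esub> g \<circ> inv\<^bsub>SpG\<^esub> h) v) = P g" if "g \<in> H" for g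
  proof -
    have g: "g \<in> carrier SpG" using that H(2) by auto
    have "(inv\<^bsub>SpG\<^esub> g) y = (\<Sum>b\<in>Basis. \<beta> (g (d b)) y *s b)"
      using representation_expand[of "(inv\<^bsub>SpG\<^esub> g) y"] by (simp add: d Sp_inv_adj[OF g])
    moreover have "functional (\<lambda>x. \<phi> (g (h x)))" using \<phi> by (simp add: functional_def SpD[OF g] SpD[OF h])
    ultimately have "\<phi> (g (h ((inv\<^bsub>SpG\<^esub> g) y))) = (\<Sum>b\<in>Basis. \<beta> (g (d b)) y * \<phi> (g (h b)))"
      using functional_sum by force
    then show ?thesis by (simp add: P_def y_def)
  qed
  ultimately show "\<exists>P\<in>polys. \<forall>g\<in>H. \<phi> ((g \<circ> h \<circ> inv\<^bsub>SpG\<^esub> g \<circ> inv\<^bsub>SpG\<^esub> h) v) = P g" by blast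
qed

lemma left_mult_connected:
  assumes H: "connectedin zar H" "H \<subseteq> carrier SpG" and h: "h \<in> carrier SpG"
  shows "connectedin zar ((\<lambda>g. h \<circ> g) ` H)"
proof (rule connected_regular_image[OF H(1)])
  fix g assume "g \<in> H"
  then show "h \<circ> g \<in> gl scale" using H(2) h Sp_mult SpD(5) by blast
next
  fix \<phi> v assume "functional \<phi>"
  then have "functional (\<lambda>x. \<phi> (h x))" by (simp add: functional_def SpD[OF h])
  from coord_poly[OF this, of v] show "\<exists>P\<in>polys. \<forall>g\<in>H. \<phi> ((h \<circ> g) v) = P g" by auto
qed

text \<open>Membership in the connected component of the identity in \<open>M\<close>, witnessed by
  a connected subset.\<close>

definition joined :: "('v \<Rightarrow> 'v) set \<Rightarrow> ('v \<Rightarrow> 'v) \<Rightarrow> bool" where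
  "joined M x \<longleftrightarrow> (\<exists>K. connectedin zar K \<and> id \<in> K \<and> x \<in> K \<and> K \<subseteq> M)"

lemma joined_mult:
  assumes M: "subgroup M SpG" and "joined M x" "joined M y"
  shows "joined M (x \<circ> y)"
proof -
  obtain K L where K: "connectedin zar K" "id \<in> K" "x \<in> K" "K \<subseteq> M"
    and L: "connectedin zar L" "id \<in> L" "y \<in> L" "L \<subseteq> M" using assms(2,3) unfolding joined_def by blast
  have MG: "M \<subseteq> carrier SpG" by (rule subgroup.subset[OF M])
  have "connectedin zar ((\<lambda>g. x \<circ> g) ` L)" using K L MG by (intro left_mult_connected) auto
  moreover have "x \<in> (\<lambda>g. x \<circ> g) ` L" by (rule image_eqI[OF _ L(2)]) simp
  ultimately have "connectedin zar (K \<union> (\<lambda>g. x \<circ> g) ` L)" using K by (intro connectedin_Un) auto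
  moreover have "x \<circ> g \<in> M" if "g \<in> L" for g using subgroup.m_closed[OF M, of x g] K L that by auto
  ultimately show ?thesis unfolding joined_def using K L by (intro exI[of _ "K \<union> (\<lambda>g. x \<circ> g) ` L"]) auto
qed

lemma joined_connected:
  assumes "id \<in> M" "\<And>x. x \<in> M \<Longrightarrow> joined M x"
  shows "connectedin zar M"
proof -
  define Ks where "Ks = {K. connectedin zar K \<and> id \<in> K \<and> K \<subseteq> M}"
  have "connectedin zar (\<Union>Ks)"
  proof (rule connectedin_Union)
    show "\<Inter>Ks \<noteq> {}" by (auto simp: Ks_def)
  qed (simp add: Ks_def)
  moreover have "\<Union>Ks = M"
  proof
    show "\<Union>Ks \<subseteq> M" by (auto simp: Ks_def)
    show "M \<subseteq> \<Union>Ks"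
    proof
      fix x assume "x \<in> M"
      from assms(2)[OF this] show "x \<in> \<Union>Ks" unfolding joined_def Ks_def by blast
    qed
  qed
  ultimately show ?thesis by simp
qed

text \<open>For fixed \<open>h2\<close> the commutators with \<open>h2\<close> form a connected
  image of \<open>H\<close> that contains the identity. \<open>joined_mult\<close> passes to
  products, and inverses of commutators are again commutators.\<close>

lemma derived_connected:
  assumes H: "subgroup H SpG" "connectedin zar H"
  shows "connectedin zar (derived SpG H)"
proof -
  interpret G: group SpG by (rule group_Sp)
  have HG: "H \<subseteq> carrier SpG" by (rule subgroup.subset[OF H(1)])
  have D: "subgroup (derived SpG H) SpG" by (rule G.derived_is_subgroup[OF HG])
  have idH: "id \<in> H" using subgroup.one_closed[OF H(1)] by simp
  have ds: "x \<in> derived_set SpG H \<longleftrightarrow> (\<exists>h1\<in>H. \<exists>h2\<in>H. x = h1 \<circ> h2 \<circ> inv\<^bsub>SpG\<^esub> h1 \<circ> inv\<^bsub>SpG\<^esub> h2)" for x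
    by simp
  have comm: "joined (derived SpG H) x" if "x \<in> derived_set SpG H" for x
  proof -
    obtain h1 h2 where h: "h1 \<in> H" "h2 \<in> H" "x = h1 \<circ> h2 \<circ> inv\<^bsub>SpG\<^esub> h1 \<circ> inv\<^bsub>SpG\<^esub> h2"
      using \<open>x \<in> derived_set SpG H\<close> unfolding ds by blast
    define K where "K = (\<lambda>g. g \<circ> h2 \<circ> inv\<^bsub>SpG\<^esub> g \<circ> inv\<^bsub>SpG\<^esub> h2) ` H"
    have h2: "h2 \<in> carrier SpG" using h HG by auto
    have "connectedin zar K" unfolding K_def by (rule commutator_connected[OF H(2) HG h2])
    moreover have "id \<in> K" unfolding K_def
    proof (rule image_eqI[OF _ idH])
      have "inv\<^bsub>SpG\<^esub> id = id" using G.inv_one by simp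
      then show "id = id \<circ> h2 \<circ> inv\<^bsub>SpG\<^esub> id \<circ> inv\<^bsub>SpG\<^esub> h2" using Sp_inv[OF h2] by (auto simp: fun_eq_iff)
    qed
    moreover have "x \<in> K" using h by (auto simp: K_def)
    moreover have "K \<subseteq> derived SpG H"
    proof
      fix z assume "z \<in> K"
      then obtain g where "g \<in> H" "z = g \<circ> h2 \<circ> inv\<^bsub>SpG\<^esub> g \<circ> inv\<^bsub>SpG\<^esub> h2" by (auto simp: K_def)
      then have "z \<in> derived_set SpG H" unfolding ds using h(2) by blast
      then show "z \<in> derived SpG H" unfolding derived_def by (rule generate.incl)
    qed
    ultimately show ?thesis unfolding joined_def by blast
  qed
  have inv_comm: "inv\<^bsub>SpG\<^esub> x \<in> derived_set SpG H" if "x \<in> derived_set SpG H" for x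
  proof -
    obtain h1 h2 where h: "h1 \<in> H" "h2 \<in> H" "x = h1 \<otimes>\<^bsub>SpG\<^esub> h2 \<otimes>\<^bsub>SpG\<^esub> inv\<^bsub>SpG\<^esub> h1 \<otimes>\<^bsub>SpG\<^esub> inv\<^bsub>SpG\<^esub> h2"
      using \<open>x \<in> derived_set SpG H\<close> unfolding ds Sp_simps by blast
    have c: "h1 \<in> carrier SpG" "h2 \<in> carrier SpG" using h HG by auto
    have "inv\<^bsub>SpG\<^esub> x = h2 \<otimes>\<^bsub>SpG\<^esub> h1 \<otimes>\<^bsub>SpG\<^esub> inv\<^bsub>SpG\<^esub> h2 \<otimes>\<^bsub>SpG\<^esub> inv\<^bsub>SpG\<^esub> h1"
      unfolding h(3) using c by (simp add: G.inv_mult_group G.m_assoc del: Sp_simps)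
    then show ?thesis unfolding ds Sp_simps using h(1,2) by blast
  qed
  have all: "joined (derived SpG H) x" if "x \<in> generate SpG (derived_set SpG H)" for x
    using that
  proof induction
    case one
    have "connectedin zar {id}" using SpD(5)[OF G.one_closed] by (simp add: topspace_zar)
    moreover have "id \<in> derived SpG H" using subgroup.one_closed[OF D] by simp
    ultimately show ?case unfolding joined_def by (intro exI[of _ "{id}"]) simp
  next
    case (incl h) then show ?case by (rule comm)
  next
    case (inv h) then show ?case by (intro comm inv_comm)
  next
    case (eng x y)
    then show ?case unfolding Sp_simps(1) by (intro joined_mult[OF D])
  qed
  show ?thesis
  proof (rule joined_connected)
    show "id \<in> derived SpG H" using subgroup.one_closed[OF D] by simp
  qed (use all in \<open>simp add: derived_def\<close>)
qed

text \<open>Eigenvectors modulo \<open>U\<close> for distinct eigenvalues are independent, so the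
  quotient has at most \<open>card Basis\<close> eigenvalues. Here \<open>h v + c v\<close> stands
  for \<open>h v - c v\<close>.\<close>

lemma finite_eigenvalues:
  assumes h: "\<And>v w. h (v + w) = h v + h w" "\<And>c v. h (c *s v) = c *s h v"
    and U: "subspace U" "\<And>u. u \<in> U \<Longrightarrow> h u \<in> U"
  shows "finite {c. \<exists>v. v \<notin> U \<and> h v + c *s v \<in> U}"
proof (rule ccontr)
  assume "infinite {c. \<exists>v. v \<notin> U \<and> h v + c *s v \<in> U}"
  then obtain C where C: "finite C" "card C = Suc (card Basis)" "C \<subseteq> {c. \<exists>v. v \<notin> U \<and> h v + c *s v \<in> U}"
    using infinite_arbitrarily_large[OF \<open>infinite {c. \<exists>v. v \<notin> U \<and> h v + c *s v \<in> U}\<close>, of "Suc (card Basis)"] by blast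
  have "\<forall>c\<in>C. \<exists>v. v \<notin> U \<and> h v + c *s v \<in> U" using C(3) by auto
  then obtain v where v: "\<forall>c\<in>C. v c \<notin> U \<and> h (v c) + c *s v c \<in> U" by (rule bchoice[THEN exE])
  have Uadd: "x \<in> U \<Longrightarrow> y \<in> U \<Longrightarrow> x + y \<in> U" "x \<in> U \<Longrightarrow> c *s x \<in> U" for x y c
    using U(1) by (auto simp: subspace_def)
  have h0: "h 0 = 0" using h(2)[of 0 0] by simp
  have h_sum: "h (\<Sum>c\<in>D. a c *s v c) = (\<Sum>c\<in>D. a c *s h (v c))" for D a
    by (induction D rule: infinite_finite_induct) (simp_all add: h h0)
  have ind: "D \<subseteq> C \<Longrightarrow> (\<Sum>c\<in>D. a c *s v c) \<in> U \<Longrightarrow> \<forall>c\<in>D. a c = 0" if "finite D" for D a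
    using that
  proof (induction D arbitrary: a rule: finite_induct)
    case (insert c0 D)
    define x where "x = (\<Sum>c\<in>insert c0 D. a c *s v c)"
    have x: "x \<in> U" using insert.prems by (simp add: x_def)
    \<comment> \<open>Modulo \<open>U\<close>, applying \<open>h - c0\<close> removes the term of
      \<open>c0\<close> and multiplies each other term by \<open>c - c0\<close>.\<close>
    have eq: "h x + c0 *s x = (\<Sum>c\<in>insert c0 D. a c *s (h (v c) + c *s v c)) + (\<Sum>c\<in>insert c0 D. (a c * (c + c0)) *s v c)"
      unfolding x_def h_sum scale_sum_right sum.distrib[symmetric]
      by (intro sum.cong refl) (simp add: scale_right_distrib scale_left_distrib distrib_left mult_ac add_ac)
    have "h x + c0 *s x \<in> U" using x by (intro Uadd U(2))
    moreover have "(\<Sum>c\<in>insert c0 D. a c *s (h (v c) + c *s v c)) \<in> U"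
      using insert.prems v by (intro subspace_sum[OF U(1)] Uadd(2)) auto
    moreover have "(\<Sum>c\<in>insert c0 D. (a c * (c + c0)) *s v c) = (\<Sum>c\<in>insert c0 D. a c *s (h (v c) + c *s v c)) + (h x + c0 *s x)" unfolding eq by (rule vadd_self_left[symmetric])
    ultimately have "(\<Sum>c\<in>insert c0 D. (a c * (c + c0)) *s v c) \<in> U" by (simp only: Uadd(1))
    then have "(\<Sum>c\<in>D. (a c * (c + c0)) *s v c) \<in> U" using insert.hyps by simp
    then have "\<forall>c\<in>D. a c * (c + c0) = 0" using insert.prems by (intro insert.IH) auto
    then have D0: "\<forall>c\<in>D. a c = 0" using insert.hyps by (auto simp: sum_eq_0_iff)
    then have "x = a c0 *s v c0" using insert.hyps by (simp add: x_def)
    then have "a c0 = 0"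
    proof (rule_tac ccontr)
      assume "x = a c0 *s v c0" "a c0 \<noteq> 0"
      then have "v c0 = inverse (a c0) *s x" by simp
      then have "v c0 \<in> U" using Uadd(2)[OF x] by simp
      then show False using v insert.prems by auto
    qed
    with D0 show ?case by simp
  qed simp
  have zU: "0 \<in> U" using U(1) by (simp add: subspace_def)
  have "inj_on v C"
  proof (rule inj_onI, rule ccontr)
    fix c d assume cd: "c \<in> C" "d \<in> C" "v c = v d" "c \<noteq> d"
    have "(\<Sum>e\<in>{c, d}. 1 *s v e) = 0" using cd by simp
    then have "\<forall>e\<in>{c, d}. (1 :: 'k) = 0" using ind[of "{c, d}" "\<lambda>_. 1"] cd zU by simp
    then have "(1 :: 'k) = 0" by blast
    then show False by simp
  qed
  moreover have "independent (v ` C)"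
  proof (rule independent_if_scalars_zero)
    show "finite (v ` C)" using C(1) by simp
    fix f x assume "(\<Sum>x\<in>v ` C. f x *s x) = 0" and x: "x \<in> v ` C"
    then have "(\<Sum>c\<in>C. f (v c) *s v c) = 0" using \<open>inj_on v C\<close> by (simp add: sum.reindex)
    then have "\<forall>c\<in>C. f (v c) = 0" using ind[OF C(1) subset_refl, of "\<lambda>c. f (v c)"] zU by simp
    then show "f x = 0" using x by auto
  qed
  then have "card (v ` C) \<le> dim UNIV" by (intro independent_card_le_dim) auto
  ultimately show False using C(2) by (simp add: card_image dim_UNIV)
qed

text \<open>Some nonzero polynomial in \<open>h\<close> maps \<open>w\<close> into \<open>U\<close>.
  When its linear factors are split off one at a time, the last vector still outside
  \<open>U\<close> is an eigenvector of the quotient.\<close>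

lemma eigenvector_mod:
  assumes h: "\<And>v w. h (v + w) = h v + h w" "\<And>c v. h (c *s v) = c *s h v"
    and U: "subspace U" "\<And>u. u \<in> U \<Longrightarrow> h u \<in> U" and W: "subspace W" "\<And>u. u \<in> W \<Longrightarrow> h u \<in> W"
    and w: "w \<in> W" "w \<notin> U"
  obtains v c where "v \<in> W" "v \<notin> U" "h v + c *s v \<in> U"
proof -
  define pe where "pe = (\<lambda>N p. \<Sum>i\<le>N. coeff p i *s (h ^^ i) w)"
  have hW: "(h ^^ i) w \<in> W" for i by (induction i) (use w W in auto)
  have h0: "h 0 = 0" using h(2)[of 0 0] by simp
  have h_sum: "h (\<Sum>i\<le>N. a i *s (h ^^ i) w) = (\<Sum>i\<le>N. a i *s (h ^^ Suc i) w)" for N a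
    by (induction N) (simp_all add: h)
  have claim: "p \<noteq> 0 \<Longrightarrow> degree p \<le> N \<Longrightarrow> pe N p \<in> U \<Longrightarrow> \<exists>v c. v \<in> W \<and> v \<notin> U \<and> h v + c *s v \<in> U" for N p
  proof (induction N arbitrary: p)
    case 0
    then obtain a where "p = [:a:]" by (auto elim: degree_eq_zeroE)
    with 0 have "a \<noteq> 0" "a *s w \<in> U" by (auto simp: pe_def)
    then have "inverse a *s (a *s w) \<in> U" using U(1) unfolding subspace_def by blast
    then show ?case using w \<open>a \<noteq> 0\<close> by simp
  next
    case (Suc N)
    show ?case
    proof (cases "degree p \<le> N")
      case True
      then have "pe (Suc N) p = pe N p" by (simp add: pe_def coeff_eq_0)
      then show ?thesis using Suc True by simp
    next
      case False
      then have deg: "degree p = Suc N" using Suc.prems by simp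
      then obtain r where "poly p r = 0" using alg_closed_imp_poly_has_root[of p] by auto
      then obtain q where q: "p = [:- r, 1:] * q" by (auto simp: poly_eq_0_iff_dvd elim: dvdE)
      have q0: "q \<noteq> 0" using q Suc.prems by auto
      have dq: "degree q = N" using deg q0 unfolding q by (subst (asm) degree_mult_eq) auto
      have pq: "coeff p 0 = r * coeff q 0" "coeff p (Suc i) = coeff q i + r * coeff q (Suc i)" for i
        by (simp_all add: q)
      have "pe (Suc N) p = (\<Sum>i\<le>Suc N. (r * coeff q i) *s (h ^^ i) w) + (\<Sum>i\<le>N. coeff q i *s (h ^^ Suc i) w)"
        unfolding pe_def sum.atMost_Suc_shift pq by (simp add: scale_left_distrib sum.distrib add_ac)
      also have "(\<Sum>i\<le>Suc N. (r * coeff q i) *s (h ^^ i) w) = r *s pe N q"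
        using coeff_eq_0[of q "Suc N"] dq by (simp add: pe_def scale_sum_right)
      also have "(\<Sum>i\<le>N. coeff q i *s (h ^^ Suc i) w) = h (pe N q)" by (simp only: pe_def h_sum)
      finally have eq: "h (pe N q) + r *s pe N q \<in> U" using Suc.prems(3) by (simp add: add.commute)
      have "pe N q \<in> W" unfolding pe_def using hW W(1) by (intro subspace_sum) (auto simp: subspace_def)
      then show ?thesis using eq Suc.IH[OF q0] dq by blast
    qed
  qed
  have "\<exists>p. p \<noteq> 0 \<and> degree p \<le> card Basis \<and> pe (card Basis) p = 0"
  proof -
    define d where "d = card Basis"
    have "\<exists>a. (\<exists>i\<le>d. a i \<noteq> 0) \<and> (\<Sum>i\<le>d. a i *s (h ^^ i) w) = 0"
    \<comment> \<open>\<open>dependent\<close> speaks of sets, so coinciding iterates need their own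
      linear relation.\<close>
    proof (cases "inj_on (\<lambda>i. (h ^^ i) w) {..d}")
      case True
      define S where "S = (\<lambda>i. (h ^^ i) w) ` {..d}"
      have "card S = Suc d" unfolding S_def using True by (simp add: card_image)
      moreover have "dim S \<le> d" using dim_subset[of S UNIV] by (simp add: d_def dim_UNIV)
      ultimately have "dependent S" by (intro dependent_biggerset_general) (simp_all add: S_def)
      then obtain u where u: "\<exists>v\<in>S. u v \<noteq> 0" "(\<Sum>v\<in>S. u v *s v) = 0"
        using dependent_finite[of S] by (auto simp: S_def)
      then have "(\<Sum>i\<le>d. u ((h ^^ i) w) *s (h ^^ i) w) = 0" using True by (simp add: S_def sum.reindex)
      moreover have "\<exists>i\<le>d. u ((h ^^ i) w) \<noteq> 0" using u(1) by (auto simp: S_def)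
      ultimately show ?thesis by (intro exI[of _ "\<lambda>i. u ((h ^^ i) w)"] conjI)
    next
      case False
      then obtain i j where ij: "i \<le> d" "j \<le> d" "i \<noteq> j" "(h ^^ i) w = (h ^^ j) w" by (auto simp: inj_on_def)
      define a where "a = (\<lambda>k. if k = i \<or> k = j then 1 else 0 :: 'k)"
      have "(\<Sum>k\<le>d. a k *s (h ^^ k) w) = (\<Sum>k\<in>{i, j}. a k *s (h ^^ k) w)"
        using ij by (intro sum.mono_neutral_right) (auto simp: a_def)
      also have "\<dots> = 0" using ij by (simp add: a_def)
      finally show ?thesis using ij by (intro exI[of _ a]) (auto simp: a_def)
    qed
    then obtain a where a: "\<exists>i\<le>d. a i \<noteq> 0" "(\<Sum>i\<le>d. a i *s (h ^^ i) w) = 0" by blast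
    define p where "p = (\<Sum>i\<le>d. monom (a i) i)"
    have cp: "coeff p k = (if k \<le> d then a k else 0)" for k by (simp add: p_def coeff_sum)
    have "p \<noteq> 0" using a(1) cp by (metis coeff_0)
    moreover have "degree p \<le> d" by (rule degree_le) (simp add: cp)
    moreover have "pe d p = 0" using a(2) by (simp add: pe_def cp)
    ultimately show ?thesis unfolding d_def by blast
  qed
  moreover have "0 \<in> U" using U(1) by (simp add: subspace_def)
  ultimately show thesis using claim that by metis
qed

text \<open>The eigenvalue of \<open>g\<inverse> h g\<close> on \<open>v\<close> modulo \<open>U\<close> is a polynomial function of \<open>g\<close> with finitely many
  values, hence constant on a connected group.\<close>

lemma conjugate_eigenvalue:
  assumes H: "subgroup H SpG" "connectedin zar H" and h: "h \<in> H"
    and U: "subspace U" "\<And>g u. g \<in> H \<Longrightarrow> u \<in> U \<Longrightarrow> g u \<in> U" and v: "v \<notin> U" "h v + a *s v \<in> U"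
    and eig: "\<And>g. g \<in> H \<Longrightarrow> \<exists>c. (inv\<^bsub>SpG\<^esub> g) (h (g v)) + c *s v \<in> U" and g: "g \<in> H"
  shows "h (g v) + a *s g v \<in> U"
proof -
  have HG: "\<And>g. g \<in> H \<Longrightarrow> g \<in> carrier SpG" using subgroup.subset[OF H(1)] by auto
  have Uadd: "x \<in> U \<Longrightarrow> y \<in> U \<Longrightarrow> x + y \<in> U" "x \<in> U \<Longrightarrow> c *s x \<in> U" for x y c
    using U(1) by (auto simp: subspace_def)
  have idH: "id \<in> H" using subgroup.one_closed[OF H(1)] by simp
  obtain z where z: "\<beta> z v = 1" "\<And>u. u \<in> U \<Longrightarrow> \<beta> z u = 0" using separating_vector[OF U(1) v(1)] by blast
  define f where "f = (\<lambda>g. \<beta> (g z) (h (g v)))"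
  have f: "f \<in> polys" unfolding f_def by (rule bilinear_poly[OF functional_\<beta>]) (simp_all add: SpD[OF HG[OF h]])
  have ev: "h (g v) + f g *s g v \<in> U \<and> g v \<notin> U" if g: "g \<in> H" for g
  proof -
    note gG = HG[OF g]
    obtain c where c: "(inv\<^bsub>SpG\<^esub> g) (h (g v)) + c *s v \<in> U" using eig[OF g] by blast
    have "\<beta> z ((inv\<^bsub>SpG\<^esub> g) (h (g v)) + c *s v) = 0" by (rule z(2)[OF c])
    then have "f g = c" by (simp add: \<beta>_add \<beta>_scale z(1) Sp_inv_adj[OF gG] f_def sum_eq_0_iff)
    moreover have "g ((inv\<^bsub>SpG\<^esub> g) (h (g v)) + c *s v) \<in> U" by (rule U(2)[OF g c])
    ultimately have "h (g v) + f g *s g v \<in> U" by (simp add: SpD[OF gG] Sp_inv[OF gG])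
    moreover have "g v \<notin> U"
    proof
      assume "g v \<in> U"
      then have "(inv\<^bsub>SpG\<^esub> g) (g v) \<in> U" using subgroup.m_inv_closed[OF H(1) g] U(2) by blast
      then show False using v(1) by (simp add: Sp_inv[OF gG])
    qed
    ultimately show ?thesis by blast
  qed
  have "finite {c. \<exists>v. v \<notin> U \<and> h v + c *s v \<in> U}"
    by (rule finite_eigenvalues) (use SpD[OF HG[OF h]] U h in auto)
  moreover have "f ` H \<subseteq> {c. \<exists>v. v \<notin> U \<and> h v + c *s v \<in> U}" using ev by blast
  ultimately have "finite (f ` H)" by (rule rev_finite_subset)
  then have "f g = f id" using connected_finite_values[OF H(2) f _ g idH] by blast
  also have "f id = a" using z(2)[OF v(2)] by (simp add: f_def \<beta>_add \<beta>_scale z(1) sum_eq_0_iff)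
  finally show ?thesis using ev[OF g] by simp
qed

text \<open>Working with \<open>W\<close> modulo \<open>U\<close> lets the result extend a flag
  without quotient spaces. By induction on the derived length the derived group \<open>D\<close> has
  a common eigenvector. In a minimal \<open>H\<close>-stable \<open>W'\<close> properly containing
  \<open>U\<close>, its weight space is \<open>H\<close>-stable by
  \<open>conjugate_eigenvalue\<close>, so \<open>D\<close> acts by scalars modulo \<open>U\<close>.
  Conjugates of \<open>h\<close> under \<open>H\<close> differ from \<open>h\<close> by elements of
  \<open>D\<close>, so the eigenspaces of \<open>h\<close> are stable too and all of
  \<open>H\<close> acts by scalars.\<close>

theorem lie_kolchin:
  assumes "subgroup H SpG" "connectedin zar H" "(derived SpG ^^ k) H = {id}"
    and "subspace U" "subspace W" "U \<subseteq> W" "w \<in> W" "w \<notin> U"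
    and "\<And>g u. g \<in> H \<Longrightarrow> u \<in> U \<Longrightarrow> g u \<in> U" "\<And>g u. g \<in> H \<Longrightarrow> u \<in> W \<Longrightarrow> g u \<in> W"
  shows "\<exists>w\<in>W. w \<notin> U \<and> (\<forall>g\<in>H. \<exists>c. g w + c *s w \<in> U)"
  using assms
proof (induction k arbitrary: H U W w)
  case 0
  have "0 \<in> U" using 0(4) by (simp add: subspace_def)
  have "g w + 1 *s w \<in> U" if "g \<in> H" for g
  proof -
    have "g w = w" using that 0(3) by auto
    then show ?thesis using \<open>0 \<in> U\<close> by simp
  qed
  then show ?case using 0(7,8) by blast
next
  case (Suc k)
  interpret G: group SpG by (rule group_Sp)
  note H = Suc.prems(1,2) and U = Suc.prems(4,9)
  have HG: "\<And>g. g \<in> H \<Longrightarrow> g \<in> carrier SpG" using subgroup.subset[OF H(1)] by auto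
  have Uadd: "x \<in> U \<Longrightarrow> y \<in> U \<Longrightarrow> x + y \<in> U" "x \<in> U \<Longrightarrow> c *s x \<in> U" for x y c
    using U(1) by (auto simp: subspace_def)
  define D where "D = derived SpG H"
  have D: "subgroup D SpG" "connectedin zar D" "D \<subseteq> H"
    unfolding D_def using G.derived_is_subgroup[OF subgroup.subset[OF H(1)]] derived_connected[OF H]
      G.derived_incl[OF subset_refl H(1)] by auto
  have Dk: "(derived SpG ^^ k) D = {id}" using Suc.prems(3) by (simp only: D_def funpow_Suc_right o_apply)
  have comm: "inv\<^bsub>SpG\<^esub> h \<circ> inv\<^bsub>SpG\<^esub> g \<circ> h \<circ> g \<in> D" if "h \<in> H" "g \<in> H" for h g
  proof -
    have "inv\<^bsub>SpG\<^esub> h \<in> H" "inv\<^bsub>SpG\<^esub> g \<in> H" using that subgroup.m_inv_closed[OF H(1)] by auto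
    moreover have "inv\<^bsub>SpG\<^esub> h \<circ> inv\<^bsub>SpG\<^esub> g \<circ> h \<circ> g = inv\<^bsub>SpG\<^esub> h \<otimes>\<^bsub>SpG\<^esub> inv\<^bsub>SpG\<^esub> g \<otimes>\<^bsub>SpG\<^esub> inv\<^bsub>SpG\<^esub> (inv\<^bsub>SpG\<^esub> h) \<otimes>\<^bsub>SpG\<^esub> inv\<^bsub>SpG\<^esub> (inv\<^bsub>SpG\<^esub> g)"
      using that HG by simp
    ultimately show ?thesis unfolding D_def derived_def by (intro generate.incl) blast
  qed
  define good where "good = (\<lambda>W'. subspace W' \<and> U \<subseteq> W' \<and> W' \<subseteq> W \<and> W' \<noteq> U \<and> (\<forall>g\<in>H. \<forall>u\<in>W'. g u \<in> W'))"
  have "good W" unfolding good_def using Suc.prems by blast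
  then obtain W' where W': "good W'" "\<And>X. good X \<Longrightarrow> dim W' \<le> dim X"
    using ex_has_least_nat[of good W dim] by blast
  have W'D: "subspace W'" "U \<subseteq> W'" "W' \<subseteq> W" "\<And>g u. g \<in> H \<Longrightarrow> u \<in> W' \<Longrightarrow> g u \<in> W'"
    using W'(1) by (auto simp: good_def)
  obtain w1 where w1: "w1 \<in> W'" "w1 \<notin> U" using W'(1) by (auto simp: good_def)
  have minimal: "E = W'" if "subspace E" "U \<subseteq> E" "E \<subseteq> W'" "x \<in> E" "x \<notin> U" "\<And>g u. g \<in> H \<Longrightarrow> u \<in> E \<Longrightarrow> g u \<in> E" for E x
  proof -
    have "good E" unfolding good_def using that W'D by blast
    then show ?thesis using W'(2) subspace_dim_equal[OF that(1) W'D(1) that(3)] by blast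
  qed
  obtain w0 where w0: "w0 \<in> W'" "w0 \<notin> U" "\<forall>g\<in>D. \<exists>c. g w0 + c *s w0 \<in> U"
    using Suc.IH[OF D(1,2) Dk U(1) W'D(1,2) w1] U(2) W'D(4) D(3) by blast
  obtain \<chi> where \<chi>: "\<forall>g\<in>D. g w0 + \<chi> g *s w0 \<in> U" using bchoice[OF w0(3)] by blast
  define E where "E = {x \<in> W'. \<forall>d\<in>D. d x + \<chi> d *s x \<in> U}"
  have E: "E = W'"
  proof (rule minimal[of E w0])
    show "subspace E"
      unfolding subspace_def
    proof (intro conjI allI ballI)
      have dG: "d \<in> carrier SpG" if "d \<in> D" for d using HG D(3) that by auto
      have W'c: "0 \<in> W'" "\<And>x y. x \<in> W' \<Longrightarrow> y \<in> W' \<Longrightarrow> x + y \<in> W'" "\<And>x c. x \<in> W' \<Longrightarrow> c *s x \<in> W'"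
        using W'D(1) by (auto simp: subspace_def)
      have "d 0 + \<chi> d *s 0 \<in> U" if "d \<in> D" for d
        using SpD(2)[OF dG[OF that], of 0 0] U(1) by (simp add: subspace_def)
      then show "0 \<in> E" using W'c(1) by (simp add: E_def)
      fix x y c assume x: "x \<in> E"
      have "d (c *s x) + \<chi> d *s (c *s x) \<in> U" if "d \<in> D" for d
      proof -
        have "d (c *s x) + \<chi> d *s (c *s x) = c *s (d x + \<chi> d *s x)"
          by (simp add: SpD[OF dG[OF that]] scale_right_distrib mult_ac)
        moreover have "d x + \<chi> d *s x \<in> U" using x that by (simp add: E_def)
        ultimately show ?thesis using Uadd(2) by metis
      qed
      then show "c *s x \<in> E" using x W'c(3) unfolding E_def by blast
      assume y: "y \<in> E"
      have "d (x + y) + \<chi> d *s (x + y) \<in> U" if "d \<in> D" for d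
      proof -
        have "d (x + y) + \<chi> d *s (x + y) = (d x + \<chi> d *s x) + (d y + \<chi> d *s y)"
          by (simp add: SpD[OF dG[OF that]] scale_right_distrib add_ac)
        moreover have "d x + \<chi> d *s x \<in> U" "d y + \<chi> d *s y \<in> U" using x y that by (simp_all add: E_def)
        ultimately show ?thesis using Uadd(1) by metis
      qed
      then show "x + y \<in> E" using x y W'c(2) unfolding E_def by blast
    qed
    show "U \<subseteq> E" using W'D(2) U(2) Uadd D(3) by (auto simp: E_def)
    show "w0 \<in> E" "w0 \<notin> U" using w0 \<chi> by (auto simp: E_def)
    show "E \<subseteq> W'" by (auto simp: E_def)
    fix g x assume g: "g \<in> H" and x: "x \<in> E"
    show "g x \<in> E"
    proof (cases "x \<in> U")
      case True
      then show ?thesis using U(2)[OF g] \<open>U \<subseteq> E\<close> by blast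
    next
      case False
      have "d (g x) + \<chi> d *s g x \<in> U" if d: "d \<in> D" for d
      proof (rule conjugate_eigenvalue[where H = H and U = U and h = d and v = x and a = "\<chi> d" and g = g])
        show "subgroup H SpG" "connectedin zar H" "subspace U" "x \<notin> U" "g \<in> H" by (fact H U(1) False g)+
        show "\<And>g u. g \<in> H \<Longrightarrow> u \<in> U \<Longrightarrow> g u \<in> U" by (rule U(2))
        show "d \<in> H" using d D(3) by auto
        show "d x + \<chi> d *s x \<in> U" using x d by (auto simp: E_def)
        fix g' assume g': "g' \<in> H"
        have dH: "d \<in> H" using d D(3) by auto
        \<comment> \<open>The conjugate of \<open>d\<close> by \<open>g'\<close>, written so that it
          visibly lies in \<open>D\<close>; hence \<open>x\<close> is an eigenvector of it as
          well.\<close>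
        define e where "e = d \<circ> (inv\<^bsub>SpG\<^esub> d \<circ> inv\<^bsub>SpG\<^esub> g' \<circ> d \<circ> g')"
        have "e \<in> D" unfolding e_def using subgroup.m_closed[OF D(1) d comm[OF dH g']] by simp
        moreover have "e x = (inv\<^bsub>SpG\<^esub> g') (d (g' x))" by (simp add: e_def Sp_inv[OF HG[OF dH]])
        moreover have "\<forall>d\<in>D. d x + \<chi> d *s x \<in> U" using x by (simp add: E_def)
        ultimately have "(inv\<^bsub>SpG\<^esub> g') (d (g' x)) + \<chi> e *s x \<in> U" by metis
        then show "\<exists>c. (inv\<^bsub>SpG\<^esub> g') (d (g' x)) + c *s x \<in> U" by blast
      qed
      then show ?thesis using W'D(4)[OF g] x by (auto simp: E_def)
    qed
  qed
  have scalar: "\<exists>a. \<forall>x\<in>W'. h x + a *s x \<in> U" if h: "h \<in> H" for h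
  proof -
    note hG = HG[OF h]
    obtain v a where v: "v \<in> W'" "v \<notin> U" "h v + a *s v \<in> U"
      using eigenvector_mod[of h U W' w1] SpD(1,2)[OF hG] U W'D w1 h by blast
    define Eh where "Eh = {x \<in> W'. h x + a *s x \<in> U}"
    have "Eh = W'"
    proof (rule minimal[of Eh v])
      show "subspace Eh"
        unfolding subspace_def
      proof (intro conjI allI ballI)
        have "h 0 = 0" using SpD(2)[OF hG, of 0 0] by simp
        then show "0 \<in> Eh" using W'D(1) U(1) by (auto simp: Eh_def subspace_def)
        fix x y c assume x: "x \<in> Eh"
        have "h (c *s x) + a *s c *s x = c *s (h x + a *s x)" by (simp add: SpD[OF hG] scale_right_distrib mult_ac)
        then show "c *s x \<in> Eh" using x W'D(1) Uadd(2) by (auto simp: Eh_def subspace_def)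
        assume y: "y \<in> Eh"
        have "h (x + y) + a *s (x + y) = (h x + a *s x) + (h y + a *s y)"
          by (simp add: SpD[OF hG] scale_right_distrib add_ac)
        then show "x + y \<in> Eh" using x y W'D(1) Uadd(1) by (auto simp: Eh_def subspace_def)
      qed
      show "U \<subseteq> Eh" using W'D(2) U(2) Uadd h by (auto simp: Eh_def)
      show "v \<in> Eh" "v \<notin> U" using v by (auto simp: Eh_def)
      show "Eh \<subseteq> W'" by (auto simp: Eh_def)
      fix g x assume g: "g \<in> H" and x: "x \<in> Eh"
      show "g x \<in> Eh"
      proof (cases "x \<in> U")
        case True
        then show ?thesis using U(2)[OF g] \<open>U \<subseteq> Eh\<close> by blast
      next
        case False
        have "h (g x) + a *s g x \<in> U"
        proof (rule conjugate_eigenvalue[where H = H and U = U and h = h and v = x and a = a and g = g])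
          show "subgroup H SpG" "connectedin zar H" "h \<in> H" "subspace U" "x \<notin> U" "g \<in> H" by (fact H h U(1) False g)+
          show "\<And>g u. g \<in> H \<Longrightarrow> u \<in> U \<Longrightarrow> g u \<in> U" by (rule U(2))
          show hx: "h x + a *s x \<in> U" using x by (auto simp: Eh_def)
          fix g' assume g': "g' \<in> H"
          \<comment> \<open>With this \<open>d\<close> one has
            \<open>g'\<inverse> h g' = h d\<close>. As \<open>d\<close> is scalar modulo
            \<open>U\<close>, the conjugate has \<open>x\<close> as eigenvector, with eigenvalue
            \<open>\<chi> d * a\<close>.\<close>
          define d where "d = inv\<^bsub>SpG\<^esub> h \<circ> inv\<^bsub>SpG\<^esub> g' \<circ> h \<circ> g'"
          have "d \<in> D" unfolding d_def by (rule comm[OF h g'])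
          moreover have "x \<in> E" using x by (auto simp: Eh_def E)
          ultimately have dx: "d x + \<chi> d *s x \<in> U" by (auto simp: E_def)
          have "(inv\<^bsub>SpG\<^esub> g') (h (g' x)) = h (d x)" by (simp add: d_def Sp_inv[OF hG])
          moreover have "h (d x) + (\<chi> d * a) *s x = h (d x + \<chi> d *s x) + \<chi> d *s (h x + a *s x)"
            by (simp add: SpD[OF hG] scale_right_distrib add_ac)
          ultimately have "(inv\<^bsub>SpG\<^esub> g') (h (g' x)) + (\<chi> d * a) *s x \<in> U"
            using U(2)[OF h dx] hx Uadd by simp
          then show "\<exists>c. (inv\<^bsub>SpG\<^esub> g') (h (g' x)) + c *s x \<in> U" by blast
        qed
        then show ?thesis using W'D(4)[OF g] x by (auto simp: Eh_def)
      qed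
    qed
    then show ?thesis by (auto simp: Eh_def)
  qed
  show ?case
  proof (intro bexI[of _ w0] conjI ballI)
    fix g assume "g \<in> H"
    from scalar[OF this] w0(1) show "\<exists>c. g w0 + c *s w0 \<in> U" by blast
  qed (use w0 W'D(3) in auto)
qed

end

section \<open>Isotropic flags\<close>

context symp
begin

lemma derived_seq_subgroup:
  assumes "subgroup H SpG"
  shows "(derived (SpG\<lparr>carrier := H\<rparr>) ^^ k) H = (derived SpG ^^ k) H"
proof -
  interpret G: group SpG by (rule group_Sp)
  have "(derived (SpG\<lparr>carrier := H\<rparr>) ^^ k) H = (derived SpG ^^ k) H \<and> (derived SpG ^^ k) H \<subseteq> H"
  proof (induction k)
    case (Suc k)
    then show ?case using G.derived_consistent[OF _ assms] G.derived_incl[OF _ assms] by simp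
  qed simp
  then show ?thesis ..
qed

text \<open>The \<open>e\<close> build the isotropic half of a stable flag. The \<open>f\<close> are
  only dual vectors: the upper half of the flag is obtained later from complements.\<close>

definition partial_flag :: "('v \<Rightarrow> 'v) set \<Rightarrow> nat \<Rightarrow> (nat \<Rightarrow> 'v) \<Rightarrow> (nat \<Rightarrow> 'v) \<Rightarrow> bool" where
  "partial_flag H r e f \<longleftrightarrow>
     (\<forall>i<r. \<forall>j<r. \<beta> (e i) (f j) = (if i = j then 1 else 0) \<and> \<beta> (e i) (e j) = 0 \<and> \<beta> (f i) (f j) = 0) \<and>
     (\<forall>i\<le>r. \<forall>g\<in>H. \<forall>x\<in>span (e ` {..<i}). g x \<in> span (e ` {..<i}))"

lemma partial_flag_bound:
  assumes "partial_flag H r e f"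
  shows "r \<le> card Basis"
proof -
  have "dim ({} \<union> e ` {..<r}) = dim {} + card {..<r}"
  proof (rule dim_dual_family[where y = f])
    fix i j assume "i \<in> {..<r}" "j \<in> {..<r}"
    then have "\<beta> (e j) (f i) = (if i = j then 1 else 0)" using assms by (auto simp: partial_flag_def)
    then show "\<beta> (f i) (e j) = (if i = j then 1 else 0)" by (simp only: \<beta>_sym[of "f i" "e j"])
  qed simp_all
  then have "r = dim (e ` {..<r})" by simp
  also have "\<dots> \<le> dim UNIV" by (rule dim_subset) simp
  finally show ?thesis by (simp add: dim_UNIV)
qed

text \<open>\<open>lie_kolchin\<close> is applied to the complement \<open>W\<close> of
  \<open>U\<close> modulo \<open>U\<close>, nonzero because of \<open>x\<close>. Every vector is
  isotropic for an alternating form, so the eigenvector found extends the flag.\<close>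

lemma partial_flag_extend:
  assumes H: "subgroup H SpG" "connectedin zar H" "(derived SpG ^^ k) H = {id}"
    and part: "partial_flag H r e f" and x: "x \<noteq> 0" "\<And>i. i < r \<Longrightarrow> \<beta> (e i) x = 0" "\<And>i. i < r \<Longrightarrow> \<beta> (f i) x = 0"
  shows "\<exists>e f. partial_flag H (Suc r) e f"
proof -
  have HG: "\<And>g. g \<in> H \<Longrightarrow> g \<in> carrier SpG" using subgroup.subset[OF H(1)] by auto
  have ef: "\<beta> (e i) (f j) = (if i = j then 1 else 0)" "\<beta> (e i) (e j) = 0" "\<beta> (f i) (f j) = 0"
    "\<beta> (f j) (e i) = (if i = j then 1 else 0)" if "i < r" "j < r" for i j
    using part that \<beta>_sym[of "f j" "e i"] by (auto simp: partial_flag_def)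
  define U where "U = span (e ` {..<r})"
  define W where "W = {x. \<forall>i<r. \<beta> (e i) x = 0}"
  have U: "subspace U" by (simp add: U_def)
  have Uadd: "x \<in> U \<Longrightarrow> y \<in> U \<Longrightarrow> x + y \<in> U" "x \<in> U \<Longrightarrow> c *s x \<in> U" for x y c
    using U by (auto simp: subspace_def)
  have eU: "e i \<in> U" if "i < r" for i using that by (auto simp: U_def intro: span_base)
  have UH: "g u \<in> U" if "g \<in> H" "u \<in> U" for g u using part that by (auto simp: partial_flag_def U_def)
  have W: "subspace W" by (auto simp: W_def subspace_def \<beta>_add \<beta>_scale)
  have UW: "U \<subseteq> W" unfolding U_def using W by (intro span_minimal) (auto simp: W_def ef)
  have \<beta>UW: "\<beta> u y = 0" if "u \<in> U" "y \<in> W" for u y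
  proof -
    have "U \<subseteq> {u. \<beta> u y = 0}"
      unfolding U_def using that(2) by (intro span_minimal) (auto simp: W_def subspace_def \<beta>_add \<beta>_scale)
    then show ?thesis using that(1) by auto
  qed
  have WH: "g u \<in> W" if "g \<in> H" "u \<in> W" for g u
  proof -
    have "\<beta> (e i) (g u) = 0" if "i < r" for i
    proof -
      have "(inv\<^bsub>SpG\<^esub> g) (e i) \<in> U" using UH[OF subgroup.m_inv_closed[OF H(1) \<open>g \<in> H\<close>] eU[OF that]] .
      then show ?thesis using \<beta>UW[OF _ \<open>u \<in> W\<close>] Sp_inv_adj(1)[OF HG[OF \<open>g \<in> H\<close>]] by metis
    qed
    then show ?thesis by (simp add: W_def)
  qed
  have "U \<subseteq> {u. u = (\<Sum>i<r. \<beta> (f i) u *s e i)}"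
    unfolding U_def
  proof (rule span_minimal)
    show "subspace {u. u = (\<Sum>i<r. \<beta> (f i) u *s e i)}"
      unfolding subspace_def mem_Collect_eq
    proof (intro conjI allI ballI impI)
      show "0 = (\<Sum>i<r. \<beta> (f i) 0 *s e i)" by simp
      fix x y assume x: "x \<in> {u. u = (\<Sum>i<r. \<beta> (f i) u *s e i)}"
      have "(\<Sum>i<r. \<beta> (f i) (c *s x) *s e i) = c *s (\<Sum>i<r. \<beta> (f i) x *s e i)" for c
        by (simp add: \<beta>_scale scale_sum_right)
      also have "c *s (\<Sum>i<r. \<beta> (f i) x *s e i) = c *s x" for c using x by simp
      finally show "c *s x = (\<Sum>i<r. \<beta> (f i) (c *s x) *s e i)" for c by (rule HOL.sym)
      assume y: "y \<in> {u. u = (\<Sum>i<r. \<beta> (f i) u *s e i)}"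
      have "(\<Sum>i<r. \<beta> (f i) (x + y) *s e i) = (\<Sum>i<r. \<beta> (f i) x *s e i) + (\<Sum>i<r. \<beta> (f i) y *s e i)"
        by (simp add: \<beta>_add scale_left_distrib sum.distrib)
      also have "\<dots> = x + y" using x y by simp
      finally show "x + y = (\<Sum>i<r. \<beta> (f i) (x + y) *s e i)" by (rule HOL.sym)
    qed
    show "e ` {..<r} \<subseteq> {u. u = (\<Sum>i<r. \<beta> (f i) u *s e i)}"
    proof clarify
      fix j assume j: "j < r"
      have "(\<Sum>i<r. \<beta> (f i) (e j) *s e i) = (\<Sum>i<r. if i = j then e j else 0)"
        using j by (intro sum.cong) (auto simp: ef)
      then show "e j = (\<Sum>i<r. \<beta> (f i) (e j) *s e i)" using j by simp
    qed
  qed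
  then have xU: "x \<notin> U" using x(1,3) by force
  have xW: "x \<in> W" using x(2) by (simp add: W_def)
  obtain w where w: "w \<in> W" "w \<notin> U" "\<forall>g\<in>H. \<exists>c. g w + c *s w \<in> U"
    using lie_kolchin[OF H U W UW xW xU] UH WH by blast
  \<comment> \<open>Removing the component in \<open>U\<close> makes \<open>w'\<close> orthogonal to
    the \<open>f\<close> as well and leaves its class modulo \<open>U\<close> unchanged.\<close>
  define u where "u = (\<Sum>i<r. \<beta> (f i) w *s e i)"
  have uU: "u \<in> U" unfolding u_def by (intro subspace_sum[OF U] Uadd(2) eU) auto
  define w' where "w' = w + u"
  have w'U: "w' \<notin> U"
  proof
    assume "w' \<in> U"
    from Uadd(1)[OF this uU] show False using w(2) by (simp add: w'_def add.assoc)
  qed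
  have ew': "\<beta> (e j) w' = 0" if "j < r" for j
  proof -
    have "w' \<in> W" unfolding w'_def using W w(1) UW uU by (auto simp: subspace_def)
    then show ?thesis using that by (simp add: W_def)
  qed
  have fw': "\<beta> (f j) w' = 0" if "j < r" for j
  proof -
    have "\<beta> (f j) u = (\<Sum>i<r. if i = j then \<beta> (f i) w else 0)"
      unfolding u_def \<beta>_sum \<beta>_scale using that by (intro sum.cong) (auto simp: ef)
    then show ?thesis using that by (simp add: w'_def \<beta>_add)
  qed
  have "w' \<noteq> 0" using w'U U by (auto simp: subspace_def)
  then obtain y1 where "\<beta> w' y1 \<noteq> 0" using \<beta>_nondeg by blast
  then obtain y0 where y0: "\<beta> w' y0 = 1" using \<beta>_scale(2)[of w' "inverse (\<beta> w' y1)" y1] by force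
  \<comment> \<open>The part of \<open>y0\<close> orthogonal to all \<open>e\<close> and
    \<open>f\<close>. What is removed is orthogonal to \<open>w'\<close>, so the pairing with
    \<open>w'\<close> stays 1.\<close>
  define y where "y = y0 + ((\<Sum>i<r. \<beta> (f i) y0 *s e i) + (\<Sum>i<r. \<beta> (e i) y0 *s f i))"
  have sums: "\<beta> (e j) (\<Sum>i<r. \<beta> (f i) y0 *s e i) = 0" "\<beta> (f j) (\<Sum>i<r. \<beta> (e i) y0 *s f i) = 0"
    "\<beta> (e j) (\<Sum>i<r. \<beta> (e i) y0 *s f i) = \<beta> (e j) y0" "\<beta> (f j) (\<Sum>i<r. \<beta> (f i) y0 *s e i) = \<beta> (f j) y0" if "j < r" for j
  proof -
    have "(\<Sum>i<r. \<beta> (e i) y0 * \<beta> (e j) (f i)) = (\<Sum>i<r. if i = j then \<beta> (e i) y0 else 0)"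
      by (intro sum.cong refl) (use that ef in auto)
    moreover have "(\<Sum>i<r. \<beta> (f i) y0 * \<beta> (f j) (e i)) = (\<Sum>i<r. if i = j then \<beta> (f i) y0 else 0)"
      by (intro sum.cong refl) (use that ef in auto)
    ultimately show "\<beta> (e j) (\<Sum>i<r. \<beta> (e i) y0 *s f i) = \<beta> (e j) y0" "\<beta> (f j) (\<Sum>i<r. \<beta> (f i) y0 *s e i) = \<beta> (f j) y0"
      using that by (simp_all add: \<beta>_sum \<beta>_scale)
    show "\<beta> (e j) (\<Sum>i<r. \<beta> (f i) y0 *s e i) = 0" "\<beta> (f j) (\<Sum>i<r. \<beta> (e i) y0 *s f i) = 0"
      using that by (simp_all add: \<beta>_sum \<beta>_scale ef)
  qed
  have ey: "\<beta> (e j) y = 0" "\<beta> (f j) y = 0" if "j < r" for j using sums[OF that] by (simp_all add: y_def \<beta>_add)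
  have "\<beta> w' (\<Sum>i<r. \<beta> (f i) y0 *s e i) = 0" "\<beta> w' (\<Sum>i<r. \<beta> (e i) y0 *s f i) = 0"
    using ew' fw' by (simp_all add: \<beta>_sum \<beta>_scale \<beta>_sym[of w'])
  then have w'y: "\<beta> w' y = 1" by (simp add: y_def \<beta>_add y0)
  define e' where "e' = e(r := w')"
  define f' where "f' = f(r := y)"
  have im: "e' ` {..<i} = e ` {..<i}" if "i \<le> r" for i using that by (auto simp: e'_def)
  have imS: "e' ` {..<Suc r} = insert w' (e ` {..<r})" 
  proof -
    have "e' r = w'" by (simp add: e'_def)
    then show ?thesis using im[of r] by (simp only: lessThan_Suc image_insert)
  qed
  have "partial_flag H (Suc r) e' f'"
    unfolding partial_flag_def
  proof (intro conjI allI impI ballI)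
    fix i j assume ij: "i < Suc r" "j < Suc r"
    have sym0: "\<beta> w' (e l) = 0" "\<beta> w' (f l) = 0" "\<beta> y (f l) = 0" if "l < r" for l
      using ew'[OF that] fw'[OF that] ey(2)[OF that] by (simp_all only: \<beta>_sym[of w'] \<beta>_sym[of y])
    have r: "i \<noteq> r \<Longrightarrow> i < r" "j \<noteq> r \<Longrightarrow> j < r" using ij by auto
    show "\<beta> (e' i) (f' j) = (if i = j then 1 else 0)" "\<beta> (e' i) (e' j) = 0" "\<beta> (f' i) (f' j) = 0"
      by (cases "i = r"; cases "j = r"; simp add: e'_def f'_def r ef ew' fw' ey w'y sym0)+
  next
    fix i g x assume i: "i \<le> Suc r" and g: "g \<in> H" and x: "x \<in> span (e' ` {..<i})"
    show "g x \<in> span (e' ` {..<i})"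
    proof (cases "i \<le> r")
      case True
      then show ?thesis using x g part by (simp add: im partial_flag_def)
    next
      case False
      then have [simp]: "i = Suc r" using i by simp
      note gG = SpD[OF HG[OF g]]
      have sub: "U \<subseteq> span (insert w' (e ` {..<r}))" unfolding U_def by (intro span_mono) auto
      have w'_in: "w' \<in> span (insert w' (e ` {..<r}))" by (intro span_base) simp
      obtain c where c: "g w + c *s w \<in> U" using w(3) g by blast
      have "g w' = c *s w' + ((g w + c *s w) + (g u + c *s u))"
        by (simp add: w'_def gG scale_right_distrib add_ac)
      moreover have mem: "(g w + c *s w) + (g u + c *s u) \<in> U" by (rule Uadd(1)[OF c Uadd(1)[OF UH[OF g uU] Uadd(2)[OF uU]]])
      ultimately have gw': "g w' \<in> span (insert w' (e ` {..<r}))"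
        using span_add[OF span_scale[OF w'_in] subsetD[OF sub mem], of c] by (simp only:)
      have "span (insert w' (e ` {..<r})) \<subseteq> {x. g x \<in> span (insert w' (e ` {..<r}))}"
      proof (rule span_minimal)
        show "insert w' (e ` {..<r}) \<subseteq> {x. g x \<in> span (insert w' (e ` {..<r}))}"
          using gw' UH[OF g] eU sub by auto
        have "g 0 = 0" using gG(2)[of 0 0] by simp
        then show "subspace {x. g x \<in> span (insert w' (e ` {..<r}))}"
          by (auto simp: subspace_def gG span_zero span_add span_scale)
      qed
      then show ?thesis using x by (auto simp: imS)
    qed
  qed
  then show ?thesis by blast
qed

text \<open>The length is bounded by \<open>card Basis\<close>, so some flag cannot be extended; by
  \<open>partial_flag_extend\<close> no nonzero vector is then orthogonal to all \<open>e\<close>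
  and \<open>f\<close>.\<close>

lemma maximal_partial_flag:
  assumes H: "subgroup H SpG" "connectedin zar H" "(derived SpG ^^ k) H = {id}"
  obtains r e f where "partial_flag H r e f"
    "\<And>x. (\<And>i. i < r \<Longrightarrow> \<beta> (e i) x = 0) \<Longrightarrow> (\<And>i. i < r \<Longrightarrow> \<beta> (f i) x = 0) \<Longrightarrow> x = 0"
proof -
  have "\<exists>r. (\<exists>e f. partial_flag H r e f) \<and> \<not> (\<exists>e f. partial_flag H (Suc r) e f)"
  proof (rule ccontr)
    assume neg: "\<not> ?thesis"
    have HG: "\<And>g. g \<in> H \<Longrightarrow> g \<in> carrier SpG" using subgroup.subset[OF H(1)] by auto
    have g0: "g 0 = 0" if "g \<in> H" for g using SpD(2)[OF HG[OF that], of 0 0] by simp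
    have "\<exists>e f. partial_flag H r e f" for r
    proof (induction r)
      case 0
      have "partial_flag H 0 e f" for e f using g0 by (simp add: partial_flag_def)
      then show ?case by blast
    next
      case (Suc r) then show ?case using neg by blast
    qed
    then obtain e f where "partial_flag H (Suc (card Basis)) e f" by blast
    then show False using partial_flag_bound by fastforce
  qed
  then obtain r e f where r: "partial_flag H r e f" "\<not> (\<exists>e f. partial_flag H (Suc r) e f)" by blast
  have "x = 0" if "\<And>i. i < r \<Longrightarrow> \<beta> (e i) x = 0" "\<And>i. i < r \<Longrightarrow> \<beta> (f i) x = 0" for x
    using partial_flag_extend[OF H r(1) _ that] r(2) by blast
  with r(1) that show thesis by blast
qed

end

section \<open>The Borel subgroup of a flag\<close>

context adapted
begin

text \<open>The span of the first \<open>i\<close> basis vectors, see \<open>Fl_span\<close>. Given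
  by linear equations, stability becomes the vanishing of polynomial functions; for
  \<open>i \<ge> 2 * n\<close> it is the whole space.\<close>

definition Fl :: "nat \<Rightarrow> 'v set" where
  "Fl i = {x. \<forall>k<2 * n. i \<le> k \<longrightarrow> \<beta> (b (op k)) x = 0}"

lemma FlD: "x \<in> Fl i \<Longrightarrow> k < 2 * n \<Longrightarrow> i \<le> k \<Longrightarrow> \<beta> (b (op k)) x = 0"
  by (simp add: Fl_def)

lemma Fl_subspace: "subspace (Fl i)" by (auto simp: Fl_def subspace_def \<beta>_add \<beta>_scale)

lemma Fl_add: "x \<in> Fl i \<Longrightarrow> y \<in> Fl i \<Longrightarrow> x + y \<in> Fl i"
  and Fl_scale: "x \<in> Fl i \<Longrightarrow> c *s x \<in> Fl i"
  and Fl_zero: "0 \<in> Fl i"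
  using Fl_subspace by (auto simp: subspace_def)

lemma Fl_mono: "i \<le> j \<Longrightarrow> Fl i \<subseteq> Fl j" by (auto simp: Fl_def)

lemma Fl_0: "x \<in> Fl 0 \<Longrightarrow> x = 0" using expand[of x] by (simp add: Fl_def)

lemma Fl_top: "2 * n \<le> i \<Longrightarrow> x \<in> Fl i" by (simp add: Fl_def)

lemma b_Fl: "j < 2 * n \<Longrightarrow> j < i \<Longrightarrow> b j \<in> Fl i"
  unfolding Fl_def
proof (intro CollectI allI impI)
  fix k assume "j < 2 * n" "j < i" "k < 2 * n" "i \<le> k"
  then show "\<beta> (b (op k)) (b j) = 0" using gram'[OF op(1), of k j] op(2)[of k] by auto
qed

lemma Fl_stable:
  assumes "\<And>v w. g (v + w) = g v + g w" "\<And>c v. g (c *s v) = c *s g v"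
    and "\<And>j. j < 2 * n \<Longrightarrow> j < i \<Longrightarrow> g (b j) \<in> Fl i'" and "x \<in> Fl i"
  shows "g x \<in> Fl i'"
proof -
  have g0: "g 0 = 0" using assms(2)[of 0 0] by simp
  have "g (\<Sum>k<N. c k *s b k) = (\<Sum>k<N. c k *s g (b k))" for N :: nat and c
    by (induction N) (simp_all add: g0 assms(1,2))
  from this[where N = "2 * n" and c = "\<lambda>k. \<beta> (b (op k)) x"]
  have "g x = (\<Sum>k<2 * n. \<beta> (b (op k)) x *s g (b k))" by (simp only: expand[symmetric])
  also have "\<dots> \<in> Fl i'"
  proof (rule subspace_sum[OF Fl_subspace])
    fix k assume "k \<in> {..<2 * n}"
    then show "\<beta> (b (op k)) x *s g (b k) \<in> Fl i'"
      using assms(3)[of k] FlD[OF assms(4), of k] by (cases "k < i") (auto simp: Fl_zero intro: Fl_scale)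
  qed
  finally show ?thesis .
qed

lemma Fl_span: "i \<le> 2 * n \<Longrightarrow> Fl i = span (b ` {..<i})"
proof
  assume i: "i \<le> 2 * n"
  show "span (b ` {..<i}) \<subseteq> Fl i" using i by (intro span_minimal Fl_subspace) (auto intro: b_Fl)
  show "Fl i \<subseteq> span (b ` {..<i})"
  proof
    fix x assume x: "x \<in> Fl i"
    have "(\<Sum>k<2 * n. \<beta> (b (op k)) x *s b k) \<in> span (b ` {..<i})"
    proof (rule span_sum)
      fix k assume "k \<in> {..<2 * n}"
      then show "\<beta> (b (op k)) x *s b k \<in> span (b ` {..<i})"
        using FlD[OF x, of k] by (cases "k < i") (auto simp: span_zero intro: span_scale span_base)
    qed
    then show "x \<in> span (b ` {..<i})" by (simp only: expand[symmetric])
  qed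
qed

lemma Fl_perp:
  assumes "i \<le> 2 * n"
  shows "x \<in> Fl i \<longleftrightarrow> (\<forall>y\<in>Fl (2 * n - i). \<beta> y x = 0)"
proof
  assume x: "x \<in> Fl i"
  have "Fl (2 * n - i) \<subseteq> {y. \<beta> y x = 0}"
    unfolding Fl_span[of "2 * n - i", simplified]
  proof (rule span_minimal)
    show "subspace {y. \<beta> y x = 0}" by (auto simp: subspace_def \<beta>_add \<beta>_scale)
    show "b ` {..<2 * n - i} \<subseteq> {y. \<beta> y x = 0}"
    proof clarify
      fix j assume j: "j < 2 * n - i"
      then have "i \<le> op j" "op j < 2 * n" "op (op j) = j" by (auto simp: op_def)
      then show "\<beta> (b j) x = 0" using FlD[OF x, of "op j"] by simp
    qed
  qed
  then show "\<forall>y\<in>Fl (2 * n - i). \<beta> y x = 0" by auto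
next
  assume *: "\<forall>y\<in>Fl (2 * n - i). \<beta> y x = 0"
  show "x \<in> Fl i" unfolding Fl_def
  proof (intro CollectI allI impI)
    fix k assume "k < 2 * n" "i \<le> k"
    then have "b (op k) \<in> Fl (2 * n - i)" by (intro b_Fl) (auto simp: op_def)
    then show "\<beta> (b (op k)) x = 0" using * by blast
  qed
qed

definition Bo :: "('v \<Rightarrow> 'v) set" where
  "Bo = {g \<in> carrier SpG. \<forall>i. \<forall>x\<in>Fl i. g x \<in> Fl i}"

lemma BoD: "g \<in> Bo \<Longrightarrow> g \<in> carrier SpG" "g \<in> Bo \<Longrightarrow> x \<in> Fl i \<Longrightarrow> g x \<in> Fl i"
  by (auto simp: Bo_def)

text \<open>The inverse of an isometry is its adjoint, so it preserves the complement of a subspace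
  that \<open>g\<close> preserves, and \<open>Fl i\<close> is the complement of
  \<open>Fl (2 * n - i)\<close>.\<close>

lemma adjoint_stable:
  assumes g: "g \<in> carrier SpG" and i: "i \<le> 2 * n" and st: "\<And>y. y \<in> Fl (2 * n - i) \<Longrightarrow> g y \<in> Fl (2 * n - i)"
    and x: "x \<in> Fl i"
  shows "(inv\<^bsub>SpG\<^esub> g) x \<in> Fl i"
  unfolding Fl_perp[OF i] using st x Fl_perp[OF i] Sp_inv_adj(2)[OF g] by auto

lemma Bo_subgroup: "subgroup Bo SpG"
proof (rule group.subgroupI[OF group_Sp])
  show "Bo \<subseteq> carrier SpG" by (auto simp: Bo_def)
  have "id \<in> Bo" using monoid.one_closed[OF group.is_monoid[OF group_Sp]] by (simp add: Bo_def)
  then show "Bo \<noteq> {}" by blast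
  fix g assume g: "g \<in> Bo"
  have "(inv\<^bsub>SpG\<^esub> g) x \<in> Fl i" if "x \<in> Fl i" for i x
  proof (cases "i \<le> 2 * n")
    case True
    show ?thesis by (rule adjoint_stable[OF BoD(1)[OF g] True BoD(2)[OF g] that])
  qed (simp add: Fl_top)
  then show "inv\<^bsub>SpG\<^esub> g \<in> Bo" using Sp_inv(1)[OF BoD(1)[OF g]] by (simp add: Bo_def)
  fix h assume "h \<in> Bo"
  then show "g \<otimes>\<^bsub>SpG\<^esub> h \<in> Bo" using g Sp_mult by (auto simp: Bo_def)
qed

lemma id_Bo: "id \<in> Bo" using subgroup.one_closed[OF Bo_subgroup] by simp

lemma BoI:
  assumes "\<And>v w. g (v + w) = g v + g w" "\<And>c v. g (c *s v) = c *s g v" "\<And>v w. \<beta> (g v) (g w) = \<beta> v w"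
    and "\<And>j. j < 2 * n \<Longrightarrow> g (b j) \<in> Fl (Suc j)"
  shows "g \<in> Bo"
proof -
  have "g x \<in> Fl i" if "x \<in> Fl i" for x i
    by (rule Fl_stable[OF assms(1,2) _ that]) (use assms(4) Fl_mono in \<open>meson Suc_leI subsetD\<close>)
  then show ?thesis using SpI[OF assms(1-3)] by (simp add: Bo_def)
qed

lemma isometryI:
  assumes "\<And>v w. g (v + w) = g v + g w" "\<And>c v. g (c *s v) = c *s g v"
    and "\<And>j k. j < 2 * n \<Longrightarrow> k < 2 * n \<Longrightarrow> \<beta> (g (b j)) (g (b k)) = \<beta> (b j) (b k)"
  shows "\<beta> (g v) (g w) = \<beta> v w"
proof -
  have g0: "g 0 = 0" using assms(2)[of 0 0] by simp
  have gs: "g (\<Sum>k<N. c k *s b k) = (\<Sum>k<N. c k *s g (b k))" for N :: nat and c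
    by (induction N) (simp_all add: g0 assms(1,2))
  have "\<beta> (g (\<Sum>k<2 * n. c k *s b k)) (g (\<Sum>k<2 * n. d k *s b k)) = \<beta> (\<Sum>k<2 * n. c k *s b k) (\<Sum>k<2 * n. d k *s b k)" for c d
    unfolding gs \<beta>_sum \<beta>_scale by (intro sum.cong refl) (simp add: assms(3))
  from this[of "\<lambda>k. \<beta> (b (op k)) v" "\<lambda>k. \<beta> (b (op k)) w"] show ?thesis by (simp only: expand[symmetric])
qed

lemma lin_eqI:
  assumes "\<And>v w. g (v + w) = g v + g w" "\<And>c v. g (c *s v) = c *s g v"
    "\<And>v w. h (v + w) = h v + h w" "\<And>c v. h (c *s v) = c *s h v"
    and "\<And>j. j < 2 * n \<Longrightarrow> g (b j) = h (b j)"
  shows "g = h"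
proof
  fix v
  have "g 0 = 0" "h 0 = 0" using assms(2)[of 0 0] assms(4)[of 0 0] by simp_all
  then have gs: "g (\<Sum>k<N. c k *s b k) = (\<Sum>k<N. c k *s g (b k))" "h (\<Sum>k<N. c k *s b k) = (\<Sum>k<N. c k *s h (b k))" for N :: nat and c
    by (induction N) (simp_all add: assms(1-4))
  have "g (\<Sum>k<2 * n. c k *s b k) = h (\<Sum>k<2 * n. c k *s b k)" for c
    unfolding gs by (intro sum.cong refl) (simp add: assms(5))
  from this[of "\<lambda>k. \<beta> (b (op k)) v"] show "g v = h v" by (simp only: expand[symmetric])
qed

lemma poly_inj:
  fixes p q :: "'k poly"
  assumes "\<And>t. t \<notin> A \<Longrightarrow> poly p t = poly q t" "finite A"
  shows "p = q"
proof (rule ccontr)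
  assume "p \<noteq> q"
  then have "finite {t. poly (p - q) t = 0}" by (intro poly_roots_finite) simp
  moreover have "UNIV \<subseteq> {t. poly (p - q) t = 0} \<union> A" using assms(1) by auto
  ultimately show False using infinite_alg_closed assms(2) by (metis finite_Un finite_subset)
qed

subsection \<open>The Borel subgroup is closed, connected and solvable\<close>

lemma Bo_closed: "closedin (subtopology zar (carrier SpG)) Bo"
proof -
  define I where "I = {(i, j). i < 2 * n \<and> j < i}"
  define F where "F = (\<lambda>(i, j) g. \<beta> (b (op i)) (g (b j)))"
  define Z where "Z = {g \<in> gl scale. \<forall>p\<in>I. F p g = 0}"
  have F: "F p \<in> polys" for p unfolding F_def by (cases p) (simp add: coord_poly[OF functional_\<beta>])
  have "gl scale - Z = (\<Union>p\<in>I. {g \<in> gl scale. F p g \<noteq> 0})" by (auto simp: Z_def)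
  moreover have "openin zar (\<Union>p\<in>I. {g \<in> gl scale. F p g \<noteq> 0})" using openin_zar[OF F] by (intro openin_Union) auto
  ultimately have "closedin zar Z" by (simp add: closedin_def topspace_zar Z_def)
  moreover have "Bo = Z \<inter> carrier SpG"
  proof
    show "Bo \<subseteq> Z \<inter> carrier SpG"
    proof
      fix g assume g: "g \<in> Bo"
      have "F (i, j) g = 0" if "i < 2 * n" "j < i" for i j
        using FlD[OF BoD(2)[OF g b_Fl[of j "Suc j"]], of i] that by (simp add: F_def)
      then show "g \<in> Z \<inter> carrier SpG" using BoD(1)[OF g] SpD(5)[OF BoD(1)[OF g]] by (auto simp: Z_def I_def)
    qed
    show "Z \<inter> carrier SpG \<subseteq> Bo"
    proof
      fix g assume g: "g \<in> Z \<inter> carrier SpG"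
      have "g (b j) \<in> Fl (Suc j)" if "j < 2 * n" for j
        using g by (auto simp: Fl_def Z_def I_def F_def)
      then show "g \<in> Bo" using g SpD[of g] by (intro BoI) auto
    qed
  qed
  ultimately show ?thesis by (auto simp: closedin_subtopology)
qed

lemma curve_poly:
  assumes "\<And>\<phi> v. functional \<phi> \<Longrightarrow> \<exists>p. \<forall>s. \<phi> (\<gamma> s v) = poly p s" "f \<in> polys"
  shows "\<exists>p. \<forall>s. f (\<gamma> s) = poly p s"
  using assms(2)
proof induction
  case (const c) show ?case by (intro exI[of _ "[:c:]"]) simp
next
  case (coord \<phi> v) then show ?case using assms(1) by (simp add: functional_iff functional_def)
next
  case (add f h)
  then obtain p q where "\<forall>s. f (\<gamma> s) = poly p s" "\<forall>s. h (\<gamma> s) = poly q s" by blast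
  then show ?case by (intro exI[of _ "p + q"]) simp
next
  case (mult f h)
  then obtain p q where "\<forall>s. f (\<gamma> s) = poly p s" "\<forall>s. h (\<gamma> s) = poly q s" by blast
  then show ?case by (intro exI[of _ "p * q"]) simp
qed

section \<open>The diagonal torus and the contraction onto it\<close>

definition diag :: "(nat \<Rightarrow> 'k) \<Rightarrow> 'v \<Rightarrow> 'v" where
  "diag t v = (\<Sum>j<2 * n. (\<beta> (b (op j)) v * t j) *s b j)"

lemma diag_lin: "diag t (v + w) = diag t v + diag t w" "diag t (c *s v) = c *s diag t v"
  by (simp_all add: diag_def \<beta>_add \<beta>_scale distrib_right scale_left_distrib sum.distrib scale_sum_right mult.assoc)

lemma coord_b: "i < 2 * n \<Longrightarrow> j < 2 * n \<Longrightarrow> \<beta> (b (op i)) (b j) = (if i = j then 1 else 0)"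
  using gram'[OF op(1)[of i], of j] op(2)[of i] by auto

lemma diag_b: "j < 2 * n \<Longrightarrow> diag t (b j) = t j *s b j"
proof -
  assume j: "j < 2 * n"
  have "diag t (b j) = (\<Sum>k<2 * n. if k = j then t j *s b j else 0)"
    unfolding diag_def using j by (intro sum.cong) (auto simp: coord_b)
  then show ?thesis using j by simp
qed

lemma diag_Bo:
  assumes "\<And>j. j < 2 * n \<Longrightarrow> t j * t (op j) = 1"
  shows "diag t \<in> Bo"
proof (rule BoI[OF diag_lin isometryI[OF diag_lin]])
  fix j k assume jk: "j < 2 * n" "k < 2 * n"
  then show "\<beta> (diag t (b j)) (diag t (b k)) = \<beta> (b j) (b k)"
    using assms[of j] by (simp add: diag_b \<beta>_scale gram' mult.commute)
next
  fix j assume "j < 2 * n"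
  then show "diag t (b j) \<in> Fl (Suc j)" by (simp add: diag_b Fl_scale b_Fl)
qed

text \<open>Conjugation by \<open>diag (s\<^sup>-\<^sup>i)\<close> scales the \<open>(i, j)\<close> entry by \<open>s\<^bsup>j-i\<^esup>\<close>; at \<open>s = 0\<close> only the diagonal survives.\<close>

definition contract :: "('v \<Rightarrow> 'v) \<Rightarrow> 'k \<Rightarrow> 'v \<Rightarrow> 'v" where
  "contract g s v = (\<Sum>j<2 * n. \<beta> (b (op j)) v *s (\<Sum>i\<le>j. (\<beta> (b (op i)) (g (b j)) * s ^ (j - i)) *s b i))"

lemma contract_lin: "contract g s (v + w) = contract g s v + contract g s w" "contract g s (c *s v) = c *s contract g s v"
proof -
  show "contract g s (v + w) = contract g s v + contract g s w"
    unfolding contract_def sum.distrib[symmetric] by (intro sum.cong refl) (simp only: \<beta>_add scale_left_distrib)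
  show "contract g s (c *s v) = c *s contract g s v"
    unfolding contract_def by (simp only: \<beta>_scale scale_sum_right scale_scale mult.assoc)
qed

lemma \<beta>_sum_sum:
  "\<beta> (\<Sum>i\<in>A. c i *s x i) (\<Sum>l\<in>B. d l *s y l) = (\<Sum>i\<in>A. \<Sum>l\<in>B. c i * d l * \<beta> (x i) (y l))"
  unfolding \<beta>_sum(1) \<beta>_scale(1) by (simp only: \<beta>_sum(2) \<beta>_scale(2) sum_distrib_left mult.assoc)

lemma contract_b:
  assumes "j < 2 * n"
  shows "contract g s (b j) = (\<Sum>i\<le>j. (\<beta> (b (op i)) (g (b j)) * s ^ (j - i)) *s b i)"
proof -
  have "contract g s (b j) = (\<Sum>k<2 * n. if k = j then (\<Sum>i\<le>j. (\<beta> (b (op i)) (g (b j)) * s ^ (j - i)) *s b i) else 0)"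
    unfolding contract_def using assms by (intro sum.cong) (auto simp: coord_b)
  then show ?thesis using assms by simp
qed

lemma Bo_column:
  assumes "g \<in> Bo" "j < 2 * n"
  shows "g (b j) = (\<Sum>i\<le>j. \<beta> (b (op i)) (g (b j)) *s b i)"
proof -
  have "g (b j) = (\<Sum>i<2 * n. \<beta> (b (op i)) (g (b j)) *s b i)" by (rule expand)
  also have "\<dots> = (\<Sum>i\<le>j. \<beta> (b (op i)) (g (b j)) *s b i)"
    using assms(2) FlD[OF BoD(2)[OF assms(1) b_Fl[of j "Suc j"]]] by (intro sum.mono_neutral_right) auto
  finally show ?thesis .
qed

text \<open>A nonzero term of the pairing has \<open>i + l + 1 = 2 * n\<close>, and then
  \<open>(j - i) + (k - l)\<close> is the constant \<open>e\<close>. So the pairing is scaled by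
  \<open>s ^ e\<close>, which is 1 in the only case where the pairing is nonzero.\<close>

lemma contract_Bo:
  assumes g: "g \<in> Bo"
  shows "contract g s \<in> Bo"
proof (rule BoI[OF contract_lin isometryI[OF contract_lin]])
  fix j k assume jk: "j < 2 * n" "k < 2 * n"
  define G where "G = (\<lambda>i j. \<beta> (b (op i)) (g (b j)))"
  define e where "e = j + k + 1 - 2 * n"
  have "\<beta> (contract g s (b j)) (contract g s (b k)) =
      (\<Sum>i\<le>j. \<Sum>l\<le>k. (G i j * s ^ (j - i)) * (G l k * s ^ (k - l)) * \<beta> (b i) (b l))"
    unfolding contract_b[OF jk(1)] contract_b[OF jk(2)] \<beta>_sum_sum G_def ..
  also have "\<dots> = (\<Sum>i\<le>j. \<Sum>l\<le>k. s ^ e * (G i j * G l k * \<beta> (b i) (b l)))"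
  proof (intro sum.cong refl)
    fix i l assume il: "i \<in> {..j}" "l \<in> {..k}"
    show "(G i j * s ^ (j - i)) * (G l k * s ^ (k - l)) * \<beta> (b i) (b l) = s ^ e * (G i j * G l k * \<beta> (b i) (b l))"
    proof (cases "i + l + 1 = 2 * n")
      case True
      then have "e = (j - i) + (k - l)" using il by (simp add: e_def)
      then show ?thesis by (simp add: power_add mult_ac)
    next
      case False
      then have "\<beta> (b i) (b l) = 0" using il jk gram[of i l] by simp
      then show ?thesis by simp
    qed
  qed
  also have "\<dots> = s ^ e * \<beta> (g (b j)) (g (b k))"
  proof -
    have "g (b j) = (\<Sum>i\<le>j. G i j *s b i)" "g (b k) = (\<Sum>i\<le>k. G i k *s b i)"
      using Bo_column[OF g jk(1)] Bo_column[OF g jk(2)] by (simp_all only: G_def)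
    then show ?thesis by (simp only: \<beta>_sum_sum sum_distrib_left)
  qed
  also have "\<beta> (g (b j)) (g (b k)) = \<beta> (b j) (b k)" by (rule SpD[OF BoD(1)[OF g]])
  also have "s ^ e * \<beta> (b j) (b k) = \<beta> (b j) (b k)" using jk by (simp add: gram e_def)
  finally show "\<beta> (contract g s (b j)) (contract g s (b k)) = \<beta> (b j) (b k)" .
next
  fix j assume j: "j < 2 * n"
  show "contract g s (b j) \<in> Fl (Suc j)"
    unfolding contract_b[OF j] using j by (intro subspace_sum[OF Fl_subspace] Fl_scale b_Fl) auto
qed

lemma contract_1:
  assumes g: "g \<in> Bo"
  shows "contract g 1 = g"
proof (rule lin_eqI[OF contract_lin SpD(1,2)[OF BoD(1)[OF g]]])
  fix j assume j: "j < 2 * n"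
  show "contract g 1 (b j) = g (b j)" using Bo_column[OF g j] contract_b[OF j, of g 1] by simp
qed

lemma contract_0: "contract g 0 = diag (\<lambda>j. \<beta> (b (op j)) (g (b j)))"
proof (rule lin_eqI[OF contract_lin diag_lin])
  fix j assume j: "j < 2 * n"
  have "contract g 0 (b j) = (\<Sum>i\<le>j. if i = j then \<beta> (b (op j)) (g (b j)) *s b j else 0)"
    unfolding contract_b[OF j] by (intro sum.cong) auto
  then show "contract g 0 (b j) = diag (\<lambda>j. \<beta> (b (op j)) (g (b j))) (b j)" using diag_b[OF j] by simp
qed

lemma contract_connected: "connectedin zar (range (contract g))" if g: "g \<in> Bo"
proof -
  have "connectedin zar (contract g ` UNIV)"
  proof (rule connected_curve)
    show "contract g s \<in> gl scale" for s by (rule SpD[OF BoD(1)[OF contract_Bo[OF g]]])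
    fix f assume f: "f \<in> polys"
    have "\<exists>p. \<forall>s. \<phi> (contract g s v) = poly p s" if \<phi>: "functional \<phi>" for \<phi> v
    proof -
      define p where "p = (\<Sum>j<2 * n. \<Sum>i\<le>j. monom (\<beta> (b (op j)) v * \<beta> (b (op i)) (g (b j)) * \<phi> (b i)) (j - i))"
      have "\<phi> (contract g s v) = poly p s" for s
        unfolding contract_def functional_sum[OF \<phi>] p_def Polynomial.poly_sum poly_monom
        by (simp add: sum_distrib_left mult_ac)
      then show ?thesis by blast
    qed
    then obtain p where "\<forall>s. f (contract g s) = poly p s" using curve_poly[OF _ f, of "contract g"] by blast
    then show "\<exists>p. \<forall>s\<in>UNIV. f (contract g s) = 0 \<longleftrightarrow> poly p s = 0" by auto
  qed simp
  then show ?thesis .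
qed

text \<open>The one-parameter torus with entry \<open>1 + s\<close> at \<open>i\<close> and its
  inverse at \<open>op i\<close>, shifted so that \<open>s = 0\<close> gives the identity;
  \<open>s = 1\<close> has to be avoided. Written as identity plus correction, it shows its
  derivative at 0.\<close>

definition tor :: "nat \<Rightarrow> 'k \<Rightarrow> 'v \<Rightarrow> 'v" where
  "tor i s v = v + ((s * \<beta> (b (op i)) v) *s b i + ((inverse (1 + s) + 1) * \<beta> (b i) v) *s b (op i))"

lemma tor_lin: "tor i s (v + w) = tor i s v + tor i s w" "tor i s (c *s v) = c *s tor i s v"
  by (simp_all add: tor_def \<beta>_add \<beta>_scale distrib_left scale_left_distrib scale_right_distrib mult_ac add_ac)

lemma tor_diag:
  assumes "i < n"
  shows "tor i s = diag (\<lambda>j. if j = i then 1 + s else if j = op i then inverse (1 + s) else 1)"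
proof (rule lin_eqI[OF tor_lin diag_lin])
  fix j assume j: "j < 2 * n"
  have i: "i < 2 * n" "op i < 2 * n" "i \<noteq> op i" using assms by (auto simp: op_def)
  have "\<beta> (b (op i)) (b j) = (if j = i then 1 else 0)" "\<beta> (b i) (b j) = (if j = op i then 1 else 0)"
    using coord_b[OF i(1) j] gram'[OF i(1) j] by auto
  then have "tor i s (b j) = (if j = i then b i + s *s b i else if j = op i then b j + (inverse (1 + s) + 1) *s b j else b j)"
    using i(3) by (simp add: tor_def)
  then show "tor i s (b j) = diag (\<lambda>j. if j = i then 1 + s else if j = op i then inverse (1 + s) else 1) (b j)"
    unfolding diag_b[OF j] using i(3) by (simp add: scale_left_distrib add_ac)
qed

lemma one_plus_eq_0: "1 + s = 0 \<longleftrightarrow> s = (1 :: 'k)" using sum_eq_0_iff[of 1 s] by auto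

lemma tor_Bo:
  assumes "i < n" "s \<noteq> 1"
  shows "tor i s \<in> Bo"
proof -
  have "1 + s \<noteq> 0" using assms(2) one_plus_eq_0 by simp
  then show ?thesis unfolding tor_diag[OF assms(1)] using assms(1) op(2) by (intro diag_Bo) (auto simp: op_def)
qed

text \<open>The torus curve agrees to first order with the line through the identity in direction
  \<open>sym (b i) (b (op i))\<close>; \<open>(1 + s)\<^sup>N\<close> clears denominators.\<close>

lemma tor_curve:
  assumes i: "i < n" and f: "f \<in> polys"
  shows "\<exists>N p r. (\<forall>s. f (\<lambda>v. v + s *s sym (b i) (b (op i)) v) = poly p s) \<and>
    (\<forall>s. s \<noteq> 1 \<longrightarrow> (1 + s) ^ N * f (tor i s) = (1 + s) ^ N * poly p s + s\<^sup>2 * poly r s)"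
  using f
proof induction
  case (const c)
  show ?case by (rule exI[of _ 0], rule exI[of _ "[:c:]"], rule exI[of _ 0]) simp
next
  case (coord \<phi> v)
  then have \<phi>: "\<phi> (x + y) = \<phi> x + \<phi> y" "\<phi> (c *s x) = c * \<phi> x" for x y c by (simp_all add: functional_iff)
  define a where "a = \<beta> (b (op i)) v * \<phi> (b i)"
  define d where "d = \<beta> (b i) v * \<phi> (b (op i))"
  have "\<phi> (v + s *s sym (b i) (b (op i)) v) = poly [:\<phi> v, a + d:] s" for s
    by (simp add: sym_def \<phi> a_def d_def algebra_simps)
  moreover have "(1 + s) ^ 1 * \<phi> (tor i s v) = (1 + s) ^ 1 * poly [:\<phi> v, a + d:] s + s\<^sup>2 * poly [:d:] s" if "s \<noteq> 1" for s
  proof -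
    have "1 + s \<noteq> 0" using that one_plus_eq_0 by simp
    then have "(1 + s) * (inverse (1 + s) + 1) = s" by (simp add: distrib_left)
    then have "(1 + s) * \<phi> (tor i s v) = (1 + s) * (\<phi> v + s * a) + s * d"
      by (simp only: tor_def \<phi> a_def d_def) (simp only: distrib_left mult.assoc[symmetric], simp only: mult_ac add_ac)
    also have "\<dots> = (1 + s) * (\<phi> v + s * (a + d)) + s\<^sup>2 * d"
      by (simp add: distrib_left distrib_right power2_eq_square mult_ac add_ac)
    finally show ?thesis by simp
  qed
  ultimately show ?case by (intro exI conjI allI impI)
next
  case (add f h)
  from add.IH(1) obtain N p r where
    1: "\<forall>s. f (\<lambda>v. v + s *s sym (b i) (b (op i)) v) = poly p s"
      "\<forall>s. s \<noteq> 1 \<longrightarrow> (1 + s) ^ N * f (tor i s) = (1 + s) ^ N * poly p s + s\<^sup>2 * poly r s"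
    by (elim exE conjE)
  from add.IH(2) obtain N' p' r' where
    2: "\<forall>s. h (\<lambda>v. v + s *s sym (b i) (b (op i)) v) = poly p' s"
      "\<forall>s. s \<noteq> 1 \<longrightarrow> (1 + s) ^ N' * h (tor i s) = (1 + s) ^ N' * poly p' s + s\<^sup>2 * poly r' s"
    by (elim exE conjE)
  show ?case
  proof (intro exI conjI allI impI)
    show "f (\<lambda>v. v + s *s sym (b i) (b (op i)) v) + h (\<lambda>v. v + s *s sym (b i) (b (op i)) v) = poly (p + p') s" for s
      by (simp only: 1(1) 2(1) poly_add poly_mult)
    fix s :: 'k assume s: "s \<noteq> 1"
    have "(1 + s) ^ (N + N') * (f (tor i s) + h (tor i s)) =
        (1 + s) ^ N' * ((1 + s) ^ N * f (tor i s)) + (1 + s) ^ N * ((1 + s) ^ N' * h (tor i s))"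
      by (simp add: power_add algebra_simps)
    also have "\<dots> = (1 + s) ^ (N + N') * poly (p + p') s + s\<^sup>2 * poly ([:1, 1:] ^ N' * r + [:1, 1:] ^ N * r') s"
      unfolding 1(2)[rule_format, OF s] 2(2)[rule_format, OF s] by (simp add: power_add algebra_simps poly_power)
    finally show "(1 + s) ^ (N + N') * (f (tor i s) + h (tor i s)) =
        (1 + s) ^ (N + N') * poly (p + p') s + s\<^sup>2 * poly ([:1, 1:] ^ N' * r + [:1, 1:] ^ N * r') s" .
  qed
next
  case (mult f h)
  from mult.IH(1) obtain N p r where
    1: "\<forall>s. f (\<lambda>v. v + s *s sym (b i) (b (op i)) v) = poly p s"
      "\<forall>s. s \<noteq> 1 \<longrightarrow> (1 + s) ^ N * f (tor i s) = (1 + s) ^ N * poly p s + s\<^sup>2 * poly r s"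
    by (elim exE conjE)
  from mult.IH(2) obtain N' p' r' where
    2: "\<forall>s. h (\<lambda>v. v + s *s sym (b i) (b (op i)) v) = poly p' s"
      "\<forall>s. s \<noteq> 1 \<longrightarrow> (1 + s) ^ N' * h (tor i s) = (1 + s) ^ N' * poly p' s + s\<^sup>2 * poly r' s"
    by (elim exE conjE)
  show ?case
  proof (intro exI conjI allI impI)
    show "f (\<lambda>v. v + s *s sym (b i) (b (op i)) v) * h (\<lambda>v. v + s *s sym (b i) (b (op i)) v) = poly (p * p') s" for s
      by (simp only: 1(1) 2(1) poly_add poly_mult)
    fix s :: 'k assume s: "s \<noteq> 1"
    have "(1 + s) ^ (N + N') * (f (tor i s) * h (tor i s)) =
        ((1 + s) ^ N * f (tor i s)) * ((1 + s) ^ N' * h (tor i s))"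
      by (simp add: power_add mult_ac)
    also have "\<dots> = (1 + s) ^ (N + N') * poly (p * p') s +
        s\<^sup>2 * poly ([:1, 1:] ^ N * p * r' + [:1, 1:] ^ N' * p' * r + [:0, 0, 1:] * r * r') s"
      unfolding 1(2)[rule_format, OF s] 2(2)[rule_format, OF s] by (simp add: power_add algebra_simps poly_power power2_eq_square)
    finally show "(1 + s) ^ (N + N') * (f (tor i s) * h (tor i s)) = (1 + s) ^ (N + N') * poly (p * p') s +
        s\<^sup>2 * poly ([:1, 1:] ^ N * p * r' + [:1, 1:] ^ N' * p' * r + [:0, 0, 1:] * r * r') s" .
  qed
qed

lemma tor_joined:
  assumes i: "i < n" and s: "s \<noteq> 1"
  shows "joined Bo (tor i s)"
proof -
  have "connectedin zar (tor i ` (- {1}))"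
  proof (rule connected_curve)
    show "tor i s \<in> gl scale" if "s \<in> - {1}" for s using SpD(5)[OF BoD(1)[OF tor_Bo[OF i]]] that by simp
    fix f assume "f \<in> polys"
    then obtain N p r where *: "\<And>s. s \<noteq> 1 \<Longrightarrow> (1 + s) ^ N * f (tor i s) = (1 + s) ^ N * poly p s + s\<^sup>2 * poly r s"
      using tor_curve[OF i] by metis
    have "f (tor i s) = 0 \<longleftrightarrow> poly ([:1, 1:] ^ N * p + [:0, 0, 1:] * r) s = 0" if "s \<noteq> 1" for s
    proof -
      have "1 + s \<noteq> 0" using that one_plus_eq_0 by simp
      moreover have eq: "poly ([:1, 1:] ^ N * p + [:0, 0, 1:] * r) s = (1 + s) ^ N * f (tor i s)"
        unfolding *[OF that] by (simp add: poly_power power2_eq_square)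
      ultimately show ?thesis unfolding eq by simp
    qed
    then show "\<exists>p. \<forall>s\<in>- {1}. f (tor i s) = 0 \<longleftrightarrow> poly p s = 0" by blast
  qed simp
  moreover have "id \<in> tor i ` (- {1})" by (rule image_eqI[of _ _ 0]) (auto simp: tor_def)
  moreover have "tor i s \<in> tor i ` (- {1})" using s by blast
  moreover have "tor i ` (- {1}) \<subseteq> Bo" using tor_Bo[OF i] by auto
  ultimately show ?thesis unfolding joined_def by blast
qed

text \<open>A diagonal isometry is a product of one-parameter tori, one for each pair
  \<open>i\<close>, \<open>op i\<close>; the factor at \<open>m\<close> has parameter
  \<open>t m + 1\<close>.\<close>

lemma diag_joined:
  assumes t: "\<And>j. j < 2 * n \<Longrightarrow> t j * t (op j) = 1"
  shows "joined Bo (diag t)"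
proof -
  define tm where "tm = (\<lambda>m j. if j < m \<or> op j < m then t j else 1)"
  have "m \<le> n \<Longrightarrow> joined Bo (diag (tm m))" for m
  proof (induction m)
    case 0
    have "diag (tm 0) = id" by (rule lin_eqI[OF diag_lin]) (simp_all add: diag_b tm_def)
    moreover have "joined Bo id"
      unfolding joined_def using SpD(5)[OF BoD(1)[OF id_Bo]] id_Bo by (intro exI[of _ "{id}"]) (simp add: topspace_zar)
    ultimately show ?case by (simp only:)
  next
    case (Suc m)
    define s where "s = t m + 1"
    have m: "m < n" "m < 2 * n" using Suc.prems by auto
    have tt: "t m * t (op m) = 1" using t m(2) by simp
    have "s \<noteq> 1" using tt by (auto simp: s_def)
    have s1: "1 + s = t m" by (simp add: s_def add.commute)
    have inv: "inverse (t m) = t (op m)" using tt by (metis inverse_unique)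
    have "diag (tm (Suc m)) = diag (tm m) \<circ> tor m s"
      unfolding tor_diag[OF m(1)]
    proof (rule lin_eqI[OF diag_lin])
      fix j assume j: "j < 2 * n"
      have "tm (Suc m) j = tm m j * (if j = m then 1 + s else if j = op m then inverse (1 + s) else 1)"
        unfolding s1 inv tm_def using m j by (auto simp: op_def)
      then show "diag (tm (Suc m)) (b j) =
          (diag (tm m) \<circ> diag (\<lambda>j. if j = m then 1 + s else if j = op m then inverse (1 + s) else 1)) (b j)"
        using j by (simp add: diag_b diag_lin mult.commute)
    qed (simp_all add: diag_lin)
    moreover have "joined Bo (diag (tm m))" using Suc by simp
    ultimately show ?case using joined_mult[OF Bo_subgroup _ tor_joined[OF m(1) \<open>s \<noteq> 1\<close>]] by (simp only:)
  qed
  then have "joined Bo (diag (tm n))" by simp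
  moreover have "diag (tm n) = diag t"
    by (rule lin_eqI[OF diag_lin diag_lin]) (auto simp: diag_b tm_def op_def)
  ultimately show ?thesis by simp
qed

text \<open>The curve \<open>contract g\<close> runs from the diagonal part of \<open>g\<close> at
  \<open>s = 0\<close> to \<open>g\<close> at \<open>s = 1\<close>, and \<open>diag_joined\<close>
  connects the diagonal part with the identity.\<close>

lemma Bo_connected: "connectedin zar Bo"
proof (rule joined_connected[OF id_Bo])
  fix g assume g: "g \<in> Bo"
  define t where "t = (\<lambda>j. \<beta> (b (op j)) (g (b j)))"
  have dB: "diag t \<in> Bo" using contract_Bo[OF g, of 0] by (simp add: contract_0 t_def)
  have "t j * t (op j) = 1" if j: "j < 2 * n" for j
    using SpD(3)[OF BoD(1)[OF dB], of "b j" "b (op j)"] j op(1)[OF j] by (simp add: diag_b \<beta>_scale gram' mult.commute)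
  then have "joined Bo (diag t)" by (rule diag_joined)
  then obtain K where K: "connectedin zar K" "id \<in> K" "diag t \<in> K" "K \<subseteq> Bo" unfolding joined_def by blast
  have "contract g 0 \<in> K" using K(3) by (simp add: contract_0 t_def)
  then have "connectedin zar (K \<union> range (contract g))"
    using K(1) contract_connected[OF g] by (intro connectedin_Un) auto
  moreover have "g \<in> range (contract g)" using contract_1[OF g] by (metis rangeI)
  ultimately show "joined Bo g" unfolding joined_def using K contract_Bo[OF g]
    by (intro exI[of _ "K \<union> range (contract g)"]) auto
qed

text \<open>The members of the group for which \<open>g - 1\<close> moves the flag down by
  \<open>k\<close> steps; \<open>k = 0\<close> gives all of \<open>Bo\<close>. Truncation in
  \<open>i - k\<close> is harmless because \<open>Fl 0\<close> is zero.\<close>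

definition Uk :: "nat \<Rightarrow> ('v \<Rightarrow> 'v) set" where
  "Uk k = {g \<in> Bo. \<forall>i. \<forall>x\<in>Fl i. g x + x \<in> Fl (i - k)}"

lemma Uk_subgroup: "subgroup (Uk k) SpG"
proof (rule group.subgroupI[OF group_Sp])
  show "Uk k \<subseteq> carrier SpG" using BoD(1) by (auto simp: Uk_def)
  have "id \<in> Uk k" using id_Bo by (simp add: Uk_def Fl_zero)
  then show "Uk k \<noteq> {}" by blast
  fix g assume g: "g \<in> Uk k"
  then have gB: "g \<in> Bo" by (simp add: Uk_def)
  have igB: "inv\<^bsub>SpG\<^esub> g \<in> Bo" by (rule subgroup.m_inv_closed[OF Bo_subgroup gB])
  have "(inv\<^bsub>SpG\<^esub> g) x + x \<in> Fl (i - k)" if x: "x \<in> Fl i" for x i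
  proof -
    have "(inv\<^bsub>SpG\<^esub> g) (g x + x) \<in> Fl (i - k)" using BoD(2)[OF igB] g x by (simp add: Uk_def)
    then show ?thesis using SpD(1)[OF BoD(1)[OF igB]] Sp_inv(3)[OF BoD(1)[OF gB]] by (simp add: add.commute)
  qed
  then show "inv\<^bsub>SpG\<^esub> g \<in> Uk k" using igB by (simp add: Uk_def)
  fix h assume h: "h \<in> Uk k"
  then have hB: "h \<in> Bo" by (simp add: Uk_def)
  have "g (h x) + x \<in> Fl (i - k)" if x: "x \<in> Fl i" for x i
  proof -
    have "g (h x) + h x \<in> Fl (i - k)" using g BoD(2)[OF hB x] by (simp add: Uk_def)
    moreover have "h x + x \<in> Fl (i - k)" using h x by (simp add: Uk_def)
    ultimately have "(g (h x) + h x) + (h x + x) \<in> Fl (i - k)" by (rule Fl_add)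
    then show ?thesis by (simp add: add.assoc)
  qed
  then show "g \<otimes>\<^bsub>SpG\<^esub> h \<in> Uk k" using subgroup.m_closed[OF Bo_subgroup gB hB] by (simp add: Uk_def)
qed

lemma Bo_scalar:
  assumes g: "g \<in> Bo"
  obtains c where "\<And>x. x \<in> Fl i \<Longrightarrow> g x + c *s x \<in> Fl (i - 1)"
proof (cases "i = 0 \<or> 2 * n < i")
  case True
  then show thesis
  proof
    assume "i = 0"
    then have "g x + 0 *s x \<in> Fl (i - 1)" if "x \<in> Fl i" for x using BoD(2)[OF g that] by simp
    with that show thesis by blast
  next
    assume "2 * n < i"
    then have "g x + 0 *s x \<in> Fl (i - 1)" for x by (intro Fl_top) simp
    with that show thesis by blast
  qed
next
  case False
  then obtain j where j: "i = Suc j" "j < 2 * n" by (cases i) auto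
  define c where "c = \<beta> (b (op j)) (g (b j))"
  note gl = SpD(1,2)[OF BoD(1)[OF g]]
  have "g x + c *s x \<in> Fl (i - 1)" if "x \<in> Fl i" for x
  proof (rule Fl_stable[of "\<lambda>x. g x + c *s x" i "i - 1" x, OF _ _ _ that])
    show "g (v + w) + c *s (v + w) = g v + c *s v + (g w + c *s w)" for v w by (simp add: gl scale_right_distrib add_ac)
    show "g (d *s v) + c *s d *s v = d *s (g v + c *s v)" for d v by (simp add: gl scale_right_distrib mult.commute)
    fix k assume k: "k < 2 * n" "k < i"
    show "g (b k) + c *s b k \<in> Fl (i - 1)"
    proof (cases "k = j")
      case True
      have "\<beta> (b (op l)) (g (b j) + c *s b j) = 0" if l: "l < 2 * n" "j \<le> l" for l
      proof (cases "l = j")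
        case True then show ?thesis using j by (simp add: \<beta>_add \<beta>_scale coord_b c_def)
      next
        case False
        then have "\<beta> (b (op l)) (g (b j)) = 0" using l j FlD[OF BoD(2)[OF g b_Fl[of j "Suc j"]], of l] by simp
        then show ?thesis using False l j by (simp add: \<beta>_add \<beta>_scale coord_b)
      qed
      then show ?thesis using True j by (simp add: Fl_def)
    next
      case False
      then have "b k \<in> Fl (i - 1)" using k j by (intro b_Fl) auto
      then show ?thesis using BoD(2)[OF g] by (intro Fl_add Fl_scale) auto
    qed
  qed
  with that show thesis by blast
qed

text \<open>The sum is \<open>g h - h g\<close>. For \<open>k = 0\<close> it vanishes on the lines
  \<open>Fl i\<close> modulo \<open>Fl (i - 1)\<close>, where both act by scalars. For
  \<open>k \<ge> 1\<close> it is the commutator of \<open>g - 1\<close> and \<open>h - 1\<close>,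
  which lowers the flag by \<open>2 * k \<ge> k + 1\<close>.\<close>

lemma Uk_commutator:
  assumes g: "g \<in> Uk k" and h: "h \<in> Uk k" and y: "y \<in> Fl i"
  shows "g (h y) + h (g y) \<in> Fl (i - Suc k)"
proof -
  have gB: "g \<in> Bo" and hB: "h \<in> Bo" using g h by (simp_all add: Uk_def)
  note gl = SpD(1,2)[OF BoD(1)[OF gB]] and hl = SpD(1,2)[OF BoD(1)[OF hB]]
  show ?thesis
  proof (cases "k = 0")
    case True
    obtain c where c: "\<And>x. x \<in> Fl i \<Longrightarrow> g x + c *s x \<in> Fl (i - 1)" using Bo_scalar[OF gB] by blast
    obtain d where d: "\<And>x. x \<in> Fl i \<Longrightarrow> h x + d *s x \<in> Fl (i - 1)" using Bo_scalar[OF hB] by blast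
    have "g (h y + d *s y) + (d *s (g y + c *s y) + (h (g y + c *s y) + c *s (h y + d *s y))) \<in> Fl (i - 1)"
      by (rule Fl_add[OF BoD(2)[OF gB d[OF y]] Fl_add[OF Fl_scale[OF c[OF y]]
            Fl_add[OF BoD(2)[OF hB c[OF y]] Fl_scale[OF d[OF y]]]]])
    moreover have "g (h y + d *s y) + (d *s (g y + c *s y) + (h (g y + c *s y) + c *s (h y + d *s y))) = g (h y) + h (g y)"
      by (simp add: gl hl scale_right_distrib mult.commute add_ac)
    ultimately show ?thesis using True by simp
  next
    case False
    define x where "x = h y + y"
    define x' where "x' = g y + y"
    have "x \<in> Fl (i - k)" "x' \<in> Fl (i - k)" using g h y by (simp_all add: Uk_def x_def x'_def)
    then have "g x + x \<in> Fl (i - k - k)" "h x' + x' \<in> Fl (i - k - k)" using g h by (simp_all only: Uk_def) blast+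
    then have "(g x + x) + (h x' + x') \<in> Fl (i - k - k)" by (rule Fl_add)
    moreover have "(g x + x) + (h x' + x') = g (h y) + h (g y)"
      by (simp add: x_def x'_def gl hl add_ac)
    moreover have "Fl (i - k - k) \<subseteq> Fl (i - Suc k)" using False by (intro Fl_mono) simp
    ultimately show ?thesis by auto
  qed
qed

lemma Uk_derived: "derived SpG (Uk k) \<subseteq> Uk (Suc k)"
proof -
  interpret G: group SpG by (rule group_Sp)
  have "derived_set SpG (Uk k) \<subseteq> Uk (Suc k)"
  proof
    fix x assume "x \<in> derived_set SpG (Uk k)"
    then obtain g h where gh: "g \<in> Uk k" "h \<in> Uk k" and x: "x = g \<circ> h \<circ> inv\<^bsub>SpG\<^esub> g \<circ> inv\<^bsub>SpG\<^esub> h" by auto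
    have B: "g \<in> Bo" "h \<in> Bo" using gh by (simp_all add: Uk_def)
    have iB: "inv\<^bsub>SpG\<^esub> g \<in> Bo" "inv\<^bsub>SpG\<^esub> h \<in> Bo" using subgroup.m_inv_closed[OF Bo_subgroup] B by auto
    have "x \<in> Bo" unfolding x using B iB subgroup.m_closed[OF Bo_subgroup] by simp
    moreover have "x v + v \<in> Fl (i - Suc k)" if v: "v \<in> Fl i" for v i
    proof -
      \<comment> \<open>With this \<open>y\<close> the sum \<open>x v + v\<close> equals
        \<open>g (h y) + h (g y)\<close>.\<close>
      define y where "y = (inv\<^bsub>SpG\<^esub> g) ((inv\<^bsub>SpG\<^esub> h) v)"
      have "y \<in> Fl i" unfolding y_def using BoD(2) iB v by blast
      then have "g (h y) + h (g y) \<in> Fl (i - Suc k)" by (rule Uk_commutator[OF gh])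
      moreover have "h (g y) = v" by (simp add: y_def Sp_inv[OF BoD(1)[OF B(1)]] Sp_inv[OF BoD(1)[OF B(2)]])
      ultimately show ?thesis by (simp add: x y_def)
    qed
    ultimately show "x \<in> Uk (Suc k)" by (simp add: Uk_def)
  qed
  then show ?thesis unfolding derived_def by (rule G.generate_subgroup_incl[OF _ Uk_subgroup])
qed

lemma Bo_solvable: "solvable (SpG\<lparr>carrier := Bo\<rparr>)"
proof -
  interpret G: group SpG by (rule group_Sp)
  have "Bo = Uk 0" using BoD(2) by (auto simp: Uk_def intro: Fl_add)
  have "(derived SpG ^^ k) Bo \<subseteq> Uk k" for k
  proof (induction k)
    case (Suc k)
    have "derived SpG ((derived SpG ^^ k) Bo) \<subseteq> derived SpG (Uk k)" by (rule G.mono_derived[OF Suc])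
    then show ?case using Uk_derived[of k] by auto
  qed (simp add: \<open>Bo = Uk 0\<close>)
  moreover have "Uk (2 * n) \<subseteq> {id}"
  proof
    fix g assume g: "g \<in> Uk (2 * n)"
    have "g x = x" for x
    proof -
      have "g x + x \<in> Fl (2 * n - 2 * n)" using g Fl_top[OF order_refl] unfolding Uk_def by blast
      then have "g x + x = 0" by (intro Fl_0) simp
      then show ?thesis by (simp add: vsum_eq_0_iff)
    qed
    then show "g \<in> {id}" by auto
  qed
  ultimately have sub: "(derived SpG ^^ (2 * n)) Bo \<subseteq> {id}" by blast
  have "\<one>\<^bsub>SpG\<^esub> \<in> (derived SpG ^^ (2 * n)) Bo"
    by (rule subgroup.one_closed[OF G.exp_of_derived_is_subgroup[OF Bo_subgroup]])
  then have eq: "(derived SpG ^^ (2 * n)) Bo = {id}" using sub by auto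
  have "(derived (SpG\<lparr>carrier := Bo\<rparr>) ^^ (2 * n)) (carrier (SpG\<lparr>carrier := Bo\<rparr>)) = {\<one>\<^bsub>SpG\<lparr>carrier := Bo\<rparr>\<^esub>}"
    using eq by (simp add: derived_seq_subgroup[OF Bo_subgroup])
  moreover have "group (SpG\<lparr>carrier := Bo\<rparr>)" by (rule G.subgroup_imp_group[OF Bo_subgroup])
  ultimately show ?thesis using group.solvable_iff_trivial_derived_seq by blast
qed

lemma Bo_ccs: "closed_connected_solvable scale SpG Bo"
  unfolding closed_connected_solvable_def
  using Bo_subgroup Bo_closed Bo_connected Bo_solvable by blast

subsection \<open>The Lie algebra of the Borel subgroup\<close>

lemma deriv_at_id_eq:
  assumes "\<And>t. poly p t = f (\<lambda>v. v + t *s x v)"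
  shows "deriv_at_id scale f x = coeff p 1"
proof -
  have "(THE p. \<forall>t. poly p t = f (\<lambda>v. v + t *s x v)) = p"
  proof (rule the_equality)
    fix q assume "\<forall>t. poly q t = f (\<lambda>v. v + t *s x v)"
    then show "q = p" using assms by (intro poly_inj[of "{}"]) auto
  qed (use assms in blast)
  then show ?thesis by (simp add: deriv_at_id_def poly_0_coeff_0 coeff_pderiv)
qed

text \<open>Obtained by differentiating the equations of the group: invariance of
  \<open>\<beta>\<close> and vanishing of the entries below the diagonal.\<close>

lemma lie_algebra_Bo_sub:
  assumes "H \<subseteq> Bo" "x \<in> lie_algebra scale H"
  shows "x \<in> sp scale \<beta>" "\<And>i y. y \<in> Fl i \<Longrightarrow> x y \<in> Fl i"
proof -
  have xl: "\<And>v w. x (v + w) = x v + x w" "\<And>c v. x (c *s v) = c *s x v"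
    using assms(2) by (auto simp: lie_algebra_def gl_iff)
  have D: "deriv_at_id scale f x = 0" if "f \<in> polys" "\<And>h. h \<in> Bo \<Longrightarrow> f h = 0" for f
  proof -
    have "\<forall>h\<in>H. f h = 0" using assms(1) that(2) by blast
    then show ?thesis using assms(2) that(1) by (simp add: lie_algebra_def)
  qed
  have "\<beta> (x v) w = \<beta> v (x w)" for v w
  proof -
    define f where "f = (\<lambda>g. \<beta> (g v) (g w) + \<beta> v w)"
    have "f \<in> polys" unfolding f_def
      by (intro poly_funs.add poly_funs.const bilinear_poly[of "\<beta> 0" "\<lambda>v. v", OF functional_\<beta>]) simp_all
    moreover have "f h = 0" if "h \<in> Bo" for h using SpD(3)[OF BoD(1)[OF that]] by (simp add: f_def)
    ultimately have "deriv_at_id scale f x = 0" by (rule D)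
    moreover have "poly [:0, \<beta> (x v) w + \<beta> v (x w), \<beta> (x v) (x w):] t = f (\<lambda>v. v + t *s x v)" for t
      by (simp add: f_def \<beta>_add \<beta>_scale algebra_simps)
    ultimately have "\<beta> (x v) w + \<beta> v (x w) = 0" using deriv_at_id_eq by fastforce
    then show ?thesis by (simp add: sum_eq_0_iff)
  qed
  then show "x \<in> sp scale \<beta>" using xl by (simp add: sp_iff)
  have "x (b j) \<in> Fl (Suc j)" if j: "j < 2 * n" for j
    unfolding Fl_def
  proof (intro CollectI allI impI)
    fix k assume k: "k < 2 * n" "Suc j \<le> k"
    define f where "f = (\<lambda>g. \<beta> (b (op k)) (g (b j)))"
    have "f \<in> polys" unfolding f_def by (rule coord_poly[OF functional_\<beta>])
    moreover have "f h = 0" if "h \<in> Bo" for h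
      using FlD[OF BoD(2)[OF that b_Fl[of j "Suc j"]]] j k by (simp add: f_def)
    ultimately have "deriv_at_id scale f x = 0" by (rule D)
    moreover have "poly [:\<beta> (b (op k)) (b j), \<beta> (b (op k)) (x (b j)):] t = f (\<lambda>v. v + t *s x v)" for t
      by (simp add: f_def \<beta>_add \<beta>_scale)
    ultimately show "\<beta> (b (op k)) (x (b j)) = 0" using deriv_at_id_eq by fastforce
  qed
  then show "x y \<in> Fl i" if "y \<in> Fl i" for i y
    using Fl_mono by (intro Fl_stable[OF xl _ that]) (meson Suc_leI subsetD)
qed

text \<open>If the image of \<open>x\<close> is isotropic, the maps \<open>v + t x v\<close>
  preserve \<open>\<beta>\<close> for all \<open>t\<close>. So a function vanishing on
  \<open>Bo\<close> vanishes along a whole line through the identity.\<close>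

lemma line_in_lie_algebra:
  assumes x: "x \<in> sp scale \<beta>" and sq: "\<And>v w. \<beta> (x v) (x w) = 0" and st: "\<And>j. j < 2 * n \<Longrightarrow> x (b j) \<in> Fl (Suc j)"
  shows "x \<in> lie_algebra scale Bo"
proof -
  have xl: "\<And>v w. x (v + w) = x v + x w" "\<And>c v. x (c *s v) = c *s x v" and xs: "\<And>v w. \<beta> (x v) w = \<beta> v (x w)"
    using x by (auto simp: sp_iff)
  have mem: "(\<lambda>v. v + t *s x v) \<in> Bo" for t
  proof (rule BoI)
    show "v + w + t *s x (v + w) = v + t *s x v + (w + t *s x w)" for v w by (simp add: xl scale_right_distrib add_ac)
    show "c *s v + t *s x (c *s v) = c *s (v + t *s x v)" for c v by (simp add: xl scale_right_distrib mult.commute)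
    show "\<beta> (v + t *s x v) (w + t *s x w) = \<beta> v w" for v w 
    proof -
      have "\<beta> v (x (x w)) = 0" using sq[of v w] by (simp only: xs)
      then show ?thesis by (simp add: \<beta>_add \<beta>_scale xs add_ac)
    qed
    show "b j + t *s x (b j) \<in> Fl (Suc j)" if "j < 2 * n" for j using st[OF that] that by (intro Fl_add Fl_scale b_Fl) auto
  qed
  have "deriv_at_id scale f x = 0" if "\<forall>h\<in>Bo. f h = 0" for f
    using deriv_at_id_eq[of 0 f x] that mem by simp
  then show ?thesis using xl by (simp add: lie_algebra_def gl_iff)
qed

text \<open>For \<open>i + j + 1 < 2 * n\<close> the image is isotropic and
  \<open>line_in_lie_algebra\<close> applies. For \<open>i + j + 1 = 2 * n\<close> the element is
  tangent to the torus, and \<open>tor_curve\<close> replaces the line.\<close>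

lemma sym_in_lie_algebra:
  assumes "i + j + 1 \<le> 2 * n" "i < 2 * n" "j < 2 * n"
  shows "sym (b i) (b j) \<in> lie_algebra scale Bo"
proof (cases "i + j + 1 = 2 * n")
  case False
  show ?thesis
  proof (rule line_in_lie_algebra[OF sym_sp])
    have "\<beta> (b i) (b j) = 0" using False gram[OF assms(2,3)] by simp
    then show "\<beta> (sym (b i) (b j) v) (sym (b i) (b j) w) = 0" for v w
      by (simp add: sym_def \<beta>_add \<beta>_scale \<beta>_sym[of "b j"])
    fix k assume k: "k < 2 * n"
    have "\<beta> (b i) (b k) *s b j \<in> Fl (Suc k)" "\<beta> (b j) (b k) *s b i \<in> Fl (Suc k)"
      using assms k gram[of i k] gram[of j k] by (auto simp: Fl_zero intro: b_Fl)
    then show "sym (b i) (b j) (b k) \<in> Fl (Suc k)" unfolding sym_def by (rule Fl_add)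
  qed
next
  case True
  have main: "sym (b i) (b (op i)) \<in> lie_algebra scale Bo" if i: "i < n" for i
  proof -
    have "deriv_at_id scale f (sym (b i) (b (op i))) = 0" if f: "f \<in> polys" "\<forall>h\<in>Bo. f h = 0" for f
    proof -
      obtain N p r where p: "\<And>s. f (\<lambda>v. v + s *s sym (b i) (b (op i)) v) = poly p s"
        and r: "\<And>s. s \<noteq> 1 \<Longrightarrow> (1 + s) ^ N * f (tor i s) = (1 + s) ^ N * poly p s + s\<^sup>2 * poly r s"
        using tor_curve[OF i f(1)] by metis
      \<comment> \<open>As \<open>f\<close> vanishes on the torus,
        \<open>(1 + s)^N p = s\<^sup>2 r\<close> as polynomials. Since \<open>(1 + s)^N\<close> has
        constant term 1, \<open>p\<close> has no terms of degree 0 and 1.\<close>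
      have "poly ([:1, 1:] ^ N * p) s = poly ([:0, 0, 1:] * r) s" if "s \<notin> {1}" for s
        using r[of s] f(2) tor_Bo[OF i, of s] that by (simp add: poly_power power2_eq_square sum_eq_0_iff)
      then have eq: "[:1, 1:] ^ N * p = [:0, 0, 1:] * r" by (rule poly_inj[of "{1}"]) simp_all
      have A0: "coeff ([:1, 1:] ^ N) 0 = (1 :: 'k)" by (simp add: poly_0_coeff_0[symmetric] poly_power)
      have "coeff ([:1, 1:] ^ N * p) 0 = 0" unfolding eq by simp
      then have p0: "coeff p 0 = 0" by (simp add: coeff_mult A0)
      have "coeff ([:1, 1:] ^ N * p) 1 = 0" unfolding eq by simp
      then have "coeff p 1 = 0" by (simp add: coeff_mult A0 p0)
      then show ?thesis using deriv_at_id_eq[of p f] p by simp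
    qed
    moreover have "sym (b i) (b (op i)) \<in> gl scale" using sym_sp by (simp add: sp_def)
    ultimately show ?thesis by (simp add: lie_algebra_def)
  qed
  show ?thesis
  proof (cases "i < n")
    case lt: True
    have "j = op i" using True by (simp add: op_def)
    then show ?thesis using main[OF lt] by simp
  next
    case False
    then have j: "j < n" "i = op j" using True by (auto simp: op_def)
    have "sym (b i) (b j) = sym (b j) (b i)" by (auto simp: sym_def add.commute)
    then show ?thesis using main[OF j(1)] j(2) by simp
  qed
qed

lemma borel_eq_Bo:
  assumes "borel_subgroup scale SpG B" "B \<subseteq> Bo"
  shows "B = Bo"
  using assms Bo_ccs by (auto simp: borel_subgroup_def)

end

section \<open>Nilpotent functionals\<close>

context symp
begin

text \<open>Makes the given Borel subgroup explicit: it lies in the stabiliser of a flag, which is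
  itself closed, connected and solvable, so maximality forces equality.\<close>

lemma borel_flag:
  assumes B: "borel_subgroup scale SpG B"
  obtains r b where "adapted scale Basis \<beta> r b" "B = adapted.Bo scale \<beta> r b"
proof -
  interpret G: group SpG by (rule group_Sp)
  have H: "subgroup B SpG" "connectedin zar B" and solv: "solvable (SpG\<lparr>carrier := B\<rparr>)"
    using B by (auto simp: borel_subgroup_def closed_connected_solvable_def)
  have "group (SpG\<lparr>carrier := B\<rparr>)" by (rule G.subgroup_imp_group[OF H(1)])
  from group.solvable_iff_trivial_derived_seq[OF this] solv
  obtain k where "(derived (SpG\<lparr>carrier := B\<rparr>) ^^ k) (carrier (SpG\<lparr>carrier := B\<rparr>)) = {\<one>\<^bsub>SpG\<lparr>carrier := B\<rparr>\<^esub>}" by blast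
  then have k: "(derived SpG ^^ k) B = {id}" by (simp add: derived_seq_subgroup[OF H(1)])
  have BG: "\<And>g. g \<in> B \<Longrightarrow> g \<in> carrier SpG" using subgroup.subset[OF H(1)] by auto
  obtain r e f where part: "partial_flag B r e f"
    and tot: "\<And>x. (\<And>i. i < r \<Longrightarrow> \<beta> (e i) x = 0) \<Longrightarrow> (\<And>i. i < r \<Longrightarrow> \<beta> (f i) x = 0) \<Longrightarrow> x = 0"
    using maximal_partial_flag[OF H k] by blast
  have ef: "\<beta> (e i) (f j) = (if i = j then 1 else 0)" "\<beta> (e i) (e j) = 0" "\<beta> (f i) (f j) = 0"
    "\<beta> (f j) (e i) = (if i = j then 1 else 0)" if "i < r" "j < r" for i j
    using part that \<beta>_sym[of "f j" "e i"] by (auto simp: partial_flag_def)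
  \<comment> \<open>The \<open>f\<close> follow in reverse order, so that \<open>b i\<close> is
    paired with \<open>b (2 * r - 1 - i)\<close>.\<close>
  define b where "b = (\<lambda>i. if i < r then e i else f (2 * r - 1 - i))"
  have ad: "adapted scale Basis \<beta> r b"
  proof (intro adapted.intro adapted_axioms.intro)
    show "symp scale Basis \<beta>" by (rule symp_axioms)
    fix i j assume ij: "i < 2 * r" "j < 2 * r"
    show "\<beta> (b i) (b j) = (if i + j + 1 = 2 * r then 1 else 0)"
    proof (cases "i < r"; cases "j < r")
      assume "i < r" "j < r" then show ?thesis by (simp add: b_def ef)
    next
      assume h: "i < r" "\<not> j < r"
      then have "2 * r - 1 - j < r" "i = 2 * r - 1 - j \<longleftrightarrow> i + j + 1 = 2 * r" using ij by auto
      then show ?thesis using h by (simp only: b_def ef if_True if_False)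
    next
      assume h: "\<not> i < r" "j < r"
      then have "2 * r - 1 - i < r" "j = 2 * r - 1 - i \<longleftrightarrow> i + j + 1 = 2 * r" using ij by auto
      then show ?thesis using h by (simp only: b_def ef if_True if_False)
    next
      assume h: "\<not> i < r" "\<not> j < r"
      then have "2 * r - 1 - i < r" "2 * r - 1 - j < r" "i + j + 1 \<noteq> 2 * r" using ij by auto
      then show ?thesis using h by (simp only: b_def ef if_True if_False)
    qed
  next
    fix x assume *: "\<And>i. i < 2 * r \<Longrightarrow> \<beta> (b i) x = 0"
    show "x = 0"
    proof (rule tot)
      fix i assume i: "i < r"
      show "\<beta> (e i) x = 0" using *[of i] i by (simp add: b_def)
      have "2 * r - 1 - i < 2 * r" "\<not> 2 * r - 1 - i < r" "2 * r - 1 - (2 * r - 1 - i) = i" using i by auto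
      then show "\<beta> (f i) x = 0" using *[of "2 * r - 1 - i"] by (simp only: b_def if_False)
    qed
  qed
  interpret A: adapted scale Basis \<beta> r b by (rule ad)
  have low: "g x \<in> A.Fl i" if "g \<in> B" "i \<le> r" "x \<in> A.Fl i" for g i x
  proof -
    have "b ` {..<i} = e ` {..<i}" using that(2) by (intro image_cong) (auto simp: b_def)
    then have "A.Fl i = span (e ` {..<i})" using A.Fl_span[of i] that(2) by simp
    then show ?thesis using part that by (simp add: partial_flag_def)
  qed
  have "B \<subseteq> A.Bo"
  proof
    fix g assume g: "g \<in> B"
    have ig: "inv\<^bsub>SpG\<^esub> g \<in> B" by (rule subgroup.m_inv_closed[OF H(1) g])
    have "g x \<in> A.Fl i" if x: "x \<in> A.Fl i" for i x
    proof -
      consider "i \<le> r" | "r < i" "i \<le> 2 * r" | "2 * r < i" by linarith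
      then show ?thesis
      proof cases
        case 1 then show ?thesis using low[OF g _ x] by blast
      next
        \<comment> \<open>Upper members of the flag are complements of lower ones, so stability
          under \<open>g\<close> follows from that of the lower ones under
          \<open>g\<inverse>\<close>.\<close>
        case 2
        have "(inv\<^bsub>SpG\<^esub> (inv\<^bsub>SpG\<^esub> g)) x \<in> A.Fl i"
        proof (rule A.adjoint_stable[OF BG[OF ig] 2(2) _ x])
          fix y assume "y \<in> A.Fl (2 * r - i)"
          then show "(inv\<^bsub>SpG\<^esub> g) y \<in> A.Fl (2 * r - i)" using low[OF ig] 2 by simp
        qed
        then show ?thesis using BG[OF g] by simp
      next
        case 3 then show ?thesis by (intro A.Fl_top) simp
      qed
    qed
    then show "g \<in> A.Bo" using BG[OF g] by (simp add: A.Bo_def)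
  qed
  then have "B = A.Bo" by (rule A.borel_eq_Bo[OF B])
  with ad that show thesis by blast
qed

end

section \<open>Nilpotent functionals and their polar operators\<close>

context adapted
begin

lemma card_Basis: "card Basis = 2 * n"
proof -
  have "dim ({} \<union> b ` {..<2 * n}) = dim {} + card {..<2 * n}"
  proof (rule dim_dual_family[where y = "\<lambda>i. b (op i)"])
    fix i j assume "i \<in> {..<2 * n}" "j \<in> {..<2 * n}"
    then show "\<beta> (b (op i)) (b j) = (if i = j then 1 else 0)" by (simp add: coord_b)
  qed simp_all
  moreover have "span (b ` {..<2 * n}) = UNIV" using Fl_span[of "2 * n"] Fl_top[of "2 * n"] by auto
  then have "dim (b ` {..<2 * n}) = dim UNIV" by (metis dim_span)
  ultimately show ?thesis by (simp add: dim_UNIV)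
qed

lemma lowering_nilpotent:
  assumes T: "T \<in> gl scale" and low: "\<And>j. j < 2 * n \<Longrightarrow> T (b j) \<in> Fl j"
  shows "(T ^^ (2 * n)) v = 0"
proof -
  have Tl: "\<And>v w. T (v + w) = T v + T w" "\<And>c v. T (c *s v) = c *s T v" using T by (auto simp: gl_iff)
  have step: "T x \<in> Fl (i - 1)" if "x \<in> Fl i" for i x
  proof (rule Fl_stable[OF Tl _ that])
    fix j assume j: "j < 2 * n" "j < i"
    then have "j \<le> i - 1" by simp
    then show "T (b j) \<in> Fl (i - 1)" using low[OF j(1)] Fl_mono by blast
  qed
  have "(T ^^ k) v \<in> Fl (2 * n - k)" for k
  proof (induction k)
    case (Suc k)
    then show ?case using step[OF Suc] by simp
  qed (simp add: Fl_top)
  from this[of "2 * n"] show ?thesis by (intro Fl_0) simp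
qed

text \<open>For \<open>\<eta>\<close> vanishing on the Lie algebra, \<open>\<beta> (T (b j)) (b (op
  k)) = \<eta> (sym (b j) (b (op k))) = 0\<close> whenever \<open>j \<le> k\<close>, so
  \<open>T\<close> lowers the flag. The operator of \<open>\<xi>\<close> is the conjugate of
  \<open>T\<close> by \<open>g\<close>.\<close>

lemma nilpotent_form_mod:
  assumes "\<xi> \<in> nilpotent_dual scale \<beta> Bo"
  obtains T where "form_mod scale Basis \<beta> (qf \<xi>) T"
proof -
  obtain g where \<xi>: "\<xi> \<in> sp_dual scale \<beta>" and g: "g \<in> carrier SpG"
    and van: "\<And>x. x \<in> lie_algebra scale Bo \<Longrightarrow> coadjoint scale \<beta> g \<xi> x = 0"
    using assms by (auto simp: nilpotent_dual_def)
  define \<eta> where "\<eta> = coadjoint scale \<beta> g \<xi>"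
  have \<eta>: "\<eta> \<in> sp_dual scale \<beta>" "\<And>v. qf \<eta> (g v) = qf \<xi> v"
    unfolding \<eta>_def by (rule coadjoint_dual[OF g \<xi>])+
  obtain T where T: "T \<in> gl scale" "\<And>v w. \<beta> (T v) w = pol (qf \<eta>) v w"
    using polar_operator[OF quadr_qf[OF \<eta>(1)]] by blast
  have Tl: "\<And>v w. T (v + w) = T v + T w" "\<And>c v. T (c *s v) = c *s T v" using T(1) by (auto simp: gl_iff)
  have "T (b j) \<in> Fl j" if j: "j < 2 * n" for j
    unfolding Fl_def
  proof (intro CollectI allI impI)
    fix k assume k: "k < 2 * n" "j \<le> k"
    have "\<beta> (b (op k)) (T (b j)) = \<beta> (T (b j)) (b (op k))" by (rule \<beta>_sym)
    also have "\<dots> = \<eta> (sym (b j) (b (op k)))" by (simp only: T(2) pol_qf[OF \<eta>(1)])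
    also have "\<dots> = 0" unfolding \<eta>_def by (rule van, rule sym_in_lie_algebra) (use j k in \<open>auto simp: op_def\<close>)
    finally show "\<beta> (b (op k)) (T (b j)) = 0" .
  qed
  then have nil: "(T ^^ (2 * n)) v = 0" for v by (rule lowering_nilpotent[OF T(1)])
  define T' where "T' = (\<lambda>v. (inv\<^bsub>SpG\<^esub> g) (T (g v)))"
  note gi = SpD[OF Sp_inv(1)[OF g]]
  have "(T' ^^ k) v = (inv\<^bsub>SpG\<^esub> g) ((T ^^ k) (g v))" for k v
    by (induction k) (simp_all add: T'_def Sp_inv[OF g])
  then have nil': "(T' ^^ (2 * n)) v = 0" for v using nil gi(2)[of 0 0] by simp
  have pol': "\<beta> (T' v) w = pol (qf \<xi>) v w" for v w
    by (simp add: T'_def Sp_inv_adj(1)[OF g] T(2) pol_def \<eta>(2)[symmetric] SpD[OF g])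
  have "form_mod scale Basis \<beta> (qf \<xi>) T'"
  proof (intro form_mod.intro form_mod_axioms.intro)
    show "symp scale Basis \<beta>" by (rule symp_axioms)
    show "T' \<in> gl scale" by (simp add: gl_iff T'_def SpD[OF g] Tl gi)
    show "qf \<xi> (c *s v) = c\<^sup>2 * qf \<xi> v" for c v using quadr_qf[OF \<xi>] by (simp add: quadr_def)
    show "qf \<xi> (v + w) = qf \<xi> v + qf \<xi> w + \<beta> (T' v) w" for v w unfolding pol' by (rule q_add)
    show "\<exists>N. \<forall>v. (T' ^^ N) v = 0" using nil' by blast
  qed
  with that show thesis by blast
qed

lemma nilpotent_normal_form:
  assumes \<xi>: "\<xi> \<in> nilpotent_dual scale \<beta> Bo"
  shows "\<exists>!ps. normal_sequence ps \<and> fm_equiv (form_module_of scale Basis \<beta> \<xi>) (W_sum ps)"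
    and "normal_sequence ps \<Longrightarrow> fm_equiv (form_module_of scale Basis \<beta> \<xi>) (W_sum ps) \<Longrightarrow> total_rank ps = n"
proof -
  obtain T where "form_mod scale Basis \<beta> (qf \<xi>) T" using nilpotent_form_mod[OF \<xi>] by blast
  then interpret F: form_mod scale Basis \<beta> "qf \<xi>" T .
  have \<xi>': "\<xi> \<in> sp_dual scale \<beta>" using \<xi> by (simp add: nilpotent_dual_def)
  have eq: "form_module_of scale Basis \<beta> \<xi> = F.fmQ UNIV"
    by (simp add: form_module_of_def F.fmQ_def alpha_form_eq[OF \<xi>'])
  show "\<exists>!ps. normal_sequence ps \<and> fm_equiv (form_module_of scale Basis \<beta> \<xi>) (W_sum ps)"
    unfolding eq by (rule F.normal_form)
  show "total_rank ps = n" if "normal_sequence ps" "fm_equiv (form_module_of scale Basis \<beta> \<xi>) (W_sum ps)"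
    using F.normal_form_rank[OF that[unfolded eq]] card_Basis by simp
qed

end

subsection \<open>Realising the normal forms\<close>

fun starts :: "nat \<Rightarrow> (nat \<times> nat) list \<Rightarrow> nat set" where
  "starts k [] = {}"
| "starts k ((l, m) # ps) = insert k (starts (k + m) ps)"

text \<open>The positions \<open>k + l - 1\<close>, one for each block with \<open>l > 0\<close>, at
  which the value \<open>\<alpha> (T^(l-1) u) = 1\<close> will be placed.\<close>

fun tops :: "nat \<Rightarrow> (nat \<times> nat) list \<Rightarrow> nat set" where
  "tops k [] = {}"
| "tops k ((l, m) # ps) = (if l = 0 then {} else {k + l - 1}) \<union> tops (k + m) ps"

lemma starts_ge: "p \<in> starts k ps \<Longrightarrow> k \<le> p"
  by (induction k ps rule: starts.induct) auto

lemma tops_ge: "p \<in> tops k ps \<Longrightarrow> k \<le> p"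
  by (induction k ps rule: tops.induct) (auto split: if_splits)

text \<open>The blocks are laid out along the flag: a block at offset \<open>k\<close> is spanned by \<open>T\<^sup>i w = b (k + m - 1 - i)\<close>
  and \<open>T\<^sup>i u = b (op (k + i))\<close>. Then \<open>T\<close> lowers the flag and \<open>\<alpha>\<close> vanishes on its isotropic part.\<close>

locale block_layout = adapted scale Basis \<beta> n b
  for scale :: "'k::alg_closed_field \<Rightarrow> 'v::ab_group_add \<Rightarrow> 'v" (infixr "*s" 75) and Basis and \<beta> and n and b +
  fixes ps :: "(nat \<times> nat) list"
  assumes ps: "normal_sequence ps" "total_rank ps = n"
begin

text \<open>Counting 0 as a start ensures that \<open>p - 1\<close> is used in \<open>q\<close> and
  \<open>T\<close> only for \<open>p > 0\<close>.\<close>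

definition st :: "nat \<Rightarrow> bool" where "st p \<longleftrightarrow> p = 0 \<or> p \<in> starts 0 ps"

text \<open>The products link neighbouring positions within a block and stop at block starts; the
  squares supply the values 1. This is the orthogonal sum of the forms \<open>W_quad\<close> in the
  coordinates of the layout.\<close>

definition q :: "'v \<Rightarrow> 'k" where
  "q v = (\<Sum>p<n. (if p \<in> tops 0 ps then (\<beta> (b p) v)\<^sup>2 else 0) +
     (if st p then 0 else \<beta> (b (op p)) v * \<beta> (b (p - 1)) v))"

definition T :: "'v \<Rightarrow> 'v" where
  "T v = (\<Sum>p<n. if st p then 0 else \<beta> (b (op p)) v *s b (p - 1) + \<beta> (b (p - 1)) v *s b (op p))"

lemma pol_q: "pol q v w = \<beta> (T v) w"
proof -
  have "\<beta> (T v) w = (\<Sum>p<n. if st p then 0 else \<beta> (b (op p)) v * \<beta> (b (p - 1)) w + \<beta> (b (p - 1)) v * \<beta> (b (op p)) w)"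
    unfolding T_def \<beta>_sum by (intro sum.cong refl) (simp add: \<beta>_add \<beta>_scale)
  also have "\<dots> = pol q v w"
    unfolding pol_def q_def sum.distrib[symmetric]
    by (intro sum.cong refl) (simp add: \<beta>_add power2_add distrib_left distrib_right add_ac mult_ac)
  finally show ?thesis by (rule HOL.sym)
qed

lemma T_lin: "T (v + w) = T v + T w" "T (c *s v) = c *s T v"
proof -
  show "T (v + w) = T v + T w"
    unfolding T_def sum.distrib[symmetric] by (intro sum.cong refl) (simp add: \<beta>_add scale_left_distrib add_ac)
  show "T (c *s v) = c *s T v"
    unfolding T_def scale_sum_right by (intro sum.cong refl) (simp add: \<beta>_scale scale_right_distrib)
qed

lemma quadr_q: "quadr q"
  unfolding quadr_def pol_q
proof (intro conjI allI)
  show "q (c *s v) = c\<^sup>2 * q v" for c v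
    unfolding q_def sum_distrib_left
    by (intro sum.cong refl) (simp add: \<beta>_scale power_mult_distrib power2_eq_square distrib_left mult_ac)
qed (simp_all add: T_lin \<beta>_add \<beta>_scale)

lemma low_gram:
  assumes "p < n" "p' < n"
  shows "\<beta> (b p) (b p') = 0" "\<beta> (b (op p)) (b (op p')) = 0"
    "\<beta> (b (op p)) (b p') = (if p = p' then 1 else 0)" "\<beta> (b p) (b (op p')) = (if p = p' then 1 else 0)"
proof -
  have h: "p < 2 * n" "p' < 2 * n" "op p < 2 * n" "op p' < 2 * n" using assms by (auto simp: op_def)
  show "\<beta> (b p) (b p') = 0" using gram[OF h(1,2)] assms by auto
  have "op p + op p' + 1 \<noteq> 2 * n" using assms by (auto simp: op_def)
  then show "\<beta> (b (op p)) (b (op p')) = 0" using gram[OF h(3,4)] by (simp only: if_False)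
  show 1: "\<beta> (b (op p)) (b p') = (if p = p' then 1 else 0)" by (rule coord_b[OF h(1,2)])
  show "\<beta> (b p) (b (op p')) = (if p = p' then 1 else 0)"
    using coord_b[OF h(2,1)] \<beta>_sym[of "b p" "b (op p')"] by auto
qed

lemma T_b:
  assumes p: "p < n"
  shows "T (b p) = (if st p then 0 else b (p - 1))"
    "T (b (op p)) = (if Suc p < n \<and> \<not> st (Suc p) then b (op (Suc p)) else 0)"
proof -
  have "T (b p) = (\<Sum>p'<n. if p' = p then (if st p then 0 else b (p - 1)) else 0)"
    unfolding T_def
  proof (intro sum.cong refl)
    fix p' assume "p' \<in> {..<n}"
    then have "p' < n" "p' - 1 < n" by auto
    then show "(if st p' then 0 else \<beta> (b (op p')) (b p) *s b (p' - 1) + \<beta> (b (p' - 1)) (b p) *s b (op p')) =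
        (if p' = p then (if st p then 0 else b (p - 1)) else 0)"
      using low_gram(3)[of p' p] low_gram(1)[of "p' - 1" p] p by auto
  qed
  then show "T (b p) = (if st p then 0 else b (p - 1))" using p by simp
  have "T (b (op p)) = (\<Sum>p'<n. if p' = Suc p then (if st (Suc p) then 0 else b (op (Suc p))) else 0)"
    unfolding T_def
  proof (intro sum.cong refl)
    fix p' assume "p' \<in> {..<n}"
    then have p': "p' < n" "p' - 1 < n" by auto
    have st0: "p' \<noteq> 0" if "\<not> st p'" using that by (auto simp: st_def)
    show "(if st p' then 0 else \<beta> (b (op p')) (b (op p)) *s b (p' - 1) + \<beta> (b (p' - 1)) (b (op p)) *s b (op p')) =
        (if p' = Suc p then (if st (Suc p) then 0 else b (op (Suc p))) else 0)"
    proof (cases "st p'")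
      case False
      have "p' - 1 = p \<longleftrightarrow> p' = Suc p" using st0[OF False] by auto
      then show ?thesis using low_gram(2)[OF p'(1) p] low_gram(4)[OF p'(2) p] False by auto
    qed auto
  qed
  then show "T (b (op p)) = (if Suc p < n \<and> \<not> st (Suc p) then b (op (Suc p)) else 0)" by simp
qed

lemma T_lowers:
  assumes j: "j < 2 * n"
  shows "T (b j) = 0 \<or> (0 < j \<and> T (b j) = b (j - 1))"
proof (cases "j < n")
  case True
  then show ?thesis using T_b(1)[OF True] by (auto simp: st_def)
next
  case False
  define p where "p = op j"
  have p: "p < n" "j = op p" using j False by (auto simp: p_def op_def)
  have "op (Suc p) = j - 1" if "Suc p < n" using p that by (simp add: op_def)
  then show ?thesis using T_b(2)[OF p(1)] p False by auto
qed

lemma q_b: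
  assumes p: "p < n"
  shows "q (b p) = 0" "q (b (op p)) = (if p \<in> tops 0 ps then 1 else 0)"
proof -
  have 1: "\<beta> (b p') (b p) = 0" "\<beta> (b (p' - 1)) (b p) = 0" "\<beta> (b (op p')) (b (op p)) = 0" if "p' < n" for p'
    using low_gram(1)[of p' p] low_gram(1)[of "p' - 1" p] low_gram(2)[of p' p] that p by auto
  show "q (b p) = 0" unfolding q_def by (intro sum.neutral ballI) (simp add: 1)
  have "q (b (op p)) = (\<Sum>p'<n. if p' = p then (if p \<in> tops 0 ps then 1 else 0) else 0)"
    unfolding q_def using p by (intro sum.cong refl) (auto simp: 1 low_gram(4))
  then show "q (b (op p)) = (if p \<in> tops 0 ps then 1 else 0)" using p by simp
qed

text \<open>The witness is the identity. A member \<open>x\<close> of the Lie algebra preserves the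
  flag, so \<open>mc x i j = 0\<close> for \<open>i + j \<ge> 2 * n\<close>. For
  \<open>i + j < 2 * n\<close> the polar form vanishes because \<open>T\<close> lowers the flag, and
  \<open>q (b i) = 0\<close> for \<open>i < n\<close>. Every term of \<open>dual_of q x\<close> is
  thus zero.\<close>

lemma dual_nilpotent: "dual_of q \<in> nilpotent_dual scale \<beta> Bo"
  unfolding nilpotent_dual_def
proof (intro CollectI conjI bexI[of _ id] ballI)
  show "dual_of q \<in> sp_dual scale \<beta>" by (rule dual_of)
  show idc: "id \<in> carrier SpG" by (rule BoD(1)[OF id_Bo])
  fix x assume x: "x \<in> lie_algebra scale Bo"
  have xsp: "x \<in> sp scale \<beta>" and xFl: "\<And>i y. y \<in> Fl i \<Longrightarrow> x y \<in> Fl i"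
    using lie_algebra_Bo_sub[OF subset_refl x] by blast+
  have mc0: "mc x i j = 0" if ij: "i < 2 * n" "j < 2 * n" "2 * n \<le> i + j" for i j
  proof -
    have "x (b (op j)) \<in> Fl (Suc (op j))" using ij by (intro xFl b_Fl op) auto
    then have "\<beta> (b (op i)) (x (b (op j))) = 0" using ij by (intro FlD) (auto simp: op_def)
    then show ?thesis by (simp add: mc_def \<beta>_sym)
  qed
  have q0: "pol q (b i) (b j) = 0" if ij: "i < 2 * n" "j < 2 * n" "i + j < 2 * n" for i j
    using T_lowers[OF ij(1)] gram[of "i - 1" j] ij by (auto simp: pol_q)
  have "dual_of q x = 0"
  proof -
    have "mc x i i * q (b i) = 0" if "i < 2 * n" for i
      using mc0[of i i] q_b(1)[of i] that by (cases "i < n") auto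
    moreover have "mc x i j * pol q (b i) (b j) = 0" if "j < 2 * n" "i < j" for i j
      using mc0[of i j] q0[of i j] that by (cases "i + j < 2 * n") auto
    ultimately have "(\<Sum>i<2 * n. mc x i i * q (b i)) + (\<Sum>j<2 * n. \<Sum>i<j. mc x i j * pol q (b i) (b j)) = 0"
      by (simp add: sum.neutral del: mult_eq_0_iff)
    then show ?thesis using xsp by (simp add: dual_of_def)
  qed
  moreover have "inv\<^bsub>SpG\<^esub> id \<circ> x \<circ> id = x" using Sp_inv(2)[OF idc] by (auto simp: fun_eq_iff)
  ultimately show "coadjoint scale \<beta> id (dual_of q) x = 0" using xsp by (simp add: coadjoint_def)
qed

sublocale fm: form_mod scale Basis \<beta> q T
proof
  show "T \<in> gl scale" by (simp add: gl_iff T_lin)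
  then have "(T ^^ (2 * n)) v = 0" for v
  proof (rule lowering_nilpotent)
    fix j assume j: "j < 2 * n"
    then show "T (b j) \<in> Fl j" using T_lowers[OF j] j b_Fl[of "j - 1" j] by (auto simp: Fl_zero)
  qed
  then show "\<exists>N. \<forall>v. (T ^^ N) v = 0" by blast
  show "q (c *s v) = c\<^sup>2 * q v" for c v using quadr_q by (simp add: quadr_def)
  show "q (v + w) = q v + q w + \<beta> (T v) w" for v w unfolding pol_q[symmetric] by (rule q_add)
qed

fun blocks :: "nat \<Rightarrow> (nat \<times> nat) list \<Rightarrow> (nat \<times> nat \<times> 'v \<times> 'v) list" where
  "blocks k [] = []"
| "blocks k ((l, m) # qs) = (l, m, b (op k), b (k + m - 1)) # blocks (k + m) qs"

text \<open>The complement of the blocks placed before offset \<open>k\<close>.\<close>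

definition tail_space :: "nat \<Rightarrow> 'v set" where
  "tail_space k = {x. \<forall>p<k. \<beta> (b p) x = 0 \<and> \<beta> (b (op p)) x = 0}"

text \<open>The last two hypotheses say that from offset \<open>k\<close> on the global
  \<open>st\<close> and \<open>tops\<close> look as if the layout began there with
  \<open>qs\<close>; this passes to the remaining blocks in the induction.\<close>

lemma blocks_complete:
  assumes "k + total_rank qs = n" "\<forall>(l, m)\<in>set qs. 1 \<le> m \<and> m div 2 \<le> l \<and> l \<le> m"
    and "\<And>p. k \<le> p \<Longrightarrow> p < n \<Longrightarrow> st p \<longleftrightarrow> p \<in> starts k qs" "\<And>p. k \<le> p \<Longrightarrow> p \<in> tops 0 ps \<longleftrightarrow> p \<in> tops k qs"
  shows "fm.complete (blocks k qs) (tail_space k)"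
  using assms
proof (induction qs arbitrary: k)
  case Nil
  have "x = 0" if "x \<in> tail_space k" for x
  proof (rule total)
    fix i assume i: "i < 2 * n"
    show "\<beta> (b i) x = 0"
    proof (cases "i < n")
      case True then show ?thesis using that Nil.prems(1) by (simp add: tail_space_def total_rank_def)
    next
      case False
      then have "op i < n" using i by (auto simp: op_def)
      then have "\<beta> (b (op (op i))) x = 0" using that Nil.prems(1) by (simp add: tail_space_def total_rank_def)
      then show ?thesis using op(2)[OF i] by simp
    qed
  qed
  moreover have "0 \<in> tail_space k" by (simp add: tail_space_def)
  ultimately show ?case by auto
next
  case (Cons a qs)
  obtain l m where [simp]: "a = (l, m)" by force
  have lm: "1 \<le> m" "m div 2 \<le> l" "l \<le> m" using Cons.prems(2) by auto
  have km: "k + m + total_rank qs = n" using Cons.prems(1) by (simp add: total_rank_def)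
  have k_n: "k < n" "k + m \<le> n" using km lm by auto
  define u where "u = b (op k)"
  define w where "w = b (k + m - 1)"
  have stk: "st k" using Cons.prems(3)[of k] k_n by simp
  have nst: "\<not> st (k + i)" if "0 < i" "i < m" for i
    using Cons.prems(3)[of "k + i"] that k_n starts_ge[of "k + i" "k + m" qs] by auto
  have st_end: "st (k + m)" if "k + m < n"
  proof -
    have "qs \<noteq> []" using that km by (auto simp: total_rank_def)
    then have "k + m \<in> starts (k + m) qs" by (cases qs) auto
    then show ?thesis using Cons.prems(3)[of "k + m"] that by simp
  qed
  have tops: "k + i \<in> tops 0 ps \<longleftrightarrow> Suc i = l" if "i < m" for i
  proof -
    have "k + i \<notin> tops (k + m) qs" using tops_ge[of "k + i" "k + m" qs] that by auto
    then show ?thesis using Cons.prems(4)[of "k + i"] by auto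
  qed
  have Tu: "(T ^^ i) u = b (op (k + i))" if "i < m" for i
    using that
  proof (induction i)
    case (Suc i)
    then show ?case using T_b(2)[of "k + i"] nst[of "Suc i"] k_n by simp
  qed (simp add: u_def)
  have Tum: "(T ^^ m) u = 0"
  proof -
    obtain i where i: "m = Suc i" using lm by (cases m) auto
    then show ?thesis using Tu[of i] T_b(2)[of "k + i"] st_end k_n by auto
  qed
  have Tw: "(T ^^ i) w = b (k + m - 1 - i)" if "i < m" for i
    using that
  proof (induction i)
    case (Suc i)
    have "k + m - 1 - i = k + (m - 1 - i)" "0 < m - 1 - i" using Suc.prems by auto
    then have "T (b (k + m - 1 - i)) = b (k + m - 1 - Suc i)"
      using T_b(1)[of "k + m - 1 - i"] nst[of "m - 1 - i"] k_n Suc.prems by auto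
    then show ?case using Suc by simp
  qed (simp add: w_def)
  have Twm: "(T ^^ m) w = 0"
  proof -
    obtain i where i: "m = Suc i" using lm by (cases m) auto
    then show ?thesis using Tw[of i] T_b(1)[of k] stk k_n by simp
  qed
  have zero: "(T ^^ i) u = 0" "(T ^^ i) w = 0" if "m \<le> i" for i
    using fm.Tp_ge[OF Tum that] fm.Tp_ge[OF Twm that] by auto
  have "\<beta> ((T ^^ i) u) w = (if Suc i = m then 1 else 0)" for i
  proof (cases "i < m")
    case True
    then show ?thesis using low_gram(3)[of "k + i" "k + m - 1"] k_n by (auto simp: Tu w_def)
  qed (simp add: zero)
  then have h: "fm.hyp m u w" using lm Tum Twm by (simp add: fm.hyp_def)
  have "q ((T ^^ i) u) = (if Suc i = l then 1 else 0)" for i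
  proof (cases "i < m")
    case True
    then show ?thesis using q_b(2)[of "k + i"] tops[OF True] k_n by (simp add: Tu)
  qed (use zero lm in auto)
  moreover have "q ((T ^^ i) w) = 0" for i
  proof (cases "i < m")
    case True
    then show ?thesis using q_b(1)[of "k + m - 1 - i"] k_n by (simp add: Tw)
  qed (use zero in simp)
  ultimately have blk: "fm.blk l m u w" using h lm by (simp add: fm.blk_def)
  have uw: "u \<in> tail_space k" "w \<in> tail_space k"
    using low_gram k_n lm by (auto simp: tail_space_def u_def w_def)
  have "tail_space k \<inter> fm.perp u \<inter> fm.perp w = tail_space (k + m)"
  proof (rule subset_antisym; rule subsetI)
    fix x assume x: "x \<in> tail_space k \<inter> fm.perp u \<inter> fm.perp w"
    have "\<beta> (b p) x = 0 \<and> \<beta> (b (op p)) x = 0" if p: "p < k + m" for p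
    proof (cases "p < k")
      case True then show ?thesis using x by (auto simp: tail_space_def)
    next
      case False
      define i where "i = p - k"
      have i: "p = k + i" "i < m" "k + m - 1 - (m - 1 - i) = p" using False p by (auto simp: i_def)
      have "\<beta> ((T ^^ i) u) x = 0" "\<beta> ((T ^^ (m - 1 - i)) w) x = 0" using x fm.perpD by auto
      then show ?thesis using Tu[of i] Tw[of "m - 1 - i"] i by simp
    qed
    then show "x \<in> tail_space (k + m)" by (simp add: tail_space_def)
  next
    fix x assume x: "x \<in> tail_space (k + m)"
    have "\<beta> ((T ^^ i) u) x = 0" "\<beta> ((T ^^ i) w) x = 0" for i
      using x lm by (cases "i < m"; auto simp: tail_space_def Tu Tw zero)+
    then show "x \<in> tail_space k \<inter> fm.perp u \<inter> fm.perp w" using x by (auto simp: tail_space_def fm.perp_def)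
  qed
  moreover have "fm.complete (blocks (k + m) qs) (tail_space (k + m))"
  proof (rule Cons.IH)
    show "k + m + total_rank qs = n" by (rule km)
    show "\<forall>(l, m)\<in>set qs. 1 \<le> m \<and> m div 2 \<le> l \<and> l \<le> m" using Cons.prems(2) by simp
    fix p assume p: "k + m \<le> p"
    show "p \<in> tops 0 ps \<longleftrightarrow> p \<in> tops (k + m) qs" using Cons.prems(4)[of p] p lm by auto
    assume "p < n"
    then show "st p \<longleftrightarrow> p \<in> starts (k + m) qs" using Cons.prems(3)[of p] p lm by auto
  qed
  ultimately show ?case using uw blk by (simp add: u_def w_def)
qed

lemma shape_blocks: "fm.shape (blocks k qs) = qs"
  by (induction k qs rule: blocks.induct) auto

lemma realisation: "fm_equiv (form_module_of scale Basis \<beta> (dual_of q)) (W_sum ps)"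
proof -
  have st0: "st p \<longleftrightarrow> p \<in> starts 0 ps" if "p < n" for p
  proof (cases ps)
    case Nil then show ?thesis using that ps by (simp add: total_rank_def)
  next
    case (Cons a qs) then show ?thesis unfolding st_def unfolding Cons by (cases a) simp
  qed
  have "fm.complete (blocks 0 ps) (tail_space 0)"
    using ps st0 by (intro blocks_complete) (auto simp: normal_sequence_def)
  then have "fm.complete (blocks 0 ps) UNIV" by (simp add: tail_space_def)
  from fm.complete_imp_equiv[OF this fm.tsub_UNIV]
  have "fm_equiv (fm.fmQ UNIV) (W_sum ps)" unfolding shape_blocks by (rule fm.fmQ_equiv_sym)
  moreover have "form_module_of scale Basis \<beta> (dual_of q) = fm.fmQ UNIV"
    by (simp add: form_module_of_def fm.fmQ_def alpha_form_eq[OF dual_of] qf_dual_of[OF quadr_q])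
  ultimately show ?thesis by simp
qed

end

section \<open>Assembling the bijection between orbits and labels\<close>

theorem mainTheorem4:
  fixes scale :: "'k::alg_closed_field \<Rightarrow> 'v::ab_group_add \<Rightarrow> 'v"
    and Basis :: "'v set"
    and \<beta> :: "'v \<Rightarrow> 'v \<Rightarrow> 'k"
    and n :: nat
    and B :: "('v \<Rightarrow> 'v) set"
  assumes "CHAR('k) = 2"
    and "finite_dimensional_vector_space scale Basis"
    and "card Basis = 2 * n"
    and "symplectic_form scale \<beta>"
    and "borel_subgroup scale (Sp scale \<beta>) B"
  shows "(\<forall>\<xi>\<in>nilpotent_dual scale \<beta> B. \<exists>!ps.
            normal_sequence ps \<and>
            fm_equiv (form_module_of scale Basis \<beta> \<xi>) (W_sum ps :: ('k, nat \<Rightarrow> 'k W_vec) form_module)) \<and>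
         (\<exists>\<Phi>.
            (\<forall>\<xi>\<in>nilpotent_dual scale \<beta> B. \<forall>ps.
               normal_sequence ps \<and>
               fm_equiv (form_module_of scale Basis \<beta> \<xi>) (W_sum ps :: ('k, nat \<Rightarrow> 'k W_vec) form_module) \<longrightarrow>
               \<Phi> (orbit (Sp scale \<beta>) (coadjoint scale \<beta>) \<xi>) = pair_of_sequence ps) \<and>
            bij_betw \<Phi>
              (orbits (Sp scale \<beta>) (nilpotent_dual scale \<beta> B) (coadjoint scale \<beta>))
              (orbit_labels n)) \<and>
         finite (orbit_labels n) \<and>
         int (card (orbit_labels n)) = int (p2 (int n)) - int (p2 (int n - 2))"
proof -
  interpret S: symp scale Basis \<beta> by (intro symp.intro symp_axioms.intro assms)
  obtain r b where "adapted scale Basis \<beta> r b" and BBo: "B = adapted.Bo scale \<beta> r b"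
    using S.borel_flag[OF assms(5)] by blast
  then interpret A: adapted scale Basis \<beta> r b by blast
  have rn: "r = n" using A.card_Basis assms(3) by simp
  define N where "N = nilpotent_dual scale \<beta> B"
  define V where "V = form_module_of scale Basis \<beta>"
  define orb where "orb = orbit (Sp scale \<beta>) (coadjoint scale \<beta>)"
  define nf where "nf = (\<lambda>\<xi> ps. normal_sequence ps \<and> fm_equiv (V \<xi>) (W_sum ps :: ('k, nat \<Rightarrow> 'k W_vec) form_module))"
  have ex1: "\<exists>!ps. nf \<xi> ps" if "\<xi> \<in> N" for \<xi>
    using A.nilpotent_normal_form(1)[of \<xi>] that unfolding nf_def V_def N_def BBo by blast
  have rank: "total_rank ps = n" if "\<xi> \<in> N" "nf \<xi> ps" for \<xi> ps
    using A.nilpotent_normal_form(2)[of \<xi> ps] that rn unfolding nf_def V_def N_def BBo by blast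
  have dual: "\<xi> \<in> sp_dual scale \<beta>" if "\<xi> \<in> N" for \<xi> using that by (simp add: N_def nilpotent_dual_def)
  have orb_iff: "fm_equiv (V \<xi>) (V \<eta>) \<longleftrightarrow> orb \<xi> = orb \<eta>" if "\<xi> \<in> N" "\<eta> \<in> N" for \<xi> \<eta>
    unfolding V_def orb_def by (rule A.form_module_of_equiv_iff[OF dual dual, OF that])
  have V_sym: "fm_equiv M (V \<xi>)" if "fm_equiv (V \<xi>) M" for \<xi> and M :: "('k, nat \<Rightarrow> 'k W_vec) form_module"
    by (rule fm_equiv_sym[OF _ _ that]) (simp_all add: V_def form_module_of_def)
  have nf_orb: "orb \<xi> = orb \<eta>" if "\<xi> \<in> N" "\<eta> \<in> N" "nf \<xi> ps" "nf \<eta> ps" for \<xi> \<eta> ps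
    using fm_equiv_trans[of "V \<xi>" "W_sum ps" "V \<eta>"] V_sym[of \<eta> "W_sum ps"] that orb_iff unfolding nf_def by blast
  have orb_nf: "nf \<eta> ps" if "\<xi> \<in> N" "\<eta> \<in> N" "nf \<xi> ps" "orb \<eta> = orb \<xi>" for \<xi> \<eta> ps
    using fm_equiv_trans[of "V \<eta>" "V \<xi>" "W_sum ps"] that orb_iff[of \<eta> \<xi>] unfolding nf_def by blast
  \<comment> \<open>An orbit is labelled through any of its members; \<open>orb_nf\<close> and the
    uniqueness of the normal form make the result unambiguous.\<close>
  define \<Phi> where "\<Phi> = (\<lambda>O'. pair_of_sequence (THE ps. \<exists>\<xi>\<in>N. orb \<xi> = O' \<and> nf \<xi> ps))"
  have \<Phi>: "\<Phi> (orb \<xi>) = pair_of_sequence ps" if \<xi>: "\<xi> \<in> N" and ps: "nf \<xi> ps" for \<xi> ps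
  proof -
    have "(THE ps. \<exists>\<eta>\<in>N. orb \<eta> = orb \<xi> \<and> nf \<eta> ps) = ps"
    proof (rule the_equality)
      show "\<exists>\<eta>\<in>N. orb \<eta> = orb \<xi> \<and> nf \<eta> ps" using \<xi> ps by blast
      fix qs assume "\<exists>\<eta>\<in>N. orb \<eta> = orb \<xi> \<and> nf \<eta> qs"
      then obtain \<eta> where "\<eta> \<in> N" "orb \<eta> = orb \<xi>" "nf \<eta> qs" by blast
      then have "nf \<xi> qs" using orb_nf[of \<eta> \<xi> qs] \<xi> by simp
      then show "qs = ps" using ex1[OF \<xi>] ps by blast
    qed
    then show ?thesis by (simp add: \<Phi>_def)
  qed
  \<comment> \<open>The layout uses the adapted basis of the given \<open>B\<close>, so the
    functional obtained is nilpotent with respect to that very subgroup.\<close>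
  have surj: "\<exists>\<xi>\<in>N. nf \<xi> ps" if "normal_sequence ps" "total_rank ps = n" for ps
  proof -
    interpret L: block_layout scale Basis \<beta> r b ps
      by unfold_locales (use that rn in simp_all)
    have "A.dual_of L.q \<in> N" unfolding N_def BBo by (rule L.dual_nilpotent)
    moreover have "nf (A.dual_of L.q) ps" unfolding nf_def V_def using that(1) L.realisation by blast
    ultimately show ?thesis by blast
  qed
  have "bij_betw \<Phi> (orb ` N) (orbit_labels n)"
  proof (rule bij_betw_imageI)
    show "inj_on \<Phi> (orb ` N)"
    proof (rule inj_onI)
      fix O1 O2 assume "O1 \<in> orb ` N" "O2 \<in> orb ` N" and eq: "\<Phi> O1 = \<Phi> O2"
      then obtain \<xi> \<eta> where h: "\<xi> \<in> N" "\<eta> \<in> N" "O1 = orb \<xi>" "O2 = orb \<eta>" by blast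
      obtain ps qs where nf: "nf \<xi> ps" "nf \<eta> qs" using ex1[OF h(1)] ex1[OF h(2)] by blast
      have "pair_of_sequence ps = pair_of_sequence qs" using eq \<Phi>[OF h(1) nf(1)] \<Phi>[OF h(2) nf(2)] h by simp
      then have "ps = qs" using pair_of_sequence_inj nf unfolding nf_def by blast
      then show "O1 = O2" using nf_orb[OF h(1,2)] nf h by simp
    qed
    show "\<Phi> ` (orb ` N) = orbit_labels n"
    proof
      show "\<Phi> ` (orb ` N) \<subseteq> orbit_labels n"
      proof (rule subsetI)
        fix x assume "x \<in> \<Phi> ` (orb ` N)"
        then obtain \<xi> where \<xi>: "\<xi> \<in> N" and x: "x = \<Phi> (orb \<xi>)" by blast
        obtain ps where ps: "nf \<xi> ps" using ex1[OF \<xi>] by blast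
        have "pair_of_sequence ps \<in> orbit_labels (total_rank ps)"
          using ps pair_of_sequence_labels unfolding nf_def by blast
        then show "x \<in> orbit_labels n" unfolding x using \<Phi>[OF \<xi> ps] rank[OF \<xi> ps] by simp
      qed
      show "orbit_labels n \<subseteq> \<Phi> ` (orb ` N)"
      proof
        fix x assume x: "x \<in> orbit_labels n"
        obtain ps where ps: "normal_sequence ps" "pair_of_sequence ps = x" "total_rank ps = n"
          using pair_of_sequence_surj[OF x] by blast
        obtain \<xi> where "\<xi> \<in> N" "nf \<xi> ps" using surj[OF ps(1,3)] by blast
        then have "x = \<Phi> (orb \<xi>)" "\<xi> \<in> N" using \<Phi>[of \<xi> ps] ps(2) by simp_all
        then show "x \<in> \<Phi> ` (orb ` N)" by blast
      qed
    qed
  qed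
  moreover have "orbits (Sp scale \<beta>) N (coadjoint scale \<beta>) = orb ` N" by (auto simp: orbits_def orb_def)
  moreover have "\<forall>\<xi>\<in>N. \<forall>ps. nf \<xi> ps \<longrightarrow> \<Phi> (orb \<xi>) = pair_of_sequence ps" using \<Phi> by blast
  moreover have "\<forall>\<xi>\<in>N. \<exists>!ps. nf \<xi> ps" using ex1 by blast
  ultimately show ?thesis
    using finite_orbit_labels card_orbit_labels unfolding N_def nf_def V_def orb_def
    by (intro conjI exI[of _ \<Phi>]) simp_all
qed

end
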